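(* Let $K$ be a multi-quadratic number field and let $K_{(12)} = K \cap \mathbb{Q}(\zeta_{12})$. Then $J_1(2,12)(K)_{\mathrm{tors}} = J_1(2,12)(K_{(12)})$, and $$J_1(2,12)(K)_{\mathrm{tors}} \cong \begin{cases} \mathbb{Z}/4 & \text{if } K_{(12)} = \mathbb{Q},\\ \mathbb{Z}/8 & \text{if } K_{(12)} = \mathbb{Q}(\sqrt{-1}) \text{ or } \mathbb{Q}(\sqrt{3}),\\ \mathbb{Z}/2 \times \mathbb{Z}/4 & \text{if } K_{(12)} = \mathbb{Q}(\sqrt{-3}),\\ \mathbb{Z}/2\times\mathbb{Z}/8 & \text{if } K_{(12)} = \mathbb{Q}(\sqrt{-1},\sqrt{3}).\end{cases}$$
   Context: A multi-quadratic number field is a number field (including $\mathbb{Q}$ itself) which is a compositum of quadratic number fields. For positive integers $M,N$, $X_1(M,MN)$ is the modular curve (coarse moduli space) attached to the level structure $\Gamma_1(M,MN) = \{\begin{pmatrix}1&b\\0&d\end{pmatrix} \in \mathrm{GL}_2(\mathbb{Z}/MN) : b \equiv 0,\ d\equiv 1 \bmod M\}$; it is defined over $\mathbb{Q}(\zeta_M)$, and $J_1(M,MN)$ denotes its Jacobian. Here $X_1(2,12)$ is defined over $\mathbb{Q}$ (it is the elliptic curve with Cremona label 24a4). $\zeta_N$ is a primitive $N$-th root of unity. *)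

theory Defs
  imports Complex_Main "HOL-Algebra.Algebra" "HOL-Algebra.Algebraic_Closure_Type"
begin

section \<open>Weierstrass curves and their groups of points\<close>

text \<open>The curve \<open>y^2 + a1 x y + a3 y = x^3 + a2 x^2 + a4 x + a6\<close>.\<close>

datatype 'a weierstrass =
  Weierstrass (coeff1: 'a) (coeff2: 'a) (coeff3: 'a) (coeff4: 'a) (coeff6: 'a)

datatype 'a point = Infinity | Affine 'a 'a

fun on_curve :: "'a::field weierstrass \<Rightarrow> 'a point \<Rightarrow> bool" where
  "on_curve W Infinity = True"
| "on_curve (Weierstrass a1 a2 a3 a4 a6) (Affine x y) =
     (y^2 + a1 * x * y + a3 * y = x^3 + a2 * x^2 + a4 * x + a6)"

fun discriminant :: "'a::field weierstrass \<Rightarrow> 'a" where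
  "discriminant (Weierstrass a1 a2 a3 a4 a6) =
     (let b2 = a1^2 + 4 * a2;
          b4 = 2 * a4 + a1 * a3;
          b6 = a3^2 + 4 * a6;
          b8 = a1^2 * a6 + 4 * a2 * a6 - a1 * a3 * a4 + a2 * a3^2 - a4^2
      in - (b2^2) * b8 - 8 * b4^3 - 27 * b6^2 + 9 * b2 * b4 * b6)"

text \<open>Chord-tangent addition; \<open>l\<close> is the slope of the chord or tangent.\<close>

fun ec_add :: "'a::field weierstrass \<Rightarrow> 'a point \<Rightarrow> 'a point \<Rightarrow> 'a point" where
  "ec_add W Infinity Q = Q"
| "ec_add W P Infinity = P"
| "ec_add (Weierstrass a1 a2 a3 a4 a6) (Affine x1 y1) (Affine x2 y2) =
     (if x1 = x2 \<and> y2 = - y1 - a1 * x1 - a3 then Infinity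
      else let l = (if x1 = x2
                    then (3 * x1^2 + 2 * a2 * x1 + a4 - a1 * y1) / (2 * y1 + a1 * x1 + a3)
                    else (y2 - y1) / (x2 - x1));
               x3 = l^2 + a1 * l - a2 - x1 - x2
           in Affine x3 (- (l * (x3 - x1) + y1) - a1 * x3 - a3))"

fun coords_in :: "'a set \<Rightarrow> 'a point \<Rightarrow> bool" where
  "coords_in K Infinity = True"
| "coords_in K (Affine x y) = (x \<in> K \<and> y \<in> K)"

text \<open>\<open>ec_group W K\<close> is \<open>W(K)\<close>, for a subfield \<open>K\<close> containing the coefficients of \<open>W\<close>.\<close>

definition ec_group :: "'a::field weierstrass \<Rightarrow> 'a set \<Rightarrow> 'a point monoid" where
  "ec_group W K =
     \<lparr>carrier = {P. on_curve W P \<and> coords_in K P}, monoid.mult = ec_add W, one = Infinity\<rparr>"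

definition torsion :: "('a, 'b) monoid_scheme \<Rightarrow> 'a set" where
  "torsion G = {P \<in> carrier G. \<exists>n::nat. n > 0 \<and> P [^]\<^bsub>G\<^esub> n = \<one>\<^bsub>G\<^esub>}"

abbreviation torsion_group :: "('a, 'b) monoid_scheme \<Rightarrow> ('a, 'b) monoid_scheme" where
  "torsion_group G \<equiv> G\<lparr>carrier := torsion G\<rparr>"


section \<open>Multi-quadratic number fields\<close>

text \<open>Number fields are taken inside \<open>\<complex>\<close>.\<close>

abbreviation complex_ring :: "complex ring" where
  "complex_ring \<equiv> ring_of_type_algebra"

abbreviation rat_adjoin :: "complex set \<Rightarrow> complex set" where
  "rat_adjoin S \<equiv> generate_field complex_ring S"

definition quadratic_field :: "complex set \<Rightarrow> bool" where
  "quadratic_field F \<longleftrightarrow> subfield F complex_ring \<and> ring.dimension complex_ring 2 \<rat> F"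

text \<open>The empty compositum is \<open>\<rat>\<close>.\<close>

definition multi_quadratic_field :: "complex set \<Rightarrow> bool" where
  "multi_quadratic_field K \<longleftrightarrow>
     (\<exists>\<F>. finite \<F> \<and> (\<forall>F\<in>\<F>. quadratic_field F) \<and> K = rat_adjoin (\<Union>\<F>))"

definition cyclotomic_field :: "nat \<Rightarrow> complex set" where
  "cyclotomic_field n = rat_adjoin {cis (2 * pi / n)}"


section \<open>The modular curve \<open>X\<^sub>1(2,12)\<close>\<close>

text \<open>
  A matrix of \<open>\<Gamma>\<^sub>1(2,12) = {(1 b; 0 d) \<in> GL\<^sub>2(\<int>/12) : b even}\<close> (\<open>d\<close> is a unit, hence odd) fixes
  \<open>e\<^sub>1\<close> and \<open>6 e\<^sub>2\<close>, and conversely every element of \<open>GL\<^sub>2(\<int>/12)\<close> fixing both lies in the group.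
  So a \<open>\<Gamma>\<^sub>1(2,12)\<close>-orbit of bases of \<open>W[12]\<close> is the same as a pair consisting of a point \<open>Q\<close>
  of order 12 (the image of \<open>e\<^sub>1\<close>) and a point \<open>P\<close> of order 2 (the image of \<open>6 e\<^sub>2\<close>) which is
  not a multiple of \<open>Q\<close>.
\<close>

definition has_order :: "('a, 'b) monoid_scheme \<Rightarrow> 'a \<Rightarrow> nat \<Rightarrow> bool" where
  "has_order G P n \<longleftrightarrow> n > 0 \<and> P \<in> carrier G \<and> P [^]\<^bsub>G\<^esub> n = \<one>\<^bsub>G\<^esub>
     \<and> (\<forall>m. 0 < m \<and> m < n \<longrightarrow> P [^]\<^bsub>G\<^esub> m \<noteq> \<one>\<^bsub>G\<^esub>)"

definition level_structure ::
    "'a::field weierstrass \<Rightarrow> 'a point \<Rightarrow> 'a point \<Rightarrow> bool" where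
  "level_structure W P Q \<longleftrightarrow> discriminant W \<noteq> 0
     \<and> has_order (ec_group W UNIV) P 2 \<and> has_order (ec_group W UNIV) Q 12
     \<and> (\<forall>k::nat. P \<noteq> Q [^]\<^bsub>ec_group W UNIV\<^esub> k)"

text \<open>The isomorphisms between Weierstrass curves are the substitutions
  \<open>x = u^2 x' + r\<close>, \<open>y = u^3 y' + u^2 s x' + t\<close> with \<open>u \<noteq> 0\<close>.\<close>

fun change_curve :: "'a::field \<Rightarrow> 'a \<Rightarrow> 'a \<Rightarrow> 'a \<Rightarrow> 'a weierstrass \<Rightarrow> 'a weierstrass" where
  "change_curve u r s t (Weierstrass a1 a2 a3 a4 a6) = Weierstrass
     ((a1 + 2 * s) / u)
     ((a2 - s * a1 + 3 * r - s^2) / u^2)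
     ((a3 + r * a1 + 2 * t) / u^3)
     ((a4 - s * a3 + 2 * r * a2 - (t + r * s) * a1 + 3 * r^2 - 2 * s * t) / u^4)
     ((a6 + r * a4 + r^2 * a2 + r^3 - t * a3 - t^2 - r * t * a1) / u^6)"

fun change_point :: "'a::field \<Rightarrow> 'a \<Rightarrow> 'a \<Rightarrow> 'a \<Rightarrow> 'a point \<Rightarrow> 'a point" where
  "change_point u r s t Infinity = Infinity"
| "change_point u r s t (Affine x y) =
     Affine ((x - r) / u^2) ((y - t - s * (x - r)) / u^3)"

definition isomorphic_triples ::
    "'a::field weierstrass \<times> 'a point \<times> 'a point \<Rightarrow> 'a weierstrass \<times> 'a point \<times> 'a point \<Rightarrow> bool"
  where
  "isomorphic_triples = (\<lambda>(W, P, Q) (W', P', Q'). \<exists>u r s t. u \<noteq> 0 \<and>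
     W' = change_curve u r s t W \<and> P' = change_point u r s t P \<and> Q' = change_point u r s t Q)"

text \<open>Polynomial functions on \<open>\<complex>\<^sup>2\<close> with rational coefficients, and their quotients.\<close>

inductive rat_poly_fun :: "(complex \<times> complex \<Rightarrow> complex) \<Rightarrow> bool" where
  "c \<in> \<rat> \<Longrightarrow> rat_poly_fun (\<lambda>z. c)"
| "rat_poly_fun fst"
| "rat_poly_fun snd"
| "rat_poly_fun f \<Longrightarrow> rat_poly_fun g \<Longrightarrow> rat_poly_fun (\<lambda>z. f z + g z)"
| "rat_poly_fun f \<Longrightarrow> rat_poly_fun g \<Longrightarrow> rat_poly_fun (\<lambda>z. f z * g z)"

definition regular_on :: "(complex \<times> complex) set \<Rightarrow> (complex \<times> complex \<Rightarrow> complex) \<Rightarrow> bool" where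
  "regular_on U f \<longleftrightarrow> (\<exists>p q. rat_poly_fun p \<and> rat_poly_fun q \<and>
     (\<forall>z\<in>U. q z \<noteq> 0 \<and> f z = p z / q z))"

definition regular_curve ::
    "(complex \<times> complex) set \<Rightarrow> (complex \<times> complex \<Rightarrow> complex weierstrass) \<Rightarrow> bool" where
  "regular_curve U W \<longleftrightarrow>
     (\<forall>a \<in> {coeff1, coeff2, coeff3, coeff4, coeff6}. regular_on U (\<lambda>z. a (W z)))"

definition regular_point ::
    "(complex \<times> complex) set \<Rightarrow> (complex \<times> complex \<Rightarrow> complex point) \<Rightarrow> bool" where
  "regular_point U P \<longleftrightarrow> (\<exists>f g. regular_on U f \<and> regular_on U g \<and>
     (\<forall>z\<in>U. P z = Affine (f z) (g z)))"

text \<open>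
  An elliptic curve \<open>E\<close> over \<open>\<rat>\<close> is a model of \<open>X\<^sub>1(2,12)\<close> if it has an open subset \<open>U\<close> (the
  complement of the cusps) carrying a family, defined over \<open>\<rat>\<close>, of elliptic curves with
  \<open>\<Gamma>\<^sub>1(2,12)\<close>-structure which represents every isomorphism class over \<open>\<complex>\<close> exactly once.
  This determines \<open>E\<close> as a curve over \<open>\<rat>\<close>: the classifying morphism
  from \<open>U\<close> to the coarse moduli space is then a morphism over \<open>\<rat>\<close> of smooth curves,
  bijective on \<open>\<complex>\<close>-points, hence an isomorphism.
\<close>

definition is_modular_curve_X1_2_12 :: "complex weierstrass \<Rightarrow> bool" where
  "is_modular_curve_X1_2_12 E \<longleftrightarrow>
     {coeff1 E, coeff2 E, coeff3 E, coeff4 E, coeff6 E} \<subseteq> \<rat> \<and> discriminant E \<noteq> 0 \<and>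
     (\<exists>U W P Q.
        U \<subseteq> {(x, y). on_curve E (Affine x y)} \<and>
        finite ({(x, y). on_curve E (Affine x y)} - U) \<and>
        regular_curve U W \<and> regular_point U P \<and> regular_point U Q \<and>
        (\<forall>z\<in>U. level_structure (W z) (P z) (Q z)) \<and>
        (\<forall>W' P' Q'. level_structure W' P' Q' \<longrightarrow>
           (\<exists>!z. z \<in> U \<and> isomorphic_triples (W', P', Q') (W z, P z, Q z))))"

text \<open>The curve 24a4, \<open>y^2 = x^3 - x^2 + x\<close>. Theorem \<open>X1_2_12_is_modular_curve\<close> at the end of this
  theory proves \<open>is_modular_curve_X1_2_12 X1_2_12\<close>.\<close>

definition X1_2_12 :: "complex weierstrass" where
  "X1_2_12 = Weierstrass 0 (- 1) 0 1 0"

text \<open>The curve has genus one and the rational point \<open>Infinity\<close>, so it is its own Jacobian, the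
  group law on \<open>Pic\<^sup>0\<close> being chord-tangent addition. A different choice of
  the model, or of the rational base point, gives an isomorphic elliptic curve over \<open>\<rat>\<close>.\<close>

definition J1_2_12 :: "complex set \<Rightarrow> complex point monoid" where
  "J1_2_12 K = ec_group X1_2_12 K"

section \<open>24a4 is a model of \<open>X\<^sub>1(2,12)\<close>\<close>

text \<open>
  A pair of a curve and a point \<open>Q\<close> of order at least 4 has a unique Tate normal form
  \<open>y^2 + (1 - c) x y - b y = x^3 - b x^2\<close> with \<open>Q = (0,0)\<close>. Order 12 forces
  \<open>b = tb q\<close>, \<open>c = tc q\<close> for a parameter \<open>q\<close> on the line, and the remaining points of order 2 are
  parametrised by the square roots \<open>s\<close> of \<open>q2 q * q6 q\<close>; the curve
  \<open>s^2 = q2 q * q6 q\<close> is birational to 24a4. The plain name \<open>algebra\<close> denotes the HOL-Algebra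
  method here, hence the qualified \<open>Groebner_Basis.algebra\<close>.
\<close>

abbreviation tate :: "'a::field \<Rightarrow> 'a \<Rightarrow> 'a weierstrass" where
  "tate b c \<equiv> Weierstrass (1 - c) (- b) (- b) 0 0"

abbreviation origin :: "'a::field point" where "origin \<equiv> Affine 0 0"

lemma ec_pow_0 [simp]: "P [^]\<^bsub>ec_group W K\<^esub> (0::nat) = Infinity"
  by (simp add: ec_group_def)

lemma ec_pow_Suc: "P [^]\<^bsub>ec_group W K\<^esub> Suc n = ec_add W (P [^]\<^bsub>ec_group W K\<^esub> n) P"
  by (simp add: ec_group_def)

lemma one_ec_group [simp]: "\<one>\<^bsub>ec_group W K\<^esub> = Infinity"
  by (simp add: ec_group_def)

lemma coords_in_UNIV: "coords_in UNIV P"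
  by (cases P) auto

lemma carrier_ec_group_UNIV: "P \<in> carrier (ec_group W UNIV) \<longleftrightarrow> on_curve W P"
  by (simp add: ec_group_def coords_in_UNIV)

lemma ec_add_Infinity: "ec_add W P Infinity = P"
  by (cases P) auto

lemma tate_add_origin:
  assumes "x \<noteq> 0" "y = l * x"
  shows "ec_add (tate b c) (Affine x y) origin =
    Affine (l^2 + (1 - c) * l + b - x) (- (l * (l^2 + (1 - c) * l + b - x)) - (1 - c) * (l^2 + (1 - c) * l + b - x) + b)"
proof -
  have l: "y / x = l" using assms by simp
  have "ec_add (tate b c) (Affine x y) origin = Affine (l^2 + (1 - c) * l - (-b) - x - 0)
      (- (l * ((l^2 + (1 - c) * l - (-b) - x - 0) - x) + y) - (1 - c) * (l^2 + (1 - c) * l - (-b) - x - 0) - (-b))"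
    using assms(1) l by (simp only: ec_add.simps Let_def) simp
  also have "\<dots> = Affine (l^2 + (1 - c) * l + b - x) (- (l * (l^2 + (1 - c) * l + b - x)) - (1 - c) * (l^2 + (1 - c) * l + b - x) + b)"
    unfolding assms(2) by (simp add: right_diff_distrib)
  finally show ?thesis .
qed

lemma tate_double_origin:
  assumes "b \<noteq> 0"
  shows "ec_add (tate b c) origin origin = Affine b (b * c)"
  using assms by (simp add: Let_def algebra_simps)

lemma tate_neg_origin:
  shows "ec_add (tate b c) (Affine 0 b) origin = Infinity"
  by simp

lemma tate_step:
  assumes "x \<noteq> 0" "y = l * x" "x' = l^2 + (1 - c) * l + b - x" "y' = - (l * x') - (1 - c) * x' + b"
  shows "ec_add (tate b c) (Affine x y) origin = Affine x' y'"
  unfolding assms(3,4) by (rule tate_add_origin[OF assms(1,2)])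

lemma on_curve_tate_x0:
  fixes b c y :: "'a::field"
  assumes "on_curve (tate b c) (Affine 0 y)"
  shows "y = 0 \<or> y = b"
proof -
  have "y * (y - b) = 0" using assms by (simp add: power2_eq_square algebra_simps)
  then show ?thesis by auto
qed

lemma on_curve_tate_add:
  fixes b c :: "'a::field"
  assumes "on_curve (tate b c) A" "b \<noteq> 0"
  shows "on_curve (tate b c) (ec_add (tate b c) A origin)"
proof (cases A)
  case Infinity
  then show ?thesis by simp
next
  case (Affine x y)
  show ?thesis
  proof (cases "x = 0")
    case True
    then consider "y = 0" | "y = b" using on_curve_tate_x0 assms Affine by blast
    then show ?thesis
    proof cases
      case 1
      then show ?thesis unfolding Affine True 1 tate_double_origin[OF assms(2)]
        by simp Groebner_Basis.algebra
    next
      case 2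
      then show ?thesis unfolding Affine True 2 tate_neg_origin by simp
    qed
  next
    case False
    define l where "l = y / x"
    have y: "y = l * x" using False by (simp add: l_def)
    define x' where "x' = l^2 + (1 - c) * l + b - x"
    define y' where "y' = - (l * x') - (1 - c) * x' + b"
    have "x^2 * (l^2 + (1 - c) * l - x + b) = x * (b * l)"
      using assms(1) unfolding Affine y by simp Groebner_Basis.algebra
    then have "x * (l^2 + (1 - c) * l - x + b) = b * l"
      using False by (simp add: power2_eq_square)
    then have xx: "x * x' = b * l" by (simp add: x'_def algebra_simps)
    have "on_curve (tate b c) (Affine x' y')"
      using xx x'_def y'_def by simp Groebner_Basis.algebra
    then show ?thesis unfolding Affine
      by (subst tate_step[OF False y x'_def y'_def])
  qed
qed

fun ec_neg :: "'a::field weierstrass \<Rightarrow> 'a point \<Rightarrow> 'a point" where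
  "ec_neg W Infinity = Infinity"
| "ec_neg (Weierstrass a1 a2 a3 a4 a6) (Affine x y) = Affine x (- y - a1 * x - a3)"

lemma ec_neg_neg: "ec_neg W (ec_neg W P) = P"
  by (cases W; cases P) auto

text \<open>\<open>- (A + Q) + Q = - A\<close> for \<open>Q = (0,0)\<close>.\<close>

lemma tate_cancel:
  fixes b c :: "'a::field"
  assumes "on_curve (tate b c) A" "b \<noteq> 0"
  shows "ec_add (tate b c) (ec_neg (tate b c) (ec_add (tate b c) A origin)) origin = ec_neg (tate b c) A"
proof (cases A)
  case Infinity
  then show ?thesis by simp
next
  case (Affine x y)
  show ?thesis
  proof (cases "x = 0")
    case True
    then consider "y = 0" | "y = b" using on_curve_tate_x0 assms Affine by blast
    then show ?thesis
    proof cases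
      case 1
      have "ec_add (tate b c) (ec_neg (tate b c) (Affine b (b * c))) origin = Affine 0 b"
        unfolding ec_neg.simps
        by (rule tate_step[where l = 0]) (use assms(2) in \<open>auto simp: algebra_simps\<close>)
      then show ?thesis unfolding Affine True 1 tate_double_origin[OF assms(2)] by simp
    next
      case 2
      then show ?thesis unfolding Affine True 2 tate_neg_origin by simp
    qed
  next
    case False
    define l where "l = y / x"
    have y: "y = l * x" using False by (simp add: l_def)
    define x' where "x' = l^2 + (1 - c) * l + b - x"
    define y' where "y' = - (l * x') - (1 - c) * x' + b"
    have "x^2 * (l^2 + (1 - c) * l - x + b) = x * (b * l)"
      using assms(1) unfolding Affine y by simp Groebner_Basis.algebra
    then have "x * (l^2 + (1 - c) * l - x + b) = b * l"
      using False by (simp add: power2_eq_square)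
    then have xx: "x * x' = b * l" by (simp add: x'_def algebra_simps)
    have n: "ec_neg (tate b c) (Affine x' y') = Affine x' (l * x')"
      by (simp add: y'_def algebra_simps)
    have "ec_add (tate b c) (Affine x' (l * x')) origin = ec_neg (tate b c) (Affine x y)"
    proof (cases "x' = 0")
      case True
      then have "l = 0" using xx assms(2) by simp
      then show ?thesis using True y x'_def tate_double_origin[OF assms(2)]
        by (simp add: algebra_simps)
    next
      case False
      have "ec_add (tate b c) (Affine x' (l * x')) origin = Affine x (- (l * x) - (1 - c) * x + b)"
        by (rule tate_step[OF False refl]) (simp_all add: x'_def)
      then show ?thesis by (simp add: y)
    qed
    then show ?thesis unfolding Affine tate_step[OF False y x'_def y'_def] n .
  qed
qed

lemma tate_multiples:
  fixes d e t :: "'a::field"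
  assumes nz: "d \<noteq> 0" "d \<noteq> 1" "e \<noteq> 0" "e \<noteq> 1" and t: "t * (1 - e) = d - e"
    and b: "b = d * e * (d - 1)" and c: "c = e * (d - 1)"
  defines "p \<equiv> \<lambda>n::nat. origin [^]\<^bsub>ec_group (tate b c) UNIV\<^esub> n"
  defines "x6 \<equiv> (e * t)^2 - (1 - c) * (e * t) + b - d * e * (e - 1)"
  shows "p 0 = Infinity" "p 1 = origin" "p 2 = Affine b (b * c)" "p 3 = Affine c (b - c)"
    "p 4 = Affine (d * (d - 1)) (d^2 * (c - d + 1))"
    "p 5 = Affine (d * e * (e - 1)) (d * e^2 * (d - e))"
    "p 6 = Affine x6 (e * t * x6 - (1 - c) * x6 + b)"
proof -
  have Suc: "p (Suc n) = ec_add (tate b c) (p n) origin" for n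
    unfolding p_def by (rule ec_pow_Suc)
  have b0: "b \<noteq> 0" and c0: "c \<noteq> 0" using nz by (simp_all add: b c)
  have S: "p (numeral (Num.inc k)) = ec_add (tate b c) (p (numeral k)) origin" for k
    using Suc[of "numeral k"] by (simp add: numeral_inc)
  show 0: "p 0 = Infinity" by (simp add: p_def)
  have 1: "p 1 = origin" using Suc[of 0] 0 by simp
  then show "p 1 = origin" .
  show 2: "p 2 = Affine b (b * c)" using Suc[of 1] 1 tate_double_origin[OF b0]
    by (simp add: numeral_2_eq_2)
  show 3: "p 3 = Affine c (b - c)"
    unfolding S[of "num.Bit0 num.One", simplified] 2
    by (rule tate_step[OF b0, where l = c]) (simp_all add: b c algebra_simps power2_eq_square)
  show 4: "p 4 = Affine (d * (d - 1)) (d^2 * (c - d + 1))"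
    unfolding S[of "num.Bit1 num.One", simplified] 3
    by (rule tate_step[OF c0, where l = "d - 1"]) (simp_all add: b c, Groebner_Basis.algebra+)
  show 5: "p 5 = Affine (d * e * (e - 1)) (d * e^2 * (d - e))"
    unfolding S[of "num.Bit0 (num.Bit0 num.One)", simplified] 4
    by (rule tate_step[where l = "d * (e - 1)"]) (use nz in \<open>simp_all add: b c\<close>, Groebner_Basis.algebra+)
  show 6: "p 6 = Affine x6 (e * t * x6 - (1 - c) * x6 + b)"
    unfolding S[of "num.Bit1 (num.Bit0 num.One)", simplified] 5
    by (rule tate_step[where l = "- (e * t)"])
       (use nz t in \<open>simp_all add: b c x6_def\<close>, Groebner_Basis.algebra+)
qed

lemma tate_inj:
  fixes b c :: "'a::field"
  assumes "on_curve (tate b c) A" "on_curve (tate b c) B" "b \<noteq> 0"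
    "ec_add (tate b c) A origin = ec_add (tate b c) B origin"
  shows "A = B"
proof -
  have "ec_neg (tate b c) A = ec_neg (tate b c) B"
    unfolding tate_cancel[OF assms(1,3), symmetric] tate_cancel[OF assms(2,3), symmetric] assms(4) ..
  then have "ec_neg (tate b c) (ec_neg (tate b c) A) = ec_neg (tate b c) (ec_neg (tate b c) B)"
    by (rule arg_cong)
  then show ?thesis unfolding ec_neg_neg .
qed

locale tate_curve =
  fixes b c d e q :: complex
  assumes nz: "d \<noteq> 0" "d \<noteq> 1" "e \<noteq> 0" "e \<noteq> 1" and d: "d = 1 - q + q * e"
    and b: "b = d * e * (d - 1)" and c: "c = e * (d - 1)"
begin

definition p :: "nat \<Rightarrow> complex point" where
  "p n = origin [^]\<^bsub>ec_group (tate b c) UNIV\<^esub> n"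

definition x6 where "x6 = e * q * (q - 1)"
definition y6 where "y6 = e * (1 - q) * x6 - (1 - c) * x6 + b"

lemma q0: "q \<noteq> 0" using nz d by auto

lemma b0: "b \<noteq> 0" using nz by (simp add: b)

lemma p_0 [simp]: "p 0 = Infinity" by (simp add: p_def)

lemma p_Suc: "p (Suc n) = ec_add (tate b c) (p n) origin"
  unfolding p_def by (rule ec_pow_Suc)

lemma p_values: "p 1 = origin" "p 2 = Affine b (b * c)" "p 3 = Affine c (b - c)"
    "p 4 = Affine (d * (d - 1)) (d^2 * (c - d + 1))"
    "p 5 = Affine (d * e * (e - 1)) (d * e^2 * (d - e))"
    "p 6 = Affine x6 y6"
proof -
  have t: "(1 - q) * (1 - e) = d - e" unfolding d by Groebner_Basis.algebra
  note m = tate_multiples[OF nz t b c, folded p_def]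
  show "p 1 = origin" "p 2 = Affine b (b * c)" "p 3 = Affine c (b - c)"
    "p 4 = Affine (d * (d - 1)) (d^2 * (c - d + 1))"
    "p 5 = Affine (d * e * (e - 1)) (d * e^2 * (d - e))"
    by (fact m)+
  have "(e * (1 - q))^2 - (1 - c) * (e * (1 - q)) + b - d * e * (e - 1) = x6"
    unfolding x6_def b c d by Groebner_Basis.algebra
  then show "p 6 = Affine x6 y6" using m(7) by (simp add: y6_def)
qed

lemma on_curve_p: "on_curve (tate b c) (p n)"
  by (induction n) (simp_all only: p_0 p_Suc on_curve.simps on_curve_tate_add[OF _ b0])

lemma p_cancel: "p (m + j) = p (n + j) \<Longrightarrow> p m = p n"
proof (induction j)
  case (Suc j)
  then show ?case
    using tate_inj[OF on_curve_p on_curve_p b0, of "m + j" "n + j"] by (simp add: p_Suc)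
qed simp

lemma p_neg_step: "ec_add (tate b c) (ec_neg (tate b c) (p (Suc n))) origin = ec_neg (tate b c) (p n)"
  unfolding p_Suc by (rule tate_cancel[OF on_curve_p b0])

lemma y6_condition: "2 * y6 + (1 - c) * x6 - b = q * e^2 * (e * q^2 - (3 * q^2 - 3 * q + 1))"
  unfolding y6_def x6_def unfolding b c d by Groebner_Basis.algebra

lemma p_12_iff: "p 12 = Infinity \<longleftrightarrow> e * q^2 = 3 * q^2 - 3 * q + 1"
proof -
  have "p 6 = ec_neg (tate b c) (p 6) \<longleftrightarrow> 2 * y6 + (1 - c) * x6 - b = 0"
    unfolding p_values by (simp add: algebra_simps, (auto simp: algebra_simps)?)
  also have "\<dots> \<longleftrightarrow> e * q^2 = 3 * q^2 - 3 * q + 1"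
    unfolding y6_condition using nz q0 by simp
  also have "p 6 = ec_neg (tate b c) (p 6) \<longleftrightarrow> p 12 = Infinity"
  proof
    assume *: "p 6 = ec_neg (tate b c) (p 6)"
    have "k \<le> 6 \<Longrightarrow> p (6 + k) = ec_neg (tate b c) (p (6 - k))" for k
    proof (induction k)
      case (Suc k)
      then have "6 - k = Suc (6 - Suc k)" "p (6 + k) = ec_neg (tate b c) (p (6 - k))" by simp_all
      then have "p (6 + Suc k) = ec_add (tate b c) (ec_neg (tate b c) (p (Suc (6 - Suc k)))) origin"
        by (simp only: p_Suc add_Suc_right)
      then show ?case by (simp only: p_neg_step)
    qed (use * in simp)
    from this[of 6] show "p 12 = Infinity" by simp
  next
    assume *: "p 12 = Infinity"
    have "k \<le> 6 \<Longrightarrow> ec_neg (tate b c) (p (12 - k)) = p k" for k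
    proof (induction k)
      case (Suc k)
      then have "12 - k = Suc (12 - Suc k)" "ec_neg (tate b c) (p (12 - k)) = p k" by simp_all
      then have "p (Suc k) = ec_add (tate b c) (ec_neg (tate b c) (p (Suc (12 - Suc k)))) origin"
        by (metis p_Suc)
      then show ?case by (simp only: p_neg_step)
    qed (use * in simp)
    from this[of 6] show "p 6 = ec_neg (tate b c) (p 6)" by simp
  qed
  finally show ?thesis by blast
qed

end

definition q2 :: "complex \<Rightarrow> complex" where "q2 q = 2*q^2-2*q+1"
definition q3 :: "complex \<Rightarrow> complex" where "q3 q = 3*q^2-3*q+1"
definition q6 :: "complex \<Rightarrow> complex" where "q6 q = 6*q^2-6*q+1"
definition qA :: "complex \<Rightarrow> complex" where "qA q = 1-8*q+22*q^2-28*q^3+12*q^4"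

definition admissible :: "complex \<Rightarrow> bool" where
  "admissible q \<longleftrightarrow> q \<noteq> 0 \<and> 1 - q \<noteq> 0 \<and> 1 - 2*q \<noteq> 0 \<and> q2 q \<noteq> 0 \<and> q3 q \<noteq> 0 \<and> q6 q \<noteq> 0"

definition qM :: "complex \<Rightarrow> complex" where "qM q = -1+6*q-14*q^2+16*q^3-6*q^4"

lemma qM: "q^3 - (1 - q) * (1 - 2*q) * q3 q = qM q"
  unfolding qM_def q3_def by Groebner_Basis.algebra

lemma qA_1: "4 * q^5 * (q - 1) * q3 q + (qM q)^2 - 4 * ((1 - q) * (1 - 2*q) * q2 q * q3 q) * q^2
    = (1 - 2*q) * q2 q * qA q"
  unfolding qM_def q2_def q3_def qA_def by Groebner_Basis.algebra

lemma qA_2: "(qA q)^2 - (1 - 2*q)^4 * q2 q * q6 q = 16 * q^5 * (1 - q) * q3 q"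
  unfolding q2_def q3_def q6_def qA_def by Groebner_Basis.algebra

lemma qA_3: "qA q + 2 * qM q = - ((1 - 2*q) * q2 q)"
  unfolding qM_def q2_def qA_def by Groebner_Basis.algebra

lemma qA_4: "6 * q^5 * (q - 1) * q3 q + (qM q)^2 - 4 * ((1 - q) * (1 - 2*q) * q2 q * q3 q) * q^2
      + qM q * (1 - 2*q) * q2 q = 2 * q * (q - 1)^5 * q3 q"
  unfolding qM_def q2_def q3_def qA_def by Groebner_Basis.algebra

lemma q6_eq: "36 * q2 q * q^5 * qM q + 16 * ((1 - q) * (1 - 2*q) * q3 q) * q2 q^2 * q^4 - 27 * q2 q * q^8
      - qM q^3 - 8 * q2 q * qM q^2 * q^2 = (1 - q)^8 * (1 - 2*q)^2 * q6 q"
  unfolding qM_def q2_def q3_def q6_def by Groebner_Basis.algebra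

text \<open>The case where the origin has order dividing 12.\<close>

locale tate_curve_12 = tate_curve +
  assumes e: "e * q^2 = q3 q"
begin

lemma dq: "d * q = q2 q"
proof -
  have "q * (d * q) = q * q2 q" using e unfolding d q2_def q3_def by Groebner_Basis.algebra
  then show ?thesis using q0 by simp
qed

lemma d1q: "(d - 1) * q = (1 - q) * (1 - 2 * q)"
  using dq unfolding q2_def by Groebner_Basis.algebra

lemma cq: "c * q^3 = (1 - q) * (1 - 2*q) * q3 q"
proof -
  have "c * q^3 = (e * q^2) * ((d - 1) * q)" unfolding c by Groebner_Basis.algebra
  then show ?thesis unfolding e d1q by Groebner_Basis.algebra
qed

lemma bq: "b * q^4 = (1 - q) * (1 - 2*q) * q2 q * q3 q"
proof -
  have "b * q^4 = (d * q) * (e * q^2) * ((d - 1) * q)" unfolding b by Groebner_Basis.algebra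
  then show ?thesis unfolding e d1q dq by Groebner_Basis.algebra
qed

lemma x6q: "x6 * q = (q - 1) * q3 q"
proof -
  have "x6 * q = (q - 1) * (e * q^2)" unfolding x6_def by Groebner_Basis.algebra
  then show ?thesis by (simp only: e)
qed

lemma p_12: "p 12 = Infinity" using p_12_iff e by (simp add: q3_def)

lemma p_nz: assumes "0 < n" "n < 12" shows "p n \<noteq> Infinity"
proof
  assume n: "p n = Infinity"
  have *: "p k \<noteq> Infinity" if "0 < k" "k \<le> 6" for k
  proof -
    have "k = 1 \<or> k = 2 \<or> k = 3 \<or> k = 4 \<or> k = 5 \<or> k = 6" using that by presburger
    then show ?thesis using p_values by (elim disjE) simp_all
  qed
  show False
  proof (cases "n \<le> 6")
    case True
    then show False using * n assms by blast
  next
    case False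
    have "p (0 + n) = p (12 - n + n)" using n p_12 assms by simp
    then have "p 0 = p (12 - n)" by (rule p_cancel)
    moreover have "0 < 12 - n" "12 - n \<le> 6" using False assms by simp_all
    ultimately show False using * by (metis p_0)
  qed
qed

lemma p_mod: "p n = p (n mod 12)"
proof -
  have *: "p (n + 12) = p n" for n
    by (induction n) (simp_all only: add_0 add_Suc p_12 p_0 p_Suc)
  have "p (n + 12 * k) = p n" for n k
    by (induction k arbitrary: n) (simp_all add: * add.assoc[symmetric])
  from this[of "n mod 12" "n div 12"] show ?thesis by simp
qed

lemma p_reflect: assumes "k \<le> 12" shows "ec_neg (tate b c) (p (12 - k)) = p k"
  using assms
proof (induction k)
  case (Suc k)
  then have "12 - k = Suc (12 - Suc k)" "ec_neg (tate b c) (p (12 - k)) = p k" by simp_all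
  then have "p (Suc k) = ec_add (tate b c) (ec_neg (tate b c) (p (Suc (12 - Suc k)))) origin"
    by (metis p_Suc)
  then show ?case by (simp only: p_neg_step)
qed (use p_12 in simp)

lemma not_multiple:
  assumes P: "P = ec_neg (tate b c) P" "P \<noteq> Infinity" "P \<noteq> p 6"
  shows "P \<noteq> p k"
proof
  assume "P = p k"
  then obtain k where k: "P = p k" "k < 12" using p_mod[of k] by (metis mod_less_divisor zero_less_numeral)
  have "p k = p (12 - k)"
    using p_reflect[of "12 - k"] P(1) k by (metis diff_diff_cancel diff_le_self less_imp_le)
  moreover have "k \<noteq> 0" "k \<noteq> 6" using k(1) P(2,3) by (metis p_0, metis)
  ultimately show False
  proof (cases "k < 6")
    case True
    have "p (0 + k) = p (12 - 2 * k + k)" using \<open>p k = p (12 - k)\<close> True by simp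
    then have "p 0 = p (12 - 2 * k)" by (rule p_cancel)
    then show False using p_nz[of "12 - 2 * k"] True \<open>k \<noteq> 0\<close> by simp
  next
    case False
    have "p (2 * k - 12 + (12 - k)) = p (0 + (12 - k))" using \<open>p k = p (12 - k)\<close> False k by simp
    then have "p (2 * k - 12) = p 0" by (rule p_cancel)
    then show False using p_nz[of "2 * k - 12"] False \<open>k \<noteq> 6\<close> k by simp
  qed
qed

lemma has_order_origin: "has_order (ec_group (tate b c) UNIV) origin 12"
  unfolding has_order_def carrier_ec_group_UNIV one_ec_group
  using p_12 p_nz unfolding p_def by simp

lemma discriminant_q:
  "discriminant (tate b c) * q^12 = b^3 * ((1-q)^9 * (1-2*q)^3 * q3 q * q6 q)"
proof -
  have "discriminant (tate b c) = b^3 * (- c * (1-c)^3 - 8*b*(1-c)^2 + 36*b*(1-c) + 16*b^2 - 27*b)"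
    unfolding discriminant.simps Let_def by simp Groebner_Basis.algebra
  then have "discriminant (tate b c) * q^12 =
      b^3 * (- (c*q^3) * (q^3-c*q^3)^3 - 8*(b*q^4)*q^2*(q^3-c*q^3)^2 + 36*(b*q^4)*q^5*(q^3-c*q^3) + 16*(b*q^4)^2*q^4 - 27*(b*q^4)*q^8)"
    by Groebner_Basis.algebra
  also have "\<dots> = b^3 * ((1-q) * (1-2*q) * q3 q * (36 * q2 q * q^5 * qM q
      + 16 * ((1 - q) * (1 - 2*q) * q3 q) * q2 q^2 * q^4 - 27 * q2 q * q^8
      - qM q^3 - 8 * q2 q * qM q^2 * q^2))"
    unfolding cq bq qM by Groebner_Basis.algebra
  also have "\<dots> = b^3 * ((1-q)^9 * (1-2*q)^3 * q3 q * q6 q)"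
    unfolding q6_eq by Groebner_Basis.algebra
  finally show ?thesis .
qed

definition quad where
  "quad x = 4 * (x^2 + x * x6 + x6^2) + ((1-c)^2 - 4*b) * (x + x6) - 2 * (1-c) * b"

lemma quad_q:
  assumes "8 * (x * q^6) = (1-2*q) * q2 q * z"
  shows "16 * q^12 * quad x = (1-2*q)^2 * q2 q^2 * ((z + qA q)^2 - (1-2*q)^4 * q2 q * q6 q)"
proof -
  have "16 * q^12 * quad x = (8*(x*q^6))^2 + 8 * (8*(x*q^6)) * (q^5 * (x6*q)) + 64 * q^10 * (x6*q)^2
      + (2 * (8*(x*q^6)) + 16 * q^5 * (x6*q)) * ((q^3 - c*q^3)^2 - 4*(b*q^4)*q^2) - 32 * q^5 * (q^3 - c*q^3) * (b*q^4)"
    unfolding quad_def by Groebner_Basis.algebra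
  also have "\<dots> = ((1-2*q) * q2 q * z)^2 + 2 * ((1-2*q) * q2 q * z) *
      (4 * q^5 * (q - 1) * q3 q + (qM q)^2 - 4 * ((1 - q) * (1 - 2*q) * q2 q * q3 q) * q^2)
     + 16 * q^5 * (q-1) * q3 q *
      ((4 * q^5 * (q - 1) * q3 q + (qM q)^2 - 4 * ((1 - q) * (1 - 2*q) * q2 q * q3 q) * q^2) +
        2 * qM q * (1-2*q) * q2 q)"
    unfolding assms x6q cq bq qM by Groebner_Basis.algebra
  also have "\<dots> = ((1-2*q) * q2 q * z)^2 + 2 * ((1-2*q) * q2 q)^2 * z * qA q
     + 16 * q^5 * (q-1) * q3 q * ((1-2*q) * q2 q) * (qA q + 2 * qM q)"
    unfolding qA_1 by Groebner_Basis.algebra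
  also have "\<dots> = ((1-2*q) * q2 q)^2 * (z^2 + 2 * z * qA q + 16 * q^5 * (1 - q) * q3 q)"
    unfolding qA_3 by Groebner_Basis.algebra
  also have "\<dots> = (1-2*q)^2 * q2 q^2 * ((z + qA q)^2 - (1-2*q)^4 * q2 q * q6 q)"
    unfolding qA_2[symmetric] by Groebner_Basis.algebra
  finally show ?thesis .
qed

lemma y6: "2 * y6 = b - (1 - c) * x6"
  using y6_condition e by (simp add: q3_def algebra_simps)

lemma two_torsion_iff:
  assumes "x \<noteq> x6"
  shows "on_curve (tate b c) (Affine x y) \<and> Affine x y = ec_neg (tate b c) (Affine x y)
    \<longleftrightarrow> 2 * y = b - (1 - c) * x \<and> quad x = 0"
proof -
  have neg: "Affine x y = ec_neg (tate b c) (Affine x y) \<longleftrightarrow> 2 * y = b - (1 - c) * x"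
    by (simp add: algebra_simps, (auto simp: algebra_simps)?)
  have curve: "on_curve (tate b c) (Affine x y) \<longleftrightarrow> quad x = 0" if y: "2 * y = b - (1 - c) * x"
  proof -
    have "on_curve (tate b c) (Affine x6 y6)" using on_curve_p[of 6] p_values by simp
    then have 6: "4 * x6^3 + ((1-c)^2 - 4*b) * x6^2 - 2 * (1-c) * b * x6 + b^2 = 0"
      using y6 by simp Groebner_Basis.algebra
    have "on_curve (tate b c) (Affine x y) \<longleftrightarrow> 4 * (y^2 + (1 - c) * x * y - b * y) = 4 * (x^3 - b * x^2)"
      by (simp only: on_curve.simps mult_cancel_left) simp
    also have "\<dots> \<longleftrightarrow> 4 * (x^3 - b * x^2) - 4 * (y^2 + (1 - c) * x * y - b * y) = 0"
      by auto
    also have "4 * (x^3 - b * x^2) - 4 * (y^2 + (1 - c) * x * y - b * y) =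
        4 * x^3 + ((1-c)^2 - 4*b) * x^2 - 2 * (1-c) * b * x + b^2 - (2*y - (b - (1-c)*x))^2"
      by Groebner_Basis.algebra
    also have "\<dots> = 4 * x^3 + ((1-c)^2 - 4*b) * x^2 - 2 * (1-c) * b * x + b^2"
      unfolding y by simp
    also have "4 * x^3 + ((1-c)^2 - 4*b) * x^2 - 2 * (1-c) * b * x + b^2 = (x - x6) * quad x"
      using 6 unfolding quad_def by Groebner_Basis.algebra
    finally show ?thesis using assms by simp
  qed
  show ?thesis using neg curve by blast
qed

lemma nonzero: assumes "discriminant (tate b c) \<noteq> 0" shows "admissible q"
proof -
  have "q3 q \<noteq> 0" using e nz q0 by auto
  moreover have "q2 q \<noteq> 0" using dq nz q0 by auto
  moreover have "1 - q \<noteq> 0" "1 - 2*q \<noteq> 0" using d1q nz q0 by auto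
  moreover have "q6 q \<noteq> 0" using discriminant_q assms q0 by auto
  ultimately show ?thesis using q0 by (simp add: admissible_def)
qed

lemma quad_x6: assumes "admissible q" shows "quad x6 \<noteq> 0"
proof
  assume 0: "quad x6 = 0"
  have "q^12 * quad x6 = 12 * q^10 * (x6*q)^2 + 2 * q^5 * (x6*q) * ((q^3 - c*q^3)^2 - 4*(b*q^4)*q^2) - 2 * q^5 * (q^3 - c*q^3) * (b*q^4)"
    unfolding quad_def by Groebner_Basis.algebra
  also have "\<dots> = 2 * q^5 * (q-1) * q3 q * (6 * q^5 * (q - 1) * q3 q + (qM q)^2
      - 4 * ((1 - q) * (1 - 2*q) * q2 q * q3 q) * q^2 + qM q * (1 - 2*q) * q2 q)"
    unfolding x6q cq bq qM by Groebner_Basis.algebra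
  also have "\<dots> = 4 * q^6 * (1-q)^6 * q3 q^2"
    unfolding qA_4 by Groebner_Basis.algebra
  finally show False using 0 assms by (auto simp: admissible_def)
qed

end

lemma pow_2: "P [^]\<^bsub>ec_group W K\<^esub> (2::nat) = ec_add W P P"
  by (simp add: numeral_2_eq_2 ec_pow_Suc ec_group_def)

lemma has_order_2_iff:
  "has_order (ec_group W UNIV) P 2 \<longleftrightarrow> P \<noteq> Infinity \<and> on_curve W P \<and> P = ec_neg W P"
proof -
  have m: "0 < m \<and> m < 2 \<longleftrightarrow> m = Suc 0" for m :: nat by auto
  have a: "ec_add W P P = Infinity \<longleftrightarrow> P = ec_neg W P"
    by (cases W; cases P) (auto simp: Let_def)
  show ?thesis unfolding has_order_def carrier_ec_group_UNIV one_ec_group pow_2 m a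
    by (auto simp: ec_group_def)
qed

lemma on_curve_change:
  fixes u :: "'a::field"
  assumes "u \<noteq> 0"
  shows "on_curve (change_curve u r s t W) (change_point u r s t P) \<longleftrightarrow> on_curve W P"
proof (cases W; cases P)
  fix a1 a2 a3 a4 a6 x y
  assume W: "W = Weierstrass a1 a2 a3 a4 a6" and P: "P = Affine x y"
  define A1 where "A1 = (a1 + 2 * s) / u"
  define A2 where "A2 = (a2 - s * a1 + 3 * r - s^2) / u^2"
  define A3 where "A3 = (a3 + r * a1 + 2 * t) / u^3"
  define A4 where "A4 = (a4 - s * a3 + 2 * r * a2 - (t + r * s) * a1 + 3 * r^2 - 2 * s * t) / u^4"
  define A6 where "A6 = (a6 + r * a4 + r^2 * a2 + r^3 - t * a3 - t^2 - r * t * a1) / u^6"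
  define x' where "x' = (x - r) / u^2"
  define y' where "y' = (y - t - s * (x - r)) / u^3"
  have A: "u * A1 = a1 + 2 * s" "u^2 * A2 = a2 - s * a1 + 3 * r - s^2"
    "u^3 * A3 = a3 + r * a1 + 2 * t"
    "u^4 * A4 = a4 - s * a3 + 2 * r * a2 - (t + r * s) * a1 + 3 * r^2 - 2 * s * t"
    "u^6 * A6 = a6 + r * a4 + r^2 * a2 + r^3 - t * a3 - t^2 - r * t * a1"
    "u^2 * x' = x - r" "u^3 * y' = y - t - s * (x - r)"
    using assms by (simp_all add: A1_def A2_def A3_def A4_def A6_def x'_def y'_def)
  have "u^6 * (y'^2 + A1 * x' * y' + A3 * y' - (x'^3 + A2 * x'^2 + A4 * x' + A6)) =
    (u^3 * y')^2 + (u * A1) * (u^2 * x') * (u^3 * y') + (u^3 * A3) * (u^3 * y')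
      - ((u^2*x')^3 + (u^2 * A2) * (u^2 * x')^2 + (u^4 * A4) * (u^2 * x') + u^6 * A6)"
    by Groebner_Basis.algebra
  also have "\<dots> = y^2 + a1 * x * y + a3 * y - (x^3 + a2 * x^2 + a4 * x + a6)"
    unfolding A by Groebner_Basis.algebra
  finally have "y'^2 + A1 * x' * y' + A3 * y' - (x'^3 + A2 * x'^2 + A4 * x' + A6) = 0 \<longleftrightarrow>
     y^2 + a1 * x * y + a3 * y - (x^3 + a2 * x^2 + a4 * x + a6) = 0"
    using assms by (metis mult_eq_0_iff power_not_zero)
  then show ?thesis
    unfolding W P change_curve.simps change_point.simps on_curve.simps right_minus_eq
      A1_def A2_def A3_def A4_def A6_def x'_def y'_def .
qed simp

lemma discriminant_change:
  fixes u :: complex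
  assumes "u \<noteq> 0"
  shows "u^12 * discriminant (change_curve u r s t W) = discriminant W"
proof (cases W)
  fix a1 a2 a3 a4 a6
  assume W: "W = Weierstrass a1 a2 a3 a4 a6"
  define A1 where "A1 = (a1 + 2 * s) / u"
  define A2 where "A2 = (a2 - s * a1 + 3 * r - s^2) / u^2"
  define A3 where "A3 = (a3 + r * a1 + 2 * t) / u^3"
  define A4 where "A4 = (a4 - s * a3 + 2 * r * a2 - (t + r * s) * a1 + 3 * r^2 - 2 * s * t) / u^4"
  define A6 where "A6 = (a6 + r * a4 + r^2 * a2 + r^3 - t * a3 - t^2 - r * t * a1) / u^6"
  have A: "u * A1 = a1 + 2 * s" "u^2 * A2 = a2 - s * a1 + 3 * r - s^2"
    "u^3 * A3 = a3 + r * a1 + 2 * t"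
    "u^4 * A4 = a4 - s * a3 + 2 * r * a2 - (t + r * s) * a1 + 3 * r^2 - 2 * s * t"
    "u^6 * A6 = a6 + r * a4 + r^2 * a2 + r^3 - t * a3 - t^2 - r * t * a1"
    using assms by (simp_all add: A1_def A2_def A3_def A4_def A6_def)
  define b2 b4 b6 where "b2 = a1^2 + 4 * a2" "b4 = 2 * a4 + a1 * a3" "b6 = a3^2 + 4 * a6"
  define B2 B4 B6 where "B2 = A1^2 + 4 * A2" "B4 = 2 * A4 + A1 * A3" "B6 = A3^2 + 4 * A6"
  have D: "4 * discriminant (Weierstrass a1 a2 a3 a4 a6) =
     36 * b2 * b4 * b6 - b2^2 * (b2 * b6 - b4^2) - 32 * b4^3 - 108 * b6^2"
     if "b2 = a1^2 + 4 * a2" "b4 = 2 * a4 + a1 * a3" "b6 = a3^2 + 4 * a6"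
     for a1 a2 a3 a4 a6 b2 b4 b6 :: complex
  proof -
    have "4 * (a1^2 * a6 + 4 * a2 * a6 - a1 * a3 * a4 + a2 * a3^2 - a4^2) = b2 * b6 - b4^2"
      unfolding that by Groebner_Basis.algebra
    then show ?thesis unfolding discriminant.simps Let_def unfolding that[symmetric]
      by Groebner_Basis.algebra
  qed
  have "u^2 * B2 = (u * A1)^2 + 4 * (u^2 * A2)"
    unfolding B2_B4_B6_def by Groebner_Basis.algebra
  then have B2: "u^2 * B2 = b2 + 12 * r"
    unfolding A b2_b4_b6_def by Groebner_Basis.algebra
  have "u^4 * B4 = 2 * (u^4 * A4) + (u * A1) * (u^3 * A3)"
    unfolding B2_B4_B6_def by Groebner_Basis.algebra
  then have B4: "u^4 * B4 = b4 + r * b2 + 6 * r^2"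
    unfolding A b2_b4_b6_def by Groebner_Basis.algebra
  have "u^6 * B6 = (u^3 * A3)^2 + 4 * (u^6 * A6)"
    unfolding B2_B4_B6_def by Groebner_Basis.algebra
  then have B6: "u^6 * B6 = b6 + 2 * r * b4 + r^2 * b2 + 4 * r^3"
    unfolding A b2_b4_b6_def by Groebner_Basis.algebra
  have "4 * (u^12 * discriminant (Weierstrass A1 A2 A3 A4 A6)) =
     u^12 * (4 * discriminant (Weierstrass A1 A2 A3 A4 A6))" by simp
  also have "\<dots> = 36 * (u^2 * B2) * (u^4 * B4) * (u^6 * B6)
     - (u^2 * B2)^2 * ((u^2 * B2) * (u^6 * B6) - (u^4 * B4)^2) - 32 * (u^4 * B4)^3 - 108 * (u^6 * B6)^2"
    unfolding D[OF B2_B4_B6_def] by Groebner_Basis.algebra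
  also have "\<dots> = 36 * b2 * b4 * b6 - b2^2 * (b2 * b6 - b4^2) - 32 * b4^3 - 108 * b6^2"
    unfolding B2 B4 B6 by Groebner_Basis.algebra
  also have "\<dots> = 4 * discriminant W" unfolding W D[OF b2_b4_b6_def] ..
  finally show ?thesis
    unfolding W change_curve.simps A1_def A2_def A3_def A4_def A6_def by simp
qed

lemma ec_add_slope:
  assumes "x1 \<noteq> x2 \<or> y2 \<noteq> - y1 - a1 * x1 - a3"
    "if x1 = x2 then 2 * y1 + a1 * x1 + a3 \<noteq> 0 \<and> l * (2 * y1 + a1 * x1 + a3) = 3 * x1^2 + 2 * a2 * x1 + a4 - a1 * y1
       else l * (x2 - x1) = y2 - y1"
    "x3 = l^2 + a1 * l - a2 - x1 - x2" "y3 = - (l * (x3 - x1) + y1) - a1 * x3 - a3"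
  shows "ec_add (Weierstrass a1 a2 a3 a4 a6) (Affine x1 y1) (Affine x2 y2) = Affine x3 y3"
proof -
  have "(if x1 = x2 then (3 * x1^2 + 2 * a2 * x1 + a4 - a1 * y1) / (2 * y1 + a1 * x1 + a3)
                    else (y2 - y1) / (x2 - x1)) = l"
  proof (cases "x1 = x2")
    case True
    then show ?thesis using assms(2) by (simp add: divide_eq_eq)
  next
    case False
    then have "x2 - x1 \<noteq> 0" by simp
    moreover have "l * (x2 - x1) = y2 - y1" using assms(2) False by simp
    ultimately show ?thesis using False by (simp add: divide_eq_eq)
  qed
  then show ?thesis using assms(1,3,4) unfolding ec_add.simps Let_def by (simp only:) auto
qed

lemma slope_exists:
  fixes a1 :: "'a::field"
  assumes "x1 \<noteq> x2 \<or> y2 \<noteq> - y1 - a1 * x1 - a3"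
    and "on_curve (Weierstrass a1 a2 a3 a4 a6) (Affine x1 y1)"
    and "on_curve (Weierstrass a1 a2 a3 a4 a6) (Affine x2 y2)"
  obtains l where
    "if x1 = x2 then 2 * y1 + a1 * x1 + a3 \<noteq> 0 \<and> l * (2 * y1 + a1 * x1 + a3) = 3 * x1^2 + 2 * a2 * x1 + a4 - a1 * y1
       else l * (x2 - x1) = y2 - y1"
proof (cases "x1 = x2")
  case True
  have "(y2 - y1) * (y2 + y1 + a1 * x1 + a3) = 0"
    using assms(2,3) True by simp Groebner_Basis.algebra
  moreover have "y2 + y1 + a1 * x1 + a3 \<noteq> 0"
  proof
    assume "y2 + y1 + a1 * x1 + a3 = 0"
    then have "y2 = - y1 - a1 * x1 - a3" by Groebner_Basis.algebra
    then show False using assms(1) True by simp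
  qed
  ultimately have "y2 = y1" by (metis mult_eq_0_iff right_minus_eq)
  with \<open>y2 + y1 + a1 * x1 + a3 \<noteq> 0\<close> have *: "2 * y1 + a1 * x1 + a3 \<noteq> 0" by (simp only: mult_2) simp
  show ?thesis
  proof (rule that)
    show "if x1 = x2 then 2 * y1 + a1 * x1 + a3 \<noteq> 0 \<and> (3 * x1^2 + 2 * a2 * x1 + a4 - a1 * y1) / (2 * y1 + a1 * x1 + a3) * (2 * y1 + a1 * x1 + a3) = 3 * x1^2 + 2 * a2 * x1 + a4 - a1 * y1
       else (3 * x1^2 + 2 * a2 * x1 + a4 - a1 * y1) / (2 * y1 + a1 * x1 + a3) * (x2 - x1) = y2 - y1"
      unfolding if_P[OF True] using * by (intro conjI nonzero_divide_mult_cancel_right) auto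
  qed
next
  case False
  show ?thesis
  proof (rule that)
    show "if x1 = x2 then 2 * y1 + a1 * x1 + a3 \<noteq> 0 \<and> (y2 - y1) / (x2 - x1) * (2 * y1 + a1 * x1 + a3) = 3 * x1^2 + 2 * a2 * x1 + a4 - a1 * y1
       else (y2 - y1) / (x2 - x1) * (x2 - x1) = y2 - y1"
      unfolding if_not_P[OF False] using False by simp
  qed
qed

lemma ec_add_change:
  fixes u :: "'a::field"
  assumes u: "u \<noteq> 0" and AB: "on_curve W A" "on_curve W B"
  shows "ec_add (change_curve u r s t W) (change_point u r s t A) (change_point u r s t B)
     = change_point u r s t (ec_add W A B)"
proof -
  obtain a1 a2 a3 a4 a6 where W: "W = Weierstrass a1 a2 a3 a4 a6" by (cases W)
  consider "A = Infinity" | "B = Infinity" | x1 y1 x2 y2 where "A = Affine x1 y1" "B = Affine x2 y2"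
    by (cases A; cases B) auto
  then show ?thesis
  proof cases
    case 1
    then show ?thesis by simp
  next
    case 2
    then show ?thesis by (simp add: ec_add_Infinity)
  next
    case 3
    define A1 where "A1 = (a1 + 2 * s) / u"
    define A2 where "A2 = (a2 - s * a1 + 3 * r - s^2) / u^2"
    define A3 where "A3 = (a3 + r * a1 + 2 * t) / u^3"
    define A4 where "A4 = (a4 - s * a3 + 2 * r * a2 - (t + r * s) * a1 + 3 * r^2 - 2 * s * t) / u^4"
    define A6 where "A6 = (a6 + r * a4 + r^2 * a2 + r^3 - t * a3 - t^2 - r * t * a1) / u^6"
    define X1 where "X1 = (x1 - r) / u^2"
    define Y1 where "Y1 = (y1 - t - s * (x1 - r)) / u^3"
    define X2 where "X2 = (x2 - r) / u^2"
    define Y2 where "Y2 = (y2 - t - s * (x2 - r)) / u^3"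
    have A: "u * A1 = a1 + 2 * s" "u^2 * A2 = a2 - s * a1 + 3 * r - s^2"
      "u^3 * A3 = a3 + r * a1 + 2 * t"
      "u^4 * A4 = a4 - s * a3 + 2 * r * a2 - (t + r * s) * a1 + 3 * r^2 - 2 * s * t"
      and P: "u^2 * X1 = x1 - r" "u^3 * Y1 = y1 - t - s * (x1 - r)"
      "u^2 * X2 = x2 - r" "u^3 * Y2 = y2 - t - s * (x2 - r)"
      using u by (simp_all add: A1_def A2_def A3_def A4_def X1_def Y1_def X2_def Y2_def)
    have W': "change_curve u r s t W = Weierstrass A1 A2 A3 A4 A6"
      unfolding W change_curve.simps A1_def A2_def A3_def A4_def A6_def ..
    have A': "change_point u r s t A = Affine X1 Y1" "change_point u r s t B = Affine X2 Y2"
      unfolding 3 change_point.simps X1_def Y1_def X2_def Y2_def by simp_all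
    have xeq: "X1 = X2 \<longleftrightarrow> x1 = x2" using u by (auto simp: X1_def X2_def)
    have yeq: "Y2 = - Y1 - A1 * X1 - A3 \<longleftrightarrow> y2 = - y1 - a1 * x1 - a3" if "x1 = x2"
    proof -
      have "u^3 * (Y2 + Y1 + A1 * X1 + A3) = u^3 * Y2 + u^3 * Y1 + (u * A1) * (u^2 * X1) + u^3 * A3"
        by Groebner_Basis.algebra
      also have "\<dots> = y2 + y1 + a1 * x1 + a3" unfolding A P that by Groebner_Basis.algebra
      finally have "Y2 + Y1 + A1 * X1 + A3 = 0 \<longleftrightarrow> y2 + y1 + a1 * x1 + a3 = 0"
        using u by (metis mult_eq_0_iff power_not_zero)
      moreover have "y + z + w + v = 0 \<longleftrightarrow> y = - z - w - v" for y z w v :: 'a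
      proof -
        have "y + z + w + v = y - (- z - w - v)" by simp
        then show ?thesis by (simp only: right_minus_eq)
      qed
      ultimately show ?thesis by simp
    qed
    show ?thesis
    proof (cases "x1 = x2 \<and> y2 = - y1 - a1 * x1 - a3")
      case True
      then have "X1 = X2 \<and> Y2 = - Y1 - A1 * X1 - A3" using xeq yeq by blast
      then show ?thesis unfolding W' A' using True by (simp add: W 3)
    next
      case False
      then have *: "x1 \<noteq> x2 \<or> y2 \<noteq> - y1 - a1 * x1 - a3" "X1 \<noteq> X2 \<or> Y2 \<noteq> - Y1 - A1 * X1 - A3"
        using xeq yeq by blast+
      obtain l where l: "if x1 = x2 then 2 * y1 + a1 * x1 + a3 \<noteq> 0 \<and> l * (2 * y1 + a1 * x1 + a3) = 3 * x1^2 + 2 * a2 * x1 + a4 - a1 * y1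
       else l * (x2 - x1) = y2 - y1"
        using slope_exists[OF *(1)] AB unfolding W 3 by blast
      define L where "L = (l - s) / u"
      have L: "u * L = l - s" using u by (simp add: L_def)
      have L': "if X1 = X2 then 2 * Y1 + A1 * X1 + A3 \<noteq> 0 \<and> L * (2 * Y1 + A1 * X1 + A3) = 3 * X1^2 + 2 * A2 * X1 + A4 - A1 * Y1
         else L * (X2 - X1) = Y2 - Y1"
      proof (cases "x1 = x2")
        case True
        have "u^3 * (2 * Y1 + A1 * X1 + A3) = 2 * (u^3 * Y1) + (u * A1) * (u^2 * X1) + u^3 * A3"
          by Groebner_Basis.algebra
        also have "\<dots> = 2 * y1 + a1 * x1 + a3" unfolding A P by Groebner_Basis.algebra
        finally have D: "u^3 * (2 * Y1 + A1 * X1 + A3) = 2 * y1 + a1 * x1 + a3" .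
        then have D0: "2 * Y1 + A1 * X1 + A3 \<noteq> 0" using l True by auto
        have l': "l * (2 * y1 + a1 * x1 + a3) = 3 * x1^2 + 2 * a2 * x1 + a4 - a1 * y1"
          using l True by simp
        have "u^4 * (L * (2 * Y1 + A1 * X1 + A3)) = (u * L) * (u^3 * (2 * Y1 + A1 * X1 + A3))"
          by Groebner_Basis.algebra
        also have "\<dots> = l * (2 * y1 + a1 * x1 + a3) - s * (2 * y1 + a1 * x1 + a3)"
          unfolding D L by Groebner_Basis.algebra
        also have "\<dots> = 3 * (u^2*X1)^2 + 2 * (u^2*A2) * (u^2*X1) + u^4*A4 - (u*A1) * (u^3*Y1)"
          unfolding l' A P by Groebner_Basis.algebra
        also have "\<dots> = u^4 * (3 * X1^2 + 2 * A2 * X1 + A4 - A1 * Y1)" by Groebner_Basis.algebra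
        finally have "L * (2 * Y1 + A1 * X1 + A3) = 3 * X1^2 + 2 * A2 * X1 + A4 - A1 * Y1"
          using u by simp
        then show ?thesis using D0 xeq True by simp
      next
        case False
        have "u^3 * (L * (X2 - X1)) = (u * L) * (u^2 * X2 - u^2 * X1)" by Groebner_Basis.algebra
        also have "\<dots> = l * (x2 - x1) - s * (x2 - x1)" unfolding L P by Groebner_Basis.algebra
        also have "l * (x2 - x1) = y2 - y1" using l False by simp
        also have "y2 - y1 - s * (x2 - x1) = u^3 * Y2 - u^3 * Y1" unfolding P by Groebner_Basis.algebra
        also have "\<dots> = u^3 * (Y2 - Y1)" by Groebner_Basis.algebra
        finally show ?thesis using u False xeq by simp
      qed
      define x3 where "x3 = l^2 + a1 * l - a2 - x1 - x2"
      define y3 where "y3 = - (l * (x3 - x1) + y1) - a1 * x3 - a3"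
      define X3 where "X3 = (x3 - r) / u^2"
      define Y3 where "Y3 = (y3 - t - s * (x3 - r)) / u^3"
      have P3: "u^2 * X3 = x3 - r" "u^3 * Y3 = y3 - t - s * (x3 - r)"
        using u by (simp_all add: X3_def Y3_def)
      have "u^2 * (L^2 + A1 * L - A2 - X1 - X2) = (u*L)^2 + (u*A1) * (u*L) - u^2*A2 - u^2*X1 - u^2*X2"
        by Groebner_Basis.algebra
      also have "\<dots> = u^2 * X3" unfolding P3 L A P x3_def by Groebner_Basis.algebra
      finally have X3: "X3 = L^2 + A1 * L - A2 - X1 - X2" using u by simp
      have "u^3 * (- (L * (X3 - X1) + Y1) - A1 * X3 - A3) =
         - ((u*L) * (u^2*X3 - u^2*X1) + u^3*Y1) - (u*A1) * (u^2*X3) - u^3*A3"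
        by Groebner_Basis.algebra
      also have "\<dots> = u^3 * Y3" unfolding P3 L A P y3_def by Groebner_Basis.algebra
      finally have Y3: "Y3 = - (L * (X3 - X1) + Y1) - A1 * X3 - A3" using u by simp
      have "ec_add W A B = Affine x3 y3"
        unfolding W 3 by (rule ec_add_slope[OF *(1) l x3_def y3_def])
      moreover have "ec_add (Weierstrass A1 A2 A3 A4 A6) (Affine X1 Y1) (Affine X2 Y2) = Affine X3 Y3"
        by (rule ec_add_slope[OF *(2) L' X3 Y3])
      ultimately show ?thesis unfolding W' A' by (simp add: X3_def Y3_def)
    qed
  qed
qed

context tate_curve_12
begin

lemma level_structure_iff:
  "level_structure (tate b c) P origin \<longleftrightarrow>
     admissible q \<and> (\<exists>x y. P = Affine x y \<and> 2 * y = b - (1 - c) * x \<and> quad x = 0)"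
proof
  assume L: "level_structure (tate b c) P origin"
  have adm: "admissible q" using L nonzero unfolding level_structure_def by blast
  have P: "P \<noteq> Infinity" "on_curve (tate b c) P" "P = ec_neg (tate b c) P"
    using L unfolding level_structure_def has_order_2_iff by blast+
  obtain x y where xy: "P = Affine x y" using P(1) by (cases P) auto
  have "P \<noteq> p 6" using L unfolding level_structure_def p_def by blast
  have "x \<noteq> x6"
  proof
    assume x: "x = x6"
    have "2 * y = b - (1 - c) * x" using P(3) unfolding xy by (simp add: algebra_simps)
    then have "2 * y = 2 * y6" unfolding x y6 .
    then show False using \<open>P \<noteq> p 6\<close> x xy p_values by simp
  qed
  then have "2 * y = b - (1 - c) * x \<and> quad x = 0"
    using two_torsion_iff P unfolding xy by blast
  then show "admissible q \<and> (\<exists>x y. P = Affine x y \<and> 2 * y = b - (1 - c) * x \<and> quad x = 0)"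
    using adm xy by blast
next
  assume "admissible q \<and> (\<exists>x y. P = Affine x y \<and> 2 * y = b - (1 - c) * x \<and> quad x = 0)"
  then obtain x y where adm: "admissible q" and P: "P = Affine x y" "2 * y = b - (1 - c) * x" "quad x = 0"
    by blast
  have x: "x \<noteq> x6" using quad_x6[OF adm] P(3) by auto
  have P': "on_curve (tate b c) P" "P = ec_neg (tate b c) P"
    using two_torsion_iff[OF x] P(2,3) unfolding P(1) by blast+
  have "P \<noteq> p k" for k
    by (rule not_multiple) (use P' x p_values P(1) in auto)
  moreover have "discriminant (tate b c) \<noteq> 0"
  proof
    assume "discriminant (tate b c) = 0"
    then have "b^3 * ((1-q)^9 * (1-2*q)^3 * q3 q * q6 q) = 0" using discriminant_q by simp
    then show False using adm b0 by (simp add: admissible_def)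
  qed
  ultimately show "level_structure (tate b c) P origin"
    unfolding level_structure_def has_order_2_iff using P' P(1) has_order_origin
    by (auto simp: p_def)
qed

end

lemma tate_normal_form:
  fixes b c :: complex
  assumes "has_order (ec_group (tate b c) UNIV) origin 12" "b \<noteq> 0"
  obtains d e q where "tate_curve_12 b c d e q"
proof -
  define pw where "pw n = origin [^]\<^bsub>ec_group (tate b c) UNIV\<^esub> n" for n :: nat
  have Suc: "pw (Suc n) = ec_add (tate b c) (pw n) origin" for n
    unfolding pw_def by (rule ec_pow_Suc)
  have S: "pw (numeral (Num.inc k)) = ec_add (tate b c) (pw (numeral k)) origin" for k
    using Suc[of "numeral k"] by (simp add: numeral_inc)
  have nz: "pw n \<noteq> Infinity" if "0 < n" "n < 12" for n
    using assms(1) that unfolding has_order_def pw_def one_ec_group by blast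
  have neg: "pw n \<noteq> Affine 0 b" if "n < 11" for n
    using nz[of "Suc n"] that unfolding Suc by auto
  have 1: "pw 1 = origin" using Suc[of 0] by (simp add: pw_def)
  have 2: "pw 2 = Affine b (b * c)" using Suc[of 1] 1 tate_double_origin[OF assms(2)]
    by (simp add: numeral_2_eq_2)
  have 3: "pw 3 = Affine c (b - c)"
    unfolding S[of "num.Bit0 num.One", simplified] 2
    by (rule tate_step[OF assms(2), where l = c]) (simp_all add: algebra_simps power2_eq_square)
  have c: "c \<noteq> 0" using 3 neg[of 3] by auto
  define d where "d = b / c"
  have b: "b = d * c" and d0: "d \<noteq> 0" using c assms(2) by (simp_all add: d_def)
  have 4: "pw 4 = Affine (d * (d - 1)) (d^2 * (c - d + 1))"
    unfolding S[of "num.Bit1 num.One", simplified] 3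
    by (rule tate_step[OF c, where l = "d - 1"]) (simp_all add: b, Groebner_Basis.algebra+)
  have d1: "d \<noteq> 1" using 4 neg[of 4] b by auto
  define e where "e = c / (d - 1)"
  have c': "c = e * (d - 1)" and e0: "e \<noteq> 0" using c d1 by (simp_all add: e_def)
  have 5: "pw 5 = Affine (d * e * (e - 1)) (d * e^2 * (d - e))"
    unfolding S[of "num.Bit0 (num.Bit0 num.One)", simplified] 4
    by (rule tate_step[where l = "d * (e - 1)"]) (use d0 d1 in \<open>simp_all add: b c'\<close>, Groebner_Basis.algebra+)
  have e1: "e \<noteq> 1" using 5 neg[of 5] b c' by auto
  define q where "q = (1 - d) / (1 - e)"
  have "q * (1 - e) = 1 - d" using e1 by (simp add: q_def)
  then have dq: "d = 1 - q + q * e" by Groebner_Basis.algebra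
  interpret tate_curve b c d e q
  proof
    have "b = d * (e * (d - 1))" by (rule b[unfolded c'])
    then show "b = d * e * (d - 1)" by (simp only: mult.assoc)
  qed (fact d0 d1 e0 e1 dq c')+
  have "p 12 = Infinity"
    using assms(1) unfolding has_order_def p_def one_ec_group by simp
  then have "e * q^2 = q3 q"
    using p_12_iff unfolding q3_def by simp
  then have "tate_curve_12 b c d e q" by unfold_locales
  then show ?thesis by (rule that)
qed

lemma has_order_change:
  fixes u :: complex
  assumes "u \<noteq> 0" and W': "change_curve u r s t W = tate b c" and b: "b \<noteq> 0"
    and Q': "change_point u r s t Q = origin"
  shows "change_point u r s t (Q [^]\<^bsub>ec_group W UNIV\<^esub> (n::nat)) = origin [^]\<^bsub>ec_group (tate b c) UNIV\<^esub> n"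
    and "on_curve (tate b c) (origin [^]\<^bsub>ec_group (tate b c) UNIV\<^esub> n)"
proof (induction n)
  case 0
  show "change_point u r s t (Q [^]\<^bsub>ec_group W UNIV\<^esub> (0::nat)) = origin [^]\<^bsub>ec_group (tate b c) UNIV\<^esub> (0::nat)"
    "on_curve (tate b c) (origin [^]\<^bsub>ec_group (tate b c) UNIV\<^esub> (0::nat))" by simp_all
next
  case (Suc n)
  show "on_curve (tate b c) (origin [^]\<^bsub>ec_group (tate b c) UNIV\<^esub> Suc n)"
    unfolding ec_pow_Suc by (rule on_curve_tate_add[OF Suc(2) b])
  have "on_curve W Q"
    using on_curve_change[OF assms(1), of r s t W Q] unfolding W' Q' by simp
  moreover have "on_curve W (Q [^]\<^bsub>ec_group W UNIV\<^esub> n)"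
    using on_curve_change[OF assms(1), of r s t W] Suc unfolding W' by metis
  ultimately show "change_point u r s t (Q [^]\<^bsub>ec_group W UNIV\<^esub> Suc n) = origin [^]\<^bsub>ec_group (tate b c) UNIV\<^esub> Suc n"
    unfolding ec_pow_Suc by (simp only: ec_add_change[OF assms(1), symmetric] W' Q' Suc(1))
qed

lemma level_structure_change:
  fixes u :: complex
  assumes u: "u \<noteq> 0" and W': "change_curve u r s t W = tate b c" and b: "b \<noteq> 0"
    and Q': "change_point u r s t Q = origin" and L: "level_structure W P Q"
  shows "level_structure (tate b c) (change_point u r s t P) origin"
proof -
  note h = has_order_change[OF u W' b Q']
  have inf: "change_point u r s t A = Infinity \<longleftrightarrow> A = Infinity" for A by (cases A) auto
  have inj: "change_point u r s t A = change_point u r s t B \<Longrightarrow> A = B" for A B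
    by (cases A; cases B) (use u in auto)
  have P: "P \<noteq> Infinity" "on_curve W P" "ec_add W P P = Infinity"
    using L unfolding level_structure_def has_order_def carrier_ec_group_UNIV one_ec_group pow_2
    by (auto dest: spec[of _ "1::nat"] simp: ec_group_def)
  have "ec_add (tate b c) (change_point u r s t P) (change_point u r s t P) = Infinity"
    using ec_add_change[OF u P(2) P(2), of r s t] P(3) W' by simp
  moreover have "change_point u r s t P \<noteq> Infinity" using P inf by blast
  moreover have "on_curve (tate b c) (change_point u r s t P)"
    using on_curve_change[OF u, of r s t W P] P W' by simp
  ultimately have "has_order (ec_group (tate b c) UNIV) (change_point u r s t P) 2"
    unfolding has_order_def carrier_ec_group_UNIV one_ec_group pow_2
    by (auto simp: less_2_cases_iff ec_group_def)
  moreover have "has_order (ec_group (tate b c) UNIV) origin 12"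
    using L unfolding level_structure_def has_order_def carrier_ec_group_UNIV one_ec_group
      h(1)[symmetric] inf by simp
  moreover have "discriminant (tate b c) \<noteq> 0"
    using discriminant_change[OF u, of r s t W] L unfolding W' level_structure_def by auto
  moreover have "change_point u r s t P \<noteq> origin [^]\<^bsub>ec_group (tate b c) UNIV\<^esub> (k::nat)" for k
    using L inj unfolding h(1)[symmetric] level_structure_def by blast
  ultimately show ?thesis unfolding level_structure_def by blast
qed

lemma level_structure_to_tate:
  fixes W :: "complex weierstrass"
  assumes L: "level_structure W P Q"
  obtains u r s t b c where "u \<noteq> 0" "change_curve u r s t W = tate b c" "b \<noteq> 0"
    "change_point u r s t Q = origin"
proof -
  obtain a1 a2 a3 a4 a6 where W: "W = Weierstrass a1 a2 a3 a4 a6" by (cases W)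
  have Q12: "Q [^]\<^bsub>ec_group W UNIV\<^esub> m \<noteq> Infinity" if "0 < m" "m < 12" for m :: nat
    using L that unfolding level_structure_def has_order_def one_ec_group by blast
  have 1: "Q [^]\<^bsub>ec_group W UNIV\<^esub> (1::nat) = Q"
    by (simp add: ec_group_def)
  have 2: "ec_add W Q Q \<noteq> Infinity" using Q12[of 2] by (simp add: pow_2)
  have 3: "ec_add W (ec_add W Q Q) Q \<noteq> Infinity"
    using Q12[of 3] unfolding numeral_3_eq_3 ec_pow_Suc by simp
  have "Q \<noteq> Infinity" using Q12[of 1] 1 by simp
  then obtain r t where Q: "Q = Affine r t" by (cases Q) auto
  have on: "t^2 + a1 * r * t + a3 * t = r^3 + a2 * r^2 + a4 * r + a6"
    using L unfolding level_structure_def has_order_def carrier_ec_group_UNIV Q W by simp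
  define M3 where "M3 = a3 + r * a1 + 2 * t"
  have tM: "t = - t - a1 * r - a3 \<longleftrightarrow> M3 = 0"
  proof -
    have "M3 = t - (- t - a1 * r - a3)" unfolding M3_def by Groebner_Basis.algebra
    then show ?thesis by (simp only: right_minus_eq)
  qed
  have M3: "M3 \<noteq> 0" using 2 tM unfolding W Q by auto
  define s where "s = (a4 + 2 * r * a2 - t * a1 + 3 * r^2) / M3"
  define M2 where "M2 = a2 - s * a1 + 3 * r - s^2"
  have sM: "s * M3 = a4 + 2 * r * a2 - t * a1 + 3 * r^2" using M3 by (simp add: s_def)
  define x2 where "x2 = s^2 + a1 * s - a2 - r - r"
  have double: "ec_add W Q Q = Affine x2 (- (s * (x2 - r) + t) - a1 * x2 - a3)"
    unfolding W Q
  proof (rule ec_add_slope[OF _ _ x2_def refl])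
    show "r \<noteq> r \<or> t \<noteq> - t - a1 * r - a3" using tM M3 by blast
    have "2 * t + a1 * r + a3 = M3" unfolding M3_def by Groebner_Basis.algebra
    then show "if r = r then 2 * t + a1 * r + a3 \<noteq> 0 \<and> s * (2 * t + a1 * r + a3) = 3 * r^2 + 2 * a2 * r + a4 - a1 * t
      else s * (r - r) = t - t"
      using M3 sM by (simp add: algebra_simps)
  qed
  have "M2 \<noteq> 0"
  proof
    assume "M2 = 0"
    then have "x2 = r" unfolding x2_def M2_def by Groebner_Basis.algebra
    then have "ec_add W (ec_add W Q Q) Q = Infinity"
      unfolding double unfolding W Q by simp
    then show False using 3 by simp
  qed
  define u where "u = M3 / M2"
  have u: "u \<noteq> 0" using M3 \<open>M2 \<noteq> 0\<close> by (simp add: u_def)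
  define b where "b = - (M2^3 / M3^2)"
  define c where "c = 1 - (a1 + 2 * s) / u"
  have e2: "M2 / u^2 = - b" and e3: "M3 / u^3 = - b"
    using M3 \<open>M2 \<noteq> 0\<close> by (simp_all add: u_def b_def power2_eq_square power3_eq_cube)
  have e4: "a4 - s * a3 + 2 * r * a2 - (t + r * s) * a1 + 3 * r^2 - 2 * s * t = 0"
    using sM unfolding M3_def by Groebner_Basis.algebra
  have e6: "a6 + r * a4 + r^2 * a2 + r^3 - t * a3 - t^2 - r * t * a1 = 0"
    using on by Groebner_Basis.algebra
  have "change_curve u r s t W = tate b c"
    unfolding W change_curve.simps e4 e6 M2_def[symmetric] M3_def[symmetric] e2 e3
    by (simp add: c_def)
  moreover have "b \<noteq> 0" using M3 \<open>M2 \<noteq> 0\<close> by (simp add: b_def)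
  moreover have "change_point u r s t Q = origin" unfolding Q by simp
  ultimately show ?thesis using u that by blast
qed

lemma change_to_tate_unique:
  fixes W :: "complex weierstrass"
  assumes "u \<noteq> 0" "change_curve u r s t W = tate b c" "b \<noteq> 0" "change_point u r s t Q = origin"
    and "u' \<noteq> 0" "change_curve u' r' s' t' W = tate b' c'" "b' \<noteq> 0" "change_point u' r' s' t' Q = origin"
  shows "u = u' \<and> r = r' \<and> s = s' \<and> t = t'"
proof -
  obtain a1 a2 a3 a4 a6 where W: "W = Weierstrass a1 a2 a3 a4 a6" by (cases W)
  obtain x y where Q: "Q = Affine x y" using assms(4) by (cases Q) auto
  have *: "r = x \<and> t = y \<and> s = (a4 + 2 * x * a2 - y * a1 + 3 * x^2) / (a3 + x * a1 + 2 * y) \<and>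
      u = (a3 + x * a1 + 2 * y) / (a2 - s * a1 + 3 * x - s^2)"
    if "u \<noteq> 0" "change_curve u r s t W = tate b c" "b \<noteq> 0" "change_point u r s t Q = origin"
    for u r s t b c
  proof -
    have r: "r = x" using that(1,4) unfolding Q by simp
    have t: "t = y" using that(1,4) r unfolding Q by simp
    define M3 where "M3 = a3 + x * a1 + 2 * y"
    define M2 where "M2 = a2 - s * a1 + 3 * x - s^2"
    have e: "M2 / u^2 = - b" "M3 / u^3 = - b"
      "(a4 - s * a3 + 2 * x * a2 - (y + x * s) * a1 + 3 * x^2 - 2 * s * y) / u^4 = 0"
      using that(2) unfolding W r t change_curve.simps M2_def M3_def by simp_all
    have nz: "M2 \<noteq> 0" "M3 \<noteq> 0" using e that(3) by auto
    have "s * M3 = a4 + 2 * x * a2 - y * a1 + 3 * x^2"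
      using e(3) that(1) unfolding M3_def by simp Groebner_Basis.algebra
    then have "s = (a4 + 2 * x * a2 - y * a1 + 3 * x^2) / M3" using nz by (simp add: eq_divide_eq)
    moreover have "M2 * u = M3"
    proof -
      have "M2 = - b * u^2" "M3 = - b * u^3" using e(1,2) that(1) by (simp_all add: divide_eq_eq)
      then show ?thesis by Groebner_Basis.algebra
    qed
    then have "u = M3 / M2" using nz by (simp add: eq_divide_eq mult.commute)
    ultimately show ?thesis using r t unfolding M3_def M2_def by simp
  qed
  show ?thesis using *[OF assms(1-4)] *[OF assms(5-8)] by simp
qed

definition tb :: "complex \<Rightarrow> complex" where "tb q = (1-q) * (1-2*q) * q2 q * q3 q / q^4"
definition tc :: "complex \<Rightarrow> complex" where "tc q = (1-q) * (1-2*q) * q3 q / q^3"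
definition tx :: "complex \<Rightarrow> complex \<Rightarrow> complex" where
  "tx q s = (1-2*q) * q2 q * ((1-2*q)^2 * s - qA q) / (8 * q^6)"
definition ty :: "complex \<Rightarrow> complex \<Rightarrow> complex" where
  "ty q s = (tb q - (1 - tc q) * tx q s) / 2"

context tate_curve_12
begin

lemma b_eq: "b = tb q" and c_eq: "c = tc q"
  using bq cq q0 by (simp_all add: tb_def tc_def eq_divide_eq)

lemma q_eq: "q = (1 - b / c) / (1 - c / (b / c - 1))"
proof -
  have "b / c = d" unfolding b c using nz by simp
  moreover have "c / (d - 1) = e" unfolding c using nz by simp
  moreover have "q * (1 - e) = 1 - d" unfolding d by Groebner_Basis.algebra
  ultimately show ?thesis using nz by (simp add: eq_divide_eq)
qed

lemma quad_iff:
  assumes "admissible q"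
  shows "quad x = 0 \<longleftrightarrow> (\<exists>s. s^2 = q2 q * q6 q \<and> x = tx q s)"
proof -
  have g: "1 - 2*q \<noteq> 0" "q2 q \<noteq> 0" "q \<noteq> 0" using assms by (simp_all add: admissible_def)
  define s where "s = (8 * (x * q^6) / ((1-2*q) * q2 q) + qA q) / (1-2*q)^2"
  have s: "(1-2*q)^2 * s - qA q = 8 * (x * q^6) / ((1-2*q) * q2 q)"
    using g by (simp add: s_def)
  have x: "x = tx q s" unfolding tx_def s using g by simp
  have iff: "quad (tx q s) = 0 \<longleftrightarrow> s^2 = q2 q * q6 q" for s
  proof -
    have "8 * (tx q s * q^6) = (1-2*q) * q2 q * ((1-2*q)^2 * s - qA q)"
      using g unfolding tx_def by simp
    note quad_q[OF this]
    also have "((1-2*q)^2 * s - qA q + qA q)^2 - (1-2*q)^4 * q2 q * q6 q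
       = (1-2*q)^4 * (s^2 - q2 q * q6 q)" by Groebner_Basis.algebra
    finally have "quad (tx q s) = 0 \<longleftrightarrow> s^2 - q2 q * q6 q = 0"
      using g by (metis mult_eq_0_iff power_not_zero zero_neq_numeral)
    then show ?thesis by simp
  qed
  show ?thesis using iff x by metis
qed

end

lemma admissible_tate:
  assumes "admissible q"
  shows "tate_curve_12 (tb q) (tc q) (q2 q / q) (q3 q / q^2) q"
proof
  note nz = assms[unfolded admissible_def]
  have d1: "(q2 q / q - 1) = (1-q) * (1-2*q) / q"
  proof -
    have "q2 q = q + (1-q) * (1-2*q)" unfolding q2_def by Groebner_Basis.algebra
    then show ?thesis using nz by (simp only: add_divide_distrib) simp
  qed
  have e1: "(q3 q / q^2 - 1) = (1-q) * (1-2*q) / q^2"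
  proof -
    have "q3 q = q^2 + (1-q) * (1-2*q)" unfolding q3_def by Groebner_Basis.algebra
    then show ?thesis using nz by (simp only: add_divide_distrib) simp
  qed
  show "q2 q / q \<noteq> 0" "q3 q / q^2 \<noteq> 0" using nz by simp_all
  have "q2 q / q - 1 \<noteq> 0" unfolding d1 using nz by simp
  then show "q2 q / q \<noteq> 1" by simp
  have "q3 q / q^2 - 1 \<noteq> 0" unfolding e1 using nz by simp
  then show "q3 q / q^2 \<noteq> 1" by simp
  have "q2 q = q - q * q + q3 q" unfolding q2_def q3_def by Groebner_Basis.algebra
  then show "q2 q / q = 1 - q + q * (q3 q / q^2)"
    using nz by (simp add: field_simps power2_eq_square)
  show "tb q = q2 q / q * (q3 q / q^2) * (q2 q / q - 1)"
    unfolding d1 tb_def by (simp add: power2_eq_square power4_eq_xxxx mult_ac)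
  show "tc q = q3 q / q^2 * (q2 q / q - 1)"
    unfolding d1 tc_def by (simp add: power2_eq_square power3_eq_cube mult_ac)
  show "q3 q / q^2 * q^2 = q3 q" using nz by simp
qed

lemma level_structure_family:
  assumes "admissible q"
  shows "level_structure (tate (tb q) (tc q)) P origin \<longleftrightarrow>
    (\<exists>s. s^2 = q2 q * q6 q \<and> P = Affine (tx q s) (ty q s))"
proof -
  interpret tate_curve_12 "tb q" "tc q" "q2 q / q" "q3 q / q^2" q by (rule admissible_tate[OF assms])
  have "2 * y = tb q - (1 - tc q) * tx q s \<longleftrightarrow> y = ty q s" for y s
    unfolding ty_def by (auto simp: mult.commute)
  then show ?thesis unfolding level_structure_iff using assms quad_iff[OF assms] by metis
qed

lemma tx_inj: "admissible q \<Longrightarrow> tx q s = tx q s' \<Longrightarrow> s = s'"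
  unfolding tx_def admissible_def by auto

lemma tb_tc_inj:
  assumes "admissible q" "admissible q'" "tb q = tb q'" "tc q = tc q'"
  shows "q = q'"
  using tate_curve_12.q_eq[OF admissible_tate[OF assms(1)]]
    tate_curve_12.q_eq[OF admissible_tate[OF assms(2)]] assms(3,4) by metis

text \<open>The parameters \<open>(q, s)\<close> in terms of a point of 24a4.\<close>

definition fam_q :: "complex \<times> complex \<Rightarrow> complex" where
  "fam_q z = (1 - fst z) / (snd z - 2 * fst z + 1)"

definition fam_s :: "complex \<times> complex \<Rightarrow> complex" where
  "fam_s z = 2 * fst z * fam_q z^2 - 1 + 4 * fam_q z - 4 * fam_q z^2"

definition open_part :: "(complex \<times> complex) set" where
  "open_part = {z. on_curve X1_2_12 (Affine (fst z) (snd z)) \<and> snd z - 2 * fst z + 1 \<noteq> 0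
     \<and> admissible (fam_q z)}"

lemma on_curve_X1_2_12: "on_curve X1_2_12 (Affine u v) \<longleftrightarrow> v^2 = u^3 - u^2 + u"
  by (simp add: X1_2_12_def)

lemma fam_params:
  assumes "z \<in> open_part"
  shows "fam_s z^2 = q2 (fam_q z) * q6 (fam_q z)"
    and "fst z = (fam_s z + 1 - 4 * fam_q z + 4 * fam_q z^2) / (2 * fam_q z^2)"
    and "snd z = 2 * fst z - 1 + (1 - fst z) / fam_q z"
proof -
  define q where "q = fam_q z"
  define u where "u = fst z"
  define w where "w = snd z - 2 * fst z + 1"
  have w: "w \<noteq> 0" and q: "admissible q" and on: "(snd z)^2 = u^3 - u^2 + u"
    using assms unfolding open_part_def w_def q_def u_def on_curve_X1_2_12 by simp_all
  have q0: "q \<noteq> 0" using q by (simp add: admissible_def)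
  have "q * w = 1 - u" using w unfolding q_def fam_q_def w_def u_def by simp
  then have u: "u = 1 - q * w" by simp
  have v: "snd z = 2 * u - 1 + w" unfolding w_def u_def by simp
  have "w * (w^2 * q^3 + w * (1 - 4*q + 2*q^2) + 2 * (1 - q)) = 0"
    using on unfolding v u by Groebner_Basis.algebra
  then have *: "w^2 * q^3 + w * (1 - 4*q + 2*q^2) + 2 * (1 - q) = 0" using w by simp
  have s: "fam_s z = - (1 - 4*q + 2*q^2 + 2 * w * q^3)"
    unfolding fam_s_def q_def[symmetric] u_def[symmetric] u by Groebner_Basis.algebra
  have "fam_s z^2 = (1 - 4*q + 2*q^2)^2 - 8 * q^3 * (1 - q)
     + 4 * q^3 * (w^2 * q^3 + w * (1 - 4*q + 2*q^2) + 2 * (1 - q))"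
    unfolding s by Groebner_Basis.algebra
  also have "\<dots> = q2 q * q6 q" unfolding * q2_def q6_def by Groebner_Basis.algebra
  finally show "fam_s z^2 = q2 (fam_q z) * q6 (fam_q z)" unfolding q_def .
  show "fst z = (fam_s z + 1 - 4 * fam_q z + 4 * fam_q z^2) / (2 * fam_q z^2)"
    using q0 unfolding fam_s_def q_def[symmetric] by simp
  have "(1 - u) / q = w" unfolding u using q0 by simp
  then show "snd z = 2 * fst z - 1 + (1 - fst z) / fam_q z"
    using v unfolding q_def[symmetric] u_def[symmetric] by simp
qed

lemma fam_params_inj:
  assumes "z \<in> open_part" "z' \<in> open_part" "fam_q z = fam_q z'" "fam_s z = fam_s z'"
  shows "z = z'"
proof -
  have "fst z = fst z'" using fam_params(2)[OF assms(1)] fam_params(2)[OF assms(2)] assms(3,4) by metis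
  moreover from this have "snd z = snd z'"
    using fam_params(3)[OF assms(1)] fam_params(3)[OF assms(2)] assms(3) by metis
  ultimately show ?thesis by (rule prod_eqI)
qed

lemma fam_params_surj:
  assumes q: "admissible q" and s: "s^2 = q2 q * q6 q"
  obtains z where "z \<in> open_part" "fam_q z = q" "fam_s z = s"
proof -
  define w where "w = - (s + 1 - 4*q + 2*q^2) / (2 * q^3)"
  have q0: "q \<noteq> 0" "1 - q \<noteq> 0" using q by (simp_all add: admissible_def)
  have "2 * w * q^3 = - (s + 1 - 4*q + 2*q^2)" using q0 by (simp add: w_def)
  then have s': "s = - (1 - 4*q + 2*q^2 + 2 * w * q^3)" by Groebner_Basis.algebra
  have "4 * q^3 * (w^2 * q^3 + w * (1 - 4*q + 2*q^2) + 2 * (1 - q)) = s^2 - q2 q * q6 q"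
    unfolding s' q2_def q6_def by Groebner_Basis.algebra
  then have *: "w^2 * q^3 + w * (1 - 4*q + 2*q^2) + 2 * (1 - q) = 0" using q0 s by simp
  have w: "w \<noteq> 0" using * q0 by auto
  define u where "u = 1 - q * w"
  define v where "v = 2 * u - 1 + w"
  have "u^3 - u^2 + u - v^2 = - w * (w^2 * q^3 + w * (1 - 4*q + 2*q^2) + 2 * (1 - q))"
    unfolding v_def u_def by Groebner_Basis.algebra
  then have on: "v^2 = u^3 - u^2 + u" unfolding * by simp
  have w': "v - 2 * u + 1 = w" by (simp add: v_def)
  have fq: "fam_q (u, v) = q" unfolding fam_q_def fst_conv snd_conv w' using w by (simp add: u_def)
  have fs: "fam_s (u, v) = s" unfolding fam_s_def fq fst_conv unfolding s' u_def by Groebner_Basis.algebra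
  have "(u, v) \<in> open_part"
    unfolding open_part_def using on w w' fq q by (simp add: on_curve_X1_2_12)
  then show ?thesis using fq fs that by blast
qed

lemma finite_line:
  fixes a1 a2 a3 :: complex
  assumes "a1 \<noteq> 0 \<or> a2 \<noteq> 0"
  shows "finite {(u, v). v^2 = u^3 - u^2 + u \<and> a1 * u + a2 * v = a3}"
proof (cases "a2 = 0")
  case True
  define k where "k = a3 / a1"
  have "finite {v. poly [:- (k^3 - k^2 + k), 0, 1:] v = 0}" by (rule poly_roots_finite) simp
  then have "finite (Pair k ` {v. poly [:- (k^3 - k^2 + k), 0, 1:] v = 0})" by (rule finite_imageI)
  then show ?thesis
  proof (rule finite_subset[rotated])
    show "{(u, v). v^2 = u^3 - u^2 + u \<and> a1 * u + a2 * v = a3} \<subseteq>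
      Pair k ` {v. poly [:- (k^3 - k^2 + k), 0, 1:] v = 0}"
      using True assms by (auto simp: k_def power2_eq_square)
  qed
next
  case False
  define k where "k = a3 / a2"
  define m where "m = a1 / a2"
  define P where "P = [:- (k^2), 1 + 2 * k * m, - 1 - m^2, 1:]"
  have "finite {u. poly P u = 0}" by (rule poly_roots_finite) (simp add: P_def)
  then have "finite ((\<lambda>u. (u, k - m * u)) ` {u. poly P u = 0})" by (rule finite_imageI)
  then show ?thesis
  proof (rule finite_subset[rotated], safe)
    fix u v assume uv: "v^2 = u^3 - u^2 + u" and "a3 = a1 * u + a2 * v"
    then have "v * a2 = a3 - a1 * u" by simp
    then have "v = (a3 - a1 * u) / a2" using False by (simp only: eq_divide_eq) simp
    then have v: "v = k - m * u" by (simp add: k_def m_def diff_divide_distrib)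
    have "poly P u = u^3 - u^2 + u - v^2"
      unfolding P_def v poly_pCons poly_0 by Groebner_Basis.algebra
    then have "poly P u = 0" using uv by simp
    then show "(u, v) \<in> (\<lambda>u. (u, k - m * u)) ` {u. poly P u = 0}" unfolding v by blast
  qed
qed

lemma finite_complement:
  "finite ({(x, y). on_curve X1_2_12 (Affine x y)} - open_part)"
proof -
  have f: "finite {q. poly p q = 0}" if "p \<noteq> 0" for p :: "complex poly"
    by (rule poly_roots_finite[OF that])
  have eqs: "poly [:1,-2,2:] q = q2 q" "poly [:1,-3,3:] q = q3 q" "poly [:1,-6,6:] q = q6 q" for q
    by (simp_all add: q2_def q3_def q6_def algebra_simps power2_eq_square)
  define bad where "bad = {0, 1, 1/2} \<union> {q. q2 q = 0} \<union> {q. q3 q = 0} \<union> {q. q6 q = 0}"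
  have "finite bad"
    unfolding bad_def eqs[symmetric] by (intro finite_UnI f) simp_all
  have adm: "admissible q" if "q \<notin> bad" for q
    using that unfolding bad_def admissible_def by (auto simp: field_simps)
  let ?L = "\<lambda>a1 a2 a3 :: complex. {(u, v). v^2 = u^3 - u^2 + u \<and> a1 * u + a2 * v = a3}"
  have "finite (?L (- 2) 1 (- 1) \<union> (\<Union>k\<in>bad. ?L (1 - 2*k) k (1 - k)))"
    using \<open>finite bad\<close> by (intro finite_UnI finite_UN_I finite_line) auto
  then show ?thesis
  proof (rule finite_subset[rotated], safe)
    fix u v
    assume on: "on_curve X1_2_12 (Affine u v)" and no: "(u, v) \<notin> open_part"
      and k: "(u, v) \<notin> (\<Union>k\<in>bad. ?L (1 - 2*k) k (1 - k))"
    show on': "v^2 = u^3 - u^2 + u" using on by (simp add: on_curve_X1_2_12)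
    show "- 2 * u + 1 * v = - 1"
    proof (rule ccontr)
      assume "- 2 * u + 1 * v \<noteq> - 1"
      then have D: "v - 2 * u + 1 \<noteq> 0" by (auto simp: algebra_simps add_eq_0_iff2)
      define q where "q = fam_q (u, v)"
      have "q * (v - 2 * u + 1) = 1 - u" using D by (simp add: q_def fam_q_def)
      then have "(1 - 2*q) * u + q * v = 1 - q" by Groebner_Basis.algebra
      moreover have "q \<in> bad"
        using adm[of q] no D on unfolding open_part_def q_def by auto
      ultimately show False using k on' by blast
    qed
  qed
qed

lemma rat_poly_fun_uminus: "rat_poly_fun f \<Longrightarrow> rat_poly_fun (\<lambda>z. - f z)"
  using rat_poly_fun.intros(5)[OF rat_poly_fun.intros(1)[of "- 1"], of f] by simp

lemma regular_const: "c \<in> \<rat> \<Longrightarrow> regular_on U (\<lambda>z. c)"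
  unfolding regular_on_def
  by (rule exI[of _ "\<lambda>z. c"], rule exI[of _ "\<lambda>z. 1"]) (auto intro: rat_poly_fun.intros)

lemma regular_fst: "regular_on U fst"
  unfolding regular_on_def
  by (rule exI[of _ fst], rule exI[of _ "\<lambda>z. 1"]) (auto intro: rat_poly_fun.intros)

lemma regular_snd: "regular_on U snd"
  unfolding regular_on_def
  by (rule exI[of _ snd], rule exI[of _ "\<lambda>z. 1"]) (auto intro: rat_poly_fun.intros)

lemma regular_add:
  assumes "regular_on U f" "regular_on U g" shows "regular_on U (\<lambda>z. f z + g z)"
proof -
  obtain p q p' q' where *: "rat_poly_fun p" "rat_poly_fun q" "rat_poly_fun p'" "rat_poly_fun q'"
    "\<forall>z\<in>U. q z \<noteq> 0 \<and> f z = p z / q z" "\<forall>z\<in>U. q' z \<noteq> 0 \<and> g z = p' z / q' z"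
    using assms unfolding regular_on_def by blast
  have "rat_poly_fun (\<lambda>z. p z * q' z + p' z * q z)" "rat_poly_fun (\<lambda>z. q z * q' z)"
    using * by (auto intro: rat_poly_fun.intros)
  moreover have "\<forall>z\<in>U. q z * q' z \<noteq> 0 \<and> f z + g z = (p z * q' z + p' z * q z) / (q z * q' z)"
    using * by (auto simp: add_frac_eq)
  ultimately show ?thesis unfolding regular_on_def by blast
qed

lemma regular_mult:
  assumes "regular_on U f" "regular_on U g" shows "regular_on U (\<lambda>z. f z * g z)"
proof -
  obtain p q p' q' where *: "rat_poly_fun p" "rat_poly_fun q" "rat_poly_fun p'" "rat_poly_fun q'"
    "\<forall>z\<in>U. q z \<noteq> 0 \<and> f z = p z / q z" "\<forall>z\<in>U. q' z \<noteq> 0 \<and> g z = p' z / q' z"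
    using assms unfolding regular_on_def by blast
  have "rat_poly_fun (\<lambda>z. p z * p' z)" "rat_poly_fun (\<lambda>z. q z * q' z)"
    using * by (auto intro: rat_poly_fun.intros)
  moreover have "\<forall>z\<in>U. q z * q' z \<noteq> 0 \<and> f z * g z = (p z * p' z) / (q z * q' z)"
    using * by auto
  ultimately show ?thesis unfolding regular_on_def by blast
qed

lemma regular_inverse:
  assumes "regular_on U f" "\<forall>z\<in>U. f z \<noteq> 0" shows "regular_on U (\<lambda>z. inverse (f z))"
proof -
  obtain p q where *: "rat_poly_fun p" "rat_poly_fun q" "\<forall>z\<in>U. q z \<noteq> 0 \<and> f z = p z / q z"
    using assms unfolding regular_on_def by blast
  then have "\<forall>z\<in>U. p z \<noteq> 0 \<and> inverse (f z) = q z / p z" using assms(2) by auto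
  then show ?thesis using * unfolding regular_on_def by blast
qed

lemma regular_minus: "regular_on U f \<Longrightarrow> regular_on U (\<lambda>z. - f z)"
  using regular_mult[OF regular_const[of "- 1"], of U f] by simp

lemma regular_diff: "regular_on U f \<Longrightarrow> regular_on U g \<Longrightarrow> regular_on U (\<lambda>z. f z - g z)"
  using regular_add[OF _ regular_minus, of U f g] by simp

lemma regular_divide:
  "regular_on U f \<Longrightarrow> regular_on U g \<Longrightarrow> \<forall>z\<in>U. g z \<noteq> 0 \<Longrightarrow> regular_on U (\<lambda>z. f z / g z)"
  using regular_mult[OF _ regular_inverse, of U f g] by (simp add: divide_inverse)

lemma regular_power: "regular_on U f \<Longrightarrow> regular_on U (\<lambda>z. f z ^ n)"
  by (induction n) (auto intro: regular_mult regular_const)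

lemmas regular = regular_const regular_fst regular_snd regular_add regular_mult regular_minus
  regular_diff regular_divide regular_power

lemma regular_family:
  defines "q \<equiv> fam_q" and "s \<equiv> fam_s" and "U \<equiv> open_part"
  shows "regular_on U (\<lambda>z. tb (q z))" "regular_on U (\<lambda>z. tc (q z))"
    "regular_on U (\<lambda>z. tx (q z) (s z))" "regular_on U (\<lambda>z. ty (q z) (s z))"
proof -
  have nz: "\<forall>z\<in>U. q z ^ n \<noteq> 0" "\<forall>z\<in>U. 8 * q z ^ n \<noteq> 0" "\<forall>z\<in>U. snd z - 2 * fst z + 1 \<noteq> 0" for n
    unfolding U_def open_part_def q_def admissible_def by auto
  have q: "regular_on U q" unfolding q_def fam_q_def[abs_def] by (intro regular nz) simp_all
  have s: "regular_on U s" unfolding s_def fam_s_def[abs_def] q_def[symmetric]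
    by (intro regular q) simp_all
  have r: "regular_on U (\<lambda>z. q2 (q z))" "regular_on U (\<lambda>z. q3 (q z))" "regular_on U (\<lambda>z. qA (q z))"
    unfolding q2_def q3_def qA_def by (intro regular q; simp)+
  show tb: "regular_on U (\<lambda>z. tb (q z))" unfolding tb_def by (intro regular q r nz) simp_all
  show tc: "regular_on U (\<lambda>z. tc (q z))" unfolding tc_def by (intro regular q r nz) simp_all
  show tx: "regular_on U (\<lambda>z. tx (q z) (s z))" unfolding tx_def
    by (intro regular q s r nz) simp_all
  have tc': "regular_on U (\<lambda>z. 1 - tc (q z))" by (rule regular_diff[OF regular_const tc]) simp
  show "regular_on U (\<lambda>z. ty (q z) (s z))" unfolding ty_def
    by (intro regular_divide regular_diff[OF tb] regular_mult[OF tc' tx] regular_const) simp_all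
qed

theorem X1_2_12_is_modular_curve: "is_modular_curve_X1_2_12 X1_2_12"
proof -
  define fW where "fW z = tate (tb (fam_q z)) (tc (fam_q z))" for z
  define fP where "fP z = Affine (tx (fam_q z) (fam_s z)) (ty (fam_q z) (fam_s z))" for z
  define fQ :: "complex \<times> complex \<Rightarrow> complex point" where "fQ z = origin" for z
  have adm: "admissible (fam_q z)" if "z \<in> open_part" for z
    using that by (simp add: open_part_def)
  have tb0: "tb (fam_q z) \<noteq> 0" if "z \<in> open_part" for z
    using adm[OF that] by (simp add: tb_def admissible_def)
  have "regular_on open_part (\<lambda>z. 1 - tc (fam_q z))"
    by (rule regular_diff[OF regular_const regular_family(2)]) simp
  then have curve: "regular_curve open_part fW"
    unfolding regular_curve_def fW_def
    by (auto intro: regular_const regular_minus[OF regular_family(1)])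
  have "regular_point open_part fP"
    unfolding regular_point_def fP_def using regular_family(3,4) by blast
  moreover have "regular_point open_part fQ"
    unfolding regular_point_def fQ_def using regular_const[OF Rats_0] by blast
  moreover have "\<forall>z\<in>open_part. level_structure (fW z) (fP z) (fQ z)"
    unfolding fW_def fP_def fQ_def using level_structure_family[OF adm] fam_params(1) by blast
  moreover have "\<exists>!z. z \<in> open_part \<and> isomorphic_triples (W, P, Q) (fW z, fP z, fQ z)"
    if L: "level_structure W P Q" for W P Q
  proof -
    obtain u r s t b c where T: "u \<noteq> 0" "change_curve u r s t W = tate b c" "b \<noteq> 0"
      "change_point u r s t Q = origin"
      by (rule level_structure_to_tate[OF L])
    note L' = level_structure_change[OF T L]
    then have "has_order (ec_group (tate b c) UNIV) origin 12" by (simp add: level_structure_def)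
    then obtain d e q where "tate_curve_12 b c d e q" using tate_normal_form T(3) by blast
    then interpret tate_curve_12 b c d e q .
    have q: "admissible q" using L' unfolding level_structure_iff by blast
    obtain s' where s': "s'^2 = q2 q * q6 q" "change_point u r s t P = Affine (tx q s') (ty q s')"
      using L' unfolding b_eq c_eq level_structure_family[OF q] by blast
    obtain z where z: "z \<in> open_part" "fam_q z = q" "fam_s z = s'"
      by (rule fam_params_surj[OF q s'(1)])
    have iso: "isomorphic_triples (W, P, Q) (fW z, fP z, fQ z)"
      unfolding isomorphic_triples_def fW_def fP_def fQ_def z prod.case
      using T s'(2) b_eq c_eq by metis
    show ?thesis
    proof (rule ex1I[of _ z])
      show "z \<in> open_part \<and> isomorphic_triples (W, P, Q) (fW z, fP z, fQ z)" using z iso by blast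
      fix z'
      assume z': "z' \<in> open_part \<and> isomorphic_triples (W, P, Q) (fW z', fP z', fQ z')"
      obtain u1 r1 s1 t1 where 1: "u1 \<noteq> 0" "change_curve u1 r1 s1 t1 W = fW z"
        "change_point u1 r1 s1 t1 P = fP z" "change_point u1 r1 s1 t1 Q = fQ z"
        using iso unfolding isomorphic_triples_def prod.case by metis
      obtain u2 r2 s2 t2 where 2: "u2 \<noteq> 0" "change_curve u2 r2 s2 t2 W = fW z'"
        "change_point u2 r2 s2 t2 P = fP z'" "change_point u2 r2 s2 t2 Q = fQ z'"
        using z' unfolding isomorphic_triples_def prod.case by metis
      have "u1 = u2 \<and> r1 = r2 \<and> s1 = s2 \<and> t1 = t2"
        by (rule change_to_tate_unique[OF 1(1) 1(2)[unfolded fW_def] tb0[OF z(1)] 1(4)[unfolded fQ_def]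
              2(1) 2(2)[unfolded fW_def] tb0[OF conjunct1[OF z']] 2(4)[unfolded fQ_def]])
      then have "fW z' = fW z" "fP z' = fP z" using 1 2 by simp_all
      then have eq: "tb (fam_q z') = tb (fam_q z)" "tc (fam_q z') = tc (fam_q z)"
        "tx (fam_q z') (fam_s z') = tx (fam_q z) (fam_s z)"
        unfolding fW_def fP_def by simp_all
      have qq: "fam_q z' = fam_q z" using tb_tc_inj adm z(1) z' eq(1,2) by blast
      have "fam_s z' = fam_s z" using tx_inj[OF adm[OF z(1)]] eq(3) unfolding qq by blast
      then show "z' = z" using fam_params_inj z(1) z' qq by blast
    qed
  qed
  moreover have "open_part \<subseteq> {(x, y). on_curve X1_2_12 (Affine x y)}"
    by (auto simp: open_part_def)
  moreover have "{coeff1 X1_2_12, coeff2 X1_2_12, coeff3 X1_2_12, coeff4 X1_2_12, coeff6 X1_2_12} \<subseteq> \<rat>"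
    by (simp add: X1_2_12_def)
  moreover have "discriminant X1_2_12 \<noteq> 0"
    by (simp add: X1_2_12_def)
  ultimately show ?thesis
    unfolding is_modular_curve_X1_2_12_def using finite_complement curve by blast
qed

end

theory Submission
  imports Defs "HOL-Computational_Algebra.Nth_Powers" "HOL-Computational_Algebra.Polynomial_FPS"
    "HOL-Computational_Algebra.Fundamental_Theorem_Algebra"
begin

text \<open>
  Write \<open>E\<close> for the curve \<open>y^2 = x^3 - x^2 + x\<close>. The group law comes from comparing divisors: the chord
  through two points gives \<open>(P) + (Q) \<sim> (P + Q) + (O)\<close>, and no function has a single simple pole, so a
  point is determined by its class. The orders of functions are read off from local power series.

  Embed \<open>K\<close> in a tower of quadratic extensions, each generated by the square root of a rational number.
  Splitting \<open>2 P = (P + \<sigma> P) + (P - \<sigma> P)\<close> along the tower reduces questions about \<open>E(K)\<close> to rational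
  points on quadratic twists of \<open>E\<close>. Two facts about those suffice. Doubling is \<open>2\<close>-adically repelling
  away from \<open>x = 0, 1, -1\<close>, so rational torsion points on every twist are killed by \<open>4\<close>, and all torsion of
  \<open>E(K)\<close> has \<open>2\<close>-power order. The twists by \<open>1, -1, 3, -3\<close> have only finitely many rational points, by
  descent on \<open>s^4 + e c s^2 t^2 + c^2 t^4 = r^2\<close>, so \<open>E(\<rat>(\<zeta>\<^sub>1\<^sub>2))\<close> is torsion.

  The \<open>16\<close> points of \<open>E(\<rat>(\<zeta>\<^sub>1\<^sub>2))\<close> are closed under halving in a multi-quadratic field: if \<open>P = 2 R\<close> then
  \<open>x(P) - \<rho> = z^2\<close> for a root \<open>\<rho>\<close> of \<open>x^2 - x + 1\<close>, hence \<open>(z \<sigma>(z))^2 = v^2\<close> for an explicit \<open>v\<close>. In the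
  cases to be excluded an automorphism \<open>\<sigma>\<close> of order \<open>2\<close> can be chosen with \<open>\<sigma>(v) = - v\<close>, whereas it
  fixes \<open>z \<sigma>(z) = \<plusminus>v\<close>.
\<close>

text \<open>A quadratic twist of \<open>E\<close> can have infinitely many rational points, so along
  a general tower only torsion is controlled on the twists, and the power of \<open>2\<close>
  obtained that way grows with the height of the tower. Closure under halving removes this
  dependence: the same \<open>16\<close> points remain for every \<open>K\<close>. Finiteness of
  rational points enters for the four twists met on the way from \<rat> to \<open>Qz12\<close>; it
  gives the inclusion of the points over \<open>K12\<close> in the torsion. The element
  \<open>v\<close> comes from a norm. If \<sigma> fixes \<open>t = x(P)\<close> and exchanges \<rho>
  and \<open>1 - \<rho>\<close>, then \<open>z^2 \<sigma>(z^2) = (t - \<rho>) (t - 1 + \<rho>) = t^2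
  - t + 1\<close>, which is \<open>3\<close> for \<open>t = -1\<close>, \<open>- t\<close> for
  \<open>t = \<plusminus>\<i>\<close> and \<open>3 t\<close> for \<open>t^2 - 4 t + 1 = 0\<close>.
  In the last two cases the square root involves the square root of \<open>2\<close>. This is why
  halving takes place in a tower that contains this root besides \<open>K\<close> and where the
  signs of \<open>\<i>\<close>, \<open>r2\<close>, \<open>r3\<close> can be prescribed
  independently. That \<sigma> has order \<open>2\<close> is what makes \<open>z \<sigma>(z)\<close>
  a fixed element.\<close>

section \<open>Coprime factorizations and descent on quartics\<close>

lemma coprime_prime_power_dvd_mult:
  fixes A B :: nat
  assumes "normalization_semidom_class.prime p" "coprime A B" "p ^ k dvd A * B"
  shows "p ^ k dvd A \<or> p ^ k dvd B"
proof (cases "p dvd A")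
  case True
  then have "\<not> p dvd B" using assms(1,2) by (meson coprime_common_divisor not_prime_unit)
  then have "coprime (p ^ k) B" using assms(1) by (simp add: prime_imp_coprime)
  then show ?thesis using assms(3) by (simp add: coprime_dvd_mult_left_iff)
next
  case False
  then have "coprime (p ^ k) A" using assms(1) by (simp add: prime_imp_coprime)
  then show ?thesis using assms(3) by (simp add: coprime_dvd_mult_right_iff)
qed

lemma coprime_mult_eq_power:
  fixes a b w :: nat
  assumes "coprime a b" "a * b = w ^ n" "n > 0"
  obtains u v where "a = u ^ n" "b = v ^ n" "w = u * v"
proof -
  have "is_nth_power n (a * b)" using assms(2) by auto
  then have "is_nth_power n a" "is_nth_power n b"
    using is_nth_power_mult_coprime_nat_iff[OF assms(1)] by auto
  then obtain u v where "a = u ^ n" "b = v ^ n" by (auto elim!: is_nth_powerE)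
  moreover have "w = u * v"
    using assms(2,3) calculation power_eq_iff_eq_base[of n w "u * v"] by (simp add: power_mult_distrib)
  ultimately show ?thesis using that by blast
qed

text \<open>The prime power cannot be shared between coprime factors, so it divides one of them;
  after cancelling it both cofactors are \<open>n\<close>-th powers.\<close>

lemma coprime_mult_eq_prime_power_mult:
  fixes A B w :: nat
  assumes p: "normalization_semidom_class.prime p" and cop: "coprime A B" and eq: "A * B = p ^ k * w ^ n" and n: "n > 0"
  obtains u v where "w = u * v" "coprime u v" "A = u ^ n \<and> B = p ^ k * v ^ n \<or> A = p ^ k * u ^ n \<and> B = v ^ n"
proof -
  have p0: "p ^ k > 0" using p by (simp add: prime_gt_0_nat)
  have "p ^ k dvd A \<or> p ^ k dvd B" by (rule coprime_prime_power_dvd_mult[OF p cop]) (simp add: eq)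
  then show ?thesis
  proof
    assume "p ^ k dvd A"
    then obtain A' where A: "A = p ^ k * A'" ..
    then have "A' * B = w ^ n" "coprime A' B" using eq p0 cop by auto
    then obtain u v where uv: "A' = u ^ n" "B = v ^ n" "w = u * v" using coprime_mult_eq_power n by metis
    then have "coprime u v" using \<open>coprime A' B\<close> n by auto
    then show ?thesis using that uv A by blast
  next
    assume "p ^ k dvd B"
    then obtain B' where B: "B = p ^ k * B'" ..
    then have "A * B' = w ^ n" "coprime A B'" using eq p0 cop by auto
    then obtain u v where uv: "A = u ^ n" "B' = v ^ n" "w = u * v" using coprime_mult_eq_power n by metis
    then have "coprime u v" using \<open>coprime A B'\<close> n by auto
    then show ?thesis using that uv B by blast
  qed
qed

text \<open>The numbers \<open>(r - d) / 2\<close> and \<open>(r + d) / 2\<close> have product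
  \<open>3 ^ k * w ^ n\<close>, and a common prime divides their difference \<open>d\<close>.
  Coprimality of \<open>d\<close> and \<open>w\<close> leaves only the prime \<open>3\<close>, which
  assumption \<open>k\<close> excludes. Hence both are \<open>n\<close>-th powers up to the factor
  \<open>3 ^ k\<close>.\<close>

lemma difference_of_squares_descent:
  fixes d w r :: int
  assumes eq: "r ^ 2 = d ^ 2 + 4 * 3 ^ k * w ^ n" and r: "r > 0" "odd r" and w: "w > 0"
    and cop: "coprime d w" and k: "k \<le> 1 \<or> \<not> 3 dvd d" and n: "n > 0"
  obtains u v where "u > 0" "v > 0" "coprime u v" "w = u * v"
    "d = 3 ^ k * v ^ n - u ^ n \<and> r = 3 ^ k * v ^ n + u ^ n \<or>
     d = v ^ n - 3 ^ k * u ^ n \<and> r = v ^ n + 3 ^ k * u ^ n"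
proof -
  have "even (r ^ 2 - d ^ 2)" using eq by simp
  then have d: "odd d" using r by simp
  define A where "A = (r - d) div 2"
  define B where "B = (r + d) div 2"
  have AB: "2 * A = r - d" "2 * B = r + d" using r d unfolding A_def B_def by simp_all
  then have rX: "r = A + B" "d = B - A" by simp_all
  have prod: "A * B = 3 ^ k * w ^ n" using eq unfolding rX by (simp add: power2_eq_square algebra_simps)
  have pos: "3 ^ k * w ^ n > 0" using w by simp
  have "d ^ 2 < r ^ 2" using eq pos by (simp only: mult.assoc)
  then have "\<bar>d\<bar> ^ 2 < r ^ 2" by simp
  then have "\<bar>d\<bar> < r" using r(1) by (meson power2_less_imp_less less_imp_le)
  then have gt: "A > 0" "B > 0" using AB by linarith+
  have "coprime A B"
  proof (rule ccontr)
    assume "\<not> coprime A B"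
    then have "\<not> is_unit (gcd A B)" by (simp add: coprime_iff_gcd_eq_1)
    moreover have "gcd A B \<noteq> 0" using gt by simp
    ultimately obtain p where p: "normalization_semidom_class.prime p" "p dvd gcd A B"
      using prime_divisor_exists by blast
    then have p: "normalization_semidom_class.prime p" "p dvd A" "p dvd B" by simp_all
    then have pX: "p dvd d" unfolding rX by simp
    have "p dvd 3 ^ k * w ^ n" using p prod by (metis dvd_mult2)
    then consider "p dvd w" | "p dvd 3 ^ k" using p(1) prime_dvd_mult_iff prime_dvd_power by blast
    then show False
    proof cases
      case 1
      then show False using cop pX p(1) by (meson coprime_common_divisor not_prime_unit)
    next
      case 2
      then have "p dvd 3" using p(1) prime_dvd_power by blast
      moreover have prime3: "normalization_semidom_class.prime (3::int)" by simp
      ultimately have p3: "p = 3" using p(1) by (metis primes_dvd_imp_eq)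
      \<comment> \<open>Now \<open>3\<close> divides \<open>d\<close>, so \<open>k\<close> is at
        most \<open>1\<close>; the second factor \<open>3\<close> of \<open>A * B\<close> has to
        come from \<open>w\<close>, which is coprime to \<open>d\<close>.\<close>
      then have "k = 1" using 2 k pX by (cases k) auto
      moreover have "3 * 3 dvd A * B" using p p3 mult_dvd_mono[of 3 A 3 B] by blast
      ultimately have "3 * 3 dvd 3 * w ^ n" using prod by simp
      then have "3 dvd w" using prime3 by (metis dvd_mult_cancel_left zero_neq_numeral prime_dvd_power)
      then show False using cop pX p3 p(1) by (meson coprime_common_divisor not_prime_unit)
    qed
  qed
  then have "coprime (nat A) (nat B)" using gt by (metis coprime_int_iff int_nat_eq less_imp_le)
  moreover have "nat A * nat B = 3 ^ k * nat w ^ n"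
  proof -
    have "int (nat A * nat B) = int (3 ^ k * nat w ^ n)" using prod gt w by simp
    then show ?thesis by (simp only: of_nat_eq_iff)
  qed
  ultimately obtain u v where uv: "nat w = u * v" "coprime u v"
    "nat A = u ^ n \<and> nat B = 3 ^ k * v ^ n \<or> nat A = 3 ^ k * u ^ n \<and> nat B = v ^ n"
    using coprime_mult_eq_prime_power_mult[of 3 "nat A" "nat B" k "nat w" n] n by auto
  have A: "A = int m" if "nat A = m" for m using that gt by auto
  have B: "B = int m" if "nat B = m" for m using that gt by auto
  have ww: "w = int u * int v" using uv(1) w by (metis int_nat_eq less_imp_le of_nat_mult)
  show ?thesis
  proof (rule that[of "int u" "int v"])
    show "w = int u * int v" by fact
    then show "int u > 0" "int v > 0" using w by (auto simp: zero_less_mult_iff)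
    show "coprime (int u) (int v)" using uv by simp
    show "d = 3 ^ k * int v ^ n - int u ^ n \<and> r = 3 ^ k * int v ^ n + int u ^ n \<or>
     d = int v ^ n - 3 ^ k * int u ^ n \<and> r = int v ^ n + 3 ^ k * int u ^ n"
      using uv(3) unfolding rX by (auto dest!: A B)
  qed
qed

lemma odd_power2_mod_8: "odd (x::int) \<Longrightarrow> x ^ 2 mod 8 = 1"
proof -
  assume "odd x"
  then have "x mod 8 \<in> {1,3,5,7}" by auto presburger
  then have "(x mod 8) ^ 2 mod 8 = 1" by auto
  then show ?thesis by (simp add: power_mod)
qed

lemma odd_power2_mod_4: "odd (x::int) \<Longrightarrow> x ^ 2 mod 4 = 1"
  using odd_power2_mod_8[of x] by presburger

lemma even_power2_mod_4: "even (x::int) \<Longrightarrow> x ^ 2 mod 4 = 0"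
  by auto

lemma power2_mod_3: "\<not> 3 dvd (x::int) \<Longrightarrow> x ^ 2 mod 3 = 1"
proof -
  assume "\<not> 3 dvd x"
  then have "x mod 3 \<in> {1,2}" by auto presburger
  then have "(x mod 3) ^ 2 mod 3 = 1" by auto
  then show ?thesis by (simp add: power_mod)
qed

lemma power4_eq_square_square: "(x::'a::comm_monoid_mult) ^ 4 = x\<^sup>2 * x\<^sup>2"
  by (simp flip: power_add)

lemma coprime_add_mult_power2_iff: "coprime (x + k * w^2) w \<longleftrightarrow> coprime x w" for x k w :: int
  using gcd_add_mult[of w "k * w" x]
  by (simp add: coprime_iff_gcd_eq_1 gcd.commute power2_eq_square algebra_simps)

text \<open>Reduces only the two arguments, so that coefficients such as \<open>3 * c^2\<close> stay
  symbolic while finitely many residues of \<open>a\<close> and \<open>b\<close> are tested.\<close>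

lemma quadratic_form_mod:
  "(i * (a * a) + j * (a * b) + k * (b * b)) mod m =
   (i * (a mod m * (a mod m)) + j * (a mod m * (b mod m)) + k * (b mod m * (b mod m))) mod m" for a b m :: int
  by (intro mod_add_cong mod_mult_cong) simp_all

lemma opposite_parity_power2_mod_4:
  fixes u v :: int
  assumes "coprime u v" "odd (i * (u^2 * u^2) + 2 * j * (u^2 * v^2) + k * (v^2 * v^2))" "odd i" "odd k"
  shows "u^2 mod 4 = 1 \<and> v^2 mod 4 = 0 \<and> odd u \<and> even v \<or> u^2 mod 4 = 0 \<and> v^2 mod 4 = 1 \<and> even u \<and> odd v"
proof -
  have "\<not> (even u \<and> even v)" using assms(1) by (metis coprime_common_divisor odd_one)
  moreover have "\<not> (odd u \<and> odd v)" using assms(2-) by auto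
  ultimately show ?thesis using odd_power2_mod_4 even_power2_mod_4 by blast
qed

text \<open>Two differences of squares in succession. With \<open>t = 2 w\<close> the equation reads
  \<open>r^2 = (s^2 + 2 e c w^2)^2 + 12 c^2 w^4\<close>, which splits \<open>w = u v\<close>.
  Completing the square in the result gives \<open>(v^2 - e c u^2)^2 = s^2 + 4 c^2 u^4\<close>,
  which splits \<open>u = q p\<close> and returns the original equation with \<open>v\<close> in
  place of \<open>r\<close>. The parity clause of the conclusion excludes \<open>q = p = 1\<close>,
  a genuine solution when \<open>c = 1\<close> and \<open>e = - 1\<close>.\<close>

lemma quartic_descent:
  fixes s t r e c :: int
  assumes c: "c = 3 ^ j" "j \<le> 1" and e: "e = 1 \<or> e = - 1"
    and s: "s > 0" "odd s" and t: "t > 0" "even t" and r: "r > 0"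
    and st: "coprime s t" and s3: "j = 0 \<or> \<not> 3 dvd s"
    and eq: "s^4 + e * c * s^2 * t^2 + c^2 * t^4 = r^2"
  obtains q p v where "q > 0" "p > 0" "v > 0" "coprime q p" "j = 0 \<or> \<not> 3 dvd q"
    "q^4 + e * c * q^2 * p^2 + c^2 * p^4 = v^2" "v < r" "odd (p * q) \<noteq> odd v"
proof -
  have e2: "e * e = 1" using e by auto
  have c_odd: "odd c" and c1: "c \<ge> 1" unfolding c(1) by simp_all
  have c2: "3 * c^2 = 3 ^ (2 * j + 1)" "c^2 = 3 ^ (2 * j)" unfolding c(1) by (simp_all add: power_mult power2_eq_square power_mult_distrib flip: power_add mult_2)
  obtain w where w: "t = 2 * w" using t by blast
  have w0: "w > 0" using t w by simp
  have sw: "coprime s w" using st unfolding w by simp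
  have "r^2 = (s^2 + 2 * e * c * w^2)^2 + 4 * (3 * c^2) * w ^ 4"
    using eq e2 unfolding w by Groebner_Basis.algebra
  then have eq': "r^2 = (s^2 + 2 * e * c * w^2)^2 + 4 * 3 ^ (2 * j + 1) * w ^ 4" unfolding c2(1) .
  have rodd: "odd r"
  proof
    assume "even r"
    then have "even (s^4 + e * c * s^2 * t^2 + c^2 * t^4)" unfolding eq by simp
    then show False using s t by simp
  qed
  have cop: "coprime (s^2 + 2 * e * c * w^2) w" using sw by (simp add: coprime_add_mult_power2_iff)
  have k: "2 * j + 1 \<le> 1 \<or> \<not> 3 dvd s^2 + 2 * e * c * w^2"
  proof (cases "j = 0")
    case False
    then have "3 dvd c" "\<not> 3 dvd s" using c s3 by simp_all
    then have "3 dvd 2 * e * c * w^2" "\<not> 3 dvd s^2" by (simp_all add: prime_dvd_power_iff)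
    then show ?thesis by (simp add: dvd_add_left_iff)
  qed simp
  obtain u v where uv: "u > 0" "v > 0" "coprime u v" "w = u * v"
      "s^2 + 2 * e * c * w^2 = 3 * c^2 * v^4 - u^4 \<or> s^2 + 2 * e * c * w^2 = v^4 - 3 * c^2 * u^4"
    unfolding c2(1) by (rule difference_of_squares_descent[OF eq' r rodd w0 cop k]) auto
  define a b where "a = u^2" and "b = v^2"
  have w2: "w^2 = a * b" using uv(4) unfolding a_def b_def by (simp add: power_mult_distrib)
  have p4: "u^4 = a * a" "v^4 = b * b" unfolding a_def b_def power4_eq_square_square by simp_all
  have c_mod: "c^2 mod 4 = 1" "odd (c^2)" using odd_power2_mod_4 c_odd by simp_all
  have s2: "s^2 mod 4 = 1" "odd (s^2)" using odd_power2_mod_4 s by simp_all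
  \<comment> \<open>One alternative of the splitting fails modulo \<open>4\<close>: one of
    \<open>a\<close>, \<open>b\<close> is \<open>1\<close> and the other \<open>0\<close>, so the
    form is \<open>3\<close>, while \<open>s^2\<close> is \<open>1\<close>.\<close>
  have "s^2 \<noteq> - 1 * (a * a) + 2 * (- e * c) * (a * b) + 3 * c^2 * (b * b)"
  proof
    assume *: "s^2 = - 1 * (a * a) + 2 * (- e * c) * (a * b) + 3 * c^2 * (b * b)"
    have "s^2 mod 4 = (- 1 * (a mod 4 * (a mod 4)) + 2 * (- e * c) * (a mod 4 * (b mod 4)) + 3 * c^2 * (b mod 4 * (b mod 4))) mod 4"
      unfolding * by (rule quadratic_form_mod)
    moreover have "a mod 4 = 1 \<and> b mod 4 = 0 \<or> a mod 4 = 0 \<and> b mod 4 = 1"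
      using opposite_parity_power2_mod_4[of u v "- 1" "- e * c" "3 * c^2"] uv(3) s2(2) c_odd *
      unfolding a_def b_def by auto
    moreover have "(3 * c^2) mod 4 = 3" using c_mod by presburger
    ultimately show False using s2 by auto
  qed
  then have s_eq: "s^2 = - (3 * c^2) * (a * a) + 2 * (- e * c) * (a * b) + 1 * (b * b)" using uv(5) w2 p4 by auto
  have par: "odd u \<noteq> odd v"
    using opposite_parity_power2_mod_4[of u v "- (3 * c^2)" "- e * c" 1] uv(3) s2(2) c_odd s_eq
    unfolding a_def b_def by auto
  have ab: "a > 0" "b > 0" using uv unfolding a_def b_def by simp_all
  have "(b - e * c * a)^2 = s^2 + 4 * c^2 * u^4" using e2 unfolding s_eq p4 by Groebner_Basis.algebra
  then have eq2: "(b - e * c * a)^2 = s^2 + 4 * 3 ^ (2 * j) * u^4" unfolding c2(2) .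
  \<comment> \<open>The next splitting asks for a positive root. A failure forces
    \<open>e = 1\<close> and \<open>b \<le> c * a\<close>, and then the formula for
    \<open>s^2\<close> is negative.\<close>
  have pos: "b - e * c * a > 0"
  proof (rule ccontr)
    assume n: "\<not> b - e * c * a > 0"
    have e1: "e = 1" using n e ab c1 by (auto simp: not_less) (smt (verit) mult_pos_pos)
    then have le: "b \<le> c * a" using n by simp
    then have "b * b \<le> (c * a) * (c * a)" using ab by (intro mult_mono) auto
    moreover have "s^2 > 0" "c * (a * b) > 0" "c^2 * (a * a) > 0" using s ab c1 by simp_all
    moreover have "s^2 = - 3 * (c^2 * (a * a)) - 2 * (c * (a * b)) + b * b" using s_eq e1 by (simp add: algebra_simps)
    moreover have "(c * a) * (c * a) = c^2 * (a * a)" by (simp add: power2_eq_square)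
    ultimately show False by linarith
  qed
  have su: "coprime s u"
    using sw unfolding uv(4) by simp
  have "odd (b - e * c * a)" using par c_odd e unfolding a_def b_def by auto
  \<comment> \<open>The two alternatives of the splitting differ by exchanging the factors of
    \<open>u\<close>, so both give this sum after renaming.\<close>
  then obtain p q where pq: "p > 0" "q > 0" "coprime q p" "u = q * p" "b - e * c * a = q^4 + c^2 * p^4"
    unfolding c2(2)
    using difference_of_squares_descent[OF eq2 pos _ uv(1) su] s3
    by (smt (verit) add.commute coprime_commute mult.commute zero_less_numeral mult_is_0 le_numeral_extra(3) zero_le)
  have new: "q^4 + e * c * q^2 * p^2 + c^2 * p^4 = v^2"
    using pq(5) unfolding b_def a_def pq(4) by (simp add: power_mult_distrib algebra_simps)
  have q3: "j = 0 \<or> \<not> 3 dvd q"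
  proof (rule ccontr)
    assume "\<not> ?thesis"
    then have j: "j = 1" "3 dvd q" using c by auto
    then have "3 dvd c" using c by simp
    then have "3 dvd q^4 + e * c * q^2 * p^2 + c^2 * p^4"
      using j by (intro dvd_add) (auto simp: power2_eq_square intro: dvd_power)
    then have "3 dvd v" unfolding new by (simp add: prime_dvd_power_iff)
    then have "3 dvd b" unfolding b_def by (simp add: power2_eq_square)
    then have "3 dvd s^2" unfolding s_eq using \<open>3 dvd c\<close> by (auto simp: power2_eq_square intro!: dvd_add)
    then show False using s3 j by (simp add: prime_dvd_power_iff)
  qed
  have "v < r"
  proof -
    have "v \<le> w" using uv by (simp add: mult_le_cancel_right1)
    then have "v < t" using w w0 by simp
    \<comment> \<open>The quartic form is positive definite: this identity gives
      \<open>3 t^4 \<le> 4 r^2\<close>, and \<open>t \<ge> 2\<close> then yields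
      \<open>t < r\<close>.\<close>
    have "(2 * s^2 + e * c * t^2)^2 + 3 * c^2 * t^4 = 4 * r^2"
      using eq e2 by Groebner_Basis.algebra
    moreover have "(2 * s^2 + e * c * t^2)^2 \<ge> 0" by simp
    moreover have "1 * t^4 \<le> c^2 * t^4" using one_le_power[OF c1, of 2] by (intro mult_right_mono) simp_all
    moreover have "2 * 2 * t^2 \<le> t * t * t^2" using t w w0 by (intro mult_mono) auto
    moreover have "t * t * t^2 = t^4" "t^2 > 0" using t by (simp_all add: power4_eq_square_square power2_eq_square)
    ultimately have "t^2 < r^2" by linarith
    then have "t < r" using r by (meson power2_less_imp_less less_imp_le)
    then show ?thesis using \<open>v < t\<close> by simp
  qed
  then show ?thesis using that[of q p v] pq uv(2) new q3 par by (simp add: mult.commute)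
qed

lemma odd_odd_form_mod_8:
  fixes s t :: int
  assumes "odd s" "odd t"
  shows "(i * s^4 + j * s^2 * t^2 + k * t^4) mod 8 = (i + j + k) mod 8"
  using quadratic_form_mod[of i "s^2" j "t^2" k 8] odd_power2_mod_8[OF assms(1)] odd_power2_mod_8[OF assms(2)]
  by (simp only: power4_eq_square_square mult.assoc mult_1_right)

lemma power2_mod_8: "(x::int)^2 mod 8 \<in> {0, 1, 4}"
proof -
  have "x mod 8 \<in> {0,1,2,3,4,5,6,7}" by auto
  then have "(x mod 8) ^ 2 mod 8 \<in> {0, 1, 4}" by auto
  then show ?thesis by (simp add: power_mod)
qed

text \<open>Infinite descent on \<open>r\<close>. By symmetry the even variable may be called
  \<open>t\<close>; for both odd the left side is \<open>3\<close> modulo \<open>8\<close>.\<close>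

lemma no_quartic_plus:
  fixes s t r :: int
  assumes "s > 0" "t > 0" "r > 0" "coprime s t" "s^4 + s^2 * t^2 + t^4 = r^2"
  shows False
  using assms
proof (induction "nat r" arbitrary: s t r rule: less_induct)
  case less
  have *: False if "s > 0" "odd s" "t > 0" "even t" "coprime s t" "s^4 + s^2 * t^2 + t^4 = r^2" for s t
  proof (rule quartic_descent[of 1 0 1 s t r])
    fix q p v :: int
    assume "q > 0" "p > 0" "v > 0" "coprime q p" "q^4 + 1 * 1 * q^2 * p^2 + 1^2 * p^4 = v^2" "v < r"
    then show False using less.hyps[of v q p] by simp
  qed (use that less.prems in auto)
  have "\<not> (odd s \<and> odd t)"
  proof
    assume "odd s \<and> odd t"
    then have "r^2 mod 8 = 3"
      using odd_odd_form_mod_8[of s t 1 1 1] unfolding less.prems(5)[symmetric] by simp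
    then show False using power2_mod_8[of r] by auto
  qed
  moreover have "\<not> (even s \<and> even t)" using less.prems(4) by (metis coprime_common_divisor odd_one)
  moreover have "coprime t s" "t^4 + t^2 * s^2 + s^4 = r^2"
    using less.prems by (simp_all add: coprime_commute algebra_simps)
  ultimately show False using *[of s t] *[of t s] less.prems by blast
qed

text \<open>Since \<open>s = t = 1\<close> is a solution, the induction hypothesis is an equality
  and parity has to contradict it. In mixed parity the smaller solution would be
  \<open>1, 1\<close>, against the parity clause of \<open>quartic_descent\<close>; two odd
  variables need a different descent, \<open>oo\<close>.\<close>

lemma quartic_minus_trivial:
  fixes s t r :: int
  assumes "s > 0" "t > 0" "r > 0" "coprime s t" "s^4 - s^2 * t^2 + t^4 = r^2"
  shows "s = t"
  using assms
proof (induction "nat r" arbitrary: s t r rule: less_induct)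
  case less
  have *: False if "s > 0" "odd s" "t > 0" "even t" "r > 0" "coprime s t" "s^4 - s^2 * t^2 + t^4 = r^2"
     "\<And>s t v. \<lbrakk>v < r; s > 0; t > 0; v > 0; coprime s t; s^4 - s^2 * t^2 + t^4 = v^2\<rbrakk> \<Longrightarrow> s = t" for s t r :: int
  proof (rule quartic_descent[of 1 0 "- 1" s t r])
    fix q p v :: int
    assume *: "q > 0" "p > 0" "v > 0" "coprime q p" "q^4 + - 1 * 1 * q^2 * p^2 + 1^2 * p^4 = v^2" "v < r" "odd (p * q) \<noteq> odd v"
    then have "q = p" using that(8)[of v q p] by simp
    then have "q = 1" "p = 1" using *(1,2,4) by simp_all
    then show False using *(5,7) by (metis add.commute even_add even_power mult_1 odd_one one_power2 power_one zero_less_numeral mult_minus_left even_minus)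
  qed (use that in auto)
  have IH: "s = t" if "v < r" "s > 0" "t > 0" "v > 0" "coprime s t" "s^4 - s^2 * t^2 + t^4 = v^2" for s t v :: int
    using less.hyps[of v s t] that by simp
  \<comment> \<open>Here \<open>r^2 = (s t)^2 + (4 x y)^2\<close> is a Pythagorean triple with
    parameters \<open>a\<close>, \<open>b\<close>, so \<open>2 x y = a b\<close> and
    \<open>s t = b^2 - a^2\<close>. These are also the legs of a triple with hypotenuse
    \<open>x^2 + y^2 < r\<close>, which turns \<open>a\<close> and \<open>b\<close> into a smaller
    solution of opposite parity.\<close>
  have oo: False if odd: "odd s" "odd t" and gt: "s > t" and pos: "s > 0" "t > 0" and cop: "coprime s t" and eq: "s^4 - s^2 * t^2 + t^4 = r^2" for s t
  proof -
    have "even (s - t)" using odd by simp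
    then obtain x where x: "s - t = 2 * x" unfolding dvd_def by blast
    have "even (s + t)" using odd by simp
    then obtain y where y: "s + t = 2 * y" unfolding dvd_def by blast
    have st: "s = x + y" "t = y - x" using x y by simp_all
    have xy: "x > 0" "y > 0" using x y gt pos by simp_all
    have "r^2 = (s^2 - t^2)^2 + (s * t)^2" using eq by Groebner_Basis.algebra
    then have eq': "r^2 = (s * t)^2 + 4 * 3^0 * (2 * x * y)^2"
      unfolding st by Groebner_Basis.algebra
    have rodd: "odd r"
    proof
      assume "even r"
      then have "even ((s * t)^2 + 4 * 3^0 * (2 * x * y)^2)" unfolding eq'[symmetric] by simp
      then show False using odd by simp
    qed
    have "coprime (s * t) (2 * x * y)"
    proof -
      have "coprime (s * t) (s^2 - t^2)"
      proof -
        have "coprime (s^2 + (- 1) * t^2) t" "coprime (- (t^2) + 1 * s^2) s"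
          using cop by (simp_all only: coprime_add_mult_power2_iff) (simp_all add: coprime_commute)
        then show ?thesis by (simp add: coprime_commute)
      qed
      moreover have "s^2 - t^2 = (2 * x * y) * 2" unfolding st by Groebner_Basis.algebra
      ultimately show ?thesis using odd by simp
    qed
    then obtain a b where ab: "a > 0" "b > 0" "coprime a b" "2 * x * y = a * b" "s * t = b^2 - a^2"
      using difference_of_squares_descent[OF eq' less.prems(3) rodd, of thesis] xy
      by (auto simp: coprime_commute)
    define m where "m = x^2 + y^2"
    have m: "m > 0" using xy by (simp add: m_def add_pos_pos)
    have m2: "m^2 = (s * t)^2 + (2 * x * y)^2" unfolding m_def st by Groebner_Basis.algebra
    have new: "b^4 - b^2 * a^2 + a^4 = m^2" unfolding m2 ab(4,5) by Groebner_Basis.algebra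
    have "(2 * x * y)^2 > 0" using xy by simp
    then have "m^2 < r^2" unfolding eq' m2 by simp
    then have mr: "m < r" using less.prems(3) by (meson power2_less_imp_less less_imp_le)
    have "odd (b^2 - a^2)" using odd unfolding ab(5)[symmetric] by simp
    then have "odd a \<noteq> odd b" by auto
    moreover have "a = b" using IH[OF mr ab(2,1) m _ new] ab(3) by (simp add: coprime_commute)
    ultimately show False by simp
  qed
  have sym: "coprime t s" "t^4 - t^2 * s^2 + s^4 = r^2"
    using less.prems by (simp_all add: coprime_commute algebra_simps)
  have "\<not> (even s \<and> even t)" using less.prems(4) by (metis coprime_common_divisor odd_one)
  moreover have "\<not> (odd s \<and> even t)" using *[of s t r] less.prems IH by blast
  moreover have "\<not> (even s \<and> odd t)" using *[of t s r] less.prems IH sym by blast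
  ultimately have "odd s" "odd t" by auto
  then show "s = t" using oo[of s t] oo[of t s] less.prems sym by (metis linorder_neqE)
qed

text \<open>The counterpart of \<open>quartic_descent\<close> for \<open>c = 3\<close> with the
  coefficient \<open>9\<close> at the odd variable. A single splitting suffices: congruences modulo
  \<open>4\<close> and \<open>3\<close> leave \<open>e = 1\<close> and
  \<open>3 s^2 = (3 b + a) (b - a)\<close> for squares \<open>a\<close>, \<open>b\<close>. The
  factors are coprime, so \<open>3 b + a\<close>, prime to \<open>3\<close>, would be a square, yet
  it is \<open>3\<close> modulo \<open>4\<close>.\<close>

lemma no_quartic_three_odd:
  fixes s t r e :: int
  assumes s: "s > 0" "odd s" and t: "t > 0" "even t" "\<not> 3 dvd t" and r: "r > 0"
    and st: "coprime s t" and e: "e = 1 \<or> e = - 1"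
    and eq: "9 * s^4 + e * 3 * s^2 * t^2 + t^4 = r^2"
  shows False
proof -
  have e2: "e * e = 1" using e by auto
  obtain w where w: "t = 2 * w" using t by blast
  have w0: "w > 0" using t w by simp
  have w3: "\<not> 3 dvd w" using t(3) dvd_mult[of 3 w 2] unfolding w by blast
  have sw: "coprime s w" using st unfolding w by simp
  have eq': "r^2 = (3 * s^2 + 2 * e * w^2)^2 + 4 * 3 ^ 1 * w ^ 4"
    using eq e2 unfolding w by Groebner_Basis.algebra
  have rodd: "odd r"
  proof
    assume "even r"
    then have "even (9 * s^4 + e * 3 * s^2 * t^2 + t^4)" unfolding eq by simp
    then show False using s t by simp
  qed
  have "coprime 3 w" using w3 by (simp add: prime_imp_coprime)
  then have cop: "coprime (3 * s^2 + 2 * e * w^2) w" using sw by (simp add: coprime_add_mult_power2_iff)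
  obtain u v where uv: "u > 0" "v > 0" "coprime u v" "w = u * v"
      "3 * s^2 + 2 * e * w^2 = 3 * v^4 - u^4 \<or> 3 * s^2 + 2 * e * w^2 = v^4 - 3 * u^4"
    by (rule difference_of_squares_descent[OF eq' r rodd w0 cop]) auto
  define a b where "a = u^2" and "b = v^2"
  have w2: "w^2 = a * b" using uv(4) unfolding a_def b_def by (simp add: power_mult_distrib)
  have p4: "u^4 = a * a" "v^4 = b * b" unfolding a_def b_def power4_eq_square_square by simp_all
  have "\<not> 3 dvd u" "\<not> 3 dvd v" using w3 unfolding uv(4) by auto
  then have ab3: "a mod 3 = 1" "b mod 3 = 1" using power2_mod_3 unfolding a_def b_def by simp_all
  have s2: "s^2 mod 8 = 1" "odd (s^2)" using odd_power2_mod_8 s by simp_all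
  have "3 * s^2 \<noteq> - 3 * (a * a) + 2 * (- e) * (a * b) + 1 * (b * b)"
  proof
    assume *: "3 * s^2 = - 3 * (a * a) + 2 * (- e) * (a * b) + 1 * (b * b)"
    have "3 * s^2 mod 4 = (- 3 * (a mod 4 * (a mod 4)) + 2 * (- e) * (a mod 4 * (b mod 4)) + 1 * (b mod 4 * (b mod 4))) mod 4"
      unfolding * by (rule quadratic_form_mod)
    moreover have "a mod 4 = 1 \<and> b mod 4 = 0 \<or> a mod 4 = 0 \<and> b mod 4 = 1"
    proof -
      have "odd (- 3 * (a * a) + 2 * (- e) * (a * b) + 1 * (b * b))" using s2(2) unfolding *[symmetric] by simp
      then show ?thesis using opposite_parity_power2_mod_4[of u v "- 3" "- e" 1] uv(3) unfolding a_def b_def by auto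
    qed
    moreover have "3 * s^2 mod 4 = 3" using s2 by presburger
    ultimately show False by auto
  qed
  then have s_eq: "3 * s^2 = - 1 * (a * a) + 2 * (- e) * (a * b) + 3 * (b * b)" using uv(5) w2 p4 by auto
  have "3 * s^2 mod 3 = (- 1 * (a mod 3 * (a mod 3)) + 2 * (- e) * (a mod 3 * (b mod 3)) + 3 * (b mod 3 * (b mod 3))) mod 3"
    unfolding s_eq by (rule quadratic_form_mod)
  then have "(2 - 2 * e) mod 3 = 0" unfolding ab3 by simp
  then have e1: "e = 1" using e by auto
  have par: "a mod 4 = 1 \<and> b mod 4 = 0 \<and> odd u \<and> even v \<or> a mod 4 = 0 \<and> b mod 4 = 1 \<and> even u \<and> odd v"
  proof -
    have "odd (- 1 * (a * a) + 2 * (- e) * (a * b) + 3 * (b * b))" using s2(2) unfolding s_eq[symmetric] by simp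
    then show ?thesis using opposite_parity_power2_mod_4[of u v "- 1" "- e" 3] uv(3) unfolding a_def b_def by auto
  qed
  \<comment> \<open>With the parities exchanged the form is \<open>7\<close> modulo
    \<open>8\<close>, whereas \<open>3 * s^2\<close> is \<open>3\<close>.\<close>
  have u_even: "even u" "odd v"
  proof -
    have m8: "3 * s^2 mod 8 = (- 1 * (a mod 8 * (a mod 8)) + 2 * (- e) * (a mod 8 * (b mod 8)) + 3 * (b mod 8 * (b mod 8))) mod 8"
      unfolding s_eq by (rule quadratic_form_mod)
    have m3: "3 * s^2 mod 8 = 3" using s2 by presburger
    have False if "odd u" "even v"
    proof -
      have "a mod 8 = 1" using odd_power2_mod_8 that unfolding a_def by simp
      moreover have "b mod 8 = 0 \<or> b mod 8 = 4"
      proof -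
        have "b mod 8 = 0 \<or> b mod 8 = 1 \<or> b mod 8 = 4" using power2_mod_8[of v] unfolding b_def by simp
        moreover have "b mod 4 = 0" using par that by auto
        ultimately show ?thesis by presburger
      qed
      ultimately show False using m8 m3 e1 by auto
    qed
    then show "even u" "odd v" using par by blast+
  qed
  have "(3 * b + a) * (b - a) = 3 * s^2" unfolding s_eq e1 by Groebner_Basis.algebra
  moreover have ab: "a > 0" "b > 0" using uv unfolding a_def b_def by simp_all
  ultimately have "b - a > 0" using s by (smt (verit) mult_nonneg_nonpos zero_less_power)
  have "coprime (3 * b + a) (b - a)"
  proof -
    have cop: "coprime b a" using uv(3) unfolding a_def b_def by (simp add: coprime_commute)
    show ?thesis
    proof (rule coprimeI)
      fix d assume d: "d dvd 3 * b + a" "d dvd b - a"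
      have "odd (b - a)" using u_even unfolding a_def b_def by simp
      then have "odd d" using d(2) dvd_trans by blast
      then have "coprime d (2 * 2)" by (simp only: coprime_mult_right_iff) simp
      then have d4: "coprime d 4" by simp
      have "d dvd (3 * b + a) + (b - a)" "d dvd (3 * b + a) - 3 * (b - a)"
        by (rule dvd_add[OF d], rule dvd_diff[OF d(1) dvd_mult[OF d(2)]])
      then have "d dvd 4 * b" "d dvd 4 * a" by simp_all
      then have "d dvd b" "d dvd a" using d4 by (simp_all add: coprime_dvd_mult_right_iff)
      then show "is_unit d" using cop by (meson coprime_common_divisor)
    qed
  qed
  define A where "A = nat (3 * b + a)"
  define B where "B = nat (b - a)"
  have AB: "int A = 3 * b + a" "int B = b - a" using \<open>b - a > 0\<close> ab unfolding A_def B_def by simp_all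
  have "coprime A B" using \<open>coprime (3 * b + a) (b - a)\<close> unfolding AB[symmetric] by simp
  have "A * B = 3 ^ 1 * nat s ^ 2"
  proof -
    have "int (A * B) = int (3 ^ 1 * nat s ^ 2)"
      using \<open>(3 * b + a) * (b - a) = 3 * s^2\<close> s AB by simp
    then show ?thesis by (simp only: of_nat_eq_iff)
  qed
  obtain x y where xy: "A = x ^ 2 \<and> B = 3 ^ 1 * y ^ 2 \<or> A = 3 ^ 1 * x ^ 2 \<and> B = y ^ 2"
    by (rule coprime_mult_eq_prime_power_mult[OF _ \<open>coprime A B\<close> \<open>A * B = 3 ^ 1 * nat s ^ 2\<close> pos2]) (simp, rule that)
  have "\<not> 3 dvd 3 * b + a" using ab3 by presburger
  then have "\<not> 3 dvd int A" using AB by simp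
  then have "A = x ^ 2" using xy by auto
  then have "3 * b + a = (int x)^2" using AB by simp
  moreover have "(3 * b + a) mod 4 = 3" using par u_even by presburger
  moreover have "(int x)^2 mod 8 = 0 \<or> (int x)^2 mod 8 = 1 \<or> (int x)^2 mod 8 = 4"
    using power2_mod_8[of "int x"] by simp
  ultimately show False by presburger
qed

text \<open>Three parities, three reasons: descent for \<open>s\<close> odd and \<open>t\<close>
  even, \<open>no_quartic_three_odd\<close> for the reverse, and for both odd the value
  \<open>5\<close> or \<open>7\<close> modulo \<open>8\<close>.\<close>

lemma no_quartic_three:
  fixes s t r e :: int
  assumes "s > 0" "t > 0" "r > 0" "coprime s t" "\<not> 3 dvd s" "e = 1 \<or> e = - 1"
    "s^4 + e * 3 * s^2 * t^2 + 9 * t^4 = r^2"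
  shows False
  using assms
proof (induction "nat r" arbitrary: s t r rule: less_induct)
  case less
  have "\<not> (odd s \<and> even t)"
  proof
    assume *: "odd s \<and> even t"
    show False
    proof (rule quartic_descent[of 3 1 e s t r])
      fix q p v :: int
      assume "q > 0" "p > 0" "v > 0" "coprime q p" "1 = (0::nat) \<or> \<not> 3 dvd q" "q^4 + e * 3 * q^2 * p^2 + 3^2 * p^4 = v^2" "v < r"
      then show False using less.hyps[of v q p] less.prems(6) by simp
    qed (use * less.prems in auto)
  qed
  moreover have "\<not> (even s \<and> odd t)"
    using no_quartic_three_odd[of t s r e] less.prems by (auto simp: coprime_commute algebra_simps)
  moreover have "\<not> (odd s \<and> odd t)"
  proof
    assume "odd s \<and> odd t"
    then have "r^2 mod 8 = (1 + e * 3 + 9) mod 8"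
      using odd_odd_form_mod_8[of s t 1 "e * 3" 9] unfolding less.prems(7)[symmetric] by simp
    then show False using power2_mod_8[of r] less.prems(6) by auto
  qed
  moreover have "\<not> (even s \<and> even t)" using less.prems(4) by (metis coprime_common_divisor odd_one)
  ultimately show False by blast
qed

text \<open>If \<open>s > t\<close>, both are odd and prime to \<open>3\<close>, and
  \<open>s^2 - t^2 = 12 w\<close> gives \<open>r^2 = (s t)^2 + 12 (2 w)^2\<close>. Splitting yields
  \<open>2 w = a b\<close> and \<open>s t\<close> equal to \<open>3 b^2 - a^2\<close> or
  \<open>b^2 - 3 a^2\<close>. With \<open>x\<close>, \<open>y\<close> the half difference and half
  sum, \<open>(x^2 + y^2)^2 = (s t)^2 + 9 (a b)^2\<close> is the quartic excluded by
  \<open>no_quartic_three\<close>.\<close>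

lemma quartic_three_trivial:
  fixes s t r :: int
  assumes pos: "s > 0" "t > 0" "r > 0" and cop: "coprime s t" and eq: "s^4 + s^2 * t^2 + t^4 = 3 * r^2"
  shows "s = t"
proof -
  have *: False if gt: "s > t" and pos: "s > 0" "t > 0" and cop: "coprime s t" and eq: "s^4 + s^2 * t^2 + t^4 = 3 * r^2" for s t
  proof -
    have s3: "\<not> 3 dvd s" and t3: "\<not> 3 dvd t"
    proof -
      have "3 dvd t" if "3 dvd s"
      proof -
        have "3 dvd 3 * r^2 - s * (s^3 + s * t^2)" using that by simp
        also have "3 * r^2 - s * (s^3 + s * t^2) = t^4" using eq by Groebner_Basis.algebra
        finally show ?thesis by (simp add: prime_dvd_power_iff)
      qed
      moreover have "3 dvd s" if "3 dvd t"
      proof -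
        have "3 dvd 3 * r^2 - t * (t^3 + t * s^2)" using that by simp
        also have "3 * r^2 - t * (t^3 + t * s^2) = s^4" using eq by Groebner_Basis.algebra
        finally show ?thesis by (simp add: prime_dvd_power_iff)
      qed
      moreover have "\<not> (3 dvd s \<and> 3 dvd t)" using cop coprime_common_divisor[of s t 3] by auto
      ultimately show "\<not> 3 dvd s" "\<not> 3 dvd t" by blast+
    qed
    have odd: "odd s" "odd t"
    proof -
      have "\<not> (even s \<and> even t)" using cop by (metis coprime_common_divisor odd_one)
      moreover have False if "even s \<noteq> even t"
      proof -
        define a b where "a = s^2" and "b = t^2"
        have "a mod 4 = 1 \<and> b mod 4 = 0 \<or> a mod 4 = 0 \<and> b mod 4 = 1"
          using that odd_power2_mod_4 even_power2_mod_4 unfolding a_def b_def by blast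
        moreover have "3 * r^2 = 1 * (a * a) + 1 * (a * b) + 1 * (b * b)"
          using eq unfolding a_def b_def power4_eq_square_square by simp
        then have "3 * r^2 mod 4 = (1 * (a mod 4 * (a mod 4)) + 1 * (a mod 4 * (b mod 4)) + 1 * (b mod 4 * (b mod 4))) mod 4"
          by (metis quadratic_form_mod)
        moreover have "(1 * (a mod 4 * (a mod 4)) + 1 * (a mod 4 * (b mod 4)) + 1 * (b mod 4 * (b mod 4))) mod 4 = 1"
          using calculation(1) by (elim disjE conjE) simp_all
        ultimately have "3 * r^2 mod 4 = 1" by metis
        moreover have "r^2 mod 8 = 0 \<or> r^2 mod 8 = 1 \<or> r^2 mod 8 = 4" using power2_mod_8[of r] by simp
        ultimately show False by presburger
      qed
      ultimately show "odd s" "odd t" by blast+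
    qed
    have "even (s - t)" using odd by simp
    then obtain x where x: "s - t = 2 * x" unfolding dvd_def by blast
    have "even (s + t)" using odd by simp
    then obtain y where y: "s + t = 2 * y" unfolding dvd_def by blast
    have st: "s = x + y" "t = y - x" using x y by simp_all
    have xy: "x > 0" "y > 0" using x y gt pos by simp_all
    have "3 dvd s^2 - t^2" using power2_mod_3[OF s3] power2_mod_3[OF t3] by presburger
    moreover have "s^2 - t^2 = 4 * (x * y)" unfolding st by Groebner_Basis.algebra
    ultimately have "3 dvd 4 * (x * y)" by simp
    then have "3 dvd x * y" by presburger
    then obtain w where w: "x * y = 3 * w" by blast
    have "x * y > 0" using xy by simp
    then have w0: "w > 0" using w by linarith
    have d: "s^2 - t^2 = 12 * w" using \<open>s^2 - t^2 = 4 * (x * y)\<close> w by simp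
    then have eqr: "r^2 = (s * t)^2 + 4 * 3^1 * (2 * w)^2" using eq by Groebner_Basis.algebra
    have rodd: "odd r"
    proof
      assume "even r"
      then have "even (s^4 + s^2 * t^2 + t^4)" unfolding eq by simp
      then show False using odd by simp
    qed
    have copst: "coprime (s * t) (2 * w)"
    proof -
      have "coprime (s^2 + (- 1) * t^2) t" "coprime (- (t^2) + 1 * s^2) s"
        using cop by (simp_all only: coprime_add_mult_power2_iff) (simp_all add: coprime_commute)
      then have "coprime (s * t) (s^2 - t^2)" by (simp add: coprime_commute)
      then show ?thesis unfolding d using odd by simp
    qed
    have w02: "2 * w > 0" using w0 by simp
    obtain a b where ab: "a > 0" "b > 0" "coprime a b" "2 * w = a * b"
      "s * t = 3 ^ 1 * b^2 - a^2 \<and> r = 3 ^ 1 * b^2 + a^2 \<or> s * t = b^2 - 3 ^ 1 * a^2 \<and> r = b^2 + 3 ^ 1 * a^2"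
      by (rule difference_of_squares_descent[OF eqr \<open>r > 0\<close> rodd w02 copst disjI1[OF le_refl] pos2]) (rule that; assumption)
    then have ab5: "s * t = 3 * b^2 - a^2 \<or> s * t = b^2 - 3 * a^2" unfolding power_one_right by blast
    define m where "m = x^2 + y^2"
    have m: "m > 0" using xy by (simp add: m_def add_pos_pos)
    have "4 * m^2 = (s^2 - t^2)^2 + 4 * (s * t)^2" unfolding m_def st by Groebner_Basis.algebra
    then have m2: "m^2 = (s * t)^2 + 9 * (a * b)^2" unfolding d ab(4)[symmetric] by Groebner_Basis.algebra
    have st3: "\<not> 3 dvd s * t" using s3 t3 by (simp add: prime_dvd_mult_iff)
    from ab5 show False
    proof
      assume st': "s * t = 3 * b^2 - a^2"
      then have "\<not> 3 dvd a" using st3 by (auto simp: power2_eq_square)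
      moreover have "a^4 + 1 * 3 * a^2 * b^2 + 9 * b^4 = m^2" using m2 unfolding st' by Groebner_Basis.algebra
      ultimately show False using no_quartic_three[of a b m 1] ab m by simp
    next
      assume st': "s * t = b^2 - 3 * a^2"
      then have "\<not> 3 dvd b" using st3 by (auto simp: power2_eq_square)
      moreover have "b^4 + 1 * 3 * b^2 * a^2 + 9 * a^4 = m^2" using m2 unfolding st' by Groebner_Basis.algebra
      ultimately show False using no_quartic_three[of b a m 1] ab m by (simp add: coprime_commute)
    qed
  qed
  have "coprime t s" "t^4 + t^2 * s^2 + s^4 = 3 * r^2" using cop eq by (simp_all add: coprime_commute algebra_simps)
  then show ?thesis using *[of s t] *[of t s] pos cop eq by (metis linorder_neqE)
qed

section \<open>Rational points on the twists by 1, -1, 3 and -3\<close>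

lemma coprime_mult_eq_square:
  fixes a b n :: int
  assumes "a > 0" "b > 0" "coprime a b" "a * b = n^2"
  obtains s t where "s > 0" "t > 0" "a = s^2" "b = t^2" "coprime s t"
proof -
  have "nat a * nat b = nat \<bar>n\<bar> ^ 2"
  proof -
    have "int (nat a * nat b) = int (nat \<bar>n\<bar> ^ 2)" using assms by simp
    then show ?thesis by (simp only: of_nat_eq_iff)
  qed
  moreover have "coprime (nat a) (nat b)" using assms by (metis coprime_int_iff int_nat_eq less_imp_le)
  ultimately obtain u v where uv: "nat a = u^2" "nat b = v^2" "nat \<bar>n\<bar> = u * v" using coprime_mult_eq_power[of "nat a" "nat b" "nat \<bar>n\<bar>" 2] by auto
  then have "a = (int u)^2" "b = (int v)^2" using assms by (metis int_nat_eq less_imp_le of_nat_power)+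
  moreover from this have "int u > 0" "int v > 0" using assms by auto
  moreover have "coprime (int u) (int v)" using assms(3) calculation by simp
  ultimately show ?thesis using that by blast
qed

lemma coprime_mult_eq_three_square:
  fixes a b n :: int
  assumes "a > 0" "b > 0" "coprime a b" "a * b = 3 * n^2"
  obtains s t where "s > 0" "t > 0" "a = s^2" "b = 3 * t^2" "coprime s t"
    | s t where "s > 0" "t > 0" "a = 3 * s^2" "b = t^2" "coprime s t"
proof -
  have "nat a * nat b = 3 ^ 1 * nat \<bar>n\<bar> ^ 2"
  proof -
    have "int (nat a * nat b) = int (3 ^ 1 * nat \<bar>n\<bar> ^ 2)" using assms by simp
    then show ?thesis by (simp only: of_nat_eq_iff)
  qed
  moreover have cop: "coprime (nat a) (nat b)" using assms by (metis coprime_int_iff int_nat_eq less_imp_le)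
  ultimately obtain u v where uv: "nat \<bar>n\<bar> = u * v" "coprime u v"
    "nat a = u^2 \<and> nat b = 3^1 * v^2 \<or> nat a = 3^1 * u^2 \<and> nat b = v^2"
    using coprime_mult_eq_prime_power_mult[OF _ cop _ pos2, of 3 1 "nat \<bar>n\<bar>" thesis] by simp
  from uv(3) show ?thesis
  proof
    assume *: "nat a = u^2 \<and> nat b = 3^1 * v^2"
    then have "a = (int u)^2" "b = 3 * (int v)^2" using assms(1,2)
      by (metis int_nat_eq less_imp_le of_nat_power, metis int_nat_eq less_imp_le of_nat_power of_nat_mult of_nat_numeral power_one_right)
    moreover from this have "int u > 0" "int v > 0" using assms by auto
    ultimately show ?thesis using that(1)[of "int u" "int v"] uv(2) by simp
  next
    assume *: "nat a = 3^1 * u^2 \<and> nat b = v^2"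
    then have "a = 3 * (int u)^2" "b = (int v)^2" using assms(1,2)
      by (metis int_nat_eq less_imp_le of_nat_power of_nat_mult of_nat_numeral power_one_right, metis int_nat_eq less_imp_le of_nat_power)
    moreover from this have "int u > 0" "int v > 0" using assms by auto
    ultimately show ?thesis using that(2)[of "int u" "int v"] uv(2) by simp
  qed
qed

text \<open>The equation \<open>e 3^k y^2 = x^3 - x^2 + x\<close> with denominators cleared, for \<open>x = e a / b\<close>.\<close>

lemma homogeneous_twist_trivial:
  fixes a b n e :: int
  assumes ab: "a > 0" "b > 0" "coprime a b" and e: "e = 1 \<or> e = - 1"
    and k: "k \<le> 1" and eq: "3 ^ k * (a * b * (a^2 - e * (a * b) + b^2)) = n^2"
  shows "a = b"
proof -
  define c where "c = a^2 - e * (a * b) + b^2"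
  have c_pos: "c > 0"
  proof -
    have "a * b > 0" "(a - b)^2 \<ge> 0" "a^2 > 0" "b^2 > 0" using ab by simp_all
    moreover have "(a - b)^2 = a^2 - 2 * (a * b) + b^2" by Groebner_Basis.algebra
    ultimately show ?thesis using e unfolding c_def by auto
  qed
  \<comment> \<open>Modulo \<open>a\<close> the factor \<open>c\<close> is \<open>b^2\<close>, and
    modulo \<open>b\<close> it is \<open>a^2\<close>. So \<open>a * b\<close> and \<open>c\<close>,
    and then \<open>a\<close> and \<open>b\<close>, are squares up to a factor
    \<open>3\<close>.\<close>
  have cop: "coprime (a * b) c"
  proof -
    have "coprime a (b^2)" "coprime b (a^2)" using ab by (simp_all add: coprime_commute)
    moreover have "gcd a c = gcd a (b^2)" using gcd_add_mult[of a "a - e * b" "b^2"]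
      unfolding c_def by (simp add: algebra_simps power2_eq_square)
    moreover have "gcd b c = gcd b (a^2)" using gcd_add_mult[of b "b - e * a" "a^2"]
      unfolding c_def by (simp add: algebra_simps power2_eq_square)
    ultimately show ?thesis by (simp add: coprime_iff_gcd_eq_1[symmetric] flip: coprime_iff_gcd_eq_1)
  qed
  have eq': "3 ^ k * (a * b * c) = n^2" using eq unfolding c_def .
  have four: "x^4 = (x^2)^2" for x :: int by (simp flip: power_mult)
  show ?thesis
  proof (cases "k = 0")
    case True
    then have "(a * b) * c = n^2" using eq' by (simp add: mult.assoc)
    then obtain m r where mr: "m > 0" "r > 0" "a * b = m^2" "c = r^2"
      using coprime_mult_eq_square[of "a * b" c n] cop ab c_pos by (metis mult_pos_pos)
    obtain s t where st: "s > 0" "t > 0" "a = s^2" "b = t^2" "coprime s t"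
      using coprime_mult_eq_square[OF ab mr(3)] by metis
    have r: "s^4 - e * (s^2 * t^2) + t^4 = r^2" using mr(4) unfolding c_def st(3,4) by (simp only: four)
    from e show ?thesis
    proof
      assume "e = 1"
      then show ?thesis using quartic_minus_trivial[of s t r] st mr r by simp
    next
      assume "e = - 1"
      then show ?thesis using no_quartic_plus[of s t r] st mr r by simp
    qed
  next
    case False
    then have "k = 1" using k by simp
    then have 3: "3 * (a * b * c) = n^2" using eq' by simp
    then have "3 dvd n^2" by (metis dvd_triv_left)
    then have "3 dvd n" by (simp add: prime_dvd_power_iff)
    then obtain n' where "n = 3 * n'" ..
    then have "a * b * c = 3 * n'^2" using 3 by (simp add: power_mult_distrib)
    moreover have "a * b > 0" using ab by simp
    ultimately consider m r where "m > 0" "r > 0" "a * b = m^2" "c = 3 * r^2"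
      | m r where "m > 0" "r > 0" "a * b = 3 * m^2" "c = r^2" "coprime (3 * m^2) c"
      using coprime_mult_eq_three_square[of "a * b" c n'] cop c_pos by metis
    then show ?thesis
    proof cases
      case (1 m r)
      obtain s t where st: "s > 0" "t > 0" "a = s^2" "b = t^2" "coprime s t"
        using coprime_mult_eq_square[OF ab 1(3)] by metis
      have r: "s^4 - e * (s^2 * t^2) + t^4 = 3 * r^2" using 1(4) unfolding c_def st(3,4) by (simp only: four)
      from e show ?thesis
      proof
        assume "e = 1"
        \<comment> \<open>A sum of two squares divisible by \<open>3\<close> has both terms
          divisible by \<open>3\<close>, against coprimality.\<close>
        then have "(s^2 + t^2)^2 = 3 * (r^2 + s^2 * t^2)" using r by Groebner_Basis.algebra
        then have "3 dvd (s^2 + t^2)^2" by simp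
        then have *: "3 dvd s^2 + t^2" by (simp add: prime_dvd_power_iff)
        have sq: "z^2 mod 3 = 0 \<or> z^2 mod 3 = 1" for z :: int
          using power2_mod_3[of z] by (cases "3 dvd z") (auto simp: power2_eq_square)
        have "3 dvd p \<and> 3 dvd q" if "3 dvd p + q" "p mod 3 = 0 \<or> p mod 3 = 1" "q mod 3 = 0 \<or> q mod 3 = 1" for p q :: int
          using that by presburger
        from this[OF * sq sq] have "3 dvd s^2" "3 dvd t^2" by simp_all
        then have "3 dvd s" "3 dvd t" by (simp_all add: prime_dvd_power_iff)
        then show ?thesis using coprime_common_divisor[OF st(5), of 3] by simp
      next
        assume "e = - 1"
        then show ?thesis using quartic_three_trivial[of s t r] st 1 r by simp
      qed
    next
      case (2 m r)
      \<comment> \<open>The factor \<open>3\<close> may sit at \<open>a\<close> or at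
        \<open>b\<close>; both placements lead to the quartic that \<open>no_quartic_three\<close>
        excludes for either sign, here \<open>- e\<close>.\<close>
      have main: False if ab': "a' > 0" "b' > 0" "coprime s t" "s > 0" "t > 0" "a' = s^2" "b' = 3 * t^2" "coprime a' b'"
        "a'^2 - e * (a' * b') + b'^2 = r^2" for a' b' s t
      proof -
        have "\<not> 3 dvd s"
        proof
          assume "3 dvd s"
          then have "3 dvd a'" "3 dvd b'" using ab' by (auto simp: power2_eq_square)
          then show False using coprime_common_divisor[OF ab'(8), of 3] by simp
        qed
        moreover have "s^4 + (- e) * 3 * s^2 * t^2 + 9 * t^4 = r^2"
          using ab'(9) unfolding ab'(6,7) four by Groebner_Basis.algebra
        ultimately show False using no_quartic_three[of s t r "- e"] ab' 2 e by auto
      qed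
      from ab(1,2,3) 2(3) show ?thesis
      proof (cases rule: coprime_mult_eq_three_square)
        case (1 s t)
        then show ?thesis using main[of a b s t] ab 2(4) unfolding c_def by simp
      next
        case (2 s t)
        then show ?thesis using main[of b a t s] ab \<open>c = r^2\<close> unfolding c_def by (simp add: coprime_commute algebra_simps)
      qed
    qed
  qed
qed

text \<open>For \<open>x = a0 / b\<close> the number \<open>m = b^2 * 3 ^ k * y\<close> is rational
  with integral square, hence an integer. Since \<open>a0^2 - a0 * b + b^2\<close> is positive, the
  sign of \<open>m^2\<close> makes \<open>e * a0\<close> positive, and the homogeneous equation
  applies to \<open>e * a0\<close> and \<open>b\<close>.\<close>

lemma rational_twist_points:
  fixes x y d :: rat
  assumes d: "d = 1 \<or> d = - 1 \<or> d = 3 \<or> d = - 3" and eq: "d * y^2 = x^3 - x^2 + x"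
  shows "x = 0 \<or> x = 1 \<or> x = - 1"
proof (rule ccontr)
  assume x: "\<not> ?thesis"
  obtain k e where k: "k \<le> (1::nat)" "e = 1 \<or> e = (-1::int)" "d = of_int e * 3 ^ k"
  proof -
    have "d = of_int 1 * 3 ^ 0 \<or> d = of_int (-1) * 3 ^ 0 \<or> d = of_int 1 * 3 ^ 1 \<or> d = of_int (-1) * 3 ^ 1"
      using d by auto
    then show ?thesis using that by (metis le_refl zero_le)
  qed
  obtain a0 b where ab: "quotient_of x = (a0, b)" "b > 0" "coprime a0 b" "x = of_int a0 / of_int b"
    by (metis quotient_of_coprime quotient_of_denom_pos quotient_of_div surj_pair)
  have "a0 \<noteq> 0" using x ab by auto
  define m where "m = of_int b ^ 2 * (of_int 3 ^ k * y)"
  have "m^2 = of_int b ^ 4 * 3 ^ k * (of_int e * (d * y^2))"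
    using k(2) unfolding m_def k(3) by (auto simp: power2_eq_square power4_eq_square_square)
  also have "\<dots> = of_int (3 ^ k * (e * a0 * b * (a0^2 - a0 * b + b^2)))"
    unfolding eq ab(4) using ab(2) by (simp add: field_simps power2_eq_square power3_eq_cube power4_eq_square_square)
  finally have m2: "m^2 = of_int (3 ^ k * (e * a0 * b * (a0^2 - a0 * b + b^2)))" .
  have "m \<in> \<int>"
  proof -
    obtain p q where pq: "quotient_of m = (p, q)" "q > 0" "coprime p q" "m = of_int p / of_int q"
      by (metis quotient_of_coprime quotient_of_denom_pos quotient_of_div surj_pair)
    define N where "N = 3 ^ k * (e * a0 * b * (a0^2 - a0 * b + b^2))"
    have "(of_int p :: rat)^2 = of_int N * of_int q ^ 2"
      using m2 pq(2) unfolding pq(4) N_def[symmetric] by (simp add: field_simps power_divide)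
    then have "(of_int (p^2) :: rat) = of_int (N * q^2)" by simp
    then have "p^2 = N * q^2" by (simp only: of_int_eq_iff)
    then have "q^2 dvd p^2" by simp
    then have "is_unit q" using pq(3) by (metis coprime_absorb_left coprime_commute pow_divides_pow_iff zero_less_numeral)
    then have "q = 1" using pq(2) by simp
    then show ?thesis using pq(4) by simp
  qed
  then obtain n where n: "m = of_int n" unfolding Ints_def by blast
  have "n^2 = 3 ^ k * (e * a0 * b * (a0^2 - a0 * b + b^2))"
    using m2 unfolding n by (metis of_int_eq_iff of_int_power)
  moreover have "e * a0 > 0"
  proof (rule ccontr)
    assume "\<not> e * a0 > 0"
    then have "e * a0 < 0" using \<open>a0 \<noteq> 0\<close> k(2) by auto
    moreover have "a0^2 - a0 * b + b^2 > 0"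
    proof -
      have "4 * (a0^2 - a0 * b + b^2) = (2 * a0 - b)^2 + 3 * b^2" by Groebner_Basis.algebra
      also have "\<dots> > 0" using ab by (intro add_nonneg_pos) simp_all
      finally show ?thesis by simp
    qed
    then have "b * (a0^2 - a0 * b + b^2) * 3^k > 0" using ab by simp
    ultimately have "(e * a0) * (b * (a0^2 - a0 * b + b^2) * 3^k) < 0" by (rule mult_neg_pos)
    then have "n^2 < 0" using \<open>n^2 = _\<close> by (simp only: ac_simps)
    then show False by simp
  qed
  moreover have "a0^2 - a0 * b + b^2 = (e * a0)^2 - e * (e * a0 * b) + b^2"
    using k(2) by auto
  moreover have "coprime (e * a0) b" using k(2) ab(3) by auto
  ultimately have "e * a0 = b" using homogeneous_twist_trivial[of "e * a0" b e k n] k ab(2) by (simp add: mult.assoc)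
  then have "a0 = e * b" using k(2) by auto
  then have "x = of_int e" using ab(2,4) by simp
  then show False using x k(2) by auto
qed

section \<open>Substitution of power series into polynomials\<close>

definition fps_eval :: "'a::comm_ring_1 fps \<Rightarrow> 'a poly \<Rightarrow> 'a fps" where
  "fps_eval f p = poly (map_poly fps_const p) f"

lemma fps_eval_pCons: "fps_eval f (pCons c p) = fps_const c + f * fps_eval f p"
  by (cases "c = 0 \<and> p = 0") (auto simp: fps_eval_def map_poly_pCons)

lemma fps_eval_0 [simp]: "fps_eval f 0 = 0"
  by (simp add: fps_eval_def)

lemma fps_eval_add: "fps_eval f (p + q) = fps_eval f p + fps_eval f q"
proof (induction p arbitrary: q)
  case (pCons a p)
  obtain b q' where q: "q = pCons b q'" by (cases q rule: pCons_cases)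
  show ?case
    unfolding q add_pCons fps_eval_pCons pCons.IH fps_const_add[symmetric] by (simp only: algebra_simps)
qed simp

lemma fps_eval_smult: "fps_eval f (smult c p) = fps_const c * fps_eval f p"
  by (induction p) (simp_all add: fps_eval_pCons algebra_simps flip: fps_const_mult)

lemma fps_eval_mult: "fps_eval f (p * q) = fps_eval f p * fps_eval f q"
  by (induction p) (simp_all add: fps_eval_pCons fps_eval_add fps_eval_smult algebra_simps)

lemma fps_eval_1 [simp]: "fps_eval f 1 = 1"
  by (simp add: one_pCons fps_eval_pCons)

lemma fps_eval_power: "fps_eval f (p ^ n) = fps_eval f p ^ n"
  by (induction n) (simp_all add: fps_eval_mult)

lemma fps_eval_uminus: "fps_eval f (- p) = - fps_eval f p"
  using fps_eval_smult[of f "- 1" p] by (simp flip: fps_const_neg)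

lemma fps_eval_nth_0: "fps_nth (fps_eval f p) 0 = poly p (fps_nth f 0)"
  by (induction p) (simp_all add: fps_eval_pCons)

lemma fps_eval_linear: "fps_eval f [:- c, 1:] = f - fps_const c"
  by (simp add: fps_eval_pCons fps_const_neg[symmetric] del: fps_const_neg)

lemma fps_eval_decomp:
  fixes p :: "'a::field poly"
  assumes "p \<noteq> 0"
  obtains u where "fps_nth u 0 \<noteq> 0" "fps_eval f p = (f - fps_const (fps_nth f 0)) ^ Polynomial.order (fps_nth f 0) p * u"
proof -
  obtain q where q: "p = [:- fps_nth f 0, 1:] ^ Polynomial.order (fps_nth f 0) p * q" "\<not> [:- fps_nth f 0, 1:] dvd q"
    using order_decomp[OF assms] by blast
  have "fps_eval f p = (f - fps_const (fps_nth f 0)) ^ Polynomial.order (fps_nth f 0) p * fps_eval f q"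
    by (subst q(1)) (simp only: fps_eval_mult fps_eval_power fps_eval_linear)
  moreover have "fps_nth (fps_eval f q) 0 \<noteq> 0"
    using q(2) by (simp add: fps_eval_nth_0 poly_eq_0_iff_dvd)
  ultimately show ?thesis using that by blast
qed

text \<open>Root multiplicity times ramification index: once the powers of the linear factor are
  split off, the cofactor has a nonzero constant term along \<open>f\<close>.\<close>

lemma fps_eval_nonzero:
  fixes p :: "'a::field poly"
  assumes "p \<noteq> 0" "f \<noteq> fps_const (fps_nth f 0)"
  shows "fps_eval f p \<noteq> 0"
    and "subdegree (fps_eval f p) = Polynomial.order (fps_nth f 0) p * subdegree (f - fps_const (fps_nth f 0))"
proof -
  obtain u where u: "fps_nth u 0 \<noteq> 0" "fps_eval f p = (f - fps_const (fps_nth f 0)) ^ Polynomial.order (fps_nth f 0) p * u"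
    by (rule fps_eval_decomp[OF assms(1), of f])
  have "u \<noteq> 0" "(f - fps_const (fps_nth f 0)) ^ Polynomial.order (fps_nth f 0) p \<noteq> 0" using u(1) assms(2) by auto
  then show "fps_eval f p \<noteq> 0"
    "subdegree (fps_eval f p) = Polynomial.order (fps_nth f 0) p * subdegree (f - fps_const (fps_nth f 0))"
    using u by simp_all
qed

section \<open>The coordinate ring of the curve\<close>

definition cubic :: "complex poly" where "cubic = [:0, 1, - 1, 1:]"

lemma poly_cubic: "poly cubic x = x^3 - x^2 + x"
  by (simp add: cubic_def power2_eq_square power3_eq_cube algebra_simps)

lemma fps_eval_cubic: "fps_eval f cubic = f^3 - f^2 + f"
  by (simp add: cubic_def fps_eval_pCons power2_eq_square power3_eq_cube algebra_simps flip: fps_const_neg)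

lemma cubic_nz: "cubic \<noteq> 0" and degree_cubic: "Polynomial.degree cubic = 3"
  by (simp_all add: cubic_def)

lemma poly_pderiv_cubic: "poly (pderiv cubic) x = 3 * x^2 - 2 * x + 1"
  by (simp add: cubic_def pderiv_pCons algebra_simps power2_eq_square)

text \<open>The two equations generate the constant \<open>3\<close>; the discriminant of the cubic
  is \<open>-3\<close>.\<close>

lemma cubic_squarefree: "poly cubic x = 0 \<Longrightarrow> poly (pderiv cubic) x \<noteq> 0"
proof
  assume "poly cubic x = 0" "poly (pderiv cubic) x = 0"
  then have "x^3 - x^2 + x = 0" "3 * x^2 - 2 * x + 1 = 0" by (simp_all add: poly_cubic poly_pderiv_cubic)
  then have "(3::complex) = 0" by Groebner_Basis.algebra
  then show False by simp
qed

lemma order_cubic: "poly cubic x = 0 \<Longrightarrow> Polynomial.order x cubic = 1"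
proof -
  assume "poly cubic x = 0"
  then have "Polynomial.order x cubic = Suc (Polynomial.order x (pderiv cubic))"
    using order_pderiv[of cubic x] cubic_nz by (simp add: order_root)
  then show ?thesis using cubic_squarefree[OF \<open>poly cubic x = 0\<close>] by (simp add: order_0I)
qed

text \<open>As a simplification rule this only permutes the arguments of a difference.\<close>

declare subdegree_minus_commute [simp del]

section \<open>Local parametrizations of the curve\<close>

text \<open>A branch of the curve through the point over \<open>x\<close> whose second coordinate is
  the principal square root; the opposite point uses \<open>- g\<close>. The order \<open>2\<close>
  at roots of the cubic is the ramification of the projection to the \<open>x\<close>-line.\<close>

definition parametrizes :: "complex fps \<times> complex fps \<Rightarrow> complex \<Rightarrow> bool" where
  "parametrizes = (\<lambda>(f, g) x. fps_nth f 0 = x \<and> fps_nth g 0 = csqrt (poly cubic x) \<and> g^2 = f^3 - f^2 + f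
     \<and> subdegree (f - fps_const x) = (if poly cubic x = 0 then 2 else 1))"

text \<open>Away from the roots \<open>x + X\<close> is a parameter and the second coordinate is a
  formal square root of a unit. At a root the cubic in \<open>x + X\<close> has a simple zero, hence
  a compositional inverse \<open>k\<close>; substituting \<open>x + k(X^2)\<close> turns the cubic
  into \<open>X^2\<close>, with square root \<open>X\<close>.\<close>

lemma ex_parametrization: "\<exists>p. parametrizes p x"
proof (cases "poly cubic x = 0")
  case False
  define f where "f = fps_const x + fps_X"
  define C where "C = f^3 - f^2 + f"
  have f0: "fps_nth f 0 = x" by (simp add: f_def)
  have C0: "fps_nth C 0 = poly cubic x"
    unfolding C_def fps_eval_cubic[symmetric] fps_eval_nth_0 f0 ..
  define g where "g = fps_radical (\<lambda>k z. csqrt (poly cubic x)) (Suc 1) C"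
  have "g ^ Suc 1 = C"
    unfolding g_def by (subst power_radical[symmetric]) (use C0 False in \<open>simp_all add: power2_eq_square[symmetric]\<close>)
  moreover have "fps_nth g 0 = csqrt (poly cubic x)" by (simp add: g_def)
  moreover have "subdegree (f - fps_const x) = 1" by (simp add: f_def)
  ultimately have "parametrizes (f, g) x"
    using f0 False by (simp add: parametrizes_def C_def numeral_2_eq_2)
  then show ?thesis ..
next
  case True
  define a where "a = fps_eval (fps_const x + fps_X) cubic"
  have a: "a = (fps_const x + fps_X)^3 - (fps_const x + fps_X)^2 + (fps_const x + fps_X)"
    by (simp add: a_def fps_eval_cubic)
  have a0: "fps_nth a 0 = 0" using True by (simp add: a_def fps_eval_nth_0)
  have "subdegree a = 1"
    unfolding a_def using fps_eval_nonzero(2)[OF cubic_nz, of "fps_const x + fps_X"] order_cubic[OF True]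
    by (simp add: fps_eq_iff)
  then have a1: "fps_nth a 1 \<noteq> 0"
    by (metis nth_subdegree_zero_iff subdegree_0 zero_neq_one)
  define k where "k = fps_inv a"
  define j where "j = fps_inv k"
  have k0: "fps_nth k 0 = 0" by (simp add: k_def fps_inv_def)
  have ak: "fps_compose a k = fps_X" using fps_inv_right[OF a0 a1] by (simp add: k_def)
  have sq0: "fps_nth (fps_X^2 :: complex fps) 0 = 0" by simp
  define f where "f = fps_const x + fps_compose k (fps_X^2)"
  have kk0: "fps_nth (fps_compose k (fps_X^2)) 0 = 0" using k0 by simp
  have "f^3 - f^2 + f = fps_compose a (fps_compose k (fps_X^2))"
    unfolding a f_def using kk0
    by (simp add: fps_compose_add_distrib fps_compose_sub_distrib flip: fps_compose_power[OF kk0])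
  also have "\<dots> = fps_compose (fps_compose a k) (fps_X^2)" using k0 by (simp add: fps_compose_assoc)
  also have "\<dots> = fps_X^2" unfolding ak by simp
  finally have C: "f^3 - f^2 + f = fps_X^2" .
  have f0: "fps_nth f 0 = x" using k0 by (simp add: f_def)
  have nc: "f \<noteq> fps_const (fps_nth f 0)"
  proof
    assume "f = fps_const (fps_nth f 0)"
    then have "fps_eval f cubic = fps_const (poly cubic x)"
      unfolding fps_eval_cubic poly_cubic f0 by (metis fps_const_add fps_const_power fps_const_sub)
    then show False using C True by (simp add: fps_eval_cubic)
  qed
  have "subdegree (fps_eval f cubic) = 2" unfolding fps_eval_cubic C by simp
  then have "subdegree (f - fps_const x) = 2"
    using fps_eval_nonzero(2)[OF cubic_nz nc] order_cubic[OF True] by (simp add: f0)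
  then have "parametrizes (f, fps_X) x"
    using f0 C True by (simp add: parametrizes_def)
  then show ?thesis ..
qed

definition par_x :: "complex \<Rightarrow> complex fps" where "par_x x = fst (SOME p. parametrizes p x)"
definition par_y :: "complex \<Rightarrow> complex fps" where "par_y x = snd (SOME p. parametrizes p x)"

lemma par:
  shows par_x_0: "fps_nth (par_x x) 0 = x" and par_y_0: "fps_nth (par_y x) 0 = csqrt (poly cubic x)"
    and par_eq: "par_y x ^ 2 = fps_eval (par_x x) cubic"
    and par_subdegree: "subdegree (par_x x - fps_const x) = (if poly cubic x = 0 then 2 else 1)"
  using someI_ex[OF ex_parametrization[of x]]
  by (simp_all add: parametrizes_def par_x_def par_y_def case_prod_beta fps_eval_cubic)

lemma par_nonconst: "par_x x \<noteq> fps_const (fps_nth (par_x x) 0)"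
proof
  assume "par_x x = fps_const (fps_nth (par_x x) 0)"
  then have "subdegree (par_x x - fps_const x) = 0" by (simp add: par_x_0)
  then show False by (simp add: par_subdegree split: if_splits)
qed

section \<open>Functions on the affine curve, their norms and orders\<close>

text \<open>The pair \<open>(a, b)\<close> stands for the regular function
  \<open>a(x) + b(x) y\<close> on the affine curve.\<close>

type_synonym cring = "complex poly \<times> complex poly"

definition cmul :: "cring \<Rightarrow> cring \<Rightarrow> cring" where
  "cmul f g = (fst f * fst g + snd f * snd g * cubic, fst f * snd g + snd f * fst g)"
definition cnorm :: "cring \<Rightarrow> complex poly" where "cnorm f = fst f ^ 2 - snd f ^ 2 * cubic"
definition cconj :: "cring \<Rightarrow> cring" where "cconj f = (fst f, - snd f)"
definition ceval :: "cring \<Rightarrow> complex \<Rightarrow> complex \<Rightarrow> complex" where "ceval f x y = poly (fst f) x + poly (snd f) x * y"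

lemma cnorm_mult: "cnorm (cmul f g) = cnorm f * cnorm g"
  unfolding cnorm_def cmul_def fst_conv snd_conv by Groebner_Basis.algebra

lemma cmul_conj: "cmul f (cconj f) = (cnorm f, 0)"
  unfolding cnorm_def cmul_def cconj_def fst_conv snd_conv by (simp add: power2_eq_square)

lemma cnorm_conj: "cnorm (cconj f) = cnorm f"
  by (simp add: cnorm_def cconj_def)

lemma cconj_zero_iff: "cconj f = (0, 0) \<longleftrightarrow> f = (0, 0)"
  by (cases f) (simp add: cconj_def)

text \<open>The terms \<open>a^2\<close> and \<open>b^2 * cubic\<close> have degrees of different
  parity and cannot cancel. So the degree of a norm is even or at least \<open>3\<close>, in
  particular never \<open>1\<close>.\<close>

lemma degree_cnorm:
  assumes "f \<noteq> (0, 0)"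
  shows "cnorm f \<noteq> 0"
    and "snd f \<noteq> 0 \<Longrightarrow> Polynomial.degree (cnorm f) \<ge> 3"
    and "snd f = 0 \<Longrightarrow> Polynomial.degree (cnorm f) = 2 * Polynomial.degree (fst f)"
proof -
  obtain a b where f: "f = (a, b)" by (cases f)
  have deg_b: "Polynomial.degree (b^2 * cubic) = 2 * Polynomial.degree b + 3" if "b \<noteq> 0"
    using that cubic_nz by (simp add: degree_mult_eq degree_power_eq degree_cubic)
  have deg_a: "Polynomial.degree (a^2) = 2 * Polynomial.degree a" by (cases "a = 0") (simp_all add: degree_power_eq)
  have b: "cnorm f \<noteq> 0 \<and> Polynomial.degree (cnorm f) \<ge> 3" if "b \<noteq> 0"
  proof -
    have ne: "Polynomial.degree (a^2) \<noteq> Polynomial.degree (b^2 * cubic)" unfolding deg_a deg_b[OF that] by presburger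
    then have "Polynomial.degree (a^2 - b^2 * cubic) \<ge> Polynomial.degree (b^2 * cubic)"
      using degree_add_eq_left[of "- (b^2 * cubic)" "a^2"] degree_add_eq_right[of "a^2" "- (b^2 * cubic)"]
      by (cases "Polynomial.degree (a^2) < Polynomial.degree (b^2 * cubic)") simp_all
    then have "Polynomial.degree (cnorm f) \<ge> 3" unfolding cnorm_def f by (simp add: deg_b[OF that])
    then show ?thesis by auto
  qed
  then show "snd f \<noteq> 0 \<Longrightarrow> Polynomial.degree (cnorm f) \<ge> 3" by (simp add: f)
  show "cnorm f \<noteq> 0" using b assms by (cases "b = 0") (auto simp: f cnorm_def)
  show "snd f = 0 \<Longrightarrow> Polynomial.degree (cnorm f) = 2 * Polynomial.degree (fst f)"
    using deg_a by (simp add: f cnorm_def)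
qed

lemma cmul_nonzero: "f \<noteq> (0, 0) \<Longrightarrow> g \<noteq> (0, 0) \<Longrightarrow> cmul f g \<noteq> (0, 0)"
proof
  assume "f \<noteq> (0, 0)" "g \<noteq> (0, 0)" "cmul f g = (0, 0)"
  then have "cnorm f * cnorm g = 0" using cnorm_mult[of f g] by (simp add: cnorm_def)
  then show False using degree_cnorm(1)[OF \<open>f \<noteq> _\<close>] degree_cnorm(1)[OF \<open>g \<noteq> _\<close>] by simp
qed

text \<open>The sign \<open>s\<close> selects the branch of the local parametrization through \<open>(x, y)\<close>.\<close>

definition local_exp :: "complex \<Rightarrow> complex \<Rightarrow> cring \<Rightarrow> complex fps" where
  "local_exp x y f = (let s = (if y = csqrt (poly cubic x) then 1 else - 1) in
     fps_eval (par_x x) (fst f) + fps_eval (par_x x) (snd f) * (fps_const s * par_y x))"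

lemma local_exp_mult: "local_exp x y (cmul f g) = local_exp x y f * local_exp x y g"
proof -
  define s where "s = (if y = csqrt (poly cubic x) then 1 else - 1 :: complex)"
  define Y where "Y = fps_const s * par_y x"
  have "Y^2 = par_y x ^ 2" by (simp add: Y_def s_def power_mult_distrib fps_const_power)
  then have Y: "fps_eval (par_x x) cubic = Y^2" by (simp add: par_eq)
  show ?thesis
    unfolding local_exp_def Let_def s_def[symmetric] Y_def[symmetric] cmul_def fst_conv snd_conv fps_eval_add fps_eval_mult Y
    by Groebner_Basis.algebra
qed

lemma local_exp_nth_0:
  assumes "y^2 = poly cubic x"
  shows "fps_nth (local_exp x y f) 0 = ceval f x y"
proof -
  have "y^2 = csqrt (poly cubic x) ^ 2" using assms by simp
  then have "y = csqrt (poly cubic x) \<or> y = - csqrt (poly cubic x)" by (simp only: power2_eq_iff)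
  then show ?thesis
    unfolding local_exp_def Let_def ceval_def
    by (auto simp: fps_eval_nth_0 par_x_0 par_y_0)
qed

lemma local_exp_poly: "local_exp x y (a, 0) = fps_eval (par_x x) a"
  by (simp add: local_exp_def Let_def)

text \<open>A vanishing expansion would make the norm, a nonzero polynomial in \<open>x\<close>,
  vanish along the nonconstant series \<open>par_x x\<close>.\<close>

lemma local_exp_nonzero: "f \<noteq> (0, 0) \<Longrightarrow> local_exp x y f \<noteq> 0"
proof
  assume f: "f \<noteq> (0, 0)" "local_exp x y f = 0"
  have "local_exp x y (cnorm f, 0) = 0" unfolding cmul_conj[symmetric] local_exp_mult f(2) by simp
  then show False using fps_eval_nonzero(1)[OF degree_cnorm(1)[OF f(1)] par_nonconst] by (simp add: local_exp_poly)
qed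

definition ordp :: "complex \<Rightarrow> complex \<Rightarrow> cring \<Rightarrow> nat" where "ordp x y f = subdegree (local_exp x y f)"

lemma ordp_mult: "f \<noteq> (0, 0) \<Longrightarrow> g \<noteq> (0, 0) \<Longrightarrow> ordp x y (cmul f g) = ordp x y f + ordp x y g"
  unfolding ordp_def local_exp_mult using local_exp_nonzero by simp

lemma ordp_eq_0_iff: "y^2 = poly cubic x \<Longrightarrow> f \<noteq> (0, 0) \<Longrightarrow> ordp x y f = 0 \<longleftrightarrow> ceval f x y \<noteq> 0"
  unfolding ordp_def subdegree_eq_0_iff using local_exp_nonzero[of f x y] local_exp_nth_0[of y x f] by auto

lemma ordp_poly: "a \<noteq> 0 \<Longrightarrow> ordp x y (a, 0) = Polynomial.order x a * (if poly cubic x = 0 then 2 else 1)"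
  unfolding ordp_def local_exp_poly using fps_eval_nonzero(2)[OF _ par_nonconst] by (simp add: par_x_0 par_subdegree)

text \<open>At a point of order 2 the two summands of \<open>a + b y\<close> have orders of different parity.\<close>

lemma ordp_two_torsion:
  assumes x: "poly cubic x = 0" and f: "(a, b) \<noteq> (0, 0)"
  shows "ordp x 0 (a, b) = (if a = 0 then 2 * Polynomial.order x b + 1 else if b = 0 then 2 * Polynomial.order x a
           else min (2 * Polynomial.order x a) (2 * Polynomial.order x b + 1))"
proof -
  have e: "local_exp x 0 (a, b) = fps_eval (par_x x) a + fps_eval (par_x x) b * par_y x"
    using x by (simp add: local_exp_def Let_def)
  have sa: "a \<noteq> 0 \<Longrightarrow> subdegree (fps_eval (par_x x) a) = 2 * Polynomial.order x a"
    and na: "a \<noteq> 0 \<Longrightarrow> fps_eval (par_x x) a \<noteq> 0" and nb: "b \<noteq> 0 \<Longrightarrow> fps_eval (par_x x) b \<noteq> 0"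
    and sb: "b \<noteq> 0 \<Longrightarrow> subdegree (fps_eval (par_x x) b) = 2 * Polynomial.order x b"
    using fps_eval_nonzero[OF _ par_nonconst[of x]] x by (simp_all add: par_x_0 par_subdegree)
  have sc: "subdegree (fps_eval (par_x x) cubic) = 2" "fps_eval (par_x x) cubic \<noteq> 0"
    using fps_eval_nonzero[OF cubic_nz par_nonconst[of x]] x order_cubic[OF x] by (simp_all add: par_x_0 par_subdegree)
  have ny: "par_y x \<noteq> 0" using sc par_eq[of x] by auto
  then have "2 * subdegree (par_y x) = subdegree (par_y x ^ 2)" by (simp add: power2_eq_square)
  then have sy: "subdegree (par_y x) = 1" using sc par_eq[of x] by simp
  have sby: "b \<noteq> 0 \<Longrightarrow> subdegree (fps_eval (par_x x) b * par_y x) = 2 * Polynomial.order x b + 1"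
    using sb nb ny sy by simp
  show ?thesis
  proof (cases "a = 0 \<or> b = 0")
    case True
    then show ?thesis using f sa sby by (auto simp: ordp_def e)
  next
    case False
    then have ne: "2 * Polynomial.order x a \<noteq> 2 * Polynomial.order x b + 1" by presburger
    have n: "fps_eval (par_x x) a \<noteq> 0" "fps_eval (par_x x) b * par_y x \<noteq> 0" using na nb ny False by auto
    have "subdegree (fps_eval (par_x x) a + fps_eval (par_x x) b * par_y x) = min (2 * Polynomial.order x a) (2 * Polynomial.order x b + 1)"
      using subdegree_add_eq1[OF n(1), of "fps_eval (par_x x) b * par_y x"]
        subdegree_add_eq2[OF n(2), of "fps_eval (par_x x) a"] sa sby False ne
      by (cases "2 * Polynomial.order x a < 2 * Polynomial.order x b + 1") auto
    then show ?thesis using False by (simp add: ordp_def e)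
  qed
qed

text \<open>Conjugation exchanges the two branches over \<open>x\<close>. At \<open>y = 0\<close>
  there is only one branch, and \<open>ordp_two_torsion\<close> depends on \<open>b\<close> only
  through its root order.\<close>

lemma ordp_conj:
  assumes y: "y^2 = poly cubic x" and f: "f \<noteq> (0, 0)"
  shows "ordp x (- y) (cconj f) = ordp x y f"
proof (cases "y = 0")
  case True
  then have x: "poly cubic x = 0" using y by simp
  obtain a b where ab: "f = (a, b)" by (cases f)
  show ?thesis using ordp_two_torsion[OF x, of a b] ordp_two_torsion[OF x, of a "- b"] f
    unfolding True by (simp add: ab cconj_def)
next
  case False
  have "y^2 = csqrt (poly cubic x) ^ 2" using y by simp
  then have "y = csqrt (poly cubic x) \<or> y = - csqrt (poly cubic x)" by (simp only: power2_eq_iff)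
  moreover have "csqrt (poly cubic x) \<noteq> - csqrt (poly cubic x)" using False y by auto
  ultimately have "local_exp x (- y) (cconj f) = local_exp x y f"
    by (auto simp: local_exp_def Let_def cconj_def fps_eval_uminus simp flip: fps_const_neg)
  then show ?thesis by (simp add: ordp_def)
qed

section \<open>Lines, their divisors and chord-tangent addition\<close>

abbreviation onE :: "complex point \<Rightarrow> bool" where "onE \<equiv> on_curve X1_2_12"
abbreviation addE :: "complex point \<Rightarrow> complex point \<Rightarrow> complex point" where "addE \<equiv> ec_add X1_2_12"
abbreviation negE :: "complex point \<Rightarrow> complex point" where "negE \<equiv> ec_neg X1_2_12"

lemma negE_Affine: "negE (Affine x y) = Affine x (- y)"
  by (simp add: X1_2_12_def)

lemma onE_cubic: "onE (Affine x y) \<longleftrightarrow> y^2 = poly cubic x"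
  by (simp add: on_curve_X1_2_12 poly_cubic)

lemma onE_neg: "onE P \<Longrightarrow> onE (negE P)"
  by (cases P) (simp_all add: negE_Affine onE_cubic)

lemma negE_negE: "negE (negE P) = P"
  by (cases P) (simp_all add: negE_Affine)

lemma addE_Infinity: "addE Infinity P = P" "addE P Infinity = P"
  by (simp_all add: ec_add_Infinity)

lemma addE_neg: "addE P (negE P) = Infinity"
  by (cases P) (simp_all add: X1_2_12_def)

text \<open>Exposes the line \<open>y = l x + m\<close> itself. Its intersections with the curve are
  the roots of \<open>x^3 - (l^2 + 1) x^2 + (1 - 2 l m) x - m^2\<close>, and the equations for
  \<open>x1\<close>, \<open>x2\<close>, \<open>x3\<close> are Vieta's relations.\<close>

lemma addE_line:
  assumes P: "onE (Affine x1 y1)" and Q: "onE (Affine x2 y2)" and ne: "\<not> (x1 = x2 \<and> y2 = - y1)"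
  obtains l m x3 where "addE (Affine x1 y1) (Affine x2 y2) = Affine x3 (- (l * x3 + m))"
    "y1 = l * x1 + m" "y2 = l * x2 + m" "x3 = l^2 + 1 - x1 - x2"
    "x1 * x2 + x1 * x3 + x2 * x3 = 1 - 2 * l * m" "x1 * x2 * x3 = m^2"
    "x1 \<noteq> x2 \<Longrightarrow> l * (x2 - x1) = y2 - y1" "x1 = x2 \<Longrightarrow> y1 \<noteq> 0 \<and> l * (2 * y1) = 3 * x1^2 - 2 * x1 + 1"
proof -
  have P': "y1^2 = x1^3 - x1^2 + x1" and Q': "y2^2 = x2^3 - x2^2 + x2"
    using P Q by (simp_all add: on_curve_X1_2_12)
  have ne': "x1 \<noteq> x2 \<or> y2 \<noteq> - y1 - 0 * x1 - 0" using ne by auto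
  obtain l where l: "if x1 = x2 then 2 * y1 + 0 * x1 + 0 \<noteq> 0 \<and> l * (2 * y1 + 0 * x1 + 0) = 3 * x1^2 + 2 * (- 1) * x1 + 1 - 0 * y1
       else l * (x2 - x1) = y2 - y1"
    by (rule slope_exists[OF ne' P[unfolded X1_2_12_def] Q[unfolded X1_2_12_def]])
  define m where "m = y1 - l * x1"
  define x3 where "x3 = l^2 + 1 - x1 - x2"
  have y1: "y1 = l * x1 + m" by (simp add: m_def)
  have y12: "x1 = x2 \<Longrightarrow> y1 = y2"
  proof -
    assume "x1 = x2"
    have "(y2 - y1) * (y2 + y1) = 0" using P' Q' unfolding \<open>x1 = x2\<close> by Groebner_Basis.algebra
    then show "y1 = y2" using ne \<open>x1 = x2\<close> by (auto simp: eq_neg_iff_add_eq_0)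
  qed
  have y2: "y2 = l * x2 + m" using l y12 by (cases "x1 = x2") (auto simp: m_def algebra_simps)
  have add: "addE (Affine x1 y1) (Affine x2 y2) = Affine x3 (- (l * x3 + m))"
    unfolding X1_2_12_def
    by (rule ec_add_slope[OF ne' l]) (simp_all add: x3_def m_def algebra_simps)
  \<comment> \<open>By the choice of \<open>x3\<close>, the intersection cubic minus the product of
    the three linear factors is \<alpha> \<open>x\<close> + \<beta>. It vanishes at
    \<open>x1\<close> and \<open>x2\<close>; in the tangent case the slope equation supplies the
    second condition.\<close>
  define \<alpha> where "\<alpha> = 1 - 2 * l * m - (x1 * x2 + x1 * x3 + x2 * x3)"
  define \<beta> where "\<beta> = x1 * x2 * x3 - m^2"
  have 1: "\<alpha> * x1 + \<beta> = 0" using P' y1 unfolding \<alpha>_def \<beta>_def x3_def by Groebner_Basis.algebra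
  have 2: "\<alpha> * x2 + \<beta> = 0" using Q' y2 unfolding \<alpha>_def \<beta>_def x3_def by Groebner_Basis.algebra
  have "\<alpha> = 0"
  proof (cases "x1 = x2")
    case True
    then have "l * (2 * y1) = 3 * x1^2 - 2 * x1 + 1" using l by simp
    then show ?thesis using y1 unfolding \<alpha>_def x3_def True[symmetric] by Groebner_Basis.algebra
  next
    case False
    have "\<alpha> * (x1 - x2) = 0" using 1 2 by Groebner_Basis.algebra
    then show ?thesis using False by simp
  qed
  then have "\<beta> = 0" using 1 by simp
  show ?thesis
    by (rule that[OF add y1 y2 x3_def])
      (use \<open>\<alpha> = 0\<close> \<open>\<beta> = 0\<close> l in \<open>auto simp: \<alpha>_def \<beta>_def algebra_simps\<close>)
qed

text \<open>At infinity: a norm of degree \<open>n\<close> in \<open>x\<close> has a pole of order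
  \<open>2 n\<close> there, and conjugation fixes this point, so each of the two factors has a pole
  of order \<open>n\<close>.\<close>

definition ord_at :: "complex point \<Rightarrow> cring \<Rightarrow> int" where
  "ord_at P f = (case P of Infinity \<Rightarrow> - int (Polynomial.degree (cnorm f)) | Affine x y \<Rightarrow> int (ordp x y f))"

lemma ord_at_Affine: "ord_at (Affine x y) f = int (ordp x y f)"
  and ord_at_Infinity: "ord_at Infinity f = - int (Polynomial.degree (cnorm f))"
  by (simp_all add: ord_at_def)

lemma ord_at_mult: "f \<noteq> (0, 0) \<Longrightarrow> g \<noteq> (0, 0) \<Longrightarrow> ord_at P (cmul f g) = ord_at P f + ord_at P g"
  by (cases P) (simp_all add: ord_at_def ordp_mult cnorm_mult degree_mult_eq degree_cnorm)

lemma ord_at_conj: "onE P \<Longrightarrow> f \<noteq> (0, 0) \<Longrightarrow> ord_at (negE P) (cconj f) = ord_at P f"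
  by (cases P) (simp_all add: ord_at_def negE_Affine ordp_conj onE_cubic cnorm_conj)

lemma order_linear: "Polynomial.order x [:- a, 1:] = of_bool (x = a)" for x :: complex
  using order_power_n_n[of a 1] by (auto intro: order_0I)

text \<open>The divisor \<open>(P) + (-P) - 2 (O)\<close> of a vertical line. At a point of order
  \<open>2\<close> the first two terms coincide and account for the ramification.\<close>

lemma ord_at_vertical:
  assumes P: "onE (Affine x y)" and T: "onE T"
  shows "ord_at T ([:- x, 1:], 0) = of_bool (T = Affine x y) + of_bool (T = negE (Affine x y)) - 2 * of_bool (T = Infinity)"
proof (cases T)
  case Infinity
  then show ?thesis by (simp add: ord_at_def cnorm_def negE_Affine degree_power_eq)
next
  case (Affine x' y')
  have "ord_at T ([:- x, 1:], 0) = of_bool (x' = x) * (if poly cubic x' = 0 then 2 else 1)"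
    by (simp add: Affine ord_at_Affine ordp_poly order_linear)
  moreover have "y'^2 = y^2" if "x' = x" using P T that unfolding Affine by (simp add: onE_cubic)
  then have "y' = y \<or> y' = - y" if "x' = x" using that by (simp add: power2_eq_iff)
  moreover have "poly cubic x' = 0 \<longleftrightarrow> y' = 0" using T unfolding Affine onE_cubic by (metis power_eq_0_iff zero_less_numeral power2_eq_iff_nonneg zero_power2)
  ultimately show ?thesis unfolding Affine by (auto simp: negE_Affine)
qed

text \<open>The orders are read off the norm, which is minus the product of the three linear
  factors. At a point on the line with \<open>y \<noteq> 0\<close> the conjugate function does not
  vanish, so the norm carries exactly the order sought; at \<open>y = 0\<close> both factors have
  equal order and the ramification doubles that of the norm.\<close>

lemma ord_at_line:
  fixes l m x1 x2 x3 :: complex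
  defines "A \<equiv> \<lambda>x. Affine x (l * x + m)"
  assumes s: "x3 = l^2 + 1 - x1 - x2" "x1 * x2 + x1 * x3 + x2 * x3 = 1 - 2 * l * m" "x1 * x2 * x3 = m^2"
    and T: "onE T"
  shows "ord_at T ([:- m, - l:], 1) = of_bool (T = A x1) + of_bool (T = A x2) + of_bool (T = A x3) - 3 * of_bool (T = Infinity)"
    and "onE (A x3)"
proof -
  define f :: cring where "f = ([:- m, - l:], 1)"
  have f0: "f \<noteq> (0, 0)" by (simp add: f_def)
  have "poly (cnorm f) z = poly (- ([:- x1, 1:] * [:- x2, 1:] * [:- x3, 1:])) z" for z
  proof -
    have "poly (cnorm f) z = (m + l * z)^2 - (z^3 - z^2 + z)"
      by (simp add: cnorm_def f_def poly_cubic power2_eq_square algebra_simps)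
    also have "\<dots> = - ((z - x1) * (z - x2) * (z - x3))" using s by Groebner_Basis.algebra
    finally show ?thesis by (simp add: algebra_simps)
  qed
  then have norm: "cnorm f = - ([:- x1, 1:] * [:- x2, 1:] * [:- x3, 1:])" by (intro poly_ext) blast
  have "poly (cnorm f) x3 = 0" by (simp only: norm poly_minus poly_mult) simp
  moreover have "poly (cnorm f) x3 = (l * x3 + m)^2 - poly cubic x3"
    by (simp add: cnorm_def f_def power2_eq_square algebra_simps)
  ultimately show "onE (A x3)" by (simp add: A_def onE_cubic)
  have ord_norm: "Polynomial.order z (cnorm f) = of_bool (z = x1) + of_bool (z = x2) + of_bool (z = x3)" for z
  proof -
    have nz: "[:- x1, 1:] * [:- x2, 1:] \<noteq> 0" "[:- x1, 1:] * [:- x2, 1:] * [:- x3, 1:] \<noteq> 0"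
      by (simp_all only: mult_eq_0_iff) simp_all
    show ?thesis unfolding norm order_uminus by (simp only: order_mult[OF nz(1)] order_mult[OF nz(2)] order_linear)
  qed
  show "ord_at T ([:- m, - l:], 1) = of_bool (T = A x1) + of_bool (T = A x2) + of_bool (T = A x3) - 3 * of_bool (T = Infinity)"
    unfolding f_def[symmetric]
  proof (cases T)
    case Infinity
    have "Polynomial.degree (cnorm f) = 3"
      unfolding norm degree_minus by (simp add: degree_mult_eq)
    then show "ord_at T f = of_bool (T = A x1) + of_bool (T = A x2) + of_bool (T = A x3) - 3 * of_bool (T = Infinity)"
      unfolding Infinity by (simp add: ord_at_Infinity A_def)
  next
    case (Affine x y)
    have y: "y^2 = poly cubic x" using T by (simp add: Affine onE_cubic)
    have ev: "ceval f x y = y - (l * x + m)" by (simp add: ceval_def f_def algebra_simps)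
    show "ord_at T f = of_bool (T = A x1) + of_bool (T = A x2) + of_bool (T = A x3) - 3 * of_bool (T = Infinity)"
    proof (cases "y = l * x + m")
      case False
      then have "ordp x y f = 0" using ordp_eq_0_iff[OF y f0] ev by simp
      then show ?thesis using False unfolding Affine by (auto simp: A_def ord_at_Affine)
    next
      case True
      have A: "Affine x y = A z \<longleftrightarrow> x = z" for z using True by (auto simp: A_def)
      have n: "(cnorm f, 0) = cmul f (cconj f)" by (simp add: cmul_conj)
      have sum: "Polynomial.order x (cnorm f) * (if poly cubic x = 0 then 2 else 1) = ordp x y f + ordp x y (cconj f)"
        using ordp_poly[OF degree_cnorm(1)[OF f0], of x y] ordp_mult[OF f0, of "cconj f" x y] f0 unfolding n
        by (simp add: cconj_zero_iff)
      have "Polynomial.order x (cnorm f) = ordp x y f"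
      proof (cases "y = 0")
        case True
        then have "ordp x y (cconj f) = ordp x y f" using ordp_conj[OF y f0] by simp
        then show ?thesis using sum y True by simp
      next
        case False
        have "ceval (cconj f) x y = - 2 * y" using True by (simp add: ceval_def f_def cconj_def algebra_simps)
        then have "ordp x y (cconj f) = 0" using ordp_eq_0_iff[OF y, of "cconj f"] f0 False by (simp add: cconj_zero_iff)
        moreover have "poly cubic x \<noteq> 0" using y False by (metis power_not_zero)
        ultimately show ?thesis using sum by simp
      qed
      then have "ord_at T f = int (of_bool (x = x1) + of_bool (x = x2) + of_bool (x = x3))"
        unfolding Affine ord_at_Affine ord_norm by simp
      then show ?thesis unfolding Affine A by simp
    qed
  qed
qed

text \<open>Linear equivalence \<open>(P) + (Q) \<sim> (S) + (O)\<close>, witnessed by the function \<open>f / g\<close>.\<close>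

definition lin_equiv :: "complex point \<Rightarrow> complex point \<Rightarrow> complex point \<Rightarrow> bool" where
  "lin_equiv P Q S \<longleftrightarrow> (\<exists>f g. f \<noteq> (0, 0) \<and> g \<noteq> (0, 0) \<and> (\<forall>T. onE T \<longrightarrow>
     ord_at T f + of_bool (T = S) + of_bool (T = Infinity) = ord_at T g + of_bool (T = P) + of_bool (T = Q)))"

text \<open>The witness is the line through \<open>P\<close> and \<open>Q\<close> divided by the
  vertical line through their sum; the third intersection point \<open>- (P + Q)\<close>
  cancels.\<close>

lemma addE_lin_equiv:
  assumes P: "onE P" and Q: "onE Q"
  shows "onE (addE P Q) \<and> lin_equiv P Q (addE P Q)"
proof (cases "P = Infinity \<or> Q = Infinity")
  case True
  have "lin_equiv P Q (addE P Q)"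
    unfolding lin_equiv_def by (rule exI[of _ "(1, 0)"], rule exI[of _ "(1, 0)"]) (use True in \<open>auto simp: addE_Infinity\<close>)
  then show ?thesis using True P Q by (auto simp: addE_Infinity)
next
  case False
  then obtain x1 y1 x2 y2 where PQ: "P = Affine x1 y1" "Q = Affine x2 y2" by (metis point.exhaust)
  have one: "ord_at T (1, 0) = 0" for T
    by (cases T) (simp_all add: ord_at_def ordp_poly cnorm_def)
  show ?thesis
  proof (cases "x1 = x2 \<and> y2 = - y1")
    case True
    then have Q': "Q = negE P" by (simp add: PQ negE_Affine)
    have "lin_equiv P Q Infinity"
      unfolding lin_equiv_def
      by (rule exI[of _ "([:- x1, 1:], 0)"], rule exI[of _ "(1, 0)"])
        (use ord_at_vertical[OF P[unfolded PQ]] one in \<open>auto simp: Q' PQ\<close>)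
    then show ?thesis by (simp add: Q' addE_neg)
  next
    case False
    obtain l m x3 where l: "addE (Affine x1 y1) (Affine x2 y2) = Affine x3 (- (l * x3 + m))"
    "y1 = l * x1 + m" "y2 = l * x2 + m" "x3 = l^2 + 1 - x1 - x2"
    "x1 * x2 + x1 * x3 + x2 * x3 = 1 - 2 * l * m" "x1 * x2 * x3 = m^2"
      by (rule addE_line[OF P[unfolded PQ] Q[unfolded PQ] False]) blast
    note line = ord_at_line[OF l(4,5,6)]
    define S where "S = addE P Q"
    have S: "S = negE (Affine x3 (l * x3 + m))" "negE S = Affine x3 (l * x3 + m)" "S = Affine x3 (- (l * x3 + m))"
      by (simp_all add: S_def PQ l(1) negE_Affine)
    have onS: "onE S" unfolding S(1) by (rule onE_neg) (rule line(2)[of Infinity], simp)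
    have "lin_equiv P Q S"
      unfolding lin_equiv_def
    proof (intro exI conjI allI impI)
      fix T assume T: "onE T"
      have "ord_at T ([:- x3, 1:], 0) = of_bool (T = S) + of_bool (T = negE S) - 2 * of_bool (T = Infinity)"
        using ord_at_vertical[OF onS[unfolded S(3)] T] unfolding S(3) .
      moreover have "ord_at T ([:- m, - l:], 1) = of_bool (T = P) + of_bool (T = Q) + of_bool (T = negE S) - 3 * of_bool (T = Infinity)"
        using line(1)[OF T] unfolding S(2) PQ l(2,3) .
      ultimately show "ord_at T ([:- m, - l:], 1) + of_bool (T = S) + of_bool (T = Infinity) =
          ord_at T ([:- x3, 1:], 0) + of_bool (T = P) + of_bool (T = Q)" by simp
    qed simp_all
    then show ?thesis using onS unfolding S_def by blast
  qed
qed

section \<open>A point is determined by its divisor class\<close>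

text \<open>Divisibility by a polynomial in \<open>x\<close> is a local condition, because the
  coordinate ring of a smooth curve is integrally closed. Here it is proved by removing one root of
  \<open>n\<close> at a time from both components of \<open>C\<close>.\<close>

lemma poly_dvd_cring:
  assumes "n \<noteq> 0" "C \<noteq> (0, 0)" and "\<And>x y. onE (Affine x y) \<Longrightarrow> ordp x y (n, 0) \<le> ordp x y C"
  obtains h where "C = cmul (n, 0) h" "h \<noteq> (0, 0)"
proof -
  have "\<exists>h. C = cmul (n, 0) h \<and> h \<noteq> (0, 0)"
    using assms
  proof (induction "Polynomial.degree n" arbitrary: n C)
    case 0
    then obtain c where c: "n = [:c:]" "c \<noteq> 0" by (metis degree_0_id pCons_eq_0_iff)
    have "C = cmul (n, 0) (smult (inverse c) (fst C), smult (inverse c) (snd C))"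
      using c by (simp add: cmul_def)
    moreover have "(smult (inverse c) (fst C), smult (inverse c) (snd C)) \<noteq> (0, 0)"
      using c 0 by (cases C) auto
    ultimately show ?case by blast
  next
    case (Suc d)
    have "\<not> constant (poly n)" using Suc.hyps(2) by (simp add: constant_degree)
    then obtain e where e: "poly n e = 0" using fundamental_theorem_of_algebra by blast
    then obtain n' where n': "n = [:- e, 1:] * n'" using poly_eq_0_iff_dvd by blast
    have n'0: "n' \<noteq> 0" using Suc.prems(1) n' by auto
    obtain a b where C: "C = (a, b)" by (cases C)
    define y where "y = csqrt (poly cubic e)"
    have on: "onE (Affine e y)" "onE (Affine e (- y))" by (simp_all add: y_def onE_cubic)
    have mul: "(n, 0) = cmul ([:- e, 1:], 0) (n', 0)" by (simp add: cmul_def n')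
    have nz: "([:- e, 1:], 0) \<noteq> (0, 0 :: complex poly)" "(n', 0) \<noteq> (0, 0 :: complex poly)" using n'0 by simp_all
    have ordn: "ordp x z (n, 0) = ordp x z ([:- e, 1:], 0) + ordp x z (n', 0)" for x z
      unfolding mul by (rule ordp_mult[OF nz])
    have lin: "ordp e z ([:- e, 1:], 0) = (if poly cubic e = 0 then 2 else 1)" for z
      by (simp add: ordp_poly order_linear)
    have ge: "ordp e z C \<ge> (if poly cubic e = 0 then 2 else 1)" if "onE (Affine e z)" for z
      using Suc.prems(3)[OF that] ordn[of e z] lin[of z] by simp
    have ev: "ceval C e z = 0" if "onE (Affine e z)" for z
      using ge[OF that] ordp_eq_0_iff[of z e C] that Suc.prems(2) by (auto simp: onE_cubic split: if_splits)
    have ab: "poly a e + poly b e * y = 0" "poly a e - poly b e * y = 0"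
      using ev[OF on(1)] ev[OF on(2)] by (simp_all add: C ceval_def)
    then have a: "poly a e = 0" and by0: "poly b e * y = 0" by Groebner_Basis.algebra+
    \<comment> \<open>Over a ramified root the value gives nothing about \<open>b\<close>. There the
      order is at least \<open>2\<close>, and the component \<open>b\<close> would contribute order
      \<open>1\<close> if it did not vanish at \<open>e\<close>.\<close>
    have b: "poly b e = 0"
    proof (cases "y = 0")
      case True
      then have c: "poly cubic e = 0" by (simp add: y_def)
      have "2 \<le> ordp e 0 (a, b)" using ge[of 0] c C by (simp add: onE_cubic)
      then have "b = 0 \<or> Polynomial.order e b \<noteq> 0"
        using ordp_two_torsion[OF c, of a b] Suc.prems(2) C by (auto split: if_splits)
      then show ?thesis using order_root by blast
    qed (use by0 in simp)
    obtain a' b' where ab': "a = [:- e, 1:] * a'" "b = [:- e, 1:] * b'"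
      using a b poly_eq_0_iff_dvd by (metis dvdE)
    have C': "C = cmul ([:- e, 1:], 0) (a', b')" by (simp add: C ab' cmul_def)
    have C'0: "(a', b') \<noteq> (0, 0)" using Suc.prems(2) C ab' by auto
    have "Polynomial.degree n = Suc (Polynomial.degree n')" unfolding n' using degree_mult_eq[of "[:- e, 1:]" n'] n'0 by (simp del: mult_pCons_left)
    then have d: "d = Polynomial.degree n'" using Suc.hyps(2) by simp
    have "ordp x z (n', 0) \<le> ordp x z (a', b')" if "onE (Affine x z)" for x z
      using Suc.prems(3)[OF that] unfolding ordn C' ordp_mult[OF nz(1) C'0] by simp
    then obtain h where h: "(a', b') = cmul (n', 0) h" "h \<noteq> (0, 0)"
      using Suc.hyps(1)[OF d n'0 C'0] by blast
    have "C = cmul (n, 0) h" unfolding C' h(1) n' by (simp add: cmul_def algebra_simps)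
    then show ?case using h(2) by blast
  qed
  then show ?thesis using that by blast
qed

lemma no_single_pole:
  assumes h: "h \<noteq> (0, 0)" and o: "ord_at Infinity h = - 1"
  shows False
proof -
  have "Polynomial.degree (cnorm h) = 1" using o by (simp add: ord_at_Infinity)
  then show False using degree_cnorm(2,3)[OF h] by (cases "snd h = 0") auto
qed

text \<open>The quotient \<open>C / n\<close> has divisor \<open>(V) - (T)\<close>. For affine
  \<open>T\<close>, multiplication by \<open>x - xT\<close> moves the pole to infinity and gives a
  regular function \<open>h\<close> with divisor \<open>(V) + (-T) - 2 (O)\<close>. A pole of order
  \<open>2\<close> forces \<open>h\<close> to be linear in \<open>x\<close>, so \<open>V\<close> is
  \<open>T\<close> or \<open>-T\<close>.\<close>

lemma div_unique_aux:
  assumes n: "n \<noteq> 0" and C: "C \<noteq> (0, 0)" and T: "onE T" and V: "onE V"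
    and eq: "\<And>P. onE P \<Longrightarrow> ord_at P C + of_bool (P = T) = ord_at P (n, 0) + of_bool (P = V)"
  shows "T = V"
proof (cases T)
  case Infinity
  show ?thesis
  proof (rule ccontr)
    assume "T \<noteq> V"
    have "ordp x y (n, 0) \<le> ordp x y C" if "onE (Affine x y)" for x y
      using eq[OF that] Infinity by (simp add: ord_at_Affine of_bool_def split: if_splits)
    then obtain h where h: "C = cmul (n, 0) h" "h \<noteq> (0, 0)" using poly_dvd_cring[OF n C] by blast
    have "ord_at Infinity C = ord_at Infinity (n, 0) + ord_at Infinity h"
      unfolding h(1) using n h(2) by (intro ord_at_mult) simp_all
    then have "ord_at Infinity h = - 1" using eq[of Infinity] \<open>T \<noteq> V\<close> Infinity by simp
    then show False using no_single_pole h(2) by blast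
  qed
next
  case (Affine xT yT)
  define C1 where "C1 = cmul C ([:- xT, 1:], 0)"
  have v0: "([:- xT, 1:], 0) \<noteq> (0, 0 :: complex poly)" by simp
  have C10: "C1 \<noteq> (0, 0)" unfolding C1_def by (rule cmul_nonzero[OF C v0])
  have eq1: "ord_at P C1 = ord_at P (n, 0) + of_bool (P = V) + of_bool (P = negE T) - 2 * of_bool (P = Infinity)" if "onE P" for P
    unfolding C1_def ord_at_mult[OF C v0] ord_at_vertical[OF T[unfolded Affine] that]
    using eq[OF that] unfolding Affine by simp
  have "ordp x y (n, 0) \<le> ordp x y C1" if "onE (Affine x y)" for x y
    using eq1[OF that] by (simp add: ord_at_Affine of_bool_def split: if_splits)
  then obtain h where h: "C1 = cmul (n, 0) h" "h \<noteq> (0, 0)" using poly_dvd_cring[OF n C10] by blast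
  have ordh: "ord_at P h = of_bool (P = V) + of_bool (P = negE T) - 2 * of_bool (P = Infinity)" if "onE P" for P
  proof -
    have "ord_at P C1 = ord_at P (n, 0) + ord_at P h"
      unfolding h(1) using n h(2) by (intro ord_at_mult) simp_all
    then show ?thesis using eq1[OF that] by simp
  qed
  have "V \<noteq> Infinity"
  proof
    assume "V = Infinity"
    then have "ord_at Infinity h = - 1" using ordh[of Infinity] by (simp add: Affine negE_Affine)
    then show False using no_single_pole h(2) by blast
  qed
  then obtain xV yV where V': "V = Affine xV yV" by (cases V) auto
  have deg: "Polynomial.degree (cnorm h) = 2" using ordh[of Infinity] by (simp add: V' Affine negE_Affine ord_at_Infinity)
  then have "snd h = 0" using degree_cnorm(2)[OF h(2)] by auto
  then obtain a where a: "h = (a, 0)" by (cases h) auto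
  have dega: "Polynomial.degree a = 1" using degree_cnorm(3)[OF h(2)] deg a by simp
  have "ord_at V h \<ge> 1" "ord_at (negE T) h \<ge> 1" using ordh[OF V] ordh[OF onE_neg[OF T]] by (simp_all add: V' Affine negE_Affine)
  then have "ordp xV yV h \<noteq> 0" "ordp xT (- yT) h \<noteq> 0" by (simp_all add: V' Affine negE_Affine ord_at_Affine)
  moreover have "onE (Affine xT (- yT))" using onE_neg[OF T] by (simp add: Affine negE_Affine)
  ultimately have "poly a xV = 0" "poly a xT = 0"
    using ordp_eq_0_iff[OF _ h(2), of yV xV] ordp_eq_0_iff[OF _ h(2), of "- yT" xT] V T
    unfolding V' Affine by (simp_all add: onE_cubic a ceval_def)
  moreover obtain a0 a1 where "a = [:a0, a1:]" "a1 \<noteq> 0" using dega by (metis degree1_coeffs)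
  ultimately have xx: "xV = xT" by (simp add: eq_neg_iff_add_eq_0[symmetric] add_eq_0_iff)
  then have "yV^2 = yT^2" using V T unfolding V' Affine by (simp add: onE_cubic)
  then have "V = T \<or> V = negE T" using xx by (auto simp: V' Affine negE_Affine power2_eq_iff)
  \<comment> \<open>As a polynomial in \<open>x\<close>, \<open>h\<close> has equal orders at
    opposite points. If \<open>V = -T\<close> differs from \<open>T\<close>, its order is
    \<open>2\<close> at \<open>V\<close> but \<open>0\<close> at \<open>T\<close>.\<close>
  moreover have "V = T" if "V = negE T"
  proof (rule ccontr)
    assume "V \<noteq> T"
    have "negE V = T" using that by (simp add: negE_negE)
    have "cconj h = h" by (simp add: a cconj_def)
    then have "ord_at (negE V) h = ord_at V h" using ord_at_conj[OF V h(2)] by simp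
    moreover have "ord_at V h = 2" using ordh[OF V] that by (simp add: V')
    moreover have "T \<noteq> negE T" "T \<noteq> V" "T \<noteq> Infinity" using that \<open>V \<noteq> T\<close> by (auto simp: Affine)
    then have "ord_at T h = 0" using ordh[OF T] by simp
    ultimately show False using \<open>negE V = T\<close> by simp
  qed
  ultimately show ?thesis by auto
qed

text \<open>Multiplying numerator and denominator by the conjugate of \<open>B\<close> makes the
  denominator a polynomial in \<open>x\<close>.\<close>

lemma div_unique:
  assumes A: "A \<noteq> (0, 0)" and B: "B \<noteq> (0, 0)" and T: "onE T" and V: "onE V"
    and eq: "\<And>P. onE P \<Longrightarrow> ord_at P A + of_bool (P = T) = ord_at P B + of_bool (P = V)"
  shows "T = V"
proof (rule div_unique_aux[OF degree_cnorm(1)[OF B] cmul_nonzero[OF A] T V])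
  show cB: "cconj B \<noteq> (0, 0)" using B by (simp add: cconj_zero_iff)
  fix P assume P: "onE P"
  show "ord_at P (cmul A (cconj B)) + of_bool (P = T) = ord_at P (cnorm B, 0) + of_bool (P = V)"
    unfolding cmul_conj[symmetric] ord_at_mult[OF A cB] ord_at_mult[OF B cB] using eq[OF P] by simp
qed

section \<open>The group axioms\<close>

lemma addE_closed: "onE P \<Longrightarrow> onE Q \<Longrightarrow> onE (addE P Q)"
  using addE_lin_equiv by blast

lemma addE_commute:
  assumes "onE P" "onE Q"
  shows "addE P Q = addE Q P"
proof -
  obtain f g where f: "f \<noteq> (0, 0)" "g \<noteq> (0, 0)" "\<And>T. onE T \<Longrightarrow>
     ord_at T f + of_bool (T = addE P Q) + of_bool (T = Infinity) = ord_at T g + of_bool (T = P) + of_bool (T = Q)"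
    using addE_lin_equiv[OF assms] unfolding lin_equiv_def by blast
  obtain f' g' where f': "f' \<noteq> (0, 0)" "g' \<noteq> (0, 0)" "\<And>T. onE T \<Longrightarrow>
     ord_at T f' + of_bool (T = addE Q P) + of_bool (T = Infinity) = ord_at T g' + of_bool (T = Q) + of_bool (T = P)"
    using addE_lin_equiv[OF assms(2,1)] unfolding lin_equiv_def by blast
  show ?thesis
  proof (rule div_unique[OF cmul_nonzero[OF f(1) f'(2)] cmul_nonzero[OF f(2) f'(1)] addE_closed[OF assms] addE_closed[OF assms(2,1)]])
    fix T assume T: "onE T"
    show "ord_at T (cmul f g') + of_bool (T = addE P Q) = ord_at T (cmul g f') + of_bool (T = addE Q P)"
      unfolding ord_at_mult[OF f(1) f'(2)] ord_at_mult[OF f(2) f'(1)] using f(3)[OF T] f'(3)[OF T] by linarith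
  qed
qed

text \<open>Four equivalences, for \<open>P + Q\<close>, \<open>(P + Q) + R\<close>,
  \<open>Q + R\<close> and \<open>P + (Q + R)\<close>; multiplying the first two and dividing by the
  last two cancels everything except the two sums to be compared.\<close>

lemma addE_assoc:
  assumes P: "onE P" and Q: "onE Q" and R: "onE R"
  shows "addE (addE P Q) R = addE P (addE Q R)"
proof -
  define S where "S = addE P Q"
  define U where "U = addE Q R"
  have S: "onE S" and U: "onE U" using addE_closed P Q R by (simp_all add: S_def U_def)
  obtain f1 g1 where 1: "f1 \<noteq> (0, 0)" "g1 \<noteq> (0, 0)" "\<And>T. onE T \<Longrightarrow>
     ord_at T f1 + of_bool (T = S) + of_bool (T = Infinity) = ord_at T g1 + of_bool (T = P) + of_bool (T = Q)"
    using addE_lin_equiv[OF P Q] unfolding lin_equiv_def S_def by blast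
  obtain f2 g2 where 2: "f2 \<noteq> (0, 0)" "g2 \<noteq> (0, 0)" "\<And>T. onE T \<Longrightarrow>
     ord_at T f2 + of_bool (T = addE S R) + of_bool (T = Infinity) = ord_at T g2 + of_bool (T = S) + of_bool (T = R)"
    using addE_lin_equiv[OF S R] unfolding lin_equiv_def by blast
  obtain f3 g3 where 3: "f3 \<noteq> (0, 0)" "g3 \<noteq> (0, 0)" "\<And>T. onE T \<Longrightarrow>
     ord_at T f3 + of_bool (T = U) + of_bool (T = Infinity) = ord_at T g3 + of_bool (T = Q) + of_bool (T = R)"
    using addE_lin_equiv[OF Q R] unfolding lin_equiv_def U_def by blast
  obtain f4 g4 where 4: "f4 \<noteq> (0, 0)" "g4 \<noteq> (0, 0)" "\<And>T. onE T \<Longrightarrow>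
     ord_at T f4 + of_bool (T = addE P U) + of_bool (T = Infinity) = ord_at T g4 + of_bool (T = P) + of_bool (T = U)"
    using addE_lin_equiv[OF P U] unfolding lin_equiv_def by blast
  note m = cmul_nonzero
  have "addE S R = addE P U"
  proof (rule div_unique[OF m[OF m[OF 1(1) 2(1)] m[OF 3(2) 4(2)]] m[OF m[OF 1(2) 2(2)] m[OF 3(1) 4(1)]]])
    fix T assume T: "onE T"
    show "ord_at T (cmul (cmul f1 f2) (cmul g3 g4)) + of_bool (T = addE S R) =
       ord_at T (cmul (cmul g1 g2) (cmul f3 f4)) + of_bool (T = addE P U)"
      unfolding ord_at_mult[OF m[OF 1(1) 2(1)] m[OF 3(2) 4(2)]] ord_at_mult[OF m[OF 1(2) 2(2)] m[OF 3(1) 4(1)]]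
        ord_at_mult[OF 1(1) 2(1)] ord_at_mult[OF 3(2) 4(2)] ord_at_mult[OF 1(2) 2(2)] ord_at_mult[OF 3(1) 4(1)]
      using 1(3)[OF T] 2(3)[OF T] 3(3)[OF T] 4(3)[OF T] by linarith
  qed (use addE_closed P R S U in auto)
  then show ?thesis by (simp add: S_def U_def)
qed

lemma comm_group_ec_group: "comm_group (ec_group X1_2_12 UNIV)"
proof (rule comm_groupI)
  show "\<exists>Q\<in>carrier (ec_group X1_2_12 UNIV). Q \<otimes>\<^bsub>ec_group X1_2_12 UNIV\<^esub> P = \<one>\<^bsub>ec_group X1_2_12 UNIV\<^esub>"
    if "P \<in> carrier (ec_group X1_2_12 UNIV)" for P
    using that addE_neg[of "negE P"] onE_neg[of P] by (auto simp: ec_group_def coords_in_UNIV negE_negE)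
qed (auto simp: ec_group_def coords_in_UNIV addE_closed addE_assoc intro: addE_commute)

section \<open>Multi-quadratic towers\<close>

text \<open>Stated with the operations of the type, where \<open>inverse 0 = 0\<close> avoids a side
  condition; \<open>subf_rat_adjoin\<close> connects it with generated fields in the sense of
  HOL-Algebra.\<close>

definition subf :: "complex set \<Rightarrow> bool" where
  "subf k \<longleftrightarrow> \<rat> \<subseteq> k \<and> (\<forall>x\<in>k. \<forall>y\<in>k. x + y \<in> k \<and> x * y \<in> k) \<and> (\<forall>x\<in>k. - x \<in> k \<and> inverse x \<in> k)"

lemma subf_Rats: "subf \<rat>"
  by (auto simp: subf_def)

lemma subfD:
  assumes "subf k"
  shows "c \<in> \<rat> \<Longrightarrow> c \<in> k" "0 \<in> k" "1 \<in> k" "numeral w \<in> k"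
    "x \<in> k \<Longrightarrow> y \<in> k \<Longrightarrow> x + y \<in> k" "x \<in> k \<Longrightarrow> y \<in> k \<Longrightarrow> x * y \<in> k" "x \<in> k \<Longrightarrow> - x \<in> k" "x \<in> k \<Longrightarrow> inverse x \<in> k"
    "x \<in> k \<Longrightarrow> y \<in> k \<Longrightarrow> x - y \<in> k" "x \<in> k \<Longrightarrow> y \<in> k \<Longrightarrow> x / y \<in> k" "x \<in> k \<Longrightarrow> x ^ n \<in> k"
proof -
  have R: "\<rat> \<subseteq> k" and am: "\<And>x y. x \<in> k \<Longrightarrow> y \<in> k \<Longrightarrow> x + y \<in> k" "\<And>x y. x \<in> k \<Longrightarrow> y \<in> k \<Longrightarrow> x * y \<in> k"
    and mi: "\<And>x. x \<in> k \<Longrightarrow> - x \<in> k" "\<And>x. x \<in> k \<Longrightarrow> inverse x \<in> k"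
    using assms by (auto simp: subf_def)
  show "c \<in> \<rat> \<Longrightarrow> c \<in> k" using R by blast
  show "0 \<in> k" "numeral w \<in> k" using R by auto
  show 1: "1 \<in> k" using R by auto
  show "x \<in> k \<Longrightarrow> y \<in> k \<Longrightarrow> x + y \<in> k" "x \<in> k \<Longrightarrow> y \<in> k \<Longrightarrow> x * y \<in> k" "x \<in> k \<Longrightarrow> - x \<in> k" "x \<in> k \<Longrightarrow> inverse x \<in> k"
    by (fact am mi)+
  show "x \<in> k \<Longrightarrow> y \<in> k \<Longrightarrow> x - y \<in> k" using am(1)[of x "- y"] mi(1)[of y] by simp
  show "x \<in> k \<Longrightarrow> y \<in> k \<Longrightarrow> x / y \<in> k" using am(2)[of x "inverse y"] mi(2)[of y] by (simp add: divide_inverse)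
  show "x \<in> k \<Longrightarrow> x ^ n \<in> k" by (induction n) (auto intro: 1 am)
qed

definition adj :: "complex set \<Rightarrow> complex \<Rightarrow> complex set" where
  "adj k e = {a + b * e | a b. a \<in> k \<and> b \<in> k}"

lemma adj_superset: "subf k \<Longrightarrow> k \<subseteq> adj k e"
proof
  fix x assume "subf k" "x \<in> k"
  moreover have "x = x + 0 * e" by simp
  ultimately show "x \<in> adj k e" unfolding adj_def using subfD(2) by blast
qed

lemma adj_generator: "subf k \<Longrightarrow> e \<in> adj k e"
proof -
  assume "subf k"
  moreover have "e = 0 + 1 * e" by simp
  ultimately show ?thesis unfolding adj_def using subfD(2,3) by blast
qed

lemma adjI: "a \<in> k \<Longrightarrow> b \<in> k \<Longrightarrow> a + b * e \<in> adj k e"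
  unfolding adj_def by blast

lemma adjE: "z \<in> adj k e \<Longrightarrow> (\<And>a b. a \<in> k \<Longrightarrow> b \<in> k \<Longrightarrow> z = a + b * e \<Longrightarrow> thesis) \<Longrightarrow> thesis"
  unfolding adj_def by blast

lemma adj_subset: "subf K \<Longrightarrow> k \<subseteq> K \<Longrightarrow> e \<in> K \<Longrightarrow> adj k e \<subseteq> K"
  unfolding adj_def using subfD(5,6) by blast

lemma subf_adj:
  assumes k: "subf k" and e: "e^2 \<in> k"
  shows "subf (adj k e)"
proof -
  note kD = subfD[OF k]
  have "\<rat> \<subseteq> adj k e" using adj_superset[OF k, of e] kD(1) by blast
  moreover have "x + y \<in> adj k e \<and> x * y \<in> adj k e" if xy: "x \<in> adj k e" "y \<in> adj k e" for x y
  proof -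
    obtain a b where x: "a \<in> k" "b \<in> k" "x = a + b * e" using xy(1) by (rule adjE)
    obtain c d where y: "c \<in> k" "d \<in> k" "y = c + d * e" using xy(2) by (rule adjE)
    have "x + y = (a + c) + (b + d) * e" "x * y = (a * c + b * d * e^2) + (a * d + b * c) * e"
      unfolding x y by Groebner_Basis.algebra+
    moreover have "a + c \<in> k" "b + d \<in> k" "a * c + b * d * e^2 \<in> k" "a * d + b * c \<in> k"
      using x y e kD by simp_all
    ultimately show ?thesis by (metis adjI)
  qed
  moreover have "- x \<in> adj k e \<and> inverse x \<in> adj k e" if xx: "x \<in> adj k e" for x
  proof -
    obtain a b where x: "a \<in> k" "b \<in> k" "x = a + b * e" using xx by (rule adjE)
    have "- x = (- a) + (- b) * e" unfolding x by simp
    then have 1: "- x \<in> adj k e" using x kD(7) by (metis adjI)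
    have 2: "inverse x \<in> adj k e"
    proof (cases "a - b * e = 0")
      case True
      then have "x = 2 * a" unfolding x by simp
      then have "inverse x \<in> k" using x kD by simp
      then show ?thesis using adj_superset[OF k] by blast
    next
      case False
      define n where "n = a^2 - b^2 * e^2"
      have n: "n = (a - b * e) * x" unfolding n_def x by Groebner_Basis.algebra
      have "(a / n) + (- b / n) * e = (a - b * e) / n" by (simp add: diff_divide_distrib)
      then have "inverse x = (a / n) + (- b / n) * e" using False by (simp add: n divide_inverse)
      moreover have "n \<in> k" unfolding n_def using x e kD by simp
      ultimately show ?thesis using x kD by (metis adjI)
    qed
    show ?thesis using 1 2 ..
  qed
  ultimately show ?thesis unfolding subf_def by blast
qed

lemma adj_coords_unique:
  assumes k: "subf k" and e: "e \<notin> k" and abcd: "a \<in> k" "b \<in> k" "c \<in> k" "d \<in> k" and eq: "a + b * e = c + d * e"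
  shows "a = c \<and> b = d"
proof -
  have "b = d"
  proof (rule ccontr)
    assume "b \<noteq> d"
    have "(b - d) * e = c - a" using eq by (simp add: algebra_simps)
    then have "e = (c - a) / (b - d)" using \<open>b \<noteq> d\<close> by (simp add: field_simps)
    then show False using e abcd subfD[OF k] by simp
  qed
  then show ?thesis using eq by simp
qed

section \<open>Automorphisms of order two and towers\<close>

text \<open>The identity is allowed. Values are constrained on \<open>k\<close> only, so that an
  involution can be prolonged generator by generator.\<close>

definition involution_on :: "complex set \<Rightarrow> (complex \<Rightarrow> complex) \<Rightarrow> bool" where
  "involution_on k \<sigma> \<longleftrightarrow> (\<forall>x\<in>k. \<forall>y\<in>k. \<sigma> (x + y) = \<sigma> x + \<sigma> y \<and> \<sigma> (x * y) = \<sigma> x * \<sigma> y) \<and>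
     (\<forall>x\<in>k. \<sigma> x \<in> k \<and> \<sigma> (\<sigma> x) = x) \<and> (\<forall>q\<in>\<rat>. \<sigma> q = q)"

lemma involution_onD:
  assumes s: "involution_on k \<sigma>" and k: "subf k"
  shows "x \<in> k \<Longrightarrow> y \<in> k \<Longrightarrow> \<sigma> (x + y) = \<sigma> x + \<sigma> y" "x \<in> k \<Longrightarrow> y \<in> k \<Longrightarrow> \<sigma> (x * y) = \<sigma> x * \<sigma> y"
    "x \<in> k \<Longrightarrow> \<sigma> x \<in> k" "x \<in> k \<Longrightarrow> \<sigma> (\<sigma> x) = x" "c \<in> \<rat> \<Longrightarrow> \<sigma> c = c"
    "x \<in> k \<Longrightarrow> \<sigma> (- x) = - \<sigma> x" "x \<in> k \<Longrightarrow> y \<in> k \<Longrightarrow> \<sigma> (x - y) = \<sigma> x - \<sigma> y" "x \<in> k \<Longrightarrow> \<sigma> (x ^ n) = \<sigma> x ^ n"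
proof -
  note kD = subfD[OF k]
  show a: "\<And>x y. x \<in> k \<Longrightarrow> y \<in> k \<Longrightarrow> \<sigma> (x + y) = \<sigma> x + \<sigma> y" and m: "\<And>x y. x \<in> k \<Longrightarrow> y \<in> k \<Longrightarrow> \<sigma> (x * y) = \<sigma> x * \<sigma> y"
    and "x \<in> k \<Longrightarrow> \<sigma> x \<in> k" "x \<in> k \<Longrightarrow> \<sigma> (\<sigma> x) = x" and q: "\<And>c. c \<in> \<rat> \<Longrightarrow> \<sigma> c = c"
    using s by (simp_all add: involution_on_def)
  have u: "\<sigma> (- z) = - \<sigma> z" if "z \<in> k" for z using m[of "- 1" z] kD(3,7) q[of "- 1"] that by simp
  then show "x \<in> k \<Longrightarrow> \<sigma> (- x) = - \<sigma> x" .
  show "x \<in> k \<Longrightarrow> y \<in> k \<Longrightarrow> \<sigma> (x - y) = \<sigma> x - \<sigma> y" using a[of x "- y"] u[of y] kD by simp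
  show "x \<in> k \<Longrightarrow> \<sigma> (x ^ n) = \<sigma> x ^ n" by (induction n) (simp_all add: q m kD)
qed

lemma involution_on_id: "involution_on k (\<lambda>x. x)"
  by (simp add: involution_on_def)

text \<open>Coordinates over \<open>k\<close> are unique since \<open>e\<close> is not in
  \<open>k\<close>, and the rational number \<open>e^2\<close> is fixed by \<sigma>, so sending
  \<open>e\<close> to \<open>t * e\<close> respects products. The sign \<open>t = 1\<close> prolongs
  an involution, \<open>t = - 1\<close> creates one.\<close>

lemma involution_extend:
  assumes k: "subf k" and s: "involution_on k \<sigma>" and e: "e \<notin> k" "e^2 \<in> \<rat>" and t: "t = 1 \<or> t = - 1"
  obtains \<sigma>' where "involution_on (adj k e) \<sigma>'" "\<And>a b. a \<in> k \<Longrightarrow> b \<in> k \<Longrightarrow> \<sigma>' (a + b * e) = \<sigma> a + t * \<sigma> b * e"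
proof -
  note kD = subfD[OF k] and sD = involution_onD[OF s k]
  define \<sigma>' where "\<sigma>' z = (SOME w. \<exists>a\<in>k. \<exists>b\<in>k. z = a + b * e \<and> w = \<sigma> a + t * \<sigma> b * e)" for z
  have val: "\<sigma>' (a + b * e) = \<sigma> a + t * \<sigma> b * e" if ab: "a \<in> k" "b \<in> k" for a b
    unfolding \<sigma>'_def
  proof (rule some_equality)
    show "\<exists>a'\<in>k. \<exists>b'\<in>k. a + b * e = a' + b' * e \<and> \<sigma> a + t * \<sigma> b * e = \<sigma> a' + t * \<sigma> b' * e" using ab by blast
    show "w = \<sigma> a + t * \<sigma> b * e" if "\<exists>a'\<in>k. \<exists>b'\<in>k. a + b * e = a' + b' * e \<and> w = \<sigma> a' + t * \<sigma> b' * e" for w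
      using that adj_coords_unique[OF k e(1)] ab by blast
  qed
  have t2: "t * t = 1" using t by auto
  have tk: "t \<in> k" "\<sigma> t = t" using t kD sD by auto
  have e2: "e^2 \<in> k" "\<sigma> (e^2) = e^2" using e(2) kD sD by auto
  have "involution_on (adj k e) \<sigma>'"
    unfolding involution_on_def
  proof (intro conjI ballI)
    fix x y assume xy: "x \<in> adj k e" "y \<in> adj k e"
    obtain a b where x: "a \<in> k" "b \<in> k" "x = a + b * e" using xy(1) by (rule adjE)
    obtain c d where y: "c \<in> k" "d \<in> k" "y = c + d * e" using xy(2) by (rule adjE)
    have 1: "x + y = (a + c) + (b + d) * e" and 2: "x * y = (a * c + b * d * e^2) + (a * d + b * c) * e"
      unfolding x y by Groebner_Basis.algebra+
    have sx: "\<sigma>' x = \<sigma> a + t * \<sigma> b * e" and sy: "\<sigma>' y = \<sigma> c + t * \<sigma> d * e" unfolding x y by (rule val, fact, fact)+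
    have "\<sigma>' (x + y) = (\<sigma> a + \<sigma> c) + t * (\<sigma> b + \<sigma> d) * e"
      unfolding 1 using x y kD sD by (simp add: val)
    then show "\<sigma>' (x + y) = \<sigma>' x + \<sigma>' y" unfolding sx sy by (simp add: algebra_simps)
    have "\<sigma>' (x * y) = (\<sigma> a * \<sigma> c + \<sigma> b * \<sigma> d * e^2) + t * (\<sigma> a * \<sigma> d + \<sigma> b * \<sigma> c) * e"
      unfolding 2 using x y e2 kD sD by (simp add: val)
    then show "\<sigma>' (x * y) = \<sigma>' x * \<sigma>' y" unfolding sx sy using t2 by Groebner_Basis.algebra
  next
    fix x assume "x \<in> adj k e"
    then obtain a b where x: "a \<in> k" "b \<in> k" "x = a + b * e" by (rule adjE)
    have sx: "\<sigma>' x = \<sigma> a + (t * \<sigma> b) * e" unfolding x by (rule val, fact, fact)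
    show "\<sigma>' x \<in> adj k e" unfolding sx using x tk kD sD by (intro adjI) auto
    have "\<sigma>' (\<sigma>' x) = \<sigma> (\<sigma> a) + t * \<sigma> (t * \<sigma> b) * e" unfolding sx using x tk kD sD by (intro val) auto
    also have "\<dots> = a + (t * t) * b * e" using x tk kD sD by simp
    finally show "\<sigma>' (\<sigma>' x) = x" using t2 x by simp
  next
    fix q :: complex assume "q \<in> \<rat>"
    then show "\<sigma>' q = q" using val[of q 0] kD sD by simp
  qed
  then show ?thesis using that val by blast
qed

text \<open>Requiring \<open>e^2\<close> to be rational, and not merely in \<open>k\<close>, keeps
  the automorphisms of order \<open>2\<close> and all twists along the tower defined over
  \<rat>.\<close>

inductive mq_tower :: "complex set \<Rightarrow> bool" where
  mq_base: "mq_tower \<rat>"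
| mq_step: "mq_tower k \<Longrightarrow> e^2 \<in> \<rat> \<Longrightarrow> e \<notin> k \<Longrightarrow> mq_tower (adj k e)"

lemma subf_mq: "mq_tower k \<Longrightarrow> subf k"
proof (induction rule: mq_tower.induct)
  case mq_base
  then show ?case by (rule subf_Rats)
next
  case (mq_step k e)
  then show ?case using subf_adj subfD(1) by blast
qed

lemma mq_tower_extend:
  assumes "finite D" "\<forall>d\<in>D. d^2 \<in> \<rat>" "mq_tower k"
  shows "\<exists>K. mq_tower K \<and> k \<subseteq> K \<and> D \<subseteq> K \<and> (\<forall>\<sigma>. involution_on k \<sigma> \<longrightarrow> (\<exists>\<sigma>'. involution_on K \<sigma>' \<and> (\<forall>x\<in>k. \<sigma>' x = \<sigma> x)))"
  using assms
proof (induction D)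
  case empty
  then show ?case by blast
next
  case (insert d D)
  then obtain K where K: "mq_tower K" "k \<subseteq> K" "D \<subseteq> K"
    "\<forall>\<sigma>. involution_on k \<sigma> \<longrightarrow> (\<exists>\<sigma>'. involution_on K \<sigma>' \<and> (\<forall>x\<in>k. \<sigma>' x = \<sigma> x))" by auto
  show ?case
  proof (cases "d \<in> K")
    case True
    then show ?thesis using K by blast
  next
    case False
    have d: "d^2 \<in> \<rat>" using insert by simp
    have sK: "subf K" using K(1) by (rule subf_mq)
    have "\<exists>\<sigma>'. involution_on (adj K d) \<sigma>' \<and> (\<forall>x\<in>k. \<sigma>' x = \<sigma> x)" if "involution_on k \<sigma>" for \<sigma>
    proof -
      obtain \<sigma>1 where 1: "involution_on K \<sigma>1" "\<forall>x\<in>k. \<sigma>1 x = \<sigma> x" using K(4) \<open>involution_on k \<sigma>\<close> by blast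
      obtain \<sigma>2 where 2: "involution_on (adj K d) \<sigma>2" "\<And>a b. a \<in> K \<Longrightarrow> b \<in> K \<Longrightarrow> \<sigma>2 (a + b * d) = \<sigma>1 a + 1 * \<sigma>1 b * d"
        using involution_extend[OF sK 1(1) False d, of 1] by auto
      have "\<sigma>2 x = \<sigma> x" if "x \<in> k" for x
        using 2(2)[of x 0] 1(2) K(2) that subfD(2)[OF sK] involution_onD(5)[OF 1(1) sK, of 0] by auto
      then show ?thesis using 2(1) by blast
    qed
    then show ?thesis
      using mq_step[OF K(1) d False] K(2,3) adj_superset[OF sK, of d] adj_generator[OF sK, of d] by blast
  qed
qed

section \<open>Points on the quadratic twists\<close>

text \<open>The twist \<open>\<delta>^2 y^2 = x^3 - x^2 + x\<close> over \<open>k\<close>, embedded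
  into the curve by \<open>(x, y) \<mapsto> (x, \<delta> y)\<close>. All twists thereby share one
  group law.\<close>

definition twist_points :: "complex \<Rightarrow> complex set \<Rightarrow> complex point set" where
  "twist_points \<delta> k = {P. onE P \<and> (P = Infinity \<or> (\<exists>x\<in>k. \<exists>y\<in>k. P = Affine x (\<delta> * y)))}"

lemma twist_points_on: "P \<in> twist_points \<delta> k \<Longrightarrow> onE P"
  by (simp add: twist_points_def)

lemma twist_points_Infinity: "Infinity \<in> twist_points \<delta> k"
  by (simp add: twist_points_def)

lemma twist_points_neg: "subf k \<Longrightarrow> P \<in> twist_points \<delta> k \<Longrightarrow> negE P \<in> twist_points \<delta> k"
proof -
  assume k: "subf k" and P: "P \<in> twist_points \<delta> k"
  show ?thesis
  proof (cases P)
    case (Affine x z)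
    then obtain y where "x \<in> k" "y \<in> k" "z = \<delta> * y" using P by (auto simp: twist_points_def)
    then have "negE P = Affine x (\<delta> * (- y))" "- y \<in> k" by (simp_all add: Affine negE_Affine subfD[OF k])
    then show ?thesis using \<open>x \<in> k\<close> onE_neg[OF twist_points_on[OF P]] unfolding twist_points_def by blast
  qed (simp add: twist_points_Infinity)
qed

text \<open>The slope of the line is \<delta> times an element \<open>l\<close> of \<open>k\<close>,
  so the sum again has the shape of a twist point, with coordinates given by formulas over
  \<open>k\<close>.\<close>

lemma addE_twist:
  assumes k: "subf k" and d: "\<delta> \<noteq> 0" "\<delta>^2 \<in> k" and xy: "x1 \<in> k" "y1 \<in> k" "x2 \<in> k" "y2 \<in> k"
    and on: "onE (Affine x1 (\<delta> * y1))" "onE (Affine x2 (\<delta> * y2))" and ne: "\<not> (x1 = x2 \<and> y2 = - y1)"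
  obtains l where "l \<in> k" "x1 \<noteq> x2 \<longrightarrow> l * (x2 - x1) = y2 - y1"
    "x1 = x2 \<longrightarrow> y1 \<noteq> 0 \<and> l * (2 * \<delta>^2 * y1) = 3 * x1^2 - 2 * x1 + 1"
    "addE (Affine x1 (\<delta> * y1)) (Affine x2 (\<delta> * y2)) =
       Affine (\<delta>^2 * l^2 + 1 - x1 - x2) (\<delta> * - (l * (\<delta>^2 * l^2 + 1 - 2 * x1 - x2) + y1))"
proof -
  note kD = subfD[OF k]
  have ne': "\<not> (x1 = x2 \<and> \<delta> * y2 = - (\<delta> * y1))" using ne d(1) by (metis mult_cancel_left mult_minus_right)
  obtain l' m x3 where l': "addE (Affine x1 (\<delta> * y1)) (Affine x2 (\<delta> * y2)) = Affine x3 (- (l' * x3 + m))"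
    "\<delta> * y1 = l' * x1 + m" "\<delta> * y2 = l' * x2 + m" "x3 = l'^2 + 1 - x1 - x2"
    "x1 \<noteq> x2 \<Longrightarrow> l' * (x2 - x1) = \<delta> * y2 - \<delta> * y1" "x1 = x2 \<Longrightarrow> \<delta> * y1 \<noteq> 0 \<and> l' * (2 * (\<delta> * y1)) = 3 * x1^2 - 2 * x1 + 1"
    by (rule addE_line[OF on ne']) blast
  define l where "l = l' / \<delta>"
  have l: "l' = \<delta> * l" using d(1) by (simp add: l_def)
  have chord: "x1 \<noteq> x2 \<Longrightarrow> l * (x2 - x1) = y2 - y1"
    using l'(5) d(1) unfolding l by (metis mult.assoc mult_cancel_left right_diff_distrib)
  have tangent: "x1 = x2 \<Longrightarrow> y1 \<noteq> 0 \<and> l * (2 * \<delta>^2 * y1) = 3 * x1^2 - 2 * x1 + 1"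
    using l'(6) unfolding l by (simp add: power2_eq_square algebra_simps)
  have "l \<in> k"
  proof (cases "x1 = x2")
    case True
    then have "l = (3 * x1^2 - 2 * x1 + 1) / (2 * \<delta>^2 * y1)" using tangent d(1) by (simp add: eq_divide_eq)
    then show ?thesis using xy d(2) kD by simp
  next
    case False
    then have "l = (y2 - y1) / (x2 - x1)" using chord by (simp add: eq_divide_eq)
    then show ?thesis using xy kD by simp
  qed
  have "x3 = \<delta>^2 * l^2 + 1 - x1 - x2" using l'(4) unfolding l by (simp add: power_mult_distrib)
  moreover have "- (l' * x3 + m) = \<delta> * - (l * (x3 - x1) + y1)" using l'(2) unfolding l by Groebner_Basis.algebra
  ultimately have add: "addE (Affine x1 (\<delta> * y1)) (Affine x2 (\<delta> * y2)) =
       Affine (\<delta>^2 * l^2 + 1 - x1 - x2) (\<delta> * - (l * (\<delta>^2 * l^2 + 1 - x1 - x2 - x1) + y1))"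
    using l'(1) by simp
  have "\<delta>^2 * l^2 + 1 - x1 - x2 - x1 = \<delta>^2 * l^2 + 1 - 2 * x1 - x2" by simp
  then show ?thesis using that \<open>l \<in> k\<close> chord tangent add by metis
qed

lemma twist_points_add:
  assumes k: "subf k" and d: "\<delta> \<noteq> 0" "\<delta>^2 \<in> k" and P: "P \<in> twist_points \<delta> k" and Q: "Q \<in> twist_points \<delta> k"
  shows "addE P Q \<in> twist_points \<delta> k"
proof (cases "P = Infinity \<or> Q = Infinity \<or> Q = negE P")
  case True
  then show ?thesis using P Q by (auto simp: addE_Infinity addE_neg twist_points_Infinity)
next
  case False
  then obtain x1 y1 x2 y2 where PQ: "x1 \<in> k" "y1 \<in> k" "x2 \<in> k" "y2 \<in> k" "P = Affine x1 (\<delta> * y1)" "Q = Affine x2 (\<delta> * y2)"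
    using P Q unfolding twist_points_def by blast
  have ne: "\<not> (x1 = x2 \<and> y2 = - y1)" using False by (auto simp: PQ negE_Affine)
  note kD = subfD[OF k]
  obtain l where l: "l \<in> k" "addE P Q = Affine (\<delta>^2 * l^2 + 1 - x1 - x2) (\<delta> * - (l * (\<delta>^2 * l^2 + 1 - 2 * x1 - x2) + y1))"
    unfolding PQ by (rule addE_twist[OF k d PQ(1-4) twist_points_on[OF P, unfolded PQ] twist_points_on[OF Q, unfolded PQ] ne])
  have "\<delta>^2 * l^2 + 1 - x1 - x2 \<in> k" "- (l * (\<delta>^2 * l^2 + 1 - 2 * x1 - x2) + y1) \<in> k"
    using l PQ d(2) kD by simp_all
  then show ?thesis using addE_closed[OF twist_points_on[OF P] twist_points_on[OF Q]] l(2)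
    unfolding twist_points_def by blast
qed

section \<open>Conjugation on a twist\<close>

text \<open>Conjugation acts on the coordinates of the twist, after division by \<delta>, so
  \<delta> is treated as a constant whether or not it lies in the field.\<close>

definition twist_conj :: "complex \<Rightarrow> (complex \<Rightarrow> complex) \<Rightarrow> complex point \<Rightarrow> complex point" where
  "twist_conj \<delta> \<sigma> P = (case P of Infinity \<Rightarrow> Infinity | Affine x y \<Rightarrow> Affine (\<sigma> x) (\<delta> * \<sigma> (y / \<delta>)))"

lemma twist_conj_simps:
  "twist_conj \<delta> \<sigma> Infinity = Infinity"
  "\<delta> \<noteq> 0 \<Longrightarrow> twist_conj \<delta> \<sigma> (Affine x (\<delta> * y)) = Affine (\<sigma> x) (\<delta> * \<sigma> y)"
  by (simp_all add: twist_conj_def)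

locale twisted_conjugation =
  fixes k :: "complex set" and \<sigma> :: "complex \<Rightarrow> complex" and \<delta> :: complex
  assumes k: "subf k" and s: "involution_on k \<sigma>" and d0: "\<delta> \<noteq> 0" and d2: "\<delta>^2 \<in> \<rat>"
begin

abbreviation "\<tau> \<equiv> twist_conj \<delta> \<sigma>"

lemmas kD = subfD[OF k]
lemmas sD = involution_onD[OF s k]

lemma d2k: "\<delta>^2 \<in> k" "\<sigma> (\<delta>^2) = \<delta>^2"
  using d2 kD sD by auto

lemma rats: "1 \<in> \<rat>" "numeral w \<in> \<rat>" by simp_all

lemma conj_in: "P \<in> twist_points \<delta> k \<Longrightarrow> \<tau> P \<in> twist_points \<delta> k"
proof -
  assume P: "P \<in> twist_points \<delta> k"
  show ?thesis
  proof (cases P)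
    case Infinity
    then show ?thesis by (simp add: twist_conj_simps twist_points_Infinity)
  next
    case (Affine x z)
    then obtain y where xy: "x \<in> k" "y \<in> k" "P = Affine x (\<delta> * y)" using P by (auto simp: twist_points_def)
    have "\<delta>^2 * y^2 = x^3 - x^2 + x" using twist_points_on[OF P] unfolding xy on_curve_X1_2_12 by (simp add: power_mult_distrib)
    then have "\<sigma> (\<delta>^2 * y^2) = \<sigma> (x^3 - x^2 + x)" by simp
    then have "\<delta>^2 * \<sigma> y^2 = \<sigma> x^3 - \<sigma> x^2 + \<sigma> x" using xy d2k kD sD by simp
    then have "onE (\<tau> P)" by (simp add: xy(3) twist_conj_simps d0 on_curve_X1_2_12 power_mult_distrib)
    then show ?thesis using xy sD(3) unfolding twist_points_def by (auto simp: twist_conj_simps d0)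
  qed
qed

lemma conj_conj: "P \<in> twist_points \<delta> k \<Longrightarrow> \<tau> (\<tau> P) = P"
  unfolding twist_points_def using sD(4) by (auto simp: twist_conj_simps d0)

lemma conj_neg: "P \<in> twist_points \<delta> k \<Longrightarrow> \<tau> (negE P) = negE (\<tau> P)"
proof -
  assume P: "P \<in> twist_points \<delta> k"
  show ?thesis
  proof (cases P)
    case (Affine x z)
    then obtain y where xy: "x \<in> k" "y \<in> k" "P = Affine x (\<delta> * y)" using P by (auto simp: twist_points_def)
    have "negE P = Affine x (\<delta> * (- y))" by (simp add: xy negE_Affine)
    then have "\<tau> (negE P) = Affine (\<sigma> x) (\<delta> * \<sigma> (- y))" by (simp only: twist_conj_simps(2)[OF d0])
    then show ?thesis using sD(6)[OF xy(2)] by (simp add: xy(3) twist_conj_simps d0 negE_Affine)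
  qed (simp add: twist_conj_simps)
qed

text \<open>Addition is given by rational formulas over the field in terms of the slope
  \<open>l\<close>; the equation defining the slope shows that \<sigma> maps it to the slope of the
  conjugate points.\<close>

lemma conj_add:
  assumes P: "P \<in> twist_points \<delta> k" and Q: "Q \<in> twist_points \<delta> k"
  shows "\<tau> (addE P Q) = addE (\<tau> P) (\<tau> Q)"
proof (cases "P = Infinity \<or> Q = Infinity \<or> Q = negE P")
  case True
  then show ?thesis using conj_neg[OF P] by (auto simp: addE_Infinity addE_neg twist_conj_simps)
next
  case False
  then obtain x1 y1 x2 y2 where PQ: "x1 \<in> k" "y1 \<in> k" "x2 \<in> k" "y2 \<in> k" "P = Affine x1 (\<delta> * y1)" "Q = Affine x2 (\<delta> * y2)"
    using P Q unfolding twist_points_def by blast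
  have ne: "\<not> (x1 = x2 \<and> y2 = - y1)" using False by (auto simp: PQ negE_Affine)
  have inj: "\<sigma> x = \<sigma> y \<Longrightarrow> x = y" if "x \<in> k" "y \<in> k" for x y using sD(4) that by metis
  have nes: "\<not> (\<sigma> x1 = \<sigma> x2 \<and> \<sigma> y2 = - \<sigma> y1)"
    using ne inj[of x1 x2] inj[of y2 "- y1"] PQ kD(7) sD(6) by auto
  obtain l where l: "l \<in> k" "x1 \<noteq> x2 \<longrightarrow> l * (x2 - x1) = y2 - y1"
    "x1 = x2 \<longrightarrow> y1 \<noteq> 0 \<and> l * (2 * \<delta>^2 * y1) = 3 * x1^2 - 2 * x1 + 1"
    "addE P Q = Affine (\<delta>^2 * l^2 + 1 - x1 - x2) (\<delta> * - (l * (\<delta>^2 * l^2 + 1 - 2 * x1 - x2) + y1))"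
    unfolding PQ by (rule addE_twist[OF k d0 d2k(1) PQ(1-4) twist_points_on[OF P, unfolded PQ] twist_points_on[OF Q, unfolded PQ] ne])
  have t: "\<tau> P = Affine (\<sigma> x1) (\<delta> * \<sigma> y1)" "\<tau> Q = Affine (\<sigma> x2) (\<delta> * \<sigma> y2)" by (simp_all add: PQ twist_conj_simps d0)
  obtain l' where l': "l' \<in> k" "\<sigma> x1 \<noteq> \<sigma> x2 \<longrightarrow> l' * (\<sigma> x2 - \<sigma> x1) = \<sigma> y2 - \<sigma> y1"
    "\<sigma> x1 = \<sigma> x2 \<longrightarrow> \<sigma> y1 \<noteq> 0 \<and> l' * (2 * \<delta>^2 * \<sigma> y1) = 3 * \<sigma> x1^2 - 2 * \<sigma> x1 + 1"
    "addE (\<tau> P) (\<tau> Q) = Affine (\<delta>^2 * l'^2 + 1 - \<sigma> x1 - \<sigma> x2) (\<delta> * - (l' * (\<delta>^2 * l'^2 + 1 - 2 * \<sigma> x1 - \<sigma> x2) + \<sigma> y1))"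
    unfolding t
    by (rule addE_twist[OF k d0 d2k(1) sD(3)[OF PQ(1)] sD(3)[OF PQ(2)] sD(3)[OF PQ(3)] sD(3)[OF PQ(4)]
          twist_points_on[OF conj_in[OF P], unfolded t] twist_points_on[OF conj_in[OF Q], unfolded t] nes])
  have "l' = \<sigma> l"
  proof (cases "x1 = x2")
    case True
    have "\<sigma> (l * (2 * \<delta>^2 * y1)) = \<sigma> (3 * x1^2 - 2 * x1 + 1)" using l(3)[rule_format, OF True] by simp
    then have "\<sigma> l * (2 * \<delta>^2 * \<sigma> y1) = 3 * \<sigma> x1^2 - 2 * \<sigma> x1 + 1"
      using l(1) PQ d2k kD sD by simp
    moreover have "\<sigma> y1 \<noteq> 0" "l' * (2 * \<delta>^2 * \<sigma> y1) = 3 * \<sigma> x1^2 - 2 * \<sigma> x1 + 1" using l'(3) True by simp_all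
    ultimately have "\<sigma> l * (2 * \<delta>^2 * \<sigma> y1) = l' * (2 * \<delta>^2 * \<sigma> y1)" by simp
    then show ?thesis using d0 \<open>\<sigma> y1 \<noteq> 0\<close> by simp
  next
    case False
    then have ne: "\<sigma> x1 \<noteq> \<sigma> x2" using inj PQ by blast
    have "\<sigma> (l * (x2 - x1)) = \<sigma> (y2 - y1)" using l(2)[rule_format, OF False] by simp
    then have "\<sigma> l * (\<sigma> x2 - \<sigma> x1) = \<sigma> y2 - \<sigma> y1" using l(1) PQ kD sD by simp
    then have "\<sigma> l * (\<sigma> x2 - \<sigma> x1) = l' * (\<sigma> x2 - \<sigma> x1)" using l'(2)[rule_format, OF ne] by simp
    then show ?thesis using ne by simp
  qed
  then show ?thesis
    unfolding l'(4) l(4) twist_conj_simps(2)[OF d0] using l(1) PQ d2k kD sD rats by simp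
qed

end

section \<open>Torsion and the splitting of a doubled point\<close>

abbreviation G0 :: "complex point monoid" where "G0 \<equiv> ec_group X1_2_12 UNIV"

lemma G0_simps: "carrier G0 = {P. onE P}" "P \<otimes>\<^bsub>G0\<^esub> Q = addE P Q" "\<one>\<^bsub>G0\<^esub> = Infinity"
  by (auto simp: ec_group_def coords_in_UNIV)

interpretation G0: comm_group G0
  by (rule comm_group_ec_group)

lemma G0_inv: "onE P \<Longrightarrow> inv\<^bsub>G0\<^esub> P = negE P"
  using addE_neg[of P] onE_neg[of P] addE_commute[of P "negE P"] by (intro G0.inv_equality) (simp_all add: G0_simps)

definition tors :: "complex point \<Rightarrow> bool" where "tors P \<longleftrightarrow> onE P \<and> (\<exists>n::nat. n > 0 \<and> P [^]\<^bsub>G0\<^esub> n = Infinity)"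

lemma pow_closed: "onE P \<Longrightarrow> onE (P [^]\<^bsub>G0\<^esub> (n::nat))"
  using G0.nat_pow_closed[of P n] by (simp add: G0_simps)

lemma pow_add_points: "onE P \<Longrightarrow> onE Q \<Longrightarrow> (addE P Q) [^]\<^bsub>G0\<^esub> (n::nat) = addE (P [^]\<^bsub>G0\<^esub> n) (Q [^]\<^bsub>G0\<^esub> n)"
  using G0.nat_pow_distrib[of P Q n] by (simp add: G0_simps)

lemma pow_dvd: "onE P \<Longrightarrow> P [^]\<^bsub>G0\<^esub> (n::nat) = Infinity \<Longrightarrow> n dvd m \<Longrightarrow> P [^]\<^bsub>G0\<^esub> m = Infinity"
proof -
  assume P: "onE P" "P [^]\<^bsub>G0\<^esub> n = Infinity" and "n dvd m"
  then obtain j where "m = n * j" by blast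
  then have "P [^]\<^bsub>G0\<^esub> m = (P [^]\<^bsub>G0\<^esub> n) [^]\<^bsub>G0\<^esub> j" using P(1) by (simp add: G0.nat_pow_pow G0_simps)
  then show ?thesis using P(2) G0.nat_pow_one[of j] by (simp add: G0_simps)
qed

lemma tors_add: "tors P \<Longrightarrow> tors Q \<Longrightarrow> tors (addE P Q)"
proof -
  assume PQ: "tors P" "tors Q"
  then obtain n m :: nat where n: "n > 0" "P [^]\<^bsub>G0\<^esub> n = Infinity" "m > 0" "Q [^]\<^bsub>G0\<^esub> m = Infinity" and on: "onE P" "onE Q"
    unfolding tors_def by blast
  have "(addE P Q) [^]\<^bsub>G0\<^esub> (n * m) = Infinity"
    unfolding pow_add_points[OF on] using pow_dvd[OF on(1) n(2), of "n * m"] pow_dvd[OF on(2) n(4), of "n * m"]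
    by (simp add: addE_Infinity)
  then show ?thesis unfolding tors_def using addE_closed[OF on] n by (metis nat_0_less_mult_iff)
qed

lemma tors_neg: "tors P \<Longrightarrow> tors (negE P)"
  unfolding tors_def using G0.nat_pow_inv[of P] onE_neg[of P] G0_inv[of P] G0.inv_one
  by (auto simp: G0_simps)

context twisted_conjugation begin

lemma pow_in: "P \<in> twist_points \<delta> k \<Longrightarrow> P [^]\<^bsub>G0\<^esub> (n::nat) \<in> twist_points \<delta> k"
  by (induction n) (simp_all add: G0_simps(2) twist_points_Infinity twist_points_add k d0 d2k)

lemma conj_pow: "P \<in> twist_points \<delta> k \<Longrightarrow> \<tau> (P [^]\<^bsub>G0\<^esub> (n::nat)) = \<tau> P [^]\<^bsub>G0\<^esub> n"
  by (induction n) (simp_all add: G0_simps(2) twist_conj_simps conj_add pow_in)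

lemma tors_conj: "P \<in> twist_points \<delta> k \<Longrightarrow> tors P \<Longrightarrow> tors (\<tau> P)"
proof -
  assume P: "P \<in> twist_points \<delta> k" and "tors P"
  then obtain n :: nat where n: "n > 0" "P [^]\<^bsub>G0\<^esub> n = Infinity" unfolding tors_def by blast
  have "\<tau> P [^]\<^bsub>G0\<^esub> n = Infinity" using conj_pow[OF P, of n] n by (simp add: twist_conj_simps)
  then show ?thesis unfolding tors_def using n(1) twist_points_on[OF conj_in[OF P]] by blast
qed

end

text \<open>\<open>2 P = (P + \<sigma> P) + (P - \<sigma> P)\<close>, and the summands are eigenvectors of the conjugation \<open>\<sigma>\<close>.\<close>

lemma twist_points_split:
  assumes hk: "subf k" and e: "e^2 \<in> \<rat>" "e \<notin> k" and d: "\<delta> \<noteq> 0" "\<delta>^2 \<in> \<rat>" and P: "P \<in> twist_points \<delta> (adj k e)"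
  obtains A B where "A \<in> twist_points \<delta> k" "B \<in> twist_points (\<delta> * e) k" "addE P P = addE A B"
    "tors P \<Longrightarrow> tors A" "tors P \<Longrightarrow> tors B"
proof -
  note hkD = subfD[OF hk]
  obtain \<sigma> where sg: "involution_on (adj k e) \<sigma>" "\<And>a b. a \<in> k \<Longrightarrow> b \<in> k \<Longrightarrow> \<sigma> (a + b * e) = a + - 1 * b * e"
    using involution_extend[OF hk involution_on_id e(2,1), of "- 1"] by auto
  have "e^2 \<in> k" using e(1) hkD(1) by blast
  then interpret twisted_conjugation "adj k e" \<sigma> \<delta>
    using subf_adj[OF hk] sg(1) d by unfold_locales auto
  have fixed: "z \<in> k" if zz: "z \<in> adj k e" "\<sigma> z = z" for z
  proof -
    obtain a b where z: "a \<in> k" "b \<in> k" "z = a + b * e" using zz(1) by (rule adjE)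
    then have "a + - 1 * b * e = a + b * e" using sg(2)[OF z(1,2)] zz(2) by simp
    then have "b = 0" using e(2) hkD(2) by auto
    then show ?thesis using z by simp
  qed
  have anti: "\<exists>b\<in>k. z = e * b" if zz: "z \<in> adj k e" "\<sigma> z = - z" for z
  proof -
    obtain a b where z: "a \<in> k" "b \<in> k" "z = a + b * e" using zz(1) by (rule adjE)
    then have "a + - 1 * b * e = - (a + b * e)" using sg(2)[OF z(1,2)] zz(2) by simp
    then have "a = 0" by simp
    then show ?thesis using z by (auto simp: mult.commute)
  qed
  define A where "A = addE P (\<tau> P)"
  define B where "B = addE P (negE (\<tau> P))"
  have tP: "\<tau> P \<in> twist_points \<delta> (adj k e)" by (rule conj_in[OF P])
  have ntP: "negE (\<tau> P) \<in> twist_points \<delta> (adj k e)" by (rule twist_points_neg[OF subf_adj[OF hk \<open>e^2 \<in> k\<close>] tP])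
  note on = twist_points_on[OF P] twist_points_on[OF tP] twist_points_on[OF ntP]
  have AL: "A \<in> twist_points \<delta> (adj k e)" "B \<in> twist_points \<delta> (adj k e)"
    unfolding A_def B_def using P tP ntP d subf_adj[OF hk \<open>e^2 \<in> k\<close>] d2k(1) by (auto intro: twist_points_add)
  have "\<tau> A = A" unfolding A_def by (simp add: conj_add P tP conj_conj addE_commute on)
  have A: "A \<in> twist_points \<delta> k"
  proof (cases A)
    case (Affine x z)
    then obtain y where xy: "x \<in> adj k e" "y \<in> adj k e" "A = Affine x (\<delta> * y)" using AL(1) by (auto simp: twist_points_def)
    then have "\<sigma> x = x" "\<sigma> y = y" using \<open>\<tau> A = A\<close> d(1) by (simp_all add: twist_conj_simps)
    then show ?thesis using fixed xy twist_points_on[OF AL(1)] unfolding twist_points_def by blast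
  qed (simp add: twist_points_Infinity)
  have "\<tau> B = addE (\<tau> P) (negE P)" unfolding B_def by (simp add: conj_add P tP ntP conj_conj conj_neg)
  also have "\<dots> = negE B"
  proof -
    have "inv\<^bsub>G0\<^esub> B = addE (inv\<^bsub>G0\<^esub> P) (inv\<^bsub>G0\<^esub> (negE (\<tau> P)))"
      unfolding B_def using G0.inv_mult[of P "negE (\<tau> P)"] on by (simp add: G0_simps)
    moreover have "onE B" using twist_points_on[OF AL(2)] .
    ultimately show ?thesis using on by (simp add: G0_inv negE_negE addE_commute onE_neg)
  qed
  finally have tB: "\<tau> B = negE B" .
  have B: "B \<in> twist_points (\<delta> * e) k"
  proof (cases B)
    case (Affine x z)
    then obtain y where xy: "x \<in> adj k e" "y \<in> adj k e" "B = Affine x (\<delta> * y)" using AL(2) by (auto simp: twist_points_def)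
    then have sxy: "\<sigma> x = x" "\<sigma> y = - y" using tB d(1) by (simp_all add: twist_conj_simps negE_Affine flip: mult_minus_right)
    \<comment> \<open>An anti-invariant second coordinate is a multiple of \<open>e\<close>, which
      joins \<delta> and moves \<open>B\<close> to the twist by
      \<open>(\<delta> * e)^2\<close>.\<close>
    obtain b where "b \<in> k" "y = e * b" using anti xy(2) sxy(2) by blast
    then have "B = Affine x ((\<delta> * e) * b)" using xy by (simp add: mult.assoc)
    then show ?thesis using fixed[OF xy(1) sxy(1)] \<open>b \<in> k\<close> twist_points_on[OF AL(2)] unfolding twist_points_def by blast
  qed (simp add: twist_points_Infinity)
  have "addE A B = addE (addE P P) (addE (\<tau> P) (negE (\<tau> P)))"
    unfolding A_def B_def using G0.m_ac[of P "\<tau> P"] on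
    by (metis addE_assoc addE_closed addE_commute)
  then have "addE P P = addE A B" by (simp add: addE_neg addE_Infinity)
  moreover have "tors A" "tors B" if "tors P"
    unfolding A_def B_def using that tors_conj[OF P] tors_add tors_neg by blast+
  ultimately show ?thesis using that A B by blast
qed

section \<open>Doubling\<close>

text \<open>The numerator \<open>(3 x^2 - 2 x + 1)^2 + 4 (1 - 2 x) y^2\<close> collapses to
  \<open>(x^2 - 1)^2\<close>: the first coordinate of a double differs from the root
  \<open>0\<close> of the cubic by a square.\<close>

lemma addE_double:
  assumes on: "onE (Affine x y)" and y: "y \<noteq> 0"
  obtains y' where "addE (Affine x y) (Affine x y) = Affine (((x^2 - 1) / (2 * y))^2) y'"
proof -
  have ne: "\<not> (x = x \<and> y = - y)" using y by auto
  obtain l m x3 where l: "addE (Affine x y) (Affine x y) = Affine x3 (- (l * x3 + m))"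
    "y = l * x + m" "x3 = l^2 + 1 - x - x" "x = x \<Longrightarrow> y \<noteq> 0 \<and> l * (2 * y) = 3 * x^2 - 2 * x + 1"
    by (rule addE_line[OF on on ne]) blast
  have c: "y^2 = x^3 - x^2 + x" using on by (simp add: on_curve_X1_2_12)
  have "x3 * (2 * y)^2 = (l * (2 * y))^2 + (1 - 2 * x) * (4 * y^2)" unfolding l(3) by Groebner_Basis.algebra
  also have "l * (2 * y) = 3 * x^2 - 2 * x + 1" using l(4) by simp
  also have "(3 * x^2 - 2 * x + 1)^2 + (1 - 2 * x) * (4 * y^2) = (x^2 - 1)^2" unfolding c by Groebner_Basis.algebra
  finally have "x3 = ((x^2 - 1) / (2 * y))^2" using y by (simp add: power_divide eq_divide_eq)
  then show ?thesis using that l(1) by blast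
qed

lemma pow_two_power_Suc:
  assumes "onE P" shows "P [^]\<^bsub>G0\<^esub> (2 ^ Suc i :: nat) = addE (P [^]\<^bsub>G0\<^esub> (2 ^ i :: nat)) (P [^]\<^bsub>G0\<^esub> (2 ^ i :: nat))"
  using G0.nat_pow_mult[of P "2 ^ i" "2 ^ i"] assms by (simp add: G0_simps mult_2)

lemma pow_two_power_Suc':
  assumes "onE P" shows "P [^]\<^bsub>G0\<^esub> (2 ^ Suc i :: nat) = (addE P P) [^]\<^bsub>G0\<^esub> (2 ^ i :: nat)"
  using G0.nat_pow_pow[of P 2 "2 ^ i"] G0.nat_pow_mult[of P 1 1] assms
  by (simp add: G0_simps numeral_2_eq_2 addE_Infinity)

lemma pow_1: "onE P \<Longrightarrow> P [^]\<^bsub>G0\<^esub> (1::nat) = P"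
  using G0.nat_pow_eone[of P] by (simp add: G0_simps)

lemma addE_y0: "addE (Affine x 0) (Affine x 0) = Infinity"
  using addE_neg[of "Affine x 0"] by (simp add: negE_Affine)

lemma tors_double:
  assumes on: "onE P" and t: "tors (addE P P)"
  shows "tors P"
proof -
  obtain n :: nat where n: "n > 0" "(addE P P) [^]\<^bsub>G0\<^esub> n = Infinity" using t unfolding tors_def by blast
  have "P [^]\<^bsub>G0\<^esub> (n + n) = (addE P P) [^]\<^bsub>G0\<^esub> n"
    using G0.nat_pow_mult[of P n n] pow_add_points[OF on on] on by (simp add: G0_simps)
  then show ?thesis using n on unfolding tors_def by (metis add_pos_pos)
qed

section \<open>Torsion points with rational \<open>x\<close>-coordinate\<close>

definition two_adic :: "nat \<Rightarrow> complex \<Rightarrow> bool" where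
  "two_adic m x \<longleftrightarrow> m \<ge> 1 \<and> (\<exists>a b :: int. odd a \<and> odd b \<and> (x = of_int (2 ^ m * a) / of_int b \<or> x = of_int a / of_int (2 ^ m * b)))"

lemma two_adic_unique:
  assumes "two_adic m x" "two_adic n x"
  shows "m = n"
proof -
  have gen: "j = k" if "odd u" "odd v" "2 ^ j * u = 2 ^ k * v" for j k :: nat and u v :: int
  proof -
    have 1: "\<not> j' < k'" if "odd u'" "2 ^ j' * u' = 2 ^ k' * v'" for j' k' :: nat and u' v' :: int
    proof
      assume "j' < k'"
      then obtain d where d: "k' = j' + Suc d" using less_imp_Suc_add by (metis add_Suc_right)
      have "u' = 2 * (2 ^ d * v')" using that(2) unfolding d power_add by simp
      then show False using that(1) by simp
    qed
    show ?thesis using 1[of u j k v] 1[of v k j u] that by simp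
  qed
  obtain a b where ab: "odd a" "odd b" "x = of_int (2 ^ m * a) / of_int b \<or> x = of_int a / of_int (2 ^ m * b)"
    using assms(1) unfolding two_adic_def by blast
  obtain c d where cd: "odd c" "odd d" "x = of_int (2 ^ n * c) / of_int d \<or> x = of_int c / of_int (2 ^ n * d)"
    using assms(2) unfolding two_adic_def by blast
  have mn: "m \<ge> 1" "n \<ge> 1" using assms unfolding two_adic_def by simp_all
  have eq: "p * s = r * q" if "x = of_int p / of_int q" "x = of_int r / of_int s" "q \<noteq> 0" "s \<noteq> 0" for p q r s :: int
  proof -
    have "(of_int (p * s) :: complex) = of_int (r * q)" using that by (simp add: field_simps)
    then show ?thesis by (simp only: of_int_eq_iff)
  qed
  have nz: "b \<noteq> 0" "d \<noteq> 0" "2 ^ m * b \<noteq> 0" "2 ^ n * d \<noteq> 0" using ab cd by auto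
  from ab(3) cd(3) show ?thesis
  proof (elim disjE)
    assume "x = of_int (2 ^ m * a) / of_int b" "x = of_int (2 ^ n * c) / of_int d"
    then have "2 ^ m * (a * d) = 2 ^ n * (c * b)" using eq[of "2 ^ m * a" b "2 ^ n * c" d] nz by (simp add: mult.assoc)
    then show ?thesis using gen[of "a * d" "c * b" m n] ab cd by simp
  next
    assume "x = of_int a / of_int (2 ^ m * b)" "x = of_int c / of_int (2 ^ n * d)"
    then have "2 ^ n * (a * d) = 2 ^ m * (c * b)" using eq[of a "2 ^ m * b" c "2 ^ n * d"] nz by (simp add: ac_simps)
    then show ?thesis using gen[of "a * d" "c * b" n m] ab cd by simp
  next
    assume "x = of_int (2 ^ m * a) / of_int b" "x = of_int c / of_int (2 ^ n * d)"
    then have "2 ^ (m + n) * (a * d) = 2 ^ 0 * (c * b)" using eq[of "2 ^ m * a" b c "2 ^ n * d"] nz by (simp add: ac_simps power_add)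
    then have "m + n = 0" by (rule gen[rotated 2]) (use ab cd in simp_all)
    then show ?thesis using mn by simp
  next
    assume "x = of_int a / of_int (2 ^ m * b)" "x = of_int (2 ^ n * c) / of_int d"
    then have "2 ^ 0 * (a * d) = 2 ^ (m + n) * (c * b)" using eq[of a "2 ^ m * b" "2 ^ n * c" d] nz by (simp add: ac_simps power_add)
    then have "0 = m + n" by (rule gen[rotated 2]) (use ab cd in simp_all)
    then show ?thesis using mn by simp
  qed
qed

lemma cubic_ratio:
  fixes p q :: int and x y :: complex
  assumes "p \<noteq> 0" "q \<noteq> 0" "p^2 - p * q + q^2 \<noteq> 0" and y: "y^2 = x^3 - x^2 + x" and x: "x = of_int p / of_int q"
  shows "y \<noteq> 0" "((x^2 - 1) / (2 * y))^2 = of_int ((p^2 - q^2)^2) / of_int (4 * (p * q * (p^2 - p * q + q^2)))"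
proof -
  define P Q where "P = (of_int p :: complex)" and "Q = (of_int q :: complex)"
  have nz: "P \<noteq> 0" "Q \<noteq> 0" using assms by (simp_all add: P_def Q_def)
  have "of_int (p^2 - p * q + q^2) \<noteq> (0 :: complex)" using assms(3) by (simp only: of_int_eq_0_iff not_False_eq_True)
  then have n: "P^2 - P * Q + Q^2 \<noteq> 0" by (simp add: P_def Q_def)
  have xPQ: "x = P / Q" by (simp add: x P_def Q_def)
  have y2: "y^2 * Q^3 = P * (P^2 - P * Q + Q^2)"
    unfolding y xPQ using nz by (simp add: field_simps power2_eq_square power3_eq_cube)
  then show y0: "y \<noteq> 0" using nz n by auto
  have "x^2 - 1 = (P^2 - Q^2) / Q^2" unfolding xPQ using nz by (simp add: field_simps power2_eq_square)
  then have "((x^2 - 1) / (2 * y))^2 = (P^2 - Q^2)^2 / (4 * Q * (y^2 * Q^3))"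
    using nz y0 by (simp add: power_divide power_mult_distrib power2_eq_square power3_eq_cube)
  also have "\<dots> = (P^2 - Q^2)^2 / (4 * (P * Q * (P^2 - P * Q + Q^2)))" unfolding y2 by (simp add: ac_simps)
  finally show "((x^2 - 1) / (2 * y))^2 = of_int ((p^2 - q^2)^2) / of_int (4 * (p * q * (p^2 - p * q + q^2)))"
    by (simp add: P_def Q_def)
qed

text \<open>Write \<open>x = p / q\<close> with one of \<open>p\<close>, \<open>q\<close> even. In
  \<open>(p^2 - q^2)^2 / (4 p q (p^2 - p q + q^2))\<close> the numerator and the quadratic form are
  odd, so the valuation is exactly \<open>- (m + 2)\<close>.\<close>

lemma two_adic_step:
  assumes t: "two_adic m x" and y: "y^2 = x^3 - x^2 + x"
  shows "y \<noteq> 0" "two_adic (m + 2) (((x^2 - 1) / (2 * y))^2)"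
proof -
  obtain a b where ab: "odd a" "odd b" "x = of_int (2 ^ m * a) / of_int b \<or> x = of_int a / of_int (2 ^ m * b)" and m: "m \<ge> 1"
    using t unfolding two_adic_def by blast
  have e: "even ((2::int) ^ m)" using m by simp
  have main: "y \<noteq> 0 \<and> two_adic (m + 2) (((x^2 - 1) / (2 * y))^2)"
    if x: "x = of_int p / of_int q" and pq: "odd (p + q)" "p * q = 2 ^ m * (a * b)" "p \<noteq> 0" "q \<noteq> 0" for p q
  proof -
    have o: "odd (p^2 - p * q + q^2)" using pq(1) by auto
    then have "p^2 - p * q + q^2 \<noteq> 0" by (metis even_zero)
    note r = cubic_ratio[OF pq(3,4) this y x]
    have "4 * (p * q * (p^2 - p * q + q^2)) = 2 ^ (m + 2) * (a * b * (p^2 - p * q + q^2))"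
      unfolding pq(2) by (simp add: power_add)
    then have "((x^2 - 1) / (2 * y))^2 = of_int ((p^2 - q^2)^2) / of_int (2 ^ (m + 2) * (a * b * (p^2 - p * q + q^2)))"
      using r(2) by (simp only:)
    moreover have "odd (a * b * (p^2 - p * q + q^2))" using ab o by simp
    moreover have "odd ((p^2 - q^2)^2)" using pq(1) by auto
    moreover have "m + 2 \<ge> 1" by simp
    ultimately show ?thesis using r(1) unfolding two_adic_def by blast
  qed
  have "y \<noteq> 0 \<and> two_adic (m + 2) (((x^2 - 1) / (2 * y))^2)"
    using ab(3)
  proof
    assume "x = of_int (2 ^ m * a) / of_int b"
    then show ?thesis using main[of "2 ^ m * a" b] ab e by (auto simp: mult.assoc)
  next
    assume "x = of_int a / of_int (2 ^ m * b)"
    then show ?thesis using main[of a "2 ^ m * b"] ab e by (auto simp: ac_simps)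
  qed
  then show "y \<noteq> 0" "two_adic (m + 2) (((x^2 - 1) / (2 * y))^2)" by blast+
qed

text \<open>The multiples by powers of \<open>2\<close> have valuations of absolute value
  \<open>m + 2 * i\<close>, hence are pairwise distinct, while a torsion point has finitely many
  multiples.\<close>

lemma two_adic_not_tors:
  assumes on: "onE (Affine x y)" and t: "two_adic m x"
  shows "\<not> tors (Affine x y)"
proof
  assume "tors (Affine x y)"
  define P where "P = Affine x y"
  have onP: "onE P" using on by (simp add: P_def)
  obtain n :: nat where n: "n > 0" "P [^]\<^bsub>G0\<^esub> n = Infinity"
    using \<open>tors (Affine x y)\<close> unfolding tors_def P_def by blast
  have ex: "\<exists>x' y'. P [^]\<^bsub>G0\<^esub> (2 ^ i :: nat) = Affine x' y' \<and> two_adic (m + 2 * i) x'" for i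
  proof (induction i)
    case 0
    then show ?case using t pow_1[OF onP] by (simp add: P_def)
  next
    case (Suc i)
    then obtain x' y' where IH: "P [^]\<^bsub>G0\<^esub> (2 ^ i :: nat) = Affine x' y'" "two_adic (m + 2 * i) x'" by blast
    have on': "onE (Affine x' y')" using pow_closed[OF onP, of "2 ^ i"] IH(1) by simp
    then have c: "y'^2 = x'^3 - x'^2 + x'" by (simp add: on_curve_X1_2_12)
    note st = two_adic_step[OF IH(2) c]
    obtain y'' where "addE (Affine x' y') (Affine x' y') = Affine (((x'^2 - 1) / (2 * y'))^2) y''"
      by (rule addE_double[OF on' st(1)])
    then show ?case using st(2) unfolding pow_two_power_Suc[OF onP] IH(1) by auto
  qed
  have inj: "inj (\<lambda>i. P [^]\<^bsub>G0\<^esub> (2 ^ i :: nat))"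
  proof (rule injI)
    fix i j assume eq: "P [^]\<^bsub>G0\<^esub> (2 ^ i :: nat) = P [^]\<^bsub>G0\<^esub> (2 ^ j :: nat)"
    obtain x' y' x'' y'' where "P [^]\<^bsub>G0\<^esub> (2 ^ i :: nat) = Affine x' y'" "two_adic (m + 2 * i) x'"
      "P [^]\<^bsub>G0\<^esub> (2 ^ j :: nat) = Affine x'' y''" "two_adic (m + 2 * j) x''" using ex by blast
    moreover from this have "x' = x''" using eq by simp
    ultimately have "m + 2 * i = m + 2 * j" using two_adic_unique by blast
    then show "i = j" by simp
  qed
  have "P [^]\<^bsub>G0\<^esub> j \<in> (\<lambda>r. P [^]\<^bsub>G0\<^esub> r) ` {..<n}" for j :: nat
  proof -
    have "P [^]\<^bsub>G0\<^esub> j = addE (P [^]\<^bsub>G0\<^esub> (n * (j div n))) (P [^]\<^bsub>G0\<^esub> (j mod n))"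
      using G0.nat_pow_mult[of P "n * (j div n)" "j mod n"] onP by (simp add: G0_simps)
    also have "P [^]\<^bsub>G0\<^esub> (n * (j div n)) = Infinity" by (rule pow_dvd[OF onP n(2)]) simp
    finally have "P [^]\<^bsub>G0\<^esub> j = P [^]\<^bsub>G0\<^esub> (j mod n)" by (simp add: addE_Infinity)
    then show ?thesis using n(1) by simp
  qed
  then have "range (\<lambda>i. P [^]\<^bsub>G0\<^esub> (2 ^ i :: nat)) \<subseteq> (\<lambda>r. P [^]\<^bsub>G0\<^esub> r) ` {..<n}" by blast
  then have "finite (range (\<lambda>i. P [^]\<^bsub>G0\<^esub> (2 ^ i :: nat)))" by (rule finite_subset) simp
  then show False using inj by (metis finite_imageD infinite_UNIV_nat)
qed

lemma odd_part: "z \<noteq> 0 \<Longrightarrow> \<exists>m z'. z = 2 ^ m * z' \<and> odd z'" for z :: int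
proof -
  assume z: "z \<noteq> 0"
  obtain y where "z = 2 ^ multiplicity 2 z * y" "odd y"
    by (rule multiplicity_decompose'[OF z, of 2]) auto
  then show ?thesis by blast
qed

text \<open>Only the first coordinate is assumed rational, which covers all twists at once. It must
  be a \<open>2\<close>-adic unit by \<open>two_adic_not_tors\<close>; then the double has positive
  valuation and is not torsion, unless \<open>x = 1\<close> or \<open>x = - 1\<close>.\<close>

lemma rational_tors:
  assumes on: "onE (Affine x y)" and x: "x \<in> \<rat>" and t: "tors (Affine x y)"
  shows "x = 0 \<or> x = 1 \<or> x = - 1"
proof (rule ccontr)
  assume ne: "\<not> ?thesis"
  obtain a b :: int where ab: "b > 0" "coprime a b" "x = of_int a / of_int b"
    using x by (rule Rats_cases')
  have a0: "a \<noteq> 0" using ne ab by auto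
  have b0: "b \<noteq> 0" using ab by simp
  have not: "\<not> two_adic m x" for m using two_adic_not_tors[OF on] t by blast
  have "odd a"
  proof
    assume "even a"
    then have ob: "odd b" using ab(2) by (metis coprime_common_divisor odd_one)
    obtain m a' where m: "a = 2 ^ m * a'" "odd a'" using odd_part[OF a0] by blast
    then have "m \<ge> 1" using \<open>even a\<close> by (cases m) auto
    then have "two_adic m x" unfolding two_adic_def using m ob ab(3) by blast
    then show False using not by blast
  qed
  have "odd b"
  proof
    assume "even b"
    obtain m b' where m: "b = 2 ^ m * b'" "odd b'" using odd_part[OF b0] by blast
    then have "m \<ge> 1" using \<open>even b\<close> by (cases m) auto
    then have "two_adic m x" unfolding two_adic_def using m \<open>odd a\<close> ab(3) by blast
    then show False using not by blast
  qed
  have o: "odd (a * b * (a^2 - a * b + b^2))" using \<open>odd a\<close> \<open>odd b\<close> by simp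
  have n: "a^2 - a * b + b^2 \<noteq> 0" using o by (metis even_zero mult_zero_right)
  have c: "y^2 = x^3 - x^2 + x" using on by (simp add: on_curve_X1_2_12)
  note r = cubic_ratio[OF a0 b0 n c ab(3)]
  \<comment> \<open>For odd \<open>a\<close>, \<open>b\<close> the numerator
    \<open>(a^2 - b^2)^2\<close> is divisible by \<open>64\<close> and the denominator contributes
    only \<open>4\<close>, which leaves a valuation of at least \<open>4\<close>.\<close>
  have "8 dvd a^2 - b^2" using odd_power2_mod_8[OF \<open>odd a\<close>] odd_power2_mod_8[OF \<open>odd b\<close>] by presburger
  then obtain d where d: "a^2 - b^2 = 8 * d" by blast
  have "d \<noteq> 0"
  proof
    assume "d = 0"
    then have "a^2 = b^2" using d by simp
    then have "a = b \<or> a = - b" by (simp add: power2_eq_iff)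
    then show False using ne ab by auto
  qed
  obtain m d' where m: "d = 2 ^ m * d'" "odd d'" using odd_part[OF \<open>d \<noteq> 0\<close>] by blast
  have "(a^2 - b^2)^2 = 4 * (2 ^ (2 * m + 4) * d'^2)"
    unfolding d m(1) by (simp add: power_mult_distrib power_add power_mult mult.commute flip: power_mult)
  then have "((x^2 - 1) / (2 * y))^2 = of_int (2 ^ (2 * m + 4) * d'^2) / of_int (a * b * (a^2 - a * b + b^2))"
    unfolding r(2) by simp
  moreover have "odd (d'^2)" using m(2) by simp
  ultimately have "two_adic (2 * m + 4) (((x^2 - 1) / (2 * y))^2)"
    unfolding two_adic_def using o by (intro conjI exI[of _ "d'^2"] exI[of _ "a * b * (a^2 - a * b + b^2)"]) auto
  moreover obtain y' where y': "addE (Affine x y) (Affine x y) = Affine (((x^2 - 1) / (2 * y))^2) y'"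
    by (rule addE_double[OF on r(1)])
  moreover have "onE (addE (Affine x y) (Affine x y))" by (rule addE_closed[OF on on])
  ultimately have "\<not> tors (addE (Affine x y) (Affine x y))" using two_adic_not_tors by simp
  then show False using tors_add[OF t t] by blast
qed

lemma pow_4_Infinity:
  assumes on: "onE (Affine x y)" and x: "x = 0 \<or> x = 1 \<or> x = - 1"
  shows "Affine x y [^]\<^bsub>G0\<^esub> (2 ^ 2 :: nat) = Infinity"
proof -
  have c: "y^2 = x^3 - x^2 + x" using on by (simp add: on_curve_X1_2_12)
  have 0: "addE Q Q = Infinity" if Q: "onE Q" "Q = Affine 0 z" for Q z
    using Q addE_y0[of 0] by (auto simp: on_curve_X1_2_12)
  have d: "addE (addE (Affine x y) (Affine x y)) (addE (Affine x y) (Affine x y)) = Infinity"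
  proof (cases "x = 0")
    case True
    then show ?thesis using 0[OF on] by (simp add: addE_Infinity)
  next
    case False
    then have "x^2 - 1 = 0" "y \<noteq> 0" using x c by (auto simp: power3_eq_cube power2_eq_square)
    then obtain y' where "addE (Affine x y) (Affine x y) = Affine 0 y'"
      using addE_double[OF on] by (metis div_0 zero_power2)
    then show ?thesis using 0 addE_closed[OF on on] by blast
  qed
  show ?thesis using d pow_two_power_Suc[OF on, of 1] pow_two_power_Suc[OF on, of 0] pow_1[OF on]
    by (simp add: numeral_2_eq_2)
qed

section \<open>Torsion and finiteness along a tower\<close>

lemma twist_rational_tors:
  assumes P: "P \<in> twist_points \<delta> \<rat>" and t: "tors P"
  shows "P [^]\<^bsub>G0\<^esub> (2 ^ 2 :: nat) = Infinity"
proof (cases P)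
  case Infinity
  then show ?thesis using G0.nat_pow_one[of "2 ^ 2"] by (simp add: G0_simps)
next
  case (Affine x y)
  then have "x \<in> \<rat>" using P by (auto simp: twist_points_def)
  moreover have "onE (Affine x y)" using twist_points_on[OF P] Affine by simp
  ultimately show ?thesis using rational_tors pow_4_Infinity t unfolding Affine by blast
qed

text \<open>Induction on the tower with \<delta> arbitrary, since a step leads from the twist by
  \<delta> to those by \<delta> and \<open>\<delta> * e\<close> over the smaller field. Each step
  costs one doubling.\<close>

lemma twist_tors_two_power:
  assumes "mq_tower k" "\<delta> \<noteq> 0" "\<delta>^2 \<in> \<rat>" "P \<in> twist_points \<delta> k" "tors P"
  shows "\<exists>m. P [^]\<^bsub>G0\<^esub> (2 ^ m :: nat) = Infinity"
  using assms
proof (induction arbitrary: \<delta> P rule: mq_tower.induct)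
  case mq_base
  then show ?case using twist_rational_tors by blast
next
  case (mq_step k e)
  have k: "subf k" using mq_step by (simp add: subf_mq)
  have e0: "e \<noteq> 0" using mq_step(3) subfD(2)[OF k] by auto
  obtain A B where AB: "A \<in> twist_points \<delta> k" "B \<in> twist_points (\<delta> * e) k" "addE P P = addE A B" "tors A" "tors B"
    using twist_points_split[OF k mq_step(2,3,5,6,7)] mq_step(8) by metis
  obtain i where i: "A [^]\<^bsub>G0\<^esub> (2 ^ i :: nat) = Infinity" using mq_step(4)[OF mq_step(5,6) AB(1,4)] by blast
  have "\<delta> * e \<noteq> 0" "(\<delta> * e)^2 \<in> \<rat>" using mq_step e0 by (simp_all add: power_mult_distrib)
  then obtain j where j: "B [^]\<^bsub>G0\<^esub> (2 ^ j :: nat) = Infinity" using mq_step(4) AB(2,5) by blast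
  have on: "onE A" "onE B" "onE P" using AB mq_step twist_points_on by blast+
  have "(addE P P) [^]\<^bsub>G0\<^esub> (2 ^ (i + j) :: nat) = Infinity"
    unfolding AB(3) pow_add_points[OF on(1,2)]
    using pow_dvd[OF on(1) i, of "2 ^ (i + j)"] pow_dvd[OF on(2) j, of "2 ^ (i + j)"]
    by (simp add: power_add addE_Infinity)
  then show ?case using pow_two_power_Suc'[OF on(3), of "i + j"] by metis
qed

lemma twist_rational_points_tors:
  assumes P: "P \<in> twist_points \<delta> \<rat>" and d: "\<delta>^2 = 1 \<or> \<delta>^2 = - 1 \<or> \<delta>^2 = 3 \<or> \<delta>^2 = - 3"
  shows "tors P"
proof (cases P)
  case Infinity
  have "Infinity [^]\<^bsub>G0\<^esub> (1::nat) = Infinity" using G0.nat_pow_one[of 1] by (simp add: G0_simps)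
  then show ?thesis unfolding Infinity tors_def by (metis on_curve.simps(1) zero_less_one)
next
  case (Affine x z)
  then obtain y where xy: "x \<in> \<rat>" "y \<in> \<rat>" "z = \<delta> * y" using P by (auto simp: twist_points_def)
  have on: "onE (Affine x z)" using twist_points_on[OF P] Affine by simp
  obtain x' y' where xy': "x = of_rat x'" "y = of_rat y'" using xy by (metis Rats_cases)
  obtain d' where d': "\<delta>^2 = of_rat d'" "d' = 1 \<or> d' = - 1 \<or> d' = 3 \<or> d' = - 3"
    using d by (metis of_rat_1 of_rat_minus of_rat_numeral_eq)
  have "\<delta>^2 * y^2 = x^3 - x^2 + x" using on unfolding xy on_curve_X1_2_12 by (simp add: power_mult_distrib)
  then have "(of_rat (d' * y'^2) :: complex) = of_rat (x'^3 - x'^2 + x')"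
    unfolding d' xy' by (simp add: of_rat_mult of_rat_power of_rat_add of_rat_diff)
  then have "d' * y'^2 = x'^3 - x'^2 + x'" by (simp only: of_rat_eq_iff)
  then have "x' = 0 \<or> x' = 1 \<or> x' = - 1" using rational_twist_points d'(2) by blast
  then have "x = 0 \<or> x = 1 \<or> x = - 1" unfolding xy' by (auto simp: of_rat_minus)
  then show ?thesis using pow_4_Infinity[OF on] on unfolding Affine tors_def
    by (intro conjI exI[of _ "2 ^ 2"]) auto
qed

text \<open>The double of \<open>P\<close> is a sum of two torsion points, and a point with torsion
  double is torsion.\<close>

lemma twist_points_tors_step:
  assumes k: "subf k" and e: "e^2 \<in> \<rat>" "e \<notin> k" and d: "\<delta> \<noteq> 0" "\<delta>^2 \<in> \<rat>"
    and A: "\<And>A. A \<in> twist_points \<delta> k \<Longrightarrow> tors A" and B: "\<And>B. B \<in> twist_points (\<delta> * e) k \<Longrightarrow> tors B"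
    and P: "P \<in> twist_points \<delta> (adj k e)"
  shows "tors P"
  using twist_points_split[OF k e d P, of "tors P"] A B tors_add tors_double[OF twist_points_on[OF P]]
  by metis

section \<open>The fields involved\<close>

definition r2 :: complex where "r2 = complex_of_real (sqrt 2)"
definition r3 :: complex where "r3 = complex_of_real (sqrt 3)"

lemma r2_sq: "r2 ^ 2 = 2" and r3_sq: "r3 ^ 2 = 3"
  unfolding r2_def r3_def of_real_power[symmetric] by simp_all

lemma r2_nz: "r2 \<noteq> 0" and r3_nz: "r3 \<noteq> 0"
  by (simp_all add: r2_def r3_def)

lemma ii_sq: "\<i> ^ 2 \<in> \<rat>" and r2_sq_Rats: "r2 ^ 2 \<in> \<rat>" and r3_sq_Rats: "r3 ^ 2 \<in> \<rat>"
  by (simp_all add: r2_sq r3_sq)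

lemma rational_square_ne:
  fixes q :: real
  assumes "q \<in> \<rat>"
  shows "q^2 \<noteq> 2" "q^2 \<noteq> 3" "q^2 \<noteq> 6"
proof -
  obtain a b :: int where ab: "b > 0" "coprime a b" "q = of_int a / of_int b" using assms by (rule Rats_cases')
  have gen: "n \<notin> {2, 3, 6}" if n: "q^2 = of_int n" for n
  proof
    assume n6: "n \<in> {2, 3, 6}"
    have "(of_int (a^2) :: real) = of_int (n * b^2)" using n ab by (simp add: power_divide field_simps)
    then have eq: "a^2 = n * b^2" by (simp only: of_int_eq_iff)
    then have "b dvd a^2" by (simp add: power2_eq_square)
    then have "is_unit b" using ab(2) by (metis coprime_commute coprime_power_right_iff coprime_absorb_left zero_less_numeral)
    then have "b = 1" using ab(1) by simp
    then have a: "\<bar>a\<bar>^2 = n" using eq by simp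
    have "\<bar>a\<bar> < 3"
    proof (rule ccontr)
      assume "\<not> \<bar>a\<bar> < 3"
      then have "3^2 \<le> \<bar>a\<bar>^2" by (intro power_mono) auto
      then show False using a n6 by auto
    qed
    then have "\<bar>a\<bar> \<in> {0, 1, 2}" by auto
    then have "\<bar>a\<bar>^2 \<in> {0, 1, 4}" by (elim insertE) (simp_all only: power2_eq_square, simp_all)
    then show False using a n6 by auto
  qed
  show "q^2 \<noteq> 2" "q^2 \<noteq> 3" "q^2 \<noteq> 6" using gen[of 2] gen[of 3] gen[of 6] by auto
qed

lemma complex_Rats: "z \<in> \<rat> \<Longrightarrow> Im z = 0 \<and> Re z \<in> \<rat>"
proof -
  assume "z \<in> \<rat>"
  then obtain a b :: int where "b > 0" "coprime a b" "z = of_int a / of_int b" by (rule Rats_cases')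
  then have "z = complex_of_real (of_int a / of_int b)" by simp
  then show ?thesis by (simp only: Im_complex_of_real Re_complex_of_real) simp
qed

lemma sqrt_not_Rats: "sqrt 2 \<notin> \<rat>" "sqrt 3 \<notin> \<rat>"
  using rational_square_ne(1)[of "sqrt 2"] rational_square_ne(2)[of "sqrt 3"] by auto

lemma adj_ii: "z \<in> adj \<rat> \<i> \<Longrightarrow> Re z \<in> \<rat> \<and> Im z \<in> \<rat>"
proof -
  assume "z \<in> adj \<rat> \<i>"
  then obtain a b where "a \<in> \<rat>" "b \<in> \<rat>" "z = a + b * \<i>" by (rule adjE)
  then show ?thesis using complex_Rats[of a] complex_Rats[of b] by simp
qed

lemma ii_not_Rats: "\<i> \<notin> \<rat>"
  using complex_Rats[of \<i>] by auto

lemma r2_not: "r2 \<notin> adj \<rat> \<i>" and r3_not: "r3 \<notin> adj \<rat> \<i>"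
  using adj_ii[of r2] adj_ii[of r3] sqrt_not_Rats by (auto simp: r2_def r3_def)

text \<open>Real parts give \<open>sqrt 3 = p + q * sqrt 2\<close> with rational \<open>p\<close>,
  \<open>q\<close>. Squaring forces \<open>p * q = 0\<close>, and then \<open>3 = p^2\<close> or
  \<open>6 = (2 q)^2\<close>.\<close>

lemma r3_not': "r3 \<notin> adj (adj \<rat> \<i>) r2"
proof
  assume "r3 \<in> adj (adj \<rat> \<i>) r2"
  then obtain a b where ab: "a \<in> adj \<rat> \<i>" "b \<in> adj \<rat> \<i>" "r3 = a + b * r2" by (rule adjE)
  define p q where "p = Re a" and "q = Re b"
  have pq: "p \<in> \<rat>" "q \<in> \<rat>" using adj_ii ab by (simp_all add: p_def q_def)
  have "sqrt 3 = p + q * sqrt 2" using arg_cong[OF ab(3), of Re] by (simp add: r2_def r3_def p_def q_def)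
  then have "(sqrt 3)^2 = (p + q * sqrt 2)^2" by simp
  then have eq: "3 = p^2 + 2 * q^2 + 2 * p * q * sqrt 2" by (simp add: power2_sum power_mult_distrib algebra_simps)
  have "p * q = 0"
  proof (rule ccontr)
    assume "p * q \<noteq> 0"
    then have "sqrt 2 = (3 - p^2 - 2 * q^2) / (2 * p * q)" using eq by (simp add: field_simps)
    moreover have "\<dots> \<in> \<rat>" using pq by simp
    ultimately show False using sqrt_not_Rats by simp
  qed
  then consider "p = 0" | "q = 0" by auto
  then show False
  proof cases
    case 1
    then have "(2 * q)^2 = 6" using eq by (simp add: power_mult_distrib)
    moreover have "2 * q \<in> \<rat>" using pq by simp
    ultimately show False using rational_square_ne(3) by blast
  next
    case 2
    then show False using eq rational_square_ne(2)[OF pq(1)] by simp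
  qed
qed

definition Qz12 :: "complex set" where "Qz12 = adj (adj \<rat> \<i>) r3"

lemma tower_ii: "mq_tower (adj \<rat> \<i>)"
  by (rule mq_step[OF mq_base ii_sq ii_not_Rats])

lemma subf_ii: "subf (adj \<rat> \<i>)"
  by (rule subf_mq[OF tower_ii])

lemma tower_Qz12: "mq_tower Qz12"
  unfolding Qz12_def by (rule mq_step[OF tower_ii r3_sq_Rats r3_not])

lemma subf_Qz12: "subf Qz12"
  by (rule subf_mq[OF tower_Qz12])

lemma Qz12_mem: "\<i> \<in> Qz12" "r3 \<in> Qz12"
  using adj_generator[OF subf_ii, of r3] adj_generator[OF subf_Rats, of \<i>] adj_superset[OF subf_ii, of r3]
  by (auto simp: Qz12_def)

lemma Qz12_subset: "subf K \<Longrightarrow> \<i> \<in> K \<Longrightarrow> r3 \<in> K \<Longrightarrow> Qz12 \<subseteq> K"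
  unfolding Qz12_def by (intro adj_subset) (auto simp: subf_def)

lemma involution_extend':
  assumes k: "subf k" and s: "involution_on k \<sigma>" and e: "e \<notin> k" "e^2 \<in> \<rat>" and t: "t = 1 \<or> t = - 1"
  shows "\<exists>\<sigma>'. involution_on (adj k e) \<sigma>' \<and> (\<forall>x\<in>k. \<sigma>' x = \<sigma> x) \<and> \<sigma>' e = t * e"
proof -
  obtain \<sigma>' where s': "involution_on (adj k e) \<sigma>'" "\<And>a b. a \<in> k \<Longrightarrow> b \<in> k \<Longrightarrow> \<sigma>' (a + b * e) = \<sigma> a + t * \<sigma> b * e"
    by (rule involution_extend[OF assms]) blast
  have "\<sigma>' x = \<sigma> x" if "x \<in> k" for x
    using s'(2)[OF that subfD(2)[OF k]] involution_onD(5)[OF s k, of 0] by simp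
  moreover have "\<sigma>' e = t * e"
    using s'(2)[OF subfD(2)[OF k] subfD(3)[OF k]] involution_onD(5)[OF s k, of 0] involution_onD(5)[OF s k, of 1] by simp
  ultimately show ?thesis using s'(1) by blast
qed

text \<open>The cyclotomic field of the \<open>24\<close>-th roots of unity, of degree
  \<open>8\<close>. It adds \<open>r2\<close> to \<open>Qz12\<close> for the sake of the halving
  argument.\<close>

definition Q8 :: "complex set" where "Q8 = adj (adj (adj \<rat> \<i>) r2) r3"

lemma tower_ii_r2: "mq_tower (adj (adj \<rat> \<i>) r2)"
  by (rule mq_step[OF tower_ii r2_sq_Rats r2_not])

lemma tower_Q8: "mq_tower Q8"
  unfolding Q8_def by (rule mq_step[OF tower_ii_r2 r3_sq_Rats r3_not'])

lemma Q8_mem: "\<i> \<in> Q8" "r2 \<in> Q8" "r3 \<in> Q8"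
  using adj_generator[OF subf_mq[OF tower_ii_r2], of r3] adj_generator[OF subf_ii, of r2] adj_generator[OF subf_Rats, of \<i>]
    adj_superset[OF subf_ii, of r2] adj_superset[OF subf_mq[OF tower_ii_r2], of r3]
  by (auto simp: Q8_def)

lemma Q8_involution:
  assumes "s = 1 \<or> s = - 1" "t = 1 \<or> t = - 1" "u = 1 \<or> u = - 1"
  shows "\<exists>\<sigma>. involution_on Q8 \<sigma> \<and> \<sigma> \<i> = s * \<i> \<and> \<sigma> r2 = t * r2 \<and> \<sigma> r3 = u * r3"
proof -
  obtain \<sigma>1 where 1: "involution_on (adj \<rat> \<i>) \<sigma>1" "\<sigma>1 \<i> = s * \<i>"
    using involution_extend'[OF subf_Rats involution_on_id ii_not_Rats ii_sq assms(1)] by blast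
  obtain \<sigma>2 where 2: "involution_on (adj (adj \<rat> \<i>) r2) \<sigma>2" "\<forall>x\<in>adj \<rat> \<i>. \<sigma>2 x = \<sigma>1 x" "\<sigma>2 r2 = t * r2"
    using involution_extend'[OF subf_ii 1(1) r2_not r2_sq_Rats assms(2)] by blast
  obtain \<sigma>3 where 3: "involution_on Q8 \<sigma>3" "\<forall>x\<in>adj (adj \<rat> \<i>) r2. \<sigma>3 x = \<sigma>2 x" "\<sigma>3 r3 = u * r3"
    using involution_extend'[OF subf_mq[OF tower_ii_r2] 2(1) r3_not' r3_sq_Rats assms(3)] unfolding Q8_def by blast
  have "\<i> \<in> adj \<rat> \<i>" "r2 \<in> adj (adj \<rat> \<i>) r2" using adj_generator subf_Rats subf_ii by blast+
  then show ?thesis using 1 2 3 adj_superset[OF subf_ii, of r2] by (intro exI[of _ \<sigma>3]) auto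
qed

section \<open>Adjunction and quadratic fields in the sense of HOL-Algebra\<close>

lemma complex_ring_simps:
  "carrier complex_ring = UNIV" "x \<otimes>\<^bsub>complex_ring\<^esub> y = x * y" "\<one>\<^bsub>complex_ring\<^esub> = 1"
  "\<zero>\<^bsub>complex_ring\<^esub> = 0" "x \<oplus>\<^bsub>complex_ring\<^esub> y = x + y"
  by (simp_all add: ring_of_type_algebra_def)

interpretation CR: cring complex_ring
  by (rule cring_from_type_algebra)

lemma complex_ring_inv: "x \<noteq> 0 \<Longrightarrow> inv\<^bsub>complex_ring\<^esub> x = inverse x"
  using CR.comm_inv_char[of x "inverse x"] by (simp add: complex_ring_simps)

lemma complex_ring_neg: "\<ominus>\<^bsub>complex_ring\<^esub> x = - x"
  using CR.minus_equality[of "- x" x] by (simp add: complex_ring_simps)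

lemma subf_rat_adjoin: "subf (rat_adjoin S)"
proof -
  let ?K = "rat_adjoin S"
  have one: "1 \<in> ?K" using generate_field.one[of complex_ring S] by (simp add: complex_ring_simps)
  have add: "x + y \<in> ?K" if "x \<in> ?K" "y \<in> ?K" for x y
    using generate_field.eng_add[OF that] by (simp add: complex_ring_simps)
  have mult: "x * y \<in> ?K" if "x \<in> ?K" "y \<in> ?K" for x y
    using generate_field.eng_mult[OF that] by (simp add: complex_ring_simps)
  have neg: "- x \<in> ?K" if "x \<in> ?K" for x
    using generate_field.a_inv[OF that] by (simp add: complex_ring_neg)
  have zero: "0 \<in> ?K" using add[OF one neg[OF one]] by simp
  have inv: "inverse x \<in> ?K" if "x \<in> ?K" for x
    using generate_field.m_inv[OF that] zero by (cases "x = 0") (simp_all add: complex_ring_inv complex_ring_simps)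
  have nat: "of_nat n \<in> ?K" for n by (induction n) (simp_all add: zero one add)
  have int: "of_int n \<in> ?K" for n using nat[of "nat n"] neg[OF nat[of "nat (- n)"]] by (cases "n \<ge> 0") auto
  have "\<rat> \<subseteq> ?K"
  proof
    fix q :: complex assume "q \<in> \<rat>"
    then obtain a b :: int where "b > 0" "coprime a b" "q = of_int a / of_int b" by (rule Rats_cases')
    then show "q \<in> ?K" using mult[OF int inv[OF int]] by (simp add: divide_inverse)
  qed
  then show ?thesis unfolding subf_def by (auto intro: add mult neg inv)
qed

lemma rat_adjoin_incl: "S \<subseteq> rat_adjoin S"
  by (auto intro: generate_field.incl)

lemma rat_adjoin_least:
  assumes K: "subf K" and S: "S \<subseteq> K"
  shows "rat_adjoin S \<subseteq> K"
proof
  fix x assume "x \<in> rat_adjoin S"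
  then show "x \<in> K"
    by (induction rule: generate_field.induct)
      (use S subfD[OF K] in \<open>auto simp: complex_ring_simps complex_ring_neg complex_ring_inv\<close>)
qed

text \<open>A basis over \<rat> is replaced by \<open>1, w\<close> for an irrational
  \<open>w\<close>, and completing the square in \<open>w^2 = a + b w\<close> gives \<delta>. An
  inclusion is claimed, so a field inside \<rat> is settled by \<delta> = 0.\<close>

lemma quadratic_field_generator:
  assumes "quadratic_field F"
  shows "\<exists>\<delta>. \<delta>^2 \<in> \<rat> \<and> F \<subseteq> adj \<rat> \<delta>"
proof (cases "F \<subseteq> \<rat>")
  case True
  then have "F \<subseteq> adj \<rat> 0" using adj_superset[OF subf_Rats] by blast
  moreover have "(0::complex)^2 \<in> \<rat>" by simp
  ultimately show ?thesis by blast
next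
  case False
  then obtain w where w: "w \<in> F" "w \<notin> \<rat>" by blast
  have F: "subfield F complex_ring" "CR.dimension 2 \<rat> F" using assms by (simp_all add: quadratic_field_def)
  have F1: "1 \<in> F" using subringE(3)[OF subfieldE(1)[OF F(1)]] by (simp add: complex_ring_simps)
  have Fm: "x * y \<in> F" if "x \<in> F" "y \<in> F" for x y
    using subringE(6)[OF subfieldE(1)[OF F(1)]] that by (simp add: complex_ring_simps)
  obtain v u where vu: "\<And>z. z \<in> F \<longleftrightarrow> (\<exists>p\<in>\<rat>. \<exists>q\<in>\<rat>. z = p * v + q * u)"
  proof -
    have "CR.dimension (Suc (Suc 0)) \<rat> F" using F(2) by (simp add: numeral_2_eq_2)
    then obtain v E where E: "F = CR.line_extension \<rat> v E" "CR.dimension (Suc 0) \<rat> E"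
      by (cases rule: CR.dimension.cases) auto
    from E(2) obtain u E' where E': "E = CR.line_extension \<rat> u E'" "CR.dimension 0 \<rat> E'"
      by (cases rule: CR.dimension.cases) auto
    from E'(2) have "E' = {0}" by (cases rule: CR.dimension.cases) (auto simp: complex_ring_simps)
    then have memE: "y \<in> E \<longleftrightarrow> (\<exists>q\<in>\<rat>. y = q * u)" for y
      unfolding E'(1) by (auto simp: CR.line_extension_mem_iff complex_ring_simps)
    have memF: "z \<in> F \<longleftrightarrow> (\<exists>p\<in>\<rat>. \<exists>y\<in>E. z = p * v + y)" for z
      unfolding E(1) by (simp add: CR.line_extension_mem_iff complex_ring_simps)
    have "z \<in> F \<longleftrightarrow> (\<exists>p\<in>\<rat>. \<exists>q\<in>\<rat>. z = p * v + q * u)" for z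
      unfolding memF Bex_def memE by auto
    then show ?thesis using that by blast
  qed
  obtain p q where pq: "p \<in> \<rat>" "q \<in> \<rat>" "1 = p * v + q * u" using F1 vu by blast
  obtain p' q' where pq': "p' \<in> \<rat>" "q' \<in> \<rat>" "w = p' * v + q' * u" using w vu by blast
  \<comment> \<open>The determinant of \<open>1, w\<close> with respect to the spanning pair
    \<open>v, u\<close>; the next two equations are Cramer's rule.\<close>
  define D where "D = p * q' - p' * q"
  have Dv: "D * v = q' - q * w" and Du: "D * u = p * w - p'"
    unfolding D_def pq'(3) using pq(3) by Groebner_Basis.algebra+
  have D: "D \<in> \<rat>" "D \<noteq> 0"
  proof -
    show "D \<in> \<rat>" unfolding D_def using pq pq' by simp
    show "D \<noteq> 0"
    proof
      assume "D = 0"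
      then have "q * w = q'" "p * w = p'" using Dv Du by simp_all
      have "p \<noteq> 0 \<or> q \<noteq> 0" using pq(3) by auto
      then have "w = q' / q \<or> w = p' / p" using \<open>q * w = q'\<close> \<open>p * w = p'\<close> by (auto simp: field_simps)
      then show False using w(2) pq pq' by auto
    qed
  qed
  have span: "\<exists>a\<in>\<rat>. \<exists>b\<in>\<rat>. z = a + b * w" if zF: "z \<in> F" for z
  proof -
    obtain s t where st: "s \<in> \<rat>" "t \<in> \<rat>" "z = s * v + t * u" using zF vu by blast
    have "D * z = (s * q' - t * p') + (t * p - s * q) * w" unfolding st(3) using Dv Du by Groebner_Basis.algebra
    then have "z = (s * q' - t * p') / D + (t * p - s * q) / D * w" using D(2) by (simp add: field_simps)
    moreover have "(s * q' - t * p') / D \<in> \<rat>" "(t * p - s * q) / D \<in> \<rat>" using st pq pq' D by simp_all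
    ultimately show ?thesis by blast
  qed
  obtain a b where ab: "a \<in> \<rat>" "b \<in> \<rat>" "w * w = a + b * w" using span[OF Fm[OF w(1) w(1)]] by blast
  define \<delta> where "\<delta> = w - b / 2"
  have "2 * \<delta> = 2 * w - b" by (simp add: \<delta>_def)
  then have "4 * \<delta>^2 = 4 * a + b^2" using ab(3) by Groebner_Basis.algebra
  then have "4 * \<delta>^2 = 4 * (a + b^2 / 4)" by (simp add: distrib_left)
  then have "\<delta>^2 = a + b^2 / 4" by (simp only: mult_cancel_left) simp
  then have "\<delta>^2 \<in> \<rat>" using ab by simp
  moreover have "F \<subseteq> adj \<rat> \<delta>"
  proof
    fix z assume "z \<in> F"
    then obtain c d where cd: "c \<in> \<rat>" "d \<in> \<rat>" "z = c + d * w" using span by blast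
    have "z = (c + d * b / 2) + d * \<delta>" unfolding cd(3) \<delta>_def by (simp add: algebra_simps)
    moreover have "c + d * b / 2 \<in> \<rat>" using cd ab by simp
    ultimately show "z \<in> adj \<rat> \<delta>" using cd(2) adjI by metis
  qed
  ultimately show ?thesis by blast
qed

text \<open>The tower starts from \<open>Q8\<close>, so that any choice of signs of
  \<open>\<i>\<close>, \<open>r2\<close>, \<open>r3\<close> prolongs to an involution of a field
  containing \<open>K\<close>.\<close>

lemma multi_quadratic_tower:
  assumes "multi_quadratic_field K"
  shows "subf K"
    and "\<exists>L. mq_tower L \<and> K \<subseteq> L \<and> Q8 \<subseteq> L \<and>
      (\<forall>\<sigma>. involution_on Q8 \<sigma> \<longrightarrow> (\<exists>\<sigma>'. involution_on L \<sigma>' \<and> (\<forall>x\<in>Q8. \<sigma>' x = \<sigma> x)))"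
proof -
  obtain \<F> where \<F>: "finite \<F>" "\<forall>F\<in>\<F>. quadratic_field F" "K = rat_adjoin (\<Union>\<F>)"
    using assms unfolding multi_quadratic_field_def by blast
  show "subf K" unfolding \<F>(3) by (rule subf_rat_adjoin)
  obtain d where d: "\<forall>F\<in>\<F>. d F ^ 2 \<in> \<rat> \<and> F \<subseteq> adj \<rat> (d F)"
    using quadratic_field_generator \<F>(2) by metis
  obtain L where L: "mq_tower L" "Q8 \<subseteq> L" "d ` \<F> \<subseteq> L"
    "\<forall>\<sigma>. involution_on Q8 \<sigma> \<longrightarrow> (\<exists>\<sigma>'. involution_on L \<sigma>' \<and> (\<forall>x\<in>Q8. \<sigma>' x = \<sigma> x))"
    using mq_tower_extend[of "d ` \<F>" Q8] d \<F>(1) tower_Q8 by auto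
  have sL: "subf L" by (rule subf_mq[OF L(1)])
  have "F \<subseteq> L" if "F \<in> \<F>" for F
  proof -
    have "adj \<rat> (d F) \<subseteq> L" using L(3) that sL by (intro adj_subset) (auto simp: subf_def)
    then show ?thesis using d that by blast
  qed
  then have "K \<subseteq> L" unfolding \<F>(3) by (intro rat_adjoin_least[OF sL]) blast
  then show "\<exists>L. mq_tower L \<and> K \<subseteq> L \<and> Q8 \<subseteq> L \<and>
      (\<forall>\<sigma>. involution_on Q8 \<sigma> \<longrightarrow> (\<exists>\<sigma>'. involution_on L \<sigma>' \<and> (\<forall>x\<in>Q8. \<sigma>' x = \<sigma> x)))"
    using L by blast
qed

lemma cyclotomic_12: "cyclotomic_field 12 = Qz12"
proof -
  define \<zeta> where "\<zeta> = cis (2 * pi / real 12)"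
  have z: "\<zeta> = (r3 + \<i>) / 2"
  proof -
    have "2 * pi / real 12 = pi / 6" by simp
    then show ?thesis unfolding \<zeta>_def by (simp add: cis_conv_exp complex_eq_iff r3_def cos_30 sin_30 Re_exp Im_exp)
  qed
  have cyc: "cyclotomic_field 12 = rat_adjoin {\<zeta>}" by (simp add: cyclotomic_field_def \<zeta>_def)
  note kD = subfD[OF subf_rat_adjoin[of "{\<zeta>}"]]
  have "\<zeta> \<in> rat_adjoin {\<zeta>}" using rat_adjoin_incl by blast
  moreover have "\<i> = \<zeta>^3"
  proof -
    have "2 * \<zeta> = r3 + \<i>" "\<i>^2 = - 1" by (simp_all add: z)
    then have "8 * \<i> = 8 * \<zeta>^3" using r3_sq by Groebner_Basis.algebra
    then show ?thesis by simp
  qed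
  ultimately have i: "\<i> \<in> rat_adjoin {\<zeta>}" using kD by metis
  moreover have "r3 = 2 * \<zeta> - \<i>" unfolding z by simp
  ultimately have r: "r3 \<in> rat_adjoin {\<zeta>}" using kD \<open>\<zeta> \<in> rat_adjoin {\<zeta>}\<close> by metis
  have "\<zeta> \<in> Qz12" unfolding z using Qz12_mem subfD[OF subf_Qz12] by metis
  then have "rat_adjoin {\<zeta>} \<subseteq> Qz12" by (intro rat_adjoin_least[OF subf_Qz12]) simp
  then show ?thesis using Qz12_subset[OF subf_rat_adjoin i r] unfolding cyc by blast
qed

section \<open>Halving\<close>

text \<open>A primitive sixth root of unity. Together with \<open>0\<close>, \<open>rho\<close> and
  its conjugate \<open>1 - rho\<close> are the roots of the cubic.\<close>

definition rho :: complex where "rho = (1 + \<i> * r3) / 2"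

lemma rho_rel: "rho^2 = rho - 1"
proof -
  have "2 * rho = 1 + \<i> * r3" by (simp add: rho_def)
  moreover have "\<i>^2 = - 1" by simp
  ultimately have "4 * (rho^2 - rho + 1) = 0" using r3_sq by Groebner_Basis.algebra
  then have "rho^2 - rho + 1 = 0" by (metis mult_eq_0_iff zero_neq_numeral)
  then show ?thesis by Groebner_Basis.algebra
qed

text \<open>Built by repeated halving: \<open>0\<close>, \<open>rho\<close>, \<open>1 - rho\<close>
  belong to order \<open>2\<close>; \<open>1\<close> and \<open>- 1\<close> are the halves of
  \<open>0\<close>; the last four are the halves of \<open>1\<close>.\<close>

definition tors_x :: "complex set" where
  "tors_x = {0, rho, 1 - rho, 1, - 1, \<i>, - \<i>, 2 + r3, 2 - r3}"

definition S16 :: "complex point set" where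
  "S16 = {P. onE P \<and> (\<forall>x y. P = Affine x y \<longrightarrow> x \<in> tors_x)}"

lemma rho_in: "subf K \<Longrightarrow> \<i> \<in> K \<Longrightarrow> r3 \<in> K \<Longrightarrow> rho \<in> K"
  unfolding rho_def using subfD[of K] by simp

text \<open>The norm \<open>z * \<sigma> z\<close> is fixed by \<sigma>, since \<sigma> has order
  two, but its square being \<open>v^2\<close> makes it \<open>v\<close> or \<open>- v\<close>,
  which \<sigma> negates.\<close>

lemma no_square_root:
  assumes K: "subf K" and s: "involution_on K \<sigma>" and z: "z \<in> K" and v: "v \<in> K" "\<sigma> v = - v" "v \<noteq> 0"
    and eq: "z^2 * \<sigma> (z^2) = v^2"
  shows False
proof -
  note sD = involution_onD[OF s K]
  define n where "n = z * \<sigma> z"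
  have n: "n \<in> K" "\<sigma> n = n" using z sD subfD[OF K] by (simp_all add: n_def)
  have "n^2 = v^2" unfolding n_def using eq z sD by (simp add: power_mult_distrib)
  then have "n = v \<or> n = - v" by (simp only: power2_eq_iff)
  then have "\<sigma> v = v" using n v sD by auto
  then show False using v by simp
qed

text \<open>The halves of \<open>0\<close> and \<open>1\<close> are computed explicitly and lie in
  \<open>tors_x\<close>. Every other value \<open>t\<close> of the doubled coordinate is
  contradicted by \<open>no_square_root\<close>, with \<sigma> or \<tau> chosen to fix
  \<open>t\<close> when \<open>t\<close> is not \<open>rho\<close> or \<open>1 - rho\<close>; both
  exchange these two.\<close>

lemma S16_halving:
  assumes K: "subf K" "\<i> \<in> K" "r2 \<in> K" "r3 \<in> K"
    and s1: "involution_on K \<sigma>" "\<sigma> \<i> = \<i>" "\<sigma> r2 = - r2" "\<sigma> r3 = - r3"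
    and s2: "involution_on K \<tau>" "\<tau> \<i> = - \<i>" "\<tau> r2 = - r2" "\<tau> r3 = r3"
    and P: "onE (Affine x y)" "x \<in> K" "y \<in> K" and dbl: "addE (Affine x y) (Affine x y) \<in> S16"
  shows "Affine x y \<in> S16"
proof (cases "y = 0")
  case True
  then have "x^3 - x^2 + x = 0" using P(1) by (simp add: on_curve_X1_2_12)
  then have "x * (x - rho) * (x - (1 - rho)) = 0" using rho_rel by Groebner_Basis.algebra
  then show ?thesis using P(1) by (auto simp: S16_def tors_x_def)
next
  case False
  note kD = subfD[OF K(1)] and sD = involution_onD[OF s1(1) K(1)] and tD = involution_onD[OF s2(1) K(1)]
  have c: "y^2 = x^3 - x^2 + x" using P(1) by (simp add: on_curve_X1_2_12)
  define t where "t = ((x^2 - 1) / (2 * y))^2"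
  obtain y' where "addE (Affine x y) (Affine x y) = Affine t y'"
    unfolding t_def by (rule addE_double[OF P(1) False])
  then have t: "t \<in> tors_x" using dbl by (simp add: S16_def)
  have ty: "4 * y^2 * t = (x^2 - 1)^2" using False by (simp add: t_def power_divide power_mult_distrib)
  have rK: "rho \<in> K" using rho_in K by blast
  \<comment> \<open>The analogue for the other two roots of the identity behind
    \<open>addE_double\<close>: the coordinate of a double minus a root is a square over any field
    containing that root.\<close>
  have sq: "\<exists>z\<in>K. t - e = z^2" if e: "e \<in> K" "e^2 = e - 1" for e
  proof
    have "4 * y^2 * (t - e) = (x^2 - 2 * e * x + 1)^2" using ty e(2) c by Groebner_Basis.algebra
    then show "t - e = ((x^2 - 2 * e * x + 1) / (2 * y))^2"
      using False by (simp add: power_divide power_mult_distrib eq_divide_eq mult.commute)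
    show "(x^2 - 2 * e * x + 1) / (2 * y) \<in> K" using e P kD by simp
  qed
  obtain z where z: "z \<in> K" "t - rho = z^2" using sq[OF rK rho_rel] by blast
  have "(1 - rho)^2 = (1 - rho) - 1" using rho_rel by Groebner_Basis.algebra
  moreover have "1 - rho \<in> K" using rK kD(3,9) by blast
  ultimately obtain z' where z': "z' \<in> K" "t - (1 - rho) = z'^2" using sq[of "1 - rho"] by blast
  have ii: "\<i>^2 = - 1" by simp
  have w: "rho - (1 - rho) = \<i> * r3" unfolding rho_def by (simp add: field_simps)
  have conj_rho: "\<phi> rho = 1 - rho" if \<phi>: "involution_on K \<phi>" "\<phi> (\<i> * r3) = - (\<i> * r3)" for \<phi>
  proof -
    have "2 * rho = 1 + \<i> * r3" by (simp add: rho_def)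
    then have "\<phi> (2 * rho) = \<phi> (1 + \<i> * r3)" by simp
    then have "2 * \<phi> rho = 1 - \<i> * r3" using rK K \<phi>(2) kD involution_onD[OF \<phi>(1) K(1)] by simp
    then show ?thesis using w by Groebner_Basis.algebra
  qed
  have srho: "\<sigma> rho = 1 - rho" using conj_rho[OF s1(1)] s1 K sD by simp
  have trho: "\<tau> rho = 1 - rho" using conj_rho[OF s2(1)] s2 K tD by simp
  have rats: "1 \<in> \<rat>" "numeral n \<in> \<rat>" for n by simp_all
  have w_not_sq: "v^2 \<noteq> \<i> * r3" if "v \<in> K" for v
  proof
    assume v: "v^2 = \<i> * r3"
    have "\<sigma> (\<i> * r3) = - (\<i> * r3)" using s1 K sD by simp
    then have "v^2 * \<sigma> (v^2) = r3^2" unfolding v using ii by Groebner_Basis.algebra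
    then show False using no_square_root[OF K(1) s1(1) that K(4) s1(4) r3_nz] by simp
  qed
  have ?thesis if j: "t = j" "j \<in> K" "\<sigma> j = j" "j^2 = - 1" for j
  proof -
    \<comment> \<open>An explicit square root of \<open>- j\<close>, the value of
      \<open>t^2 - t + 1\<close> at \<open>t = j\<close>. The denominator \<open>r2\<close> makes
      \<sigma> negate it.\<close>
    define v where "v = (1 - j) / r2"
    have v: "v \<in> K" "\<sigma> v = - v" "v \<noteq> 0" "v^2 = - j"
    proof -
      show vK: "v \<in> K" unfolding v_def using j K kD by simp
      have vr: "v * r2 = 1 - j" by (simp add: v_def r2_nz)
      then have "\<sigma> (v * r2) = \<sigma> (1 - j)" by simp
      then have "\<sigma> v * (- r2) = 1 - j" using vK j K s1 kD sD rats by simp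
      then have "\<sigma> v * r2 = - v * r2" using vr by Groebner_Basis.algebra
      then show "\<sigma> v = - v" using r2_nz mult_right_cancel by blast
      have "2 * v^2 = 2 * (- j)" using vr j(4) r2_sq by Groebner_Basis.algebra
      then show v2: "v^2 = - j" by (simp only: mult_cancel_left) simp
      have "j \<noteq> 0" using j(4) by auto
      then show "v \<noteq> 0" using v2 by auto
    qed
    have "z^2 * \<sigma> (z^2) = (j - rho) * (j - (1 - rho))"
      unfolding z(2)[symmetric] j(1) using rK srho j K s1 kD sD rats by simp
    also have "\<dots> = v^2" unfolding v(4) using rho_rel j(4) by Groebner_Basis.algebra
    finally show ?thesis using no_square_root[OF K(1) s1(1) z(1) v(1-3)] by blast
  qed
  note t_i = this
  have ?thesis if s: "t = 2 + s" "s \<in> K" "\<tau> s = s" "s^2 = 3" for s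
  proof -
    \<comment> \<open>At \<open>t = 2 + s\<close> the norm is \<open>3 t\<close>, and
      \<open>2 + s = ((s + 1) / r2)^2\<close> with \<open>s^2 = 3\<close> yields this square root.
      As \<tau> fixes \<open>s\<close>, only the sign of \<open>r2\<close> changes.\<close>
    define v where "v = s * r2 * (s + 1) / 2"
    have v: "v \<in> K" "\<tau> v = - v" "v \<noteq> 0" "v^2 = 3 * t"
    proof -
      show vK: "v \<in> K" unfolding v_def using s K kD by simp
      have v2: "2 * v = s * r2 * (s + 1)" by (simp add: v_def)
      then have "\<tau> (2 * v) = \<tau> (s * r2 * (s + 1))" by simp
      then have "2 * \<tau> v = - (s * r2 * (s + 1))" using vK s K s2 kD tD rats by simp
      then have "2 * \<tau> v = 2 * (- v)" using v2 by simp
      then show "\<tau> v = - v" by (simp only: mult_cancel_left) simp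
      have "4 * v^2 = 4 * (3 * t)" using v2 r2_sq s(4) unfolding s(1) by Groebner_Basis.algebra
      then show v3: "v^2 = 3 * t" by simp
      have "t * (2 - s) = 4 - s^2" unfolding s(1) by (simp add: power2_eq_square algebra_simps)
      then have "t \<noteq> 0" using s(4) by auto
      then show "v \<noteq> 0" using v3 by auto
    qed
    have "z^2 * \<tau> (z^2) = (2 + s - rho) * (2 + s - (1 - rho))"
      unfolding z(2)[symmetric] s(1) using rK trho s K s2 kD tD rats by simp
    also have "\<dots> = v^2" unfolding v(4) s(1) using rho_rel s(4) by Groebner_Basis.algebra
    finally show ?thesis using no_square_root[OF K(1) s2(1) z(1) v(1-3)] by blast
  qed
  note t_3 = this
  consider "t = 0" | "t = 1" | "t = rho" | "t = 1 - rho" | "t = - 1" | "t = \<i>" | "t = - \<i>" | "t = 2 + r3" | "t = 2 - r3"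
    using t unfolding tors_x_def by blast
  then show ?thesis
  proof cases
    case 1
    then have "x^2 - 1 = 0" using ty by simp
    then have "(x - 1) * (x + 1) = 0" by Groebner_Basis.algebra
    then have "x = 1 \<or> x = - 1" by (auto simp: eq_neg_iff_add_eq_0)
    then show ?thesis using P(1) by (auto simp: S16_def tors_x_def)
  next
    case 2
    \<comment> \<open>With \<open>t = 1\<close> the equation \<open>(x^2 - 1)^2 = 4 y^2\<close>
      factors as \<open>(x^2 + 1) (x^2 - 4 x + 1) = 0\<close>.\<close>
    then have "(x - \<i>) * (x + \<i>) * ((x - (2 + r3)) * (x - (2 - r3))) = 0" using ty c ii r3_sq by Groebner_Basis.algebra
    then have "x = \<i> \<or> x = - \<i> \<or> x = 2 + r3 \<or> x = 2 - r3" by (auto simp: eq_neg_iff_add_eq_0)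
    then show ?thesis using P(1) by (auto simp: S16_def tors_x_def)
  next
    case 3
    then have "z'^2 = \<i> * r3" using z'(2) w by simp
    then show ?thesis using w_not_sq[OF z'(1)] by simp
  next
    case 4
    then have "(\<i> * z)^2 = \<i> * r3" using z(2) w ii by Groebner_Basis.algebra
    moreover have "\<i> * z \<in> K" using K z kD by simp
    ultimately show ?thesis using w_not_sq by blast
  next
    case 5
    have "z^2 * \<sigma> (z^2) = (- 1 - rho) * (- 1 - (1 - rho))"
      unfolding z(2)[symmetric] 5 using rK srho kD sD rats by simp
    also have "\<dots> = r3^2" using rho_rel r3_sq by Groebner_Basis.algebra
    finally show ?thesis using no_square_root[OF K(1) s1(1) z(1) K(4) s1(4) r3_nz] by blast
  next
    case 6
    then show ?thesis using t_i[of \<i>] K s1 ii by simp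
  next
    case 7
    then show ?thesis using t_i[of "- \<i>"] K s1 kD sD by simp
  next
    case 8
    then show ?thesis using t_3[of r3] K s2 r3_sq by simp
  next
    case 9
    then show ?thesis using t_3[of "- r3"] K s2 r3_sq kD tD by simp
  qed
qed

section \<open>The torsion points\<close>

lemma cubic_values:
  fixes e :: complex
  shows "e^2 = e - 1 \<Longrightarrow> e^3 - e^2 + e = 0"
    and "e^2 = - 1 \<Longrightarrow> e^3 - e^2 + e = 1"
    and "e^2 = 3 \<Longrightarrow> (2 + e)^3 - (2 + e)^2 + (2 + e) = (e * (2 + e))^2"
    and "e^2 = 3 \<Longrightarrow> ((2 + e)^2 - 1)^2 = 4 * (e * (2 + e))^2"
proof -
  show "e^2 = e - 1 \<Longrightarrow> e^3 - e^2 + e = 0" "e^2 = - 1 \<Longrightarrow> e^3 - e^2 + e = 1"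
    by Groebner_Basis.algebra+
  assume "e^2 = 3"
  then have sq: "e * e = 3" "e * (e * z) = 3 * z" for z by (simp_all add: power2_eq_square flip: mult.assoc)
  then have pow: "(2 + e)^2 = 7 + 4 * e" "(2 + e)^3 = 26 + 15 * e" "(7 + 4 * e - 1)^2 = 84 + 48 * e"
    "(e * (2 + e))^2 = 21 + 12 * e"
    by (simp_all add: power2_eq_square power3_eq_cube algebra_simps)
  show "(2 + e)^3 - (2 + e)^2 + (2 + e) = (e * (2 + e))^2" "((2 + e)^2 - 1)^2 = 4 * (e * (2 + e))^2"
    unfolding pow by simp_all
qed

lemma tors_x_squares:
  assumes "x \<in> tors_x" and on: "y^2 = x^3 - x^2 + x"
  obtains "x = 0" "y = 0" | "x = rho" "y = 0" | "x = 1 - rho" "y = 0" | "x = 1" "y = 1 \<or> y = - 1"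
    | "x = - 1" "y = \<i> * r3 \<or> y = - (\<i> * r3)" | "x = \<i>" "y = 1 \<or> y = - 1" | "x = - \<i>" "y = 1 \<or> y = - 1"
    | "x = 2 + r3" "y = r3 * (2 + r3) \<or> y = - (r3 * (2 + r3))"
    | "x = 2 - r3" "y = r3 * (2 - r3) \<or> y = - (r3 * (2 - r3))"
proof -
  have sq: "y = v \<or> y = - v" if "y^2 = v^2" for v using that by (simp add: power2_eq_iff)
  have one: "y = 1 \<or> y = - 1" if "y^2 = 1" using sq[of 1] that by simp
  have ii: "\<i>^2 = - 1" "(- \<i>)^2 = - 1" by simp_all
  have r: "(- r3)^2 = 3" using r3_sq by simp
  have rho': "(1 - rho)^2 = (1 - rho) - 1" using rho_rel by (simp add: power2_diff)
  consider "x = 0" | "x = rho" | "x = 1 - rho" | "x = 1" | "x = - 1" | "x = \<i>" | "x = - \<i>" | "x = 2 + r3" | "x = 2 - r3"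
    using assms(1) unfolding tors_x_def by blast
  then show ?thesis
  proof cases
    case 1
    then show ?thesis using on that(1) by simp
  next
    case 2
    then show ?thesis using on cubic_values(1)[OF rho_rel] that(2) by simp
  next
    case 3
    then show ?thesis using on cubic_values(1)[OF rho'] that(3) by simp
  next
    case 4
    then show ?thesis using on one that(4) by simp
  next
    case 5
    have "y^2 = (\<i> * r3)^2" using on r3_sq by (simp add: 5 power_mult_distrib)
    then show ?thesis using sq that(5) 5 by blast
  next
    case 6
    then show ?thesis using on cubic_values(2)[OF ii(1)] one that(6) by simp
  next
    case 7
    have "y^2 = 1" using on cubic_values(2)[OF ii(2)] unfolding 7 by (rule trans)
    then show ?thesis using one that(7) 7 by blast
  next
    case 8
    have "y^2 = (r3 * (2 + r3))^2" using on cubic_values(3)[OF r3_sq] unfolding 8 by (rule trans)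
    then show ?thesis using sq that(8) 8 by blast
  next
    case 9
    have "x = 2 + - r3" by (simp add: 9)
    then have "y^2 = (- r3 * (2 + - r3))^2" using on cubic_values(3)[OF r] by (simp only:)
    then have "y^2 = (r3 * (2 - r3))^2" by simp
    then show ?thesis using sq that(9) 9 by blast
  qed
qed

lemma S16_Qz12:
  assumes "P \<in> S16"
  shows "coords_in Qz12 P"
proof (cases P)
  case (Affine x y)
  note kD = subfD[OF subf_Qz12]
  have x: "x \<in> tors_x" and on: "y^2 = x^3 - x^2 + x" using assms by (simp_all add: Affine S16_def on_curve_X1_2_12)
  have rho: "rho \<in> Qz12" "1 - rho \<in> Qz12" using rho_in[OF subf_Qz12] Qz12_mem kD by simp_all
  have w: "\<i> * r3 \<in> Qz12" "- (\<i> * r3) \<in> Qz12" "- \<i> \<in> Qz12" using Qz12_mem kD by simp_all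
  have u: "2 + r3 \<in> Qz12" "2 - r3 \<in> Qz12" "r3 * (2 + r3) \<in> Qz12" "r3 * (2 - r3) \<in> Qz12"
    "- (r3 * (2 + r3)) \<in> Qz12" "- (r3 * (2 - r3)) \<in> Qz12" using Qz12_mem kD by simp_all
  have "x \<in> Qz12 \<and> y \<in> Qz12"
    using x on by (cases rule: tors_x_squares) (use rho w u Qz12_mem kD(2,3) kD(7)[OF kD(3)] in auto)
  then show ?thesis by (simp add: Affine)
qed simp

lemma twist_points_1: "twist_points 1 K = {P. onE P \<and> coords_in K P}"
proof -
  have "P \<in> twist_points 1 K \<longleftrightarrow> onE P \<and> coords_in K P" for P
    unfolding twist_points_def by (cases P) auto
  then show ?thesis by blast
qed

lemma carrier_J: "carrier (J1_2_12 K) = twist_points 1 K"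
  by (simp add: J1_2_12_def ec_group_def twist_points_1)

lemma pow_J: "P [^]\<^bsub>J1_2_12 K\<^esub> (n::nat) = P [^]\<^bsub>G0\<^esub> n"
  unfolding J1_2_12_def by (induction n) (simp_all only: ec_pow_0 ec_pow_Suc)

lemma torsion_J: "torsion (J1_2_12 K) = {P \<in> twist_points 1 K. tors P}"
  unfolding torsion_def carrier_J pow_J tors_def
  by (auto simp: J1_2_12_def twist_points_def)

lemma two_power_tors_S16:
  assumes K: "subf K" "\<i> \<in> K" "r2 \<in> K" "r3 \<in> K"
    and s1: "involution_on K \<sigma>" "\<sigma> \<i> = \<i>" "\<sigma> r2 = - r2" "\<sigma> r3 = - r3"
    and s2: "involution_on K \<tau>" "\<tau> \<i> = - \<i>" "\<tau> r2 = - r2" "\<tau> r3 = r3"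
    and P: "P \<in> twist_points 1 K" and m: "P [^]\<^bsub>G0\<^esub> (2 ^ m :: nat) = Infinity"
  shows "P \<in> S16"
  using P m
proof (induction m arbitrary: P)
  case 0
  then have "P = Infinity" using pow_1[OF twist_points_on[OF 0(1)]] by simp
  then show ?case by (simp add: S16_def)
next
  case (Suc m)
  have on: "onE P" by (rule twist_points_on[OF Suc.prems(1)])
  have "addE P P \<in> twist_points 1 K"
    using Suc.prems(1) subfD(3)[OF K(1)] by (intro twist_points_add[OF K(1)]) simp_all
  then have d: "addE P P \<in> S16" using Suc.IH Suc.prems(2) pow_two_power_Suc'[OF on] by simp
  show ?case
  proof (cases P)
    case (Affine x y)
    then have "x \<in> K" "y \<in> K" using Suc.prems(1) by (simp_all add: twist_points_1)
    then show ?thesis using S16_halving[OF K s1 s2 _ _ _ d[unfolded Affine]] on unfolding Affine by blast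
  qed (simp add: S16_def)
qed

text \<open>Supplies the two involutions for the halving argument on the enlarged tower: one fixes
  \<open>\<i>\<close>, the other \<open>r3\<close>, and each negates the remaining two
  generators.\<close>

lemma tors_S16:
  assumes K: "multi_quadratic_field K" and P: "P \<in> twist_points 1 K" and t: "tors P"
  shows "P \<in> S16"
proof -
  obtain L where L: "mq_tower L" "K \<subseteq> L" "Q8 \<subseteq> L"
    "\<forall>\<sigma>. involution_on Q8 \<sigma> \<longrightarrow> (\<exists>\<sigma>'. involution_on L \<sigma>' \<and> (\<forall>x\<in>Q8. \<sigma>' x = \<sigma> x))"
    using multi_quadratic_tower(2)[OF K] by blast
  have PL: "P \<in> twist_points 1 L" using P L(2) unfolding twist_points_def by blast
  have sL: "subf L" "\<i> \<in> L" "r2 \<in> L" "r3 \<in> L" using subf_mq[OF L(1)] L(3) Q8_mem by blast+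
  obtain m where m: "P [^]\<^bsub>G0\<^esub> (2 ^ m :: nat) = Infinity"
    using twist_tors_two_power[OF L(1) _ _ PL t] by auto
  have ex: "\<exists>\<sigma>. involution_on L \<sigma> \<and> \<sigma> \<i> = s * \<i> \<and> \<sigma> r2 = - r2 \<and> \<sigma> r3 = u * r3"
    if su: "s = 1 \<or> s = - 1" "u = 1 \<or> u = - 1" for s u
  proof -
    obtain \<sigma> where "involution_on Q8 \<sigma>" "\<sigma> \<i> = s * \<i>" "\<sigma> r2 = - 1 * r2" "\<sigma> r3 = u * r3"
      using Q8_involution[of s "- 1" u] su by auto
    then show ?thesis using L(4) Q8_mem by (metis mult_minus1)
  qed
  obtain \<sigma> where s1: "involution_on L \<sigma>" "\<sigma> \<i> = \<i>" "\<sigma> r2 = - r2" "\<sigma> r3 = - r3" using ex[of 1 "- 1"] by auto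
  obtain \<tau> where s2: "involution_on L \<tau>" "\<tau> \<i> = - \<i>" "\<tau> r2 = - r2" "\<tau> r3 = r3" using ex[of "- 1" 1] by auto
  show ?thesis by (rule two_power_tors_S16[OF sL s1 s2 PL m])
qed

text \<open>Descending through \<open>\<i>\<close> and \<open>r3\<close> reaches the twists with
  \<delta> equal to \<open>1\<close>, \<open>\<i>\<close>, \<open>r3\<close> and
  \<open>r3 * \<i>\<close>, whose squares are \<open>1\<close>, \<open>-1\<close>, \<open>3\<close>,
  \<open>-3\<close>.\<close>

lemma Qz12_points_tors:
  assumes "P \<in> twist_points 1 Qz12"
  shows "tors P"
proof -
  have i0: "P \<in> twist_points \<delta> (adj \<rat> \<i>) \<Longrightarrow> tors P" if d: "\<delta> \<noteq> 0" "\<delta>^2 = 1 \<or> \<delta>^2 = 3" for \<delta> P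
  proof (rule twist_points_tors_step[OF subf_Rats ii_sq ii_not_Rats d(1)])
    show "\<delta>^2 \<in> \<rat>" using d by auto
    show "tors A" if "A \<in> twist_points \<delta> \<rat>" for A using twist_rational_points_tors[OF that] d by blast
    show "tors B" if "B \<in> twist_points (\<delta> * \<i>) \<rat>" for B
      using twist_rational_points_tors[OF that] d by (auto simp: power_mult_distrib)
  qed
  show ?thesis
  proof (rule twist_points_tors_step[OF subf_ii r3_sq_Rats r3_not _ _ _ _ assms[unfolded Qz12_def]])
    show "tors A" if "A \<in> twist_points 1 (adj \<rat> \<i>)" for A using i0[of 1 A] that by simp
    show "tors B" if "B \<in> twist_points (1 * r3) (adj \<rat> \<i>)" for B using i0[of r3 B] that r3_nz r3_sq by simp
  qed simp_all
qed

lemma torsion_eq: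
  assumes K: "multi_quadratic_field K"
  shows "torsion (J1_2_12 K) = carrier (J1_2_12 (K \<inter> Qz12))"
    and "torsion (J1_2_12 K) = {P \<in> S16. coords_in (K \<inter> Qz12) P}"
proof -
  have 1: "torsion (J1_2_12 K) \<subseteq> {P \<in> S16. coords_in (K \<inter> Qz12) P}"
  proof
    fix P assume "P \<in> torsion (J1_2_12 K)"
    then have P: "P \<in> twist_points 1 K" "tors P" by (simp_all add: torsion_J)
    then have "P \<in> S16" by (rule tors_S16[OF K])
    then show "P \<in> {P \<in> S16. coords_in (K \<inter> Qz12) P}" using S16_Qz12[of P] P(1)
      by (cases P) (auto simp: twist_points_1)
  qed
  have 2: "{P \<in> S16. coords_in (K \<inter> Qz12) P} \<subseteq> carrier (J1_2_12 (K \<inter> Qz12))"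
    by (auto simp: carrier_J twist_points_1 S16_def)
  have 3: "carrier (J1_2_12 (K \<inter> Qz12)) \<subseteq> torsion (J1_2_12 K)"
  proof
    fix P assume "P \<in> carrier (J1_2_12 (K \<inter> Qz12))"
    then have "P \<in> twist_points 1 K" "P \<in> twist_points 1 Qz12" unfolding carrier_J twist_points_def by blast+
    then show "P \<in> torsion (J1_2_12 K)" using Qz12_points_tors by (simp add: torsion_J)
  qed
  show "torsion (J1_2_12 K) = carrier (J1_2_12 (K \<inter> Qz12))"
    "torsion (J1_2_12 K) = {P \<in> S16. coords_in (K \<inter> Qz12) P}" using 1 2 3 by blast+
qed

section \<open>The isomorphism types\<close>

text \<open>\<open>Affine 0 0\<close> has order exactly \<open>2\<close>, which determines the order
  of any point with this multiple.\<close>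

lemma ord_two_power:
  assumes g: "onE g" and h: "g [^]\<^bsub>G0\<^esub> (2 ^ j :: nat) = Affine 0 0"
  shows "G0.ord g = 2 ^ Suc j"
proof -
  have gc: "g \<in> carrier G0" using g by (simp add: G0_simps)
  have "g [^]\<^bsub>G0\<^esub> (2 ^ Suc j :: nat) = \<one>\<^bsub>G0\<^esub>"
    unfolding pow_two_power_Suc[OF g] h by (simp add: G0_simps addE_y0)
  then have "G0.ord g dvd 2 ^ Suc j" using G0.pow_eq_id[OF gc] by blast
  moreover have "\<not> G0.ord g dvd 2 ^ j" using G0.pow_eq_id[OF gc, of "2 ^ j"] h by (simp add: G0_simps)
  ultimately obtain i where "i \<le> Suc j" "G0.ord g = 2 ^ i" using divides_primepow_nat[of 2 "G0.ord g" "Suc j"] by auto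
  moreover from this have "\<not> i \<le> j" using \<open>\<not> G0.ord g dvd 2 ^ j\<close> le_imp_power_dvd by metis
  ultimately show ?thesis by (simp add: le_Suc_eq)
qed

locale finite_point_group =
  fixes T :: "complex point set" and H :: "complex point monoid"
  assumes H: "carrier H = T" "\<And>P Q. P \<otimes>\<^bsub>H\<^esub> Q = addE P Q" and T: "\<And>P. P \<in> T \<Longrightarrow> onE P"
    and cl: "\<And>P Q. P \<in> T \<Longrightarrow> Q \<in> T \<Longrightarrow> addE P Q \<in> T" and O: "Infinity \<in> T" and fin: "finite T"
begin

lemma pow_T: "g \<in> T \<Longrightarrow> g [^]\<^bsub>G0\<^esub> (n::nat) \<in> T"
  by (induction n) (simp_all add: O cl G0_simps(2))

lemma pow_mod: "g \<in> T \<Longrightarrow> g [^]\<^bsub>G0\<^esub> (k mod G0.ord g) = g [^]\<^bsub>G0\<^esub> k"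
proof -
  assume g: "g \<in> T"
  then have on: "onE g" by (rule T)
  then have gc: "g \<in> carrier G0" by (simp add: G0_simps)
  have "g [^]\<^bsub>G0\<^esub> (G0.ord g * (k div G0.ord g)) = Infinity"
    using G0.pow_eq_id[OF gc, of "G0.ord g * (k div G0.ord g)"] by (simp add: G0_simps)
  then show ?thesis using G0.nat_pow_mult[OF gc, of "G0.ord g * (k div G0.ord g)" "k mod G0.ord g"]
    by (simp add: G0_simps addE_Infinity)
qed

lemma pow_inj: "g \<in> T \<Longrightarrow> g [^]\<^bsub>G0\<^esub> a = g [^]\<^bsub>G0\<^esub> b \<Longrightarrow> a < G0.ord g \<Longrightarrow> b < G0.ord g \<Longrightarrow> a = b" for a b :: nat
proof (induction a b rule: linorder_wlog)
  case (le a b)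
  then have on: "onE g" using T by blast
  then have gc: "g \<in> carrier G0" by (simp add: G0_simps)
  have "g [^]\<^bsub>G0\<^esub> a \<otimes>\<^bsub>G0\<^esub> g [^]\<^bsub>G0\<^esub> (b - a) = g [^]\<^bsub>G0\<^esub> b"
    using G0.nat_pow_mult[OF gc, of a "b - a"] le(1) by simp
  then have "g [^]\<^bsub>G0\<^esub> a \<otimes>\<^bsub>G0\<^esub> g [^]\<^bsub>G0\<^esub> (b - a) = g [^]\<^bsub>G0\<^esub> a \<otimes>\<^bsub>G0\<^esub> \<one>\<^bsub>G0\<^esub>"
    using le(3) G0.r_one[of "g [^]\<^bsub>G0\<^esub> a"] gc by (metis G0.nat_pow_closed)
  then have "g [^]\<^bsub>G0\<^esub> (b - a) = \<one>\<^bsub>G0\<^esub>" using gc by (metis G0.l_cancel G0.nat_pow_closed G0.one_closed)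
  then have "G0.ord g dvd b - a" using G0.pow_eq_id[OF gc] by blast
  then have "b - a = 0" using le by (metis dvd_imp_le less_imp_diff_less linorder_not_less neq0_conv)
  then show ?case using le by simp
qed simp

lemma nat_mod_sum: "a \<ge> 0 \<Longrightarrow> b \<ge> 0 \<Longrightarrow> nat ((a + b) mod int n) = (nat a + nat b) mod n"
  by (simp add: nat_mod_distrib nat_add_distrib)

text \<open>An injective image of \<open>n\<close> elements fills \<open>T\<close> because
  \<open>T\<close> has at most \<open>n\<close> elements; an upper bound for the number of points is
  therefore enough.\<close>

lemma cyclic_iso:
  assumes g: "g \<in> T" and n: "G0.ord g = n" "n > 0" and card: "card T \<le> n"
  shows "H \<cong> integer_mod_group n"
proof -
  have on: "onE g" by (rule T[OF g])
  then have gc: "g \<in> carrier G0" by (simp add: G0_simps)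
  define \<phi> where "\<phi> a = g [^]\<^bsub>G0\<^esub> nat a" for a :: int
  have c: "carrier (integer_mod_group n) = {0..<int n}" using n by (simp add: carrier_integer_mod_group)
  have im: "\<phi> a \<in> T" for a unfolding \<phi>_def by (rule pow_T[OF g])
  have "\<phi> \<in> hom (integer_mod_group n) H"
  proof (rule homI)
    fix a b assume "a \<in> carrier (integer_mod_group n)" "b \<in> carrier (integer_mod_group n)"
    then have ab: "a \<ge> 0" "b \<ge> 0" by (simp_all add: c)
    show "\<phi> (a \<otimes>\<^bsub>integer_mod_group n\<^esub> b) = \<phi> a \<otimes>\<^bsub>H\<^esub> \<phi> b"
      using pow_mod[OF g, of "nat a + nat b"] G0.nat_pow_mult[OF gc, of "nat a" "nat b"] ab n
      by (simp add: \<phi>_def H nat_mod_sum G0_simps)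
  qed (use pow_T[OF g] in \<open>simp add: \<phi>_def H\<close>)
  moreover have "inj_on \<phi> {0..<int n}"
  proof (rule inj_onI)
    fix a b assume ab: "a \<in> {0..<int n}" "b \<in> {0..<int n}" "\<phi> a = \<phi> b"
    then have "nat a = nat b" unfolding \<phi>_def by (intro pow_inj[OF g]) (auto simp: n)
    then show "a = b" using ab eq_nat_nat_iff[of a b] by simp
  qed
  moreover from this have "card (\<phi> ` {0..<int n}) = n" by (simp add: card_image)
  then have "\<phi> ` {0..<int n} = T" using card im by (intro card_seteq fin) auto
  ultimately have "\<phi> \<in> iso (integer_mod_group n) H" by (simp add: iso_def bij_betw_def c H)
  then have "integer_mod_group n \<cong> H" by (auto simp: is_iso_def)
  then show ?thesis by (rule group.iso_sym[OF group_integer_mod_group])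
qed

lemma two_cyclic_iso:
  assumes g: "g \<in> T" and n: "G0.ord g = n" "n > 0" and t: "t \<in> T" "addE t t = Infinity" "\<And>k::nat. t \<noteq> g [^]\<^bsub>G0\<^esub> k"
    and card: "card T \<le> 2 * n"
  shows "H \<cong> integer_mod_group 2 \<times>\<times> integer_mod_group n"
proof -
  have on: "onE g" "onE t" by (rule T[OF g], rule T[OF t(1)])
  then have gc: "g \<in> carrier G0" "t \<in> carrier G0" by (simp_all add: G0_simps)
  have ordt: "t [^]\<^bsub>G0\<^esub> (k mod 2) = t [^]\<^bsub>G0\<^esub> k" for k :: nat
  proof -
    have "t [^]\<^bsub>G0\<^esub> (2::nat) = Infinity" using t(2) pow_2[of X1_2_12 UNIV t] by simp
    then have "t [^]\<^bsub>G0\<^esub> (2 * (k div 2)) = Infinity" using pow_dvd[OF on(2)] by simp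
    then show ?thesis using G0.nat_pow_mult[OF gc(2), of "2 * (k div 2)" "k mod 2"] by (simp add: G0_simps addE_Infinity)
  qed
  define \<phi> where "\<phi> = (\<lambda>(a, b). addE (t [^]\<^bsub>G0\<^esub> nat a) (g [^]\<^bsub>G0\<^esub> nat b))"
  have c: "carrier (integer_mod_group 2 \<times>\<times> integer_mod_group n) = {0..<2} \<times> {0..<int n}"
    using n by (simp add: carrier_integer_mod_group)
  have im: "\<phi> x \<in> T" for x unfolding \<phi>_def using pow_T g t cl by (simp add: case_prod_beta)
  have "\<phi> \<in> hom (integer_mod_group 2 \<times>\<times> integer_mod_group n) H"
  proof (rule homI)
    fix x y assume x: "x \<in> carrier (integer_mod_group 2 \<times>\<times> integer_mod_group n)" and y: "y \<in> carrier (integer_mod_group 2 \<times>\<times> integer_mod_group n)"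
    obtain a b a' b' where xy: "x = (a, b)" "y = (a', b')" by (metis surj_pair)
    have pos: "a \<ge> 0" "b \<ge> 0" "a' \<ge> 0" "b' \<ge> 0" using x y unfolding c xy by simp_all
    have "\<phi> (x \<otimes>\<^bsub>integer_mod_group 2 \<times>\<times> integer_mod_group n\<^esub> y) =
      addE (t [^]\<^bsub>G0\<^esub> ((nat a + nat a') mod 2)) (g [^]\<^bsub>G0\<^esub> ((nat b + nat b') mod n))"
      by (simp only: xy \<phi>_def prod.case mult_DirProd mult_integer_mod_group
          nat_mod_sum[OF pos(1,3)] nat_mod_sum[OF pos(2,4)])
    also have "\<dots> = addE (t [^]\<^bsub>G0\<^esub> (nat a + nat a')) (g [^]\<^bsub>G0\<^esub> (nat b + nat b'))"
      using pow_mod[OF g] ordt n by simp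
    also have "\<dots> = (t [^]\<^bsub>G0\<^esub> nat a \<otimes>\<^bsub>G0\<^esub> t [^]\<^bsub>G0\<^esub> nat a') \<otimes>\<^bsub>G0\<^esub> (g [^]\<^bsub>G0\<^esub> nat b \<otimes>\<^bsub>G0\<^esub> g [^]\<^bsub>G0\<^esub> nat b')"
      by (simp only: G0.nat_pow_mult[OF gc(1)] G0.nat_pow_mult[OF gc(2)] G0_simps(2)[symmetric])
    also have "\<dots> = (t [^]\<^bsub>G0\<^esub> nat a \<otimes>\<^bsub>G0\<^esub> g [^]\<^bsub>G0\<^esub> nat b) \<otimes>\<^bsub>G0\<^esub> (t [^]\<^bsub>G0\<^esub> nat a' \<otimes>\<^bsub>G0\<^esub> g [^]\<^bsub>G0\<^esub> nat b')"
      using gc by (simp add: G0.m_ac)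
    finally show "\<phi> (x \<otimes>\<^bsub>integer_mod_group 2 \<times>\<times> integer_mod_group n\<^esub> y) = \<phi> x \<otimes>\<^bsub>H\<^esub> \<phi> y"
      by (simp add: H xy \<phi>_def G0_simps(2))
  qed (use im in \<open>simp add: H\<close>)
  moreover have inj: "inj_on \<phi> ({0..<2} \<times> {0..<int n})"
  proof (rule inj_onI)
    have no: False if "addE t (g [^]\<^bsub>G0\<^esub> b) = g [^]\<^bsub>G0\<^esub> b'" for b b' :: nat
    proof -
      \<comment> \<open>Expresses the inverse of the power \<open>b\<close> of \<open>g\<close> as a
        power with a natural exponent.\<close>
      define e where "e = (n - 1) * b"
      have "b + e = n * b" unfolding e_def using n by (cases n) simp_all
      then have e: "g [^]\<^bsub>G0\<^esub> b \<otimes>\<^bsub>G0\<^esub> g [^]\<^bsub>G0\<^esub> e = \<one>\<^bsub>G0\<^esub>"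
        using G0.pow_eq_id[OF gc(1), of "n * b"] gc n by (simp add: G0.nat_pow_mult)
      have "g [^]\<^bsub>G0\<^esub> (b' + e) = (t \<otimes>\<^bsub>G0\<^esub> g [^]\<^bsub>G0\<^esub> b) \<otimes>\<^bsub>G0\<^esub> g [^]\<^bsub>G0\<^esub> e"
        using that gc by (simp add: G0_simps(2) flip: G0.nat_pow_mult)
      also have "\<dots> = t \<otimes>\<^bsub>G0\<^esub> (g [^]\<^bsub>G0\<^esub> b \<otimes>\<^bsub>G0\<^esub> g [^]\<^bsub>G0\<^esub> e)" using gc by (simp add: G0.m_assoc)
      also have "\<dots> = t" unfolding e by (rule G0.r_one[OF gc(2)])
      finally show False using t(3) by metis
    qed
    have p01: "t [^]\<^bsub>G0\<^esub> (0::nat) = Infinity" "t [^]\<^bsub>G0\<^esub> (1::nat) = t" using pow_1[OF on(2)] by simp_all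
    fix x y assume x: "x \<in> {0..<2} \<times> {0..<int n}" and y: "y \<in> {0..<2} \<times> {0..<int n}" and eq: "\<phi> x = \<phi> y"
    obtain a b a' b' where xy: "x = (a, b)" "y = (a', b')" by (metis surj_pair)
    have r: "a = 0 \<or> a = 1" "a' = 0 \<or> a' = 1" "b \<ge> 0" "b' \<ge> 0" "nat b < n" "nat b' < n" using x y unfolding xy by auto
    have eq': "addE (t [^]\<^bsub>G0\<^esub> nat a) (g [^]\<^bsub>G0\<^esub> nat b) = addE (t [^]\<^bsub>G0\<^esub> nat a') (g [^]\<^bsub>G0\<^esub> nat b')"
      using eq unfolding xy \<phi>_def by simp
    have aa: "a = a'"
    proof (rule ccontr)
      assume "a \<noteq> a'"
      then consider "a = 0" "a' = 1" | "a = 1" "a' = 0" using r by blast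
      then show False
        using eq' no[of "nat b" "nat b'"] no[of "nat b'" "nat b"] p01 by cases (simp_all add: addE_Infinity)
    qed
    have "t [^]\<^bsub>G0\<^esub> nat a \<otimes>\<^bsub>G0\<^esub> g [^]\<^bsub>G0\<^esub> nat b = t [^]\<^bsub>G0\<^esub> nat a \<otimes>\<^bsub>G0\<^esub> g [^]\<^bsub>G0\<^esub> nat b'"
      using eq' unfolding aa by (simp add: G0_simps(2))
    then have "g [^]\<^bsub>G0\<^esub> nat b = g [^]\<^bsub>G0\<^esub> nat b'" using gc by (metis G0.l_cancel G0.nat_pow_closed)
    then have "nat b = nat b'" using pow_inj[OF g] r n by blast
    then show "x = y" using aa r xy by simp
  qed
  moreover from inj have "card (\<phi> ` ({0..<2} \<times> {0..<int n})) = 2 * n" by (simp add: card_image card_cartesian_product)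
  then have "\<phi> ` ({0..<2} \<times> {0..<int n}) = T" using card im by (intro card_seteq fin) auto
  ultimately have "\<phi> \<in> iso (integer_mod_group 2 \<times>\<times> integer_mod_group n) H"
    by (simp only: iso_def bij_betw_def c H(1) mem_Collect_eq simp_thms)
  then have "integer_mod_group 2 \<times>\<times> integer_mod_group n \<cong> H" by (auto simp: is_iso_def)
  then show ?thesis by (rule group.iso_sym[OF DirProd_group[OF group_integer_mod_group group_integer_mod_group]])
qed

end

section \<open>The sixteen points and the field required by each\<close>

text \<open>The four lists group the points by the irrationality they need: none,
  \<open>\<i> * r3\<close>, \<open>\<i>\<close> and \<open>r3\<close>. Lengths of concatenations
  then bound the torsion for each \<open>K12\<close>.\<close>

definition pts_Q :: "complex point list" where
  "pts_Q = [Infinity, Affine 0 0, Affine 1 1, Affine 1 (- 1)]"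
definition pts_w :: "complex point list" where
  "pts_w = [Affine rho 0, Affine (1 - rho) 0, Affine (- 1) (\<i> * r3), Affine (- 1) (- (\<i> * r3))]"
definition pts_i :: "complex point list" where
  "pts_i = [Affine \<i> 1, Affine \<i> (- 1), Affine (- \<i>) 1, Affine (- \<i>) (- 1)]"
definition pts_3 :: "complex point list" where
  "pts_3 = [Affine (2 + r3) (r3 * (2 + r3)), Affine (2 + r3) (- (r3 * (2 + r3))),
     Affine (2 - r3) (r3 * (2 - r3)), Affine (2 - r3) (- (r3 * (2 - r3)))]"

lemma S16_cases:
  assumes P: "P \<in> S16" and c: "coords_in K P" and K: "subf K"
  shows "P \<in> set pts_Q \<or> P \<in> set pts_w \<and> \<i> * r3 \<in> K \<or> P \<in> set pts_i \<and> \<i> \<in> K \<or> P \<in> set pts_3 \<and> r3 \<in> K"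
proof (cases P)
  case (Affine x y)
  note kD = subfD[OF K]
  have x: "x \<in> tors_x" and on: "y^2 = x^3 - x^2 + x" using P by (simp_all add: Affine S16_def on_curve_X1_2_12)
  have xK: "x \<in> K" "y \<in> K" using c by (simp_all add: Affine)
  have w: "\<i> * r3 = 2 * rho - 1" by (simp add: rho_def)
  from x on show ?thesis
  proof (cases rule: tors_x_squares)
    case 2
    then have "2 * rho - 1 \<in> K" using xK(1) kD(3,4,6,9) by simp
    then show ?thesis using 2 w by (simp add: Affine pts_w_def)
  next
    case 3
    have "1 - 2 * x \<in> K" using xK(1) kD(3,4,6,9) by simp
    moreover have "1 - 2 * x = \<i> * r3" unfolding w 3 by simp
    ultimately show ?thesis using 3 by (simp add: Affine pts_w_def)
  next
    case 5
    then have "\<i> * r3 \<in> K" using xK(2) kD(7)[of y] by auto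
    then show ?thesis using 5 by (auto simp: Affine pts_w_def)
  next
    case 7
    then have "\<i> \<in> K" using xK(1) kD(7)[of x] by simp
    then show ?thesis using 7 by (auto simp: Affine pts_i_def)
  next
    case 8
    then have "r3 = x - 2" by simp
    moreover have "x - 2 \<in> K" using xK(1) kD(4,9) by simp
    ultimately have "r3 \<in> K" by (simp only:)
    then show ?thesis using 8 by (auto simp: Affine pts_3_def)
  next
    case 9
    then have "r3 = 2 - x" by simp
    moreover have "2 - x \<in> K" using xK(1) kD(4,9) by simp
    ultimately have "r3 \<in> K" by (simp only:)
    then show ?thesis using 9 by (auto simp: Affine pts_3_def)
  qed (use xK in \<open>auto simp: Affine pts_Q_def pts_i_def\<close>)
qed (simp add: pts_Q_def)

lemma generators:
  "onE (Affine 0 0)" "onE (Affine 1 1)" "onE (Affine \<i> 1)" "onE (Affine (2 + r3) (r3 * (2 + r3)))" "onE (Affine rho 0)"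
proof -
  have ii: "\<i>^2 = - 1" by simp
  show "onE (Affine 0 0)" "onE (Affine 1 1)" by (simp_all add: on_curve_X1_2_12)
  show "onE (Affine \<i> 1)" unfolding on_curve_X1_2_12 cubic_values(2)[OF ii] by simp
  show "onE (Affine (2 + r3) (r3 * (2 + r3)))" unfolding on_curve_X1_2_12 cubic_values(3)[OF r3_sq] ..
  show "onE (Affine rho 0)" unfolding on_curve_X1_2_12 cubic_values(1)[OF rho_rel] by simp
qed

lemma double_x1: "onE (Affine 1 y) \<Longrightarrow> addE (Affine 1 y) (Affine 1 y) = Affine 0 0"
proof -
  assume on: "onE (Affine 1 y)"
  then have "y \<noteq> 0" by (auto simp: on_curve_X1_2_12)
  then obtain y' where y': "addE (Affine 1 y) (Affine 1 y) = Affine 0 y'" using addE_double[OF on] by auto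
  then have "onE (Affine 0 y')" using addE_closed[OF on on] by simp
  then show ?thesis using y' by (simp add: on_curve_X1_2_12)
qed

lemma ord_4: "G0.ord (Affine 1 1) = 4"
  using ord_two_power[OF generators(2), of 1] double_x1[OF generators(2)] pow_2[of X1_2_12 UNIV "Affine 1 1"] by simp

text \<open>The condition makes the first coordinate of the double \<open>1\<close>; its double in
  turn is \<open>Affine 0 0\<close>, so such a point has order \<open>8\<close>.\<close>

lemma pow_4_eq:
  assumes on: "onE (Affine x y)" and y: "y \<noteq> 0" and x: "(x^2 - 1)^2 = 4 * y^2"
  shows "Affine x y [^]\<^bsub>G0\<^esub> (2 ^ 2 :: nat) = Affine 0 0"
proof -
  have "((x^2 - 1) / (2 * y))^2 = 1" using x y by (simp add: power_divide power_mult_distrib)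
  then obtain y' where y': "addE (Affine x y) (Affine x y) = Affine 1 y'" using addE_double[OF on y] by metis
  then have "onE (Affine 1 y')" using addE_closed[OF on on] by simp
  then show ?thesis using double_x1 y' pow_two_power_Suc[OF on, of 1] pow_2[of X1_2_12 UNIV "Affine x y"]
    by (simp add: numeral_2_eq_2)
qed

lemma pow_4_i: "Affine \<i> 1 [^]\<^bsub>G0\<^esub> (2 ^ 2 :: nat) = Affine 0 0"
  by (rule pow_4_eq[OF generators(3)]) simp_all

lemma pow_4_3: "Affine (2 + r3) (r3 * (2 + r3)) [^]\<^bsub>G0\<^esub> (2 ^ 2 :: nat) = Affine 0 0"
proof (rule pow_4_eq[OF generators(4)])
  have "(2 + r3) * (2 - r3) = 1" using r3_sq by (simp add: power2_eq_square algebra_simps)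
  then show "r3 * (2 + r3) \<noteq> 0" using r3_nz by auto
  show "((2 + r3)^2 - 1)^2 = 4 * (r3 * (2 + r3))^2" by (rule cubic_values(4)[OF r3_sq])
qed

lemma ord_8: "G0.ord (Affine \<i> 1) = 8" "G0.ord (Affine (2 + r3) (r3 * (2 + r3))) = 8"
  using ord_two_power[OF generators(3) pow_4_i] ord_two_power[OF generators(4) pow_4_3] by simp_all

text \<open>The only point of order \<open>2\<close> in the cyclic group of \<open>g\<close> is
  \<open>Affine 0 0\<close>: a multiple killed by \<open>2\<close> is a multiple of the
  \<open>2 ^ j\<close>-th one.\<close>

lemma rho_not_multiple:
  assumes g: "onE g" and h: "g [^]\<^bsub>G0\<^esub> (2 ^ j :: nat) = Affine 0 0"
  shows "Affine rho 0 \<noteq> g [^]\<^bsub>G0\<^esub> (k::nat)"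
proof
  assume eq: "Affine rho 0 = g [^]\<^bsub>G0\<^esub> k"
  have gc: "g \<in> carrier G0" using g by (simp add: G0_simps)
  have "g [^]\<^bsub>G0\<^esub> (k + k) = addE (Affine rho 0) (Affine rho 0)"
    unfolding eq using gc by (simp add: G0_simps(2) flip: G0.nat_pow_mult)
  then have "g [^]\<^bsub>G0\<^esub> (k + k) = \<one>\<^bsub>G0\<^esub>" by (simp add: addE_y0 G0_simps)
  then have "2 ^ Suc j dvd 2 * k" using G0.pow_eq_id[OF gc] ord_two_power[OF g h] by (simp add: mult_2)
  then have "2 ^ j dvd k" by simp
  then obtain i where "k = 2 ^ j * i" ..
  then have "Affine rho 0 = Affine 0 0 [^]\<^bsub>G0\<^esub> i" unfolding eq using gc h by (simp add: G0.nat_pow_pow[symmetric])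
  moreover have "Affine 0 0 [^]\<^bsub>G0\<^esub> i \<in> {Infinity, Affine 0 0}"
    by (induction i) (auto simp: G0_simps(2) addE_y0 addE_Infinity)
  ultimately have "rho = 0" by auto
  then show False using rho_rel by simp
qed

lemma torsion_group_J_locale:
  assumes K: "multi_quadratic_field K"
  shows "finite_point_group (torsion (J1_2_12 K)) (torsion_group (J1_2_12 K))"
proof
  have sK: "subf K" by (rule multi_quadratic_tower(1)[OF K])
  show "P \<otimes>\<^bsub>torsion_group (J1_2_12 K)\<^esub> Q = addE P Q" for P Q by (simp add: J1_2_12_def ec_group_def)
  show "onE P" if "P \<in> torsion (J1_2_12 K)" for P using that twist_points_on by (auto simp: torsion_J)
  show "addE P Q \<in> torsion (J1_2_12 K)" if "P \<in> torsion (J1_2_12 K)" "Q \<in> torsion (J1_2_12 K)" for P Q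
    using that subfD(3)[OF sK] by (simp add: torsion_J tors_add twist_points_add[OF sK])
  show "Infinity \<in> torsion (J1_2_12 K)" unfolding torsion_eq(2)[OF K] by (simp add: S16_def)
  have "torsion (J1_2_12 K) \<subseteq> set (pts_Q @ pts_w @ pts_i @ pts_3)"
    using S16_cases[of _ UNIV] unfolding torsion_eq(2)[OF K] by (auto simp: subf_def coords_in_UNIV)
  then show "finite (torsion (J1_2_12 K))" by (rule finite_subset) simp
qed simp

lemma Im_rat_adjoin_r3: "z \<in> rat_adjoin {r3} \<Longrightarrow> Im z = 0"
proof -
  have "r3^2 \<in> \<rat>" by (rule r3_sq_Rats)
  then have "rat_adjoin {r3} \<subseteq> adj \<rat> r3"
    by (intro rat_adjoin_least subf_adj subf_Rats) (auto intro: adj_generator subf_Rats)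
  moreover assume "z \<in> rat_adjoin {r3}"
  ultimately obtain a b where "a \<in> \<rat>" "b \<in> \<rat>" "z = a + b * r3" by (blast elim: adjE)
  then show ?thesis using complex_Rats by (simp add: r3_def)
qed

lemma rat_adjoin_i_subset: "rat_adjoin {\<i>} \<subseteq> adj \<rat> \<i>"
  by (intro rat_adjoin_least subf_ii) (simp add: adj_generator subf_Rats)

lemma rat_adjoin_w_not: "\<i> \<notin> rat_adjoin {\<i> * r3}" "r3 \<notin> rat_adjoin {\<i> * r3}"
proof -
  have "(\<i> * r3)^2 \<in> \<rat>" by (simp add: power_mult_distrib r3_sq)
  then have sub: "rat_adjoin {\<i> * r3} \<subseteq> adj \<rat> (\<i> * r3)"
    by (intro rat_adjoin_least subf_adj subf_Rats) (auto intro: adj_generator subf_Rats)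
  show "r3 \<notin> rat_adjoin {\<i> * r3}"
  proof
    assume "r3 \<in> rat_adjoin {\<i> * r3}"
    then obtain a b where ab: "a \<in> \<rat>" "b \<in> \<rat>" "r3 = a + b * (\<i> * r3)" using sub by (blast elim: adjE)
    have "sqrt 3 = Re a" using arg_cong[OF ab(3), of Re] complex_Rats[OF ab(2)] by (simp add: r3_def)
    then show False using complex_Rats[OF ab(1)] sqrt_not_Rats(2) by simp
  qed
  show "\<i> \<notin> rat_adjoin {\<i> * r3}"
  proof
    assume "\<i> \<in> rat_adjoin {\<i> * r3}"
    then obtain a b where ab: "a \<in> \<rat>" "b \<in> \<rat>" "\<i> = a + b * (\<i> * r3)" using sub by (blast elim: adjE)
    have "1 = Re b * sqrt 3" using arg_cong[OF ab(3), of Im] complex_Rats[OF ab(1)] complex_Rats[OF ab(2)] by (simp add: r3_def)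
    then have "sqrt 3 = 1 / Re b" by (auto simp: eq_divide_eq mult.commute)
    then show False using complex_Rats[OF ab(2)] sqrt_not_Rats(2) by simp
  qed
qed

lemma csqrt_values: "csqrt (- 1) = \<i>" "csqrt 3 = r3" "csqrt (- 3) = \<i> * r3"
  using csqrt_of_real[of 3] csqrt_of_real'[of "- 3"] by (simp_all add: r3_def mult.commute)

theorem theorem4p9:
  fixes K K12 :: "complex set"
  assumes "multi_quadratic_field K"
    and "K12 = K \<inter> cyclotomic_field 12"
  shows "torsion (J1_2_12 K) = carrier (J1_2_12 K12)
    \<and> (K12 = \<rat> \<longrightarrow>
        torsion_group (J1_2_12 K) \<cong> integer_mod_group 4)
    \<and> (K12 = rat_adjoin {csqrt (- 1)} \<or> K12 = rat_adjoin {csqrt 3} \<longrightarrow>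
        torsion_group (J1_2_12 K) \<cong> integer_mod_group 8)
    \<and> (K12 = rat_adjoin {csqrt (- 3)} \<longrightarrow>
        torsion_group (J1_2_12 K) \<cong> integer_mod_group 2 \<times>\<times> integer_mod_group 4)
    \<and> (K12 = rat_adjoin {csqrt (- 1), csqrt 3} \<longrightarrow>
        torsion_group (J1_2_12 K) \<cong> integer_mod_group 2 \<times>\<times> integer_mod_group 8)"
proof -
  have K12: "K \<inter> Qz12 = K12" using assms(2) by (simp add: cyclotomic_12)
  define T where "T = torsion (J1_2_12 K)"
  have Teq: "T = {P \<in> S16. coords_in K12 P}" "T = twist_points 1 K12"
    using torsion_eq[OF assms(1)] by (simp_all add: T_def K12 carrier_J)
  interpret finite_point_group T "torsion_group (J1_2_12 K)"
    unfolding T_def by (rule torsion_group_J_locale[OF assms(1)])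
  have mem: "Affine x y \<in> T" if "onE (Affine x y)" "x \<in> K12" "y \<in> K12" for x y
    using that by (simp add: Teq(2) twist_points_1)
  \<comment> \<open>Each of the five cases pairs this upper bound with explicit points generating a
    group of that size.\<close>
  have sub: "T \<subseteq> set pts_Q \<union> (if \<i> * r3 \<in> K12 then set pts_w else {}) \<union>
      (if \<i> \<in> K12 then set pts_i else {}) \<union> (if r3 \<in> K12 then set pts_3 else {})" if "subf K12"
    using S16_cases[OF _ _ that] unfolding Teq(1) by auto
  have card: "card T \<le> length xs" if "T \<subseteq> set xs" for xs
    using card_mono[OF _ that] card_length[of xs] by simp
  have rho_t: "addE (Affine rho 0) (Affine rho 0) = Infinity" by (rule addE_y0)
  have one: "1 \<in> K12" "0 \<in> K12" if "subf K12" using subfD(2,3)[OF that] by simp_all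
  have nil: "length (pts_Q @ pts_w @ pts_i @ pts_3) = 16" "length (pts_Q @ pts_i) = 8" "length (pts_Q @ pts_3) = 8"
    "length (pts_Q @ pts_w) = 8" "length pts_Q = 4"
    by (simp_all add: pts_Q_def pts_w_def pts_i_def pts_3_def)
  have w_i: "r3 = - \<i> * (\<i> * r3)" by simp
  have c1: "torsion_group (J1_2_12 K) \<cong> integer_mod_group 4" if q: "K12 = \<rat>"
  proof (rule cyclic_iso[OF _ ord_4])
    have s: "subf K12" unfolding q by (rule subf_Rats)
    show "Affine 1 1 \<in> T" using mem generators(2) one[OF s] by blast
    have "r3 \<notin> \<rat>" "\<i> * r3 \<notin> \<rat>" "\<i> \<notin> \<rat>"
      using complex_Rats[of r3] complex_Rats[of "\<i> * r3"] ii_not_Rats sqrt_not_Rats(2) by (auto simp: r3_def)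
    then have "T \<subseteq> set pts_Q" using sub[OF s] unfolding q by simp
    then show "card T \<le> 4" using card nil(5) by metis
  qed simp
  have c2: "torsion_group (J1_2_12 K) \<cong> integer_mod_group 8" if q: "K12 = rat_adjoin {\<i>}"
  proof (rule cyclic_iso[OF _ ord_8(1)])
    have s: "subf K12" unfolding q by (rule subf_rat_adjoin)
    have i: "\<i> \<in> K12" using rat_adjoin_incl unfolding q by blast
    show "Affine \<i> 1 \<in> T" using mem generators(3) one[OF s] i by blast
    have r: "r3 \<notin> K12" using r3_not rat_adjoin_i_subset unfolding q by blast
    moreover have "\<i> * r3 \<notin> K12" using r i subfD(6,7)[OF s] w_i by metis
    ultimately have "T \<subseteq> set (pts_Q @ pts_i)" using sub[OF s] i by simp
    then show "card T \<le> 8" using card nil(2) by metis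
  qed simp
  have c3: "torsion_group (J1_2_12 K) \<cong> integer_mod_group 8" if q: "K12 = rat_adjoin {r3}"
  proof (rule cyclic_iso[OF _ ord_8(2)])
    have s: "subf K12" unfolding q by (rule subf_rat_adjoin)
    have r: "r3 \<in> K12" using rat_adjoin_incl unfolding q by blast
    have "2 + r3 \<in> K12" "r3 * (2 + r3) \<in> K12" using r subfD(4,5,6)[OF s] by simp_all
    then show "Affine (2 + r3) (r3 * (2 + r3)) \<in> T" using mem generators(4) by blast
    have "\<i> \<notin> K12" "\<i> * r3 \<notin> K12"
      using Im_rat_adjoin_r3[of \<i>] Im_rat_adjoin_r3[of "\<i> * r3"] unfolding q by (auto simp: r3_def)
    then have "T \<subseteq> set (pts_Q @ pts_3)" using sub[OF s] r by simp
    then show "card T \<le> 8" using card nil(3) by metis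
  qed simp
  have c4: "torsion_group (J1_2_12 K) \<cong> integer_mod_group 2 \<times>\<times> integer_mod_group 4" if q: "K12 = rat_adjoin {\<i> * r3}"
  proof (rule two_cyclic_iso[OF _ ord_4 _ _ rho_t])
    have s: "subf K12" unfolding q by (rule subf_rat_adjoin)
    have w: "\<i> * r3 \<in> K12" using rat_adjoin_incl unfolding q by blast
    then have "rho \<in> K12" unfolding rho_def using subfD[OF s] by simp
    then show "Affine rho 0 \<in> T" using mem generators(5) one[OF s] by blast
    show "Affine 1 1 \<in> T" using mem generators(2) one[OF s] by blast
    show "Affine rho 0 \<noteq> Affine 1 1 [^]\<^bsub>G0\<^esub> k" for k :: nat
      using rho_not_multiple[OF generators(2), of 1] double_x1[OF generators(2)] pow_2[of X1_2_12 UNIV "Affine 1 1"] by simp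
    have "\<i> \<notin> K12" "r3 \<notin> K12" using rat_adjoin_w_not unfolding q by blast+
    then have "T \<subseteq> set (pts_Q @ pts_w)" using sub[OF s] w by simp
    then show "card T \<le> 2 * 4" using card nil(4) by fastforce
  qed simp
  have c5: "torsion_group (J1_2_12 K) \<cong> integer_mod_group 2 \<times>\<times> integer_mod_group 8" if q: "K12 = rat_adjoin {\<i>, r3}"
  proof (rule two_cyclic_iso[OF _ ord_8(1) _ _ rho_t rho_not_multiple[OF generators(3) pow_4_i]])
    have s: "subf K12" unfolding q by (rule subf_rat_adjoin)
    have ir: "\<i> \<in> K12" "r3 \<in> K12" using rat_adjoin_incl unfolding q by blast+
    have "rho \<in> K12" by (rule rho_in[OF s ir])
    then show "Affine rho 0 \<in> T" using mem generators(5) one[OF s] by blast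
    show "Affine \<i> 1 \<in> T" using mem generators(3) one[OF s] ir by blast
    have "T \<subseteq> set (pts_Q @ pts_w @ pts_i @ pts_3)" using sub[OF s] by (auto split: if_splits)
    then show "card T \<le> 2 * 8" using card nil(1) by fastforce
  qed simp
  have "torsion (J1_2_12 K) = carrier (J1_2_12 K12)" using torsion_eq(1)[OF assms(1)] K12 by simp
  then show ?thesis using c1 c2 c3 c4 c5 unfolding csqrt_values by blast
qed

end
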